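(* Let $\alpha\in(0,1)$, $K,\varepsilon>0$, and let $\sigma:\mathbb R_+\times\mathbb R^d\to\mathbb R^{d\times d_1}$ be Borel measurable with $$\varepsilon I\le(\sigma\sigma^* )(s,x)\le KI,\qquad|\sigma(s,x)-\sigma(s,y)|\le K|x-y|^\alpha\qquad\text{for all }x,y\in\mathbb R^d,\ s>0.$$ Let $x_0\in\mathbb R^d$ be non-random, and for $n=1,2,\dots$ let $x_n$ be the Euler approximation defined by $$x_n(t)=x_0+\int_0^t\sigma(s,x_n(\kappa_n(s)))\,dw(s).$$ Let $q\ge1$ and $p>d/\alpha$ satisfy $\frac dp+\frac2q<2$, and assume that for each $T>0$ there is a constant $\delta(T)>0$ such that $$\min_{i:\,t^n_{i+1}\le T}(t^n_{i+1}-t^n_i)/d_n(T)\ge\delta(T)\quad\text{for all }n\ge1.$$ Then for any $T\in[0,\infty)$ and Borel functions $f$ on $\mathbb R_+\times\mathbb R^d$ we have $$E\exp\Big(\int_0^Tf(r,x_n(\kappa_n(r)))\,dr\Big)\le2\exp\Big(N\big(\|f\|_{p,q,T}^q+d_n^{q-1}(T)\|f\|_{\infty,q,T}^q\big)\Big),$$ where $N$ depends only on $d,\alpha,K,\varepsilon,p,q,\delta(T),T$.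
   Context: $w$ is a $d_1$-dimensional Wiener process; $\sigma^*$ is the transpose of $\sigma$. For each $n\ge1$, $0=t_0^n<t_1^n<t_2^n<\cdots$ is a partition of $\mathbb R_+$ with $\lim_{i\to\infty}t_i^n=\infty$; $\kappa_n(t):=t_i^n$ for $t\in[t_i^n,t_{i+1}^n)$; $d_n(T):=\sup_{i:\,t^n_{i+1}\le T}|t^n_{i+1}-t^n_i|$, and $d_n(T)\to0$ as $n\to\infty$ for every $T>0$. For $p,q\in[1,\infty)$, $\|f\|_{p,q,T}=\big(\int_0^T\|f(t,\cdot)\|_p^q\,dt\big)^{1/q}$ with $\|\cdot\|_p$ the $L_p(\mathbb R^d)$-norm, and $\|f\|_{\infty,q,T}=\big(\int_0^T\sup_{x\in\mathbb R^d}|f(t,x)|^q\,dt\big)^{1/q}$.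
   Formalization: Adds, for each n considered, the condition T − κ_n(T) ≤ d_n(T)/δ(T) on the incomplete last interval, without which the bound fails because d_n(T) ignores that interval; N is chosen for a fixed underlying set type of the probability space. *)

theory Defs
  imports "HOL-Probability.Probability"
begin

section \<open>Powers, exponentials and mixed norms with values in the extended half-line\<close>

text \<open>Only used with a positive exponent, where the top element is mapped to itself.\<close>

definition ennreal_powr :: "ennreal \<Rightarrow> real \<Rightarrow> ennreal" where
  "ennreal_powr x a = (if x = \<infinity> then \<infinity> else ennreal (enn2real x powr a))"

definition ennreal_exp :: "ennreal \<Rightarrow> ennreal" where
  "ennreal_exp x = (if x = \<infinity> then \<infinity> else ennreal (exp (enn2real x)))"

definition Lp_norm :: "real \<Rightarrow> (real ^ 'd \<Rightarrow> real) \<Rightarrow> ennreal" where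
  "Lp_norm p g = ennreal_powr (\<integral>\<^sup>+ x. ennreal (\<bar>g x\<bar> powr p) \<partial>lborel) (1 / p)"

definition mixed_norm :: "real \<Rightarrow> real \<Rightarrow> real \<Rightarrow> (real \<Rightarrow> real ^ 'd \<Rightarrow> real) \<Rightarrow> ennreal" where
  "mixed_norm p q T f =
     ennreal_powr (\<integral>\<^sup>+ r\<in>{0..T}. ennreal_powr (Lp_norm p (f r)) q \<partial>lborel) (1 / q)"

text \<open>The supremum over \<open>x\<close> (not an essential supremum) of a Borel function of \<open>(r, x)\<close> need not
  be Borel in \<open>r\<close>, but it is Lebesgue measurable; hence the completed measure.\<close>

definition mixed_sup_norm :: "real \<Rightarrow> real \<Rightarrow> (real \<Rightarrow> real ^ 'd \<Rightarrow> real) \<Rightarrow> ennreal" where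
  "mixed_sup_norm q T f =
     ennreal_powr (\<integral>\<^sup>+ r\<in>{0..T}. ennreal_powr (\<Squnion>x. ennreal \<bar>f r x\<bar>) q \<partial>lebesgue) (1 / q)"


section \<open>Partitions of the half-line\<close>

definition partition_seq :: "(nat \<Rightarrow> real) \<Rightarrow> bool" where
  "partition_seq \<tau> \<longleftrightarrow> \<tau> 0 = 0 \<and> strict_mono \<tau> \<and> filterlim \<tau> at_top sequentially"

definition kappa :: "(nat \<Rightarrow> real) \<Rightarrow> real \<Rightarrow> real" where
  "kappa \<tau> r = \<tau> (THE i. \<tau> i \<le> r \<and> r < \<tau> (Suc i))"

text \<open>Only subintervals contained in \<open>[0, T]\<close> count; the incomplete one, from \<open>kappa \<tau> T\<close>
  to \<open>T\<close>, may be longer than \<open>mesh \<tau> T\<close>. Inserting \<open>0\<close> gives the value \<open>0\<close> when there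
  is no such subinterval and changes nothing otherwise.\<close>

definition mesh :: "(nat \<Rightarrow> real) \<Rightarrow> real \<Rightarrow> real" where
  "mesh \<tau> T = Sup (insert 0 {\<tau> (Suc i) - \<tau> i | i. \<tau> (Suc i) \<le> T})"


section \<open>Wiener processes and the Ito integral\<close>

definition filtration_on :: "'w measure \<Rightarrow> (real \<Rightarrow> 'w measure) \<Rightarrow> bool" where
  "filtration_on M F \<longleftrightarrow>
     (\<forall>r\<ge>0. subalgebra M (F r)) \<and> (\<forall>r\<ge>0. \<forall>s\<ge>r. sets (F r) \<subseteq> sets (F s))"

text \<open>The dimension \<open>m\<close> of the Wiener process is a natural number and not a type, so that it can be
  quantified inside a formula; \<open>W k\<close> for \<open>k < m\<close> are the coordinate processes. The increment over
  \<open>[r, s]\<close>, as an element of the product space of \<open>m\<close> real lines, is independent of \<open>F r\<close> and has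
  the distribution \<open>N(0, (s - r) I)\<close>.\<close>

definition wiener_process ::
    "'w measure \<Rightarrow> (real \<Rightarrow> 'w measure) \<Rightarrow> nat \<Rightarrow> (nat \<Rightarrow> real \<Rightarrow> 'w \<Rightarrow> real) \<Rightarrow> bool" where
  "wiener_process M F m W \<longleftrightarrow>
     prob_space M \<and> filtration_on M F \<and>
     (\<forall>k<m. \<forall>r\<ge>0. W k r \<in> borel_measurable (F r)) \<and>
     (AE \<omega> in M. \<forall>k<m. W k 0 \<omega> = 0 \<and> continuous_on {0..} (\<lambda>r. W k r \<omega>)) \<and>
     (\<forall>r\<ge>0. \<forall>s>r.
        let V = (\<Pi>\<^sub>M k\<in>{..<m}. (borel :: real measure));
            D = (\<lambda>\<omega>. \<lambda>k\<in>{..<m}. W k s \<omega> - W k r \<omega>)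
        in prob_space.indep_set M (sets (F r)) {D -` B \<inter> space M | B. B \<in> sets V} \<and>
           distr M V D = (\<Pi>\<^sub>M k\<in>{..<m}. density lborel (\<lambda>z. ennreal (normal_density 0 (sqrt (s - r)) z))))"

text \<open>A simple process is \<open>\<Sum>j<l. \<xi> j 1_(s j, s (j + 1)]\<close>, encoded as the triple \<open>(l, s, \<xi>)\<close>.\<close>

type_synonym ('w, 'b) simple_proc = "nat \<times> (nat \<Rightarrow> real) \<times> (nat \<Rightarrow> 'w \<Rightarrow> 'b)"

definition is_simple_proc ::
    "(real \<Rightarrow> 'w measure) \<Rightarrow> ('w, 'b::euclidean_space) simple_proc \<Rightarrow> bool" where
  "is_simple_proc F = (\<lambda>(l, s, \<xi>).
     0 \<le> s 0 \<and> mono s \<and>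
     (\<forall>j<l. \<xi> j \<in> borel_measurable (F (s j)) \<and> (\<exists>C. \<forall>\<omega>. norm (\<xi> j \<omega>) \<le> C)))"

definition simple_val :: "('w, 'b::euclidean_space) simple_proc \<Rightarrow> real \<Rightarrow> 'w \<Rightarrow> 'b" where
  "simple_val = (\<lambda>(l, s, \<xi>) r \<omega>. \<Sum>j<l. indicat_real {s j<..s (Suc j)} r *\<^sub>R \<xi> j \<omega>)"

definition simple_ito ::
    "(real \<Rightarrow> 'w \<Rightarrow> real) \<Rightarrow> ('w, 'b::euclidean_space) simple_proc \<Rightarrow> real \<Rightarrow> 'w \<Rightarrow> 'b" where
  "simple_ito B = (\<lambda>(l, s, \<xi>) t \<omega>.
     \<Sum>j<l. (B (min (s (Suc j)) t) \<omega> - B (min (s j) t) \<omega>) *\<^sub>R \<xi> j \<omega>)"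

definition progressively_measurable ::
    "(real \<Rightarrow> 'w measure) \<Rightarrow> real \<Rightarrow> (real \<Rightarrow> 'w \<Rightarrow> 'b::euclidean_space) \<Rightarrow> bool" where
  "progressively_measurable F t H \<longleftrightarrow>
     (\<forall>u\<in>{0..t}. (\<lambda>(r, \<omega>). H r \<omega>) \<in> borel_measurable (restrict_space borel {0..u} \<Otimes>\<^sub>M F u))"

text \<open>\<open>Y\<close> is (a version of) the stochastic integral of \<open>H\<close> over \<open>[0, t]\<close> with respect to the
  one-dimensional Wiener process \<open>B\<close>: the limit in mean square of integrals of simple processes
  which approximate \<open>H\<close> in mean square on \<open>[0, t] \<times> \<Omega>\<close>.\<close>

definition has_ito_integral ::
    "'w measure \<Rightarrow> (real \<Rightarrow> 'w measure) \<Rightarrow> (real \<Rightarrow> 'w \<Rightarrow> real) \<Rightarrow>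
     (real \<Rightarrow> 'w \<Rightarrow> 'b::euclidean_space) \<Rightarrow> real \<Rightarrow> ('w \<Rightarrow> 'b) \<Rightarrow> bool" where
  "has_ito_integral M F B H t Y \<longleftrightarrow>
     progressively_measurable F t H \<and> Y \<in> borel_measurable M \<and>
     (\<exists>S. (\<forall>j::nat. is_simple_proc F (S j)) \<and>
        ((\<lambda>j. \<integral>\<^sup>+ \<omega>. (\<integral>\<^sup>+ r\<in>{0..t}. ennreal ((norm (simple_val (S j) r \<omega> - H r \<omega>))\<^sup>2) \<partial>lborel) \<partial>M)
           \<longlonglongrightarrow> 0) \<and>
        ((\<lambda>j. \<integral>\<^sup>+ \<omega>. ennreal ((norm (simple_ito B (S j) t \<omega> - Y \<omega>))\<^sup>2) \<partial>M) \<longlonglongrightarrow> 0))"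

text \<open>The integral of a matrix-valued process with respect to an \<open>m\<close>-dimensional Wiener process;
  the matrix is given by its columns \<open>G k\<close>, \<open>k < m\<close>.\<close>

definition has_vector_ito_integral ::
    "'w measure \<Rightarrow> (real \<Rightarrow> 'w measure) \<Rightarrow> nat \<Rightarrow> (nat \<Rightarrow> real \<Rightarrow> 'w \<Rightarrow> real) \<Rightarrow>
     (nat \<Rightarrow> real \<Rightarrow> 'w \<Rightarrow> 'b::euclidean_space) \<Rightarrow> real \<Rightarrow> ('w \<Rightarrow> 'b) \<Rightarrow> bool" where
  "has_vector_ito_integral M F m W G t Y \<longleftrightarrow>
     (\<exists>Z. (\<forall>k<m. has_ito_integral M F (W k) (G k) t (Z k)) \<and>
          (AE \<omega> in M. Y \<omega> = (\<Sum>k<m. Z k \<omega>)))"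


section \<open>Coefficients and Euler approximations\<close>

text \<open>A \<open>d \<times> m\<close> matrix \<open>A\<close> is given by its columns \<open>A 0, \<dots>, A (m - 1)\<close>; the values \<open>A k\<close> with
  \<open>k \<ge> m\<close> are irrelevant. The first definition is \<open>A A\<^sup>*\<close>, the second the Euclidean
  (Hilbert--Schmidt) distance of two matrices.\<close>

definition mat_AAt :: "nat \<Rightarrow> (nat \<Rightarrow> real ^ 'd) \<Rightarrow> real ^ 'd ^ 'd" where
  "mat_AAt m A = (\<chi> i j. \<Sum>k<m. A k $ i * A k $ j)"

definition mat_dist :: "nat \<Rightarrow> (nat \<Rightarrow> real ^ 'd) \<Rightarrow> (nat \<Rightarrow> real ^ 'd) \<Rightarrow> real" where
  "mat_dist m A B = L2_set (\<lambda>k. norm (A k - B k)) {..<m}"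

definition psd_le :: "real ^ 'd ^ 'd \<Rightarrow> real ^ 'd ^ 'd \<Rightarrow> bool" where
  "psd_le A B \<longleftrightarrow> (\<forall>v. v \<bullet> (A *v v) \<le> v \<bullet> (B *v v))"

definition borel_on_halfspace :: "(real \<Rightarrow> real ^ 'd \<Rightarrow> 'b::topological_space) \<Rightarrow> bool" where
  "borel_on_halfspace g \<longleftrightarrow>
     (\<lambda>(r, x). g r x) \<in> borel_measurable (restrict_space borel ({0..} \<times> UNIV))"

text \<open>The equation fixes \<open>X r\<close> up to null sets for each \<open>r\<close>; only the values at the points of the
  partition are ever used, so no continuity of paths is imposed.\<close>

definition euler_approx ::
    "'w measure \<Rightarrow> (real \<Rightarrow> 'w measure) \<Rightarrow> nat \<Rightarrow> (nat \<Rightarrow> real \<Rightarrow> 'w \<Rightarrow> real) \<Rightarrow>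
     (real \<Rightarrow> real ^ 'd \<Rightarrow> nat \<Rightarrow> real ^ 'd) \<Rightarrow> real ^ 'd \<Rightarrow> (nat \<Rightarrow> real) \<Rightarrow>
     (real \<Rightarrow> 'w \<Rightarrow> real ^ 'd) \<Rightarrow> bool" where
  "euler_approx M F m W \<sigma> x0 \<tau> X \<longleftrightarrow>
     (\<forall>r\<ge>0. X r \<in> borel_measurable (F r)) \<and>
     (\<forall>r\<ge>0. has_vector_ito_integral M F m W
        (\<lambda>k s \<omega>. \<sigma> s (X (kappa \<tau> s) \<omega>) k) r (\<lambda>\<omega>. X r \<omega> - x0))"

end

theory Submission
  imports Defs
begin

text \<open>
  At the points of the partition the Euler scheme is a Markov chain. On an interval from \<open>\<tau> i\<close> to
  \<open>\<tau> (Suc i)\<close> the coefficient is evaluated at the frozen state, so given the past the increment is a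
  centred Gaussian vector whose covariance is the integral of \<open>\<sigma> \<sigma>\<^sup>*\<close> over the interval at that state
  (\<open>one_step_law\<close>). The exponent splits into a sum of potentials \<open>pot j\<close>, each evaluated at one state of
  the chain, and everything reduces to a bound for a chain with Gaussian transition densities.

  Khasminskii's argument gives such a bound. If on a block of consecutive intervals the expected sum of
  the potentials is at most \<open>1 / 4\<close> from every starting point, the expected exponential over the block is
  at most 2. The intervals carry masses \<open>\<mu> j\<close> whose total is at most the sum of the two norms in the
  theorem, so a greedy choice needs at most about \<open>(\<Sum>j. \<mu> j) / c0\<close> blocks, and the factors multiply to
  the exponential of a multiple of the total mass (\<open>khasminskii\<close>).

  The expected sum over a block is small because the chain smooths: after a time \<open>t\<close> its transition
  operator maps \<open>L\<^sub>p\<close> into bounded functions with norm at most a constant times \<open>t\<close> to the power \<open>- d / (2 p)\<close>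
  (\<open>steps_sup_bound\<close>), and the condition \<open>d / p + 2 / q < 2\<close> says exactly that this power is integrable
  against a function in \<open>L\<^sub>q\<close> of time. There is no smoothing in the first interval of a block, since the
  chain starts from a point; there the supremum norm is used, and Young's inequality on an interval of
  about the length of the mesh produces the factor \<open>mesh powr (q - 1)\<close>. The comparability of the steps enters
  whenever a sum over the partition is compared with an integral. The last interval may be longer than
  the mesh, but it is at most a constant multiple of it by hypothesis.

  The smoothing estimate is a discrete parametrix. The coefficient is only Hoelder continuous, so the
  transition densities are compared with those of the chain whose covariances are frozen at the end
  point \<open>y\<close>. Replacing one true step by a frozen one costs, by Hoelder continuity and the Gaussian decay,
  a factor \<open>h * t powr (\<alpha> / 2 - 1)\<close> for a step of length \<open>h\<close> at distance \<open>t\<close> from the end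
  (\<open>frozen_difference\<close>); these costs form a convergent sum, and over short times the resulting inequality
  closes by induction. The Gaussian comparison behind it uses only that an elliptic quadratic form is a
  multiple of the identity plus finitely many rank one forms, each of which acts on the density as an
  average over shifts.
\<close>

section \<open>Gaussian densities as Fourier integrals\<close>

lemma lborel_prod_integral:
  fixes f :: "'a::euclidean_space \<Rightarrow> real \<Rightarrow> complex"
  assumes f: "\<And>b. b \<in> Basis \<Longrightarrow> integrable lborel (f b)"
  shows "integrable lborel (\<lambda>x. \<Prod>b\<in>Basis. f b (x \<bullet> b))" (is ?I)
    and "(\<integral>x. (\<Prod>b\<in>Basis. f b (x \<bullet> b)) \<partial>lborel) = (\<Prod>b\<in>Basis. (\<integral>x. f b x \<partial>lborel))" (is ?E)
proof -
  interpret P: product_sigma_finite "\<lambda>_::'a. lborel :: real measure" ..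
  have m: "\<And>b. b \<in> Basis \<Longrightarrow> f b \<in> borel_measurable borel"
    using f by (auto dest!: borel_measurable_integrable)
  have mm: "(\<lambda>x. \<Prod>b\<in>Basis. f b (x \<bullet> b)) \<in> borel_measurable (borel :: 'a measure)"
    by (intro borel_measurable_prod measurable_compose[OF _ m] borel_measurable_inner) auto
  have g: "(\<lambda>f. \<Sum>b\<in>Basis. f b *\<^sub>R b) \<in> measurable (\<Pi>\<^sub>M b\<in>Basis. lborel) (borel :: 'a measure)"
    by measurable
  have *: "(\<Prod>b\<in>Basis. f b ((\<Sum>c\<in>Basis. x c *\<^sub>R c) \<bullet> b)) = (\<Prod>b\<in>Basis. f b (x b))" for x
    by (intro prod.cong) (auto simp: inner_sum_left_Basis)
  show ?I
    by (subst lborel_eq, subst integrable_distr_eq[OF g mm])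
       (simp add: * P.product_integrable_prod f)
  show ?E
    by (subst lborel_eq, subst integral_distr[OF g mm])
       (simp add: * P.product_integral_prod f)
qed

lemma std_normal_char:
  "integrable lborel (\<lambda>z. cis (t * z) * complex_of_real (std_normal_density z))"
  "(\<integral>z. cis (t * z) * complex_of_real (std_normal_density z) \<partial>lborel) = complex_of_real (exp (- t\<^sup>2 / 2))"
proof -
  show "integrable lborel (\<lambda>z. cis (t * z) * complex_of_real (std_normal_density z))"
  proof (rule Bochner_Integration.integrable_bound[OF integrable_normal_density[where \<mu>=0 and \<sigma>=1]])
    show "(\<lambda>z. cis (t * z) * complex_of_real (std_normal_density z)) \<in> borel_measurable lborel"
      unfolding cis_conv_exp by measurable
  qed (auto simp: norm_mult)
  have "complex_of_real (exp (- t\<^sup>2 / 2)) = char std_normal_distribution t"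
    by (simp add: char_std_normal_distribution)
  also have "\<dots> = (\<integral>z. std_normal_density z *\<^sub>R iexp (t * z) \<partial>lborel)"
    unfolding char_def by (subst integral_density) (auto simp: normal_density_nonneg)
  also have "\<dots> = (\<integral>z. cis (t * z) * complex_of_real (std_normal_density z) \<partial>lborel)"
    by (intro Bochner_Integration.integral_cong) (auto simp: cis_conv_exp scaleR_conv_of_real)
  finally show "(\<integral>z. cis (t * z) * complex_of_real (std_normal_density z) \<partial>lborel) = complex_of_real (exp (- t\<^sup>2 / 2))"
    by simp
qed

lemma gaussian_fourier_1d:
  assumes s: "0 < s"
  shows "integrable lborel (\<lambda>x. cis (x * t) * complex_of_real (exp (- s * x\<^sup>2 / 2)))"
    and "(\<integral>x. cis (x * t) * complex_of_real (exp (- s * x\<^sup>2 / 2)) \<partial>lborel)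
           = complex_of_real (sqrt (2 * pi / s) * exp (- t\<^sup>2 / (2 * s)))"
proof -
  have eq: "cis (x * t) * complex_of_real (exp (- s * x\<^sup>2 / 2)) =
     complex_of_real (sqrt (2 * pi)) * (cis (t / sqrt s * (0 + sqrt s * x)) * complex_of_real (std_normal_density (0 + sqrt s * x)))" for x
    using s by (simp add: std_normal_density_def power_mult_distrib mult_ac)
  show "integrable lborel (\<lambda>x. cis (x * t) * complex_of_real (exp (- s * x\<^sup>2 / 2)))"
    unfolding eq using s
    by (intro integrable_mult_right lborel_integrable_real_affine std_normal_char(1)) auto
  have "(\<integral>x. cis (x * t) * complex_of_real (exp (- s * x\<^sup>2 / 2)) \<partial>lborel)
     = complex_of_real (sqrt (2 * pi)) * (\<integral>x. cis (t / sqrt s * (0 + sqrt s * x)) * complex_of_real (std_normal_density (0 + sqrt s * x)) \<partial>lborel)"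
    unfolding eq by (rule integral_mult_right_zero)
  also have "(\<integral>x. cis (t / sqrt s * (0 + sqrt s * x)) * complex_of_real (std_normal_density (0 + sqrt s * x)) \<partial>lborel)
     = complex_of_real (exp (- (t / sqrt s)\<^sup>2 / 2)) /\<^sub>R sqrt s"
    using s std_normal_char(2)[of "t / sqrt s"]
      lborel_integral_real_affine[of "sqrt s" "\<lambda>z. cis (t / sqrt s * z) * complex_of_real (std_normal_density z)" 0]
    by (simp only: scaleR_scaleR) (auto simp: scaleR_scaleR)
  also have "complex_of_real (sqrt (2 * pi)) * (complex_of_real (exp (- (t / sqrt s)\<^sup>2 / 2)) /\<^sub>R sqrt s)
      = complex_of_real (sqrt (2 * pi / s) * exp (- t\<^sup>2 / (2 * s)))"
    using s by (simp add: scaleR_conv_of_real real_sqrt_divide power_divide divide_simps)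
  finally show "(\<integral>x. cis (x * t) * complex_of_real (exp (- s * x\<^sup>2 / 2)) \<partial>lborel)
           = complex_of_real (sqrt (2 * pi / s) * exp (- t\<^sup>2 / (2 * s)))" .
qed

definition iso_gdens :: "real \<Rightarrow> 'a::euclidean_space \<Rightarrow> real" where
  "iso_gdens s v = (2 * pi * s) powr (- real DIM('a) / 2) * exp (- (v \<bullet> v) / (2 * s))"

text \<open>The density of \<open>N(0, Q)\<close>, with the covariance given as a quadratic form. Defining it by Fourier
  inversion avoids determinants and inverse matrices; adding forms is convolving densities.\<close>

definition gdens :: "('a::euclidean_space \<Rightarrow> real) \<Rightarrow> 'a \<Rightarrow> real" where
  "gdens Q v = (1 / (2 * pi) ^ DIM('a)) * (\<integral>l. cos (l \<bullet> v) * exp (- Q l / 2) \<partial>lborel)"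

lemma iso_fourier:
  fixes v :: "'a::euclidean_space"
  assumes s: "0 < s"
  shows "integrable lborel (\<lambda>l::'a. exp (- (s * (l \<bullet> l)) / 2))"
    and "gdens (\<lambda>l. s * (l \<bullet> l)) v = iso_gdens s v"
proof -
  have eq: "(\<Prod>b\<in>Basis. cis ((l \<bullet> b) * (v \<bullet> b)) * complex_of_real (exp (- s * (l \<bullet> b)\<^sup>2 / 2)))
      = cis (l \<bullet> v) * complex_of_real (exp (- (s * (l \<bullet> l)) / 2))" for l v :: 'a
  proof -
    have 1: "(\<Prod>b\<in>Basis. complex_of_real (exp (- s * (l \<bullet> b)\<^sup>2 / 2))) = complex_of_real (exp (- (s * (l \<bullet> l)) / 2))"
    proof -
      have "(\<Prod>b\<in>Basis. exp (- s * (l \<bullet> b)\<^sup>2 / 2)) = exp (\<Sum>b\<in>Basis. - s * (l \<bullet> b)\<^sup>2 / 2)"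
        by (rule exp_sum[symmetric]) simp
      also have "(\<Sum>b\<in>Basis. - s * (l \<bullet> b)\<^sup>2 / 2) = - (s * (l \<bullet> l)) / 2"
        by (subst euclidean_inner[of l l]) (simp add: sum_distrib_left sum_negf sum_divide_distrib power2_eq_square)
      finally show ?thesis by (simp only: of_real_prod[symmetric])
    qed
    have 2: "(\<Prod>b\<in>Basis. cis ((l \<bullet> b) * (v \<bullet> b))) = cis (l \<bullet> v)"
      by (simp add: cis_conv_exp euclidean_inner[of l v] exp_sum sum_distrib_left)
    show ?thesis by (simp only: prod.distrib 1 2)
  qed
  note P = lborel_prod_integral[of "\<lambda>b x. cis (x * (v \<bullet> b)) * complex_of_real (exp (- s * x\<^sup>2 / 2))" for v :: 'a,
      OF gaussian_fourier_1d(1)[OF s], unfolded eq]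
  have "integrable lborel (\<lambda>l::'a. norm (cis (l \<bullet> v) * complex_of_real (exp (- (s * (l \<bullet> l)) / 2))))"
    using P(1) by (rule integrable_norm)
  then show "integrable lborel (\<lambda>l::'a. exp (- (s * (l \<bullet> l)) / 2))"
    by (simp add: norm_mult)
  have "(\<integral>l. cos (l \<bullet> v) * exp (- (s * (l \<bullet> l)) / 2) \<partial>lborel)
     = (\<integral>l. Re (cis (l \<bullet> v) * complex_of_real (exp (- (s * (l \<bullet> l)) / 2))) \<partial>lborel)"
    by (intro Bochner_Integration.integral_cong) auto
  also have "\<dots> = Re (\<integral>l. cis (l \<bullet> v) * complex_of_real (exp (- (s * (l \<bullet> l)) / 2)) \<partial>lborel)"
    by (rule integral_Re[OF P(1)])
  also have "\<dots> = Re (\<Prod>b\<in>(Basis::'a set). complex_of_real (sqrt (2 * pi / s) * exp (- (v \<bullet> b)\<^sup>2 / (2 * s))))"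
    by (subst P(2)) (simp only: gaussian_fourier_1d(2)[OF s])
  also have "\<dots> = (\<Prod>b\<in>(Basis::'a set). sqrt (2 * pi / s) * exp (- (v \<bullet> b)\<^sup>2 / (2 * s)))"
    by (simp only: of_real_prod[symmetric] Re_complex_of_real)
  also have "\<dots> = sqrt (2 * pi / s) ^ DIM('a) * exp (- (v \<bullet> v) / (2 * s))"
    by (simp add: prod.distrib exp_sum[symmetric] sum_negf sum_divide_distrib[symmetric]
          power2_eq_square euclidean_inner[of v v])
  finally have L: "(\<integral>l. cos (l \<bullet> v) * exp (- (s * (l \<bullet> l)) / 2) \<partial>lborel) = \<dots>" .
  have h: "1 / (2 * pi) ^ DIM('a) * sqrt (2 * pi / s) ^ DIM('a) = (2 * pi * s) powr (- real DIM('a) / 2)"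
  proof -
    have a: "sqrt (2 * pi / s) / (2 * pi) = (2 * pi * s) powr (-1/2)"
    proof -
      have p: "sqrt (2 * pi) * sqrt (2 * pi) = 2 * pi" by simp
      have "sqrt (2 * pi / s) / (2 * pi) = (sqrt (2 * pi) / sqrt s) / (sqrt (2 * pi) * sqrt (2 * pi))"
        by (simp only: p real_sqrt_divide)
      also have "\<dots> = inverse (sqrt (2 * pi * s))"
        using s by (simp add: real_sqrt_mult field_simps)
      also have "\<dots> = (2 * pi * s) powr (-1/2)"
        using s by (simp add: powr_minus powr_half_sqrt)
      finally show ?thesis .
    qed
    have h: "1 / (2 * pi) ^ DIM('a) * sqrt (2 * pi / s) ^ DIM('a) = (sqrt (2 * pi / s) / (2 * pi)) ^ DIM('a)"
      by (simp add: power_divide)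
    also have "\<dots> = ((2 * pi * s) powr (-1/2)) powr real DIM('a)"
      using s by (subst powr_realpow) (auto simp: a)
    also have "\<dots> = (2 * pi * s) powr (- real DIM('a) / 2)" by (simp add: powr_powr)
    finally show ?thesis .
  qed
  show "gdens (\<lambda>l. s * (l \<bullet> l)) v = iso_gdens s v"
    by (simp only: gdens_def iso_gdens_def L mult.assoc[symmetric] h)
qed

lemma gdens_integrable:
  fixes Q :: "'a::euclidean_space \<Rightarrow> real"
  assumes [measurable]: "Q \<in> borel_measurable borel" and s: "0 < s" and Q: "\<And>l. s * (l \<bullet> l) \<le> Q l"
  shows "integrable lborel (\<lambda>l. exp (- Q l / 2))" and "integrable lborel (\<lambda>l. cos (l \<bullet> v) * exp (- Q l / 2))"
proof -
  show 1: "integrable lborel (\<lambda>l. exp (- Q l / 2))"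
    by (rule Bochner_Integration.integrable_bound[OF iso_fourier(1)[OF s]]) (use Q in auto)
  show "integrable lborel (\<lambda>l. cos (l \<bullet> v) * exp (- Q l / 2))"
    by (rule Bochner_Integration.integrable_bound[OF 1]) (auto simp: abs_mult mult_left_le_one_le)
qed

lemma std_normal_cos_sin:
  "integrable lborel (\<lambda>z. cos (t * z) * std_normal_density z)"
  "integrable lborel (\<lambda>z. sin (t * z) * std_normal_density z)"
  "(\<integral>z. cos (t * z) * std_normal_density z \<partial>lborel) = exp (- t\<^sup>2 / 2)"
  "(\<integral>z. sin (t * z) * std_normal_density z \<partial>lborel) = 0"
  using integrable_Re[OF std_normal_char(1)[of t]] integrable_Im[OF std_normal_char(1)[of t]]
    integral_Re[OF std_normal_char(1)[of t]] integral_Im[OF std_normal_char(1)[of t]]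
  by (simp_all only: std_normal_char(2)) (simp_all)

lemma gdens_measurable [measurable]:
  fixes Q :: "'a::euclidean_space \<Rightarrow> real"
  assumes [measurable]: "Q \<in> borel_measurable borel"
  shows "gdens Q \<in> borel_measurable borel"
  unfolding gdens_def by measurable

lemma gdens_bounded:
  fixes Q :: "'a::euclidean_space \<Rightarrow> real"
  assumes "Q \<in> borel_measurable borel" "0 < s" "\<And>l. s * (l \<bullet> l) \<le> Q l"
  shows "\<bar>gdens Q v\<bar> \<le> gdens Q 0"
proof -
  have "\<bar>\<integral>l. cos (l \<bullet> v) * exp (- Q l / 2) \<partial>lborel\<bar> \<le> (\<integral>l. exp (- Q l / 2) \<partial>lborel)"
    using Bochner_Integration.integral_norm_bound_integral[OF gdens_integrable(2)[OF assms] gdens_integrable(1)[OF assms], of v]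
    by (auto simp: abs_mult mult_left_le_one_le)
  then show ?thesis
    unfolding gdens_def by (auto simp: abs_mult intro!: divide_right_mono)
qed

text \<open>In Fourier space \<open>exp (- (c \<bullet> l)\<^sup>2 / 2)\<close> is the characteristic function of a standard normal
  multiple of \<open>c\<close>. So the density of the larger form is the average of the smaller one over random shifts
  along \<open>c\<close>. All estimates for \<open>gdens\<close> are derived from the isotropic case by iterating this.\<close>

lemma gdens_add_rank_one:
  fixes Q :: "'a::euclidean_space \<Rightarrow> real"
  assumes Qm[measurable]: "Q \<in> borel_measurable borel" and s: "0 < s" and Q: "\<And>l. s * (l \<bullet> l) \<le> Q l"
  shows "integrable lborel (\<lambda>z. gdens Q (v - z *\<^sub>R c) * std_normal_density z)"
    and "gdens (\<lambda>l. Q l + (c \<bullet> l)\<^sup>2) v = (\<integral>z. gdens Q (v - z *\<^sub>R c) * std_normal_density z \<partial>lborel)"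
proof -
  note gi = gdens_integrable[OF assms]
  show "integrable lborel (\<lambda>z. gdens Q (v - z *\<^sub>R c) * std_normal_density z)"
    by (rule Bochner_Integration.integrable_bound[where f="\<lambda>z. gdens Q 0 * std_normal_density z"])
       (use gdens_bounded[OF assms] in \<open>auto simp: abs_mult intro!: mult_right_mono order_trans[OF _ abs_ge_self]\<close>)
  let ?F = "\<lambda>z l. cos (l \<bullet> (v - z *\<^sub>R c)) * exp (- Q l / 2) * std_normal_density z"
  have F: "integrable (lborel \<Otimes>\<^sub>M lborel) (\<lambda>(z, l). ?F z l)"
  proof (rule Bochner_Integration.integrable_bound)
    show "integrable (lborel \<Otimes>\<^sub>M lborel) (\<lambda>(z, l). std_normal_density z * exp (- Q l / 2))"
      by (rule lborel_pair.Fubini_integrable) (use gi(1) in \<open>auto simp: abs_mult\<close>)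
  qed (auto simp: abs_mult mult_left_le_one_le intro!: AE_I2)
  have inner: "(\<integral>z. ?F z l \<partial>lborel) = cos (l \<bullet> v) * exp (- (Q l + (c \<bullet> l)\<^sup>2) / 2)" for l
  proof -
    have "?F z l = exp (- Q l / 2) * cos (l \<bullet> v) * (cos ((l \<bullet> c) * z) * std_normal_density z)
        + exp (- Q l / 2) * sin (l \<bullet> v) * (sin ((l \<bullet> c) * z) * std_normal_density z)" for z
      by (simp add: inner_diff_right cos_diff algebra_simps)
    then have "(\<integral>z. ?F z l \<partial>lborel) = exp (- Q l / 2) * cos (l \<bullet> v) * exp (- (l \<bullet> c)\<^sup>2 / 2)"
      using std_normal_cos_sin[of "l \<bullet> c"] by simp
    also have "\<dots> = cos (l \<bullet> v) * exp (- (Q l + (c \<bullet> l)\<^sup>2) / 2)"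
    proof -
      have "- Q l / 2 + - (l \<bullet> c)\<^sup>2 / 2 = - (Q l + (c \<bullet> l)\<^sup>2) / 2" by (simp add: inner_commute[of l c] field_simps)
      then have "exp (- Q l / 2) * exp (- (l \<bullet> c)\<^sup>2 / 2) = exp (- (Q l + (c \<bullet> l)\<^sup>2) / 2)"
        by (simp only: mult_exp_exp)
      then show ?thesis by (metis mult.assoc mult.commute)
    qed
    finally show ?thesis .
  qed
  have "(\<integral>z. gdens Q (v - z *\<^sub>R c) * std_normal_density z \<partial>lborel)
     = (\<integral>z. (1 / (2 * pi) ^ DIM('a)) * (\<integral>l. ?F z l \<partial>lborel) \<partial>lborel)"
    by (intro Bochner_Integration.integral_cong) (auto simp: gdens_def)
  also have "\<dots> = (1 / (2 * pi) ^ DIM('a)) * (\<integral>z. (\<integral>l. ?F z l \<partial>lborel) \<partial>lborel)"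
    by (rule integral_mult_right_zero)
  also have "(\<integral>z. (\<integral>l. ?F z l \<partial>lborel) \<partial>lborel) = (\<integral>l. (\<integral>z. ?F z l \<partial>lborel) \<partial>lborel)"
    by (rule lborel_pair.Fubini_integral[OF F, symmetric])
  also have "(1 / (2 * pi) ^ DIM('a)) * \<dots> = gdens (\<lambda>l. Q l + (c \<bullet> l)\<^sup>2) v"
    by (simp only: gdens_def inner)
  finally show "gdens (\<lambda>l. Q l + (c \<bullet> l)\<^sup>2) v = (\<integral>z. gdens Q (v - z *\<^sub>R c) * std_normal_density z \<partial>lborel)"
    by simp
qed

text \<open>Quadratic forms are kept as functions, so that integrals of them over time are formed pointwise.\<close>

definition qform :: "('a::euclidean_space \<Rightarrow> real) \<Rightarrow> bool" where
  "qform Q \<longleftrightarrow> (\<exists>B. bilinear B \<and> (\<forall>x y. B x y = B y x) \<and> (\<forall>l. Q l = B l l))"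

text \<open>Completing the square in one coordinate leaves a form that vanishes in that coordinate; induction
  over the basis. If \<open>B b b = 0\<close> then Cauchy--Schwarz makes the whole row of \<open>b\<close> vanish.\<close>

lemma bilinear_symmetric_psd_sum_squares:
  fixes B :: "'a::euclidean_space \<Rightarrow> 'a \<Rightarrow> real"
  assumes "finite J" "J \<subseteq> Basis" "bilinear B" "\<And>x y. B x y = B y x" "\<And>x. 0 \<le> B x x"
    and "\<And>b x. b \<in> Basis \<Longrightarrow> b \<notin> J \<Longrightarrow> B b x = 0"
  shows "\<exists>c. \<forall>l. B l l = (\<Sum>b\<in>J. (c b \<bullet> l)\<^sup>2)"
  using assms
proof (induction J arbitrary: B rule: finite_induct)
  case empty
  have "B l l = 0" for l
  proof -
    have lin: "linear (\<lambda>x. B x l)" using empty.prems(2) by (simp add: bilinear_def)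
    have "B l l = B (\<Sum>b\<in>Basis. (l \<bullet> b) *\<^sub>R b) l" by (simp add: euclidean_representation)
    also have "\<dots> = (\<Sum>b\<in>Basis. (l \<bullet> b) * B b l)"
      using linear_sum[OF lin, of "\<lambda>b. (l \<bullet> b) *\<^sub>R b" Basis] linear_cmul[OF lin] by simp
    also have "\<dots> = 0" using empty.prems(5) by simp
    finally show ?thesis .
  qed
  then show ?case by simp
next
  case (insert i J)
  have lin1: "linear (\<lambda>x. B x y)" and lin2: "linear (B x)" for x y
    using insert.prems(2) by (auto simp: bilinear_def)
  note lins = linear_add[OF lin1] linear_add[OF lin2] linear_cmul[OF lin1] linear_cmul[OF lin2]
  have i: "i \<in> Basis" using insert.prems by auto
  show ?case
  proof (cases "B i i = 0")
    case True
    have z: "B i x = 0" for x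
    proof (rule ccontr)
      assume nz: "B i x \<noteq> 0"
      define r where "r = - (B x x + 1) / (2 * B i x)"
      have "B (r *\<^sub>R i + x) (r *\<^sub>R i + x) = 2 * r * B i x + B x x"
        using True by (simp add: lins insert.prems(3)[of x i] algebra_simps)
      also have "\<dots> = - 1" using nz by (simp add: r_def field_simps)
      finally show False using insert.prems(4)[of "r *\<^sub>R i + x"] by simp
    qed
    have "\<exists>c. \<forall>l. B l l = (\<Sum>b\<in>J. (c b \<bullet> l)\<^sup>2)"
      
    proof (rule insert.IH[of B])
      show "B b x = 0" if "b \<in> Basis" "b \<notin> J" for b x
        using insert.prems(5)[of b x] z that by (cases "b = i") auto
    qed (use insert.prems in auto)
    then obtain c where c: "\<And>l. B l l = (\<Sum>b\<in>J. (c b \<bullet> l)\<^sup>2)" by blast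
    show ?thesis
      by (rule exI[of _ "c(i := 0)"]) (use insert.hyps in \<open>auto simp: c intro!: sum.cong\<close>)
  next
    case False
    then have pos: "0 < B i i" using insert.prems(4)[of i] by simp
    define C where "C x y = B x y - B i x * B i y / B i i" for x y
    have "\<exists>c. \<forall>l. C l l = (\<Sum>b\<in>J. (c b \<bullet> l)\<^sup>2)"
    proof (rule insert.IH[of C])
      show "bilinear C"
        unfolding bilinear_def C_def
        by (auto intro!: linearI simp: lins add_divide_distrib algebra_simps diff_divide_distrib)
      show "C x y = C y x" for x y by (simp add: C_def insert.prems(3)[of x y])
      show "0 \<le> C x x" for x
      proof -
        define r where "r = - B i x / B i i"
        have "0 \<le> B (r *\<^sub>R i + x) (r *\<^sub>R i + x)" by (rule insert.prems(4))
        also have "\<dots> = r * r * B i i + 2 * r * B i x + B x x"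
          by (simp add: lins insert.prems(3)[of x i] algebra_simps)
        also have "\<dots> = C x x" using pos by (simp add: r_def C_def field_simps)
        finally show ?thesis .
      qed
      show "C b x = 0" if "b \<in> Basis" "b \<notin> J" for b x
      proof (cases "b = i")
        case True then show ?thesis using pos by (simp add: C_def)
      next
        case False
        then have "B b y = 0" for y using insert.prems(5) that by auto
        then show ?thesis by (simp add: C_def insert.prems(3)[of i b])
      qed
    qed (use insert.prems in auto)
    then obtain c where c: "\<And>l. C l l = (\<Sum>b\<in>J. (c b \<bullet> l)\<^sup>2)" by blast
    define e where "e = (\<Sum>b\<in>Basis. (B i b / sqrt (B i i)) *\<^sub>R b)"
    have e: "e \<bullet> l = B i l / sqrt (B i i)" for l
    proof -
      have "B i l = B i (\<Sum>b\<in>Basis. (l \<bullet> b) *\<^sub>R b)" by (simp add: euclidean_representation)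
      also have "\<dots> = (\<Sum>b\<in>Basis. (l \<bullet> b) * B i b)"
        using linear_sum[OF lin2, of i "\<lambda>b. (l \<bullet> b) *\<^sub>R b" Basis] linear_cmul[OF lin2] by simp
      finally show ?thesis
        by (simp add: e_def inner_sum_left sum_divide_distrib inner_commute[of l] mult_ac)
    qed
    have "B l l = (e \<bullet> l)\<^sup>2 + (\<Sum>b\<in>J. (c b \<bullet> l)\<^sup>2)" for l
      using pos unfolding c[symmetric] by (simp add: e C_def power_divide power2_eq_square)
    moreover have "(\<Sum>b\<in>J. ((c(i := e)) b \<bullet> l)\<^sup>2) = (\<Sum>b\<in>J. (c b \<bullet> l)\<^sup>2)" for l
      using insert.hyps by (intro sum.cong) auto
    ultimately show ?thesis
      by (intro exI[of _ "c(i := e)"]) (use insert.hyps in auto)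
  qed
qed

lemma qform_psd_sum_squares:
  fixes Q :: "'a::euclidean_space \<Rightarrow> real"
  assumes q: "qform Q" and nn: "\<And>l. 0 \<le> Q l" and up: "\<And>l. Q l \<le> \<kappa> * (l \<bullet> l)"
  obtains c where "\<And>l. Q l = (\<Sum>b\<in>(Basis::'a set). (c b \<bullet> l)\<^sup>2)" "\<And>b::'a. b \<in> Basis \<Longrightarrow> c b \<bullet> c b \<le> \<kappa>"
proof -
  from q obtain B where B: "bilinear B" "\<And>x y. B x y = B y x" "\<And>l. Q l = B l l"
    by (auto simp: qform_def)
  have "\<exists>c. \<forall>l. B l l = (\<Sum>b\<in>(Basis::'a set). (c b \<bullet> l)\<^sup>2)"
    by (rule bilinear_symmetric_psd_sum_squares[of Basis B]) (use B nn in auto)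
  then obtain c where c: "\<And>l. Q l = (\<Sum>b\<in>(Basis::'a set). (c b \<bullet> l)\<^sup>2)" using B(3) by auto
  have "c b \<bullet> c b \<le> \<kappa>" if b: "b \<in> Basis" for b :: 'a
  proof (cases "c b = 0")
    case True
    from b have "b \<bullet> b = 1" by simp
    then have "0 \<le> \<kappa>" using nn[of b] up[of b] by simp
    then show ?thesis using True by simp
  next
    case False
    have "(c b \<bullet> c b)\<^sup>2 \<le> (\<Sum>b'\<in>Basis. (c b' \<bullet> c b)\<^sup>2)" by (rule member_le_sum[OF b]) auto
    also have "\<dots> \<le> \<kappa> * (c b \<bullet> c b)" using up[of "c b"] c by simp
    finally show ?thesis using False by (simp add: power2_eq_square)
  qed
  with c show thesis by (rule that)
qed

lemma qform_add:
  assumes "qform Q" "qform R"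
  shows "qform (\<lambda>l. Q l + R l)"
proof -
  obtain B C where B: "bilinear B" "\<And>x y. B x y = B y x" "\<And>l. Q l = B l l"
    and C: "bilinear C" "\<And>x y. C x y = C y x" "\<And>l. R l = C l l"
    using assms unfolding qform_def by blast
  have bil: "bilinear (\<lambda>x y. B x y + C x y)"
    unfolding bilinear_def
    by (intro conjI allI linear_compose_add) (use B(1) C(1) in \<open>simp_all add: bilinear_def\<close>)
  have sym: "B x y + C x y = B y x + C y x" for x y by (simp only: B(2)[of x y] C(2)[of x y])
  show ?thesis
    unfolding qform_def
    by (rule exI[of _ "\<lambda>x y. B x y + C x y"]) (intro conjI allI bil sym, simp only: B(3) C(3))
qed

lemma qform_diff:
  assumes "qform Q" "qform R"
  shows "qform (\<lambda>l. Q l - R l)"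
proof -
  obtain B C where B: "bilinear B" "\<And>x y. B x y = B y x" "\<And>l. Q l = B l l"
    and C: "bilinear C" "\<And>x y. C x y = C y x" "\<And>l. R l = C l l"
    using assms unfolding qform_def by blast
  have bil: "bilinear (\<lambda>x y. B x y - C x y)"
    unfolding bilinear_def
    by (intro conjI allI linear_compose_sub) (use B(1) C(1) in \<open>simp_all add: bilinear_def\<close>)
  have sym: "B x y - C x y = B y x - C y x" for x y by (simp only: B(2)[of x y] C(2)[of x y])
  show ?thesis
    unfolding qform_def
    by (rule exI[of _ "\<lambda>x y. B x y - C x y"]) (intro conjI allI bil sym, simp only: B(3) C(3))
qed

lemma qform_scaled_norm: "qform (\<lambda>l::'a::euclidean_space. r * (l \<bullet> l))"
proof -
  have "bilinear (\<lambda>x y::'a. r * (x \<bullet> y))"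
    unfolding bilinear_def by (intro conjI allI linearI) (simp_all add: inner_add_left inner_add_right algebra_simps)
  then show ?thesis
    unfolding qform_def by (intro exI[of _ "\<lambda>x y. r * (x \<bullet> y)"] conjI allI inner_commute refl arg_cong[where f="(*) r"])
qed

lemma qform_zero: "qform (\<lambda>l::'a::euclidean_space. 0)"
  using qform_scaled_norm[of 0] by (simp only: mult_zero_left)

lemma qform_sum: "(\<And>i. i \<in> I \<Longrightarrow> qform (Q i)) \<Longrightarrow> qform (\<lambda>l. \<Sum>i\<in>I. Q i l)"
proof (induction I rule: infinite_finite_induct)
  case (infinite A)
  then show ?case by (simp only: sum.infinite qform_zero simp_thms)
next
  case empty
  show ?case by (simp only: sum.empty qform_zero)
next
  case (insert x F)
  have "qform (\<lambda>l. Q x l + (\<Sum>i\<in>F. Q i l))"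
    by (rule qform_add) (use insert in blast)+
  then show ?case by (simp only: sum.insert[OF insert.hyps])
qed

section \<open>Off-diagonal bounds for elliptic Gaussian densities\<close>

lemma exp_quarter_std_normal:
  "integrable lborel (\<lambda>z. exp (z\<^sup>2 / 4) * std_normal_density z)"
  "(\<integral>z. exp (z\<^sup>2 / 4) * std_normal_density z \<partial>lborel) = sqrt 2"
proof -
  have eq: "exp (z\<^sup>2 / 4) * std_normal_density z = sqrt 2 * normal_density 0 (sqrt 2) z" for z
  proof -
    have "exp (z\<^sup>2 / 4) * exp (- z\<^sup>2 / 2) = exp (- z\<^sup>2 / 4)" by (simp add: mult_exp_exp)
    moreover have "1 / sqrt 2 = sqrt 2 / (2::real)" by (simp add: real_div_sqrt field_simps)
    ultimately show ?thesis by (simp add: normal_density_def real_sqrt_mult field_simps)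
  qed
  show "integrable lborel (\<lambda>z. exp (z\<^sup>2 / 4) * std_normal_density z)"
    unfolding eq by (intro integrable_mult_right integrable_normal_density) simp
  show "(\<integral>z. exp (z\<^sup>2 / 4) * std_normal_density z \<partial>lborel) = sqrt 2"
    unfolding eq by simp
qed

text \<open>Gaussian decay survives averaging over shifts along \<open>c\<close> at half the rate:
  \<open>v \<bullet> v \<le> 2 (v - z c) \<bullet> (v - z c) + 2 z\<^sup>2 (c \<bullet> c)\<close>, and the bound on \<open>b (c \<bullet> c)\<close> leaves an integrable
  factor \<open>exp (z\<^sup>2 / 4)\<close>.\<close>

lemma gaussian_mixing:
  fixes F :: "'a::euclidean_space \<Rightarrow> real"
  assumes F: "\<And>v. \<bar>F v\<bar> \<le> B * exp (- b * (v \<bullet> v))" and b: "0 \<le> b" "b * (c \<bullet> c) \<le> 1 / 4"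
  shows "\<bar>\<integral>z. F (v - z *\<^sub>R c) * std_normal_density z \<partial>lborel\<bar> \<le> sqrt 2 * B * exp (- (b / 2) * (v \<bullet> v))"
proof -
  have B: "0 \<le> B" using F[of 0] by simp
  have pt: "norm (F (v - z *\<^sub>R c) * std_normal_density z)
      \<le> B * exp (- (b / 2) * (v \<bullet> v)) * (exp (z\<^sup>2 / 4) * std_normal_density z)" for z
  proof -
    let ?u = "v - z *\<^sub>R c"
    have "v \<bullet> v \<le> 2 * (?u \<bullet> ?u) + 2 * (z\<^sup>2 * (c \<bullet> c))"
    proof -
      have "0 \<le> (?u - z *\<^sub>R c) \<bullet> (?u - z *\<^sub>R c)" by simp
      then show ?thesis
        by (simp add: inner_diff_left inner_diff_right inner_commute[of c v] power2_eq_square algebra_simps)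
    qed
    then have "b / 2 * (v \<bullet> v) \<le> b / 2 * (2 * (?u \<bullet> ?u) + 2 * (z\<^sup>2 * (c \<bullet> c)))"
      using b(1) by (intro mult_left_mono) auto
    also have "\<dots> = b * (?u \<bullet> ?u) + z\<^sup>2 * (b * (c \<bullet> c))" by (simp add: algebra_simps)
    also have "\<dots> \<le> b * (?u \<bullet> ?u) + z\<^sup>2 * (1 / 4)"
      using b(2) by (intro add_left_mono mult_left_mono) auto
    finally have "- b * (?u \<bullet> ?u) \<le> - (b / 2) * (v \<bullet> v) + z\<^sup>2 / 4" by simp
    then have "B * exp (- b * (?u \<bullet> ?u)) \<le> B * exp (- (b / 2) * (v \<bullet> v) + z\<^sup>2 / 4)"
      using B by (intro mult_left_mono) auto
    then have "\<bar>F ?u\<bar> \<le> B * exp (- (b / 2) * (v \<bullet> v)) * exp (z\<^sup>2 / 4)"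
      using F[of ?u] by (simp only: exp_add mult.assoc)
    then have "\<bar>F ?u\<bar> * std_normal_density z \<le> B * exp (- (b / 2) * (v \<bullet> v)) * exp (z\<^sup>2 / 4) * std_normal_density z"
      by (intro mult_right_mono) auto
    then show ?thesis by (simp add: abs_mult mult.assoc)
  qed
  show ?thesis
  proof (cases "integrable lborel (\<lambda>z. F (v - z *\<^sub>R c) * std_normal_density z)")
    case True
    have "norm (\<integral>z. F (v - z *\<^sub>R c) * std_normal_density z \<partial>lborel)
       \<le> (\<integral>z. B * exp (- (b / 2) * (v \<bullet> v)) * (exp (z\<^sup>2 / 4) * std_normal_density z) \<partial>lborel)"
      by (rule Bochner_Integration.integral_norm_bound_integral[OF True])
         (intro integrable_mult_right exp_quarter_std_normal pt)+
    also have "\<dots> = B * exp (- (b / 2) * (v \<bullet> v)) * sqrt 2"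
      by (simp only: integral_mult_right_zero exp_quarter_std_normal)
    finally show ?thesis by (simp add: mult_ac)
  next
    case False
    then show ?thesis using B by (simp add: not_integrable_integral_eq)
  qed
qed

definition sqf :: "real \<Rightarrow> 'b set \<Rightarrow> ('b \<Rightarrow> 'a::euclidean_space) \<Rightarrow> 'a \<Rightarrow> real" where
  "sqf s J c l = s * (l \<bullet> l) + (\<Sum>b\<in>J. (c b \<bullet> l)\<^sup>2)"

lemma sqf_measurable [measurable]: "sqf s J c \<in> borel_measurable borel"
  unfolding sqf_def[abs_def] by measurable

lemma sqf_lower: "s * (l \<bullet> l) \<le> sqf s J c l"
  unfolding sqf_def by (simp add: sum_nonneg)

lemma sqf_insert: "finite J \<Longrightarrow> i \<notin> J \<Longrightarrow> sqf s (insert i J) c = (\<lambda>l. sqf s J c l + (c i \<bullet> l)\<^sup>2)"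
  by (auto simp: sqf_def fun_eq_iff)

lemma sqf_empty: "sqf s {} c = (\<lambda>l. s * (l \<bullet> l))"
  by (auto simp: sqf_def fun_eq_iff)

text \<open>Linear combinations of shifts of a density; those of interest are the density itself and its
  second differences, and both obey the same rank one averaging.\<close>

definition shift_comb :: "(real \<times> 'a) list \<Rightarrow> ('a::euclidean_space \<Rightarrow> real) \<Rightarrow> 'a \<Rightarrow> real" where
  "shift_comb xs Q v = (\<Sum>(a, w)\<leftarrow>xs. a * gdens Q (v - w))"

lemma shift_comb_rank_one:
  fixes Q :: "'a::euclidean_space \<Rightarrow> real"
  assumes Q: "Q \<in> borel_measurable borel" "0 < s" "\<And>l. s * (l \<bullet> l) \<le> Q l"
  shows "integrable lborel (\<lambda>z. shift_comb xs Q (v - z *\<^sub>R c) * std_normal_density z) \<and>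
    shift_comb xs (\<lambda>l. Q l + (c \<bullet> l)\<^sup>2) v = (\<integral>z. shift_comb xs Q (v - z *\<^sub>R c) * std_normal_density z \<partial>lborel)"
proof (induction xs)
  case Nil
  show ?case by (simp add: shift_comb_def)
next
  case (Cons x xs)
  obtain a w where x: "x = (a, w)" by (cases x)
  have eq: "shift_comb (x # xs) Q (v - z *\<^sub>R c) * std_normal_density z
     = a * (gdens Q ((v - w) - z *\<^sub>R c) * std_normal_density z) + shift_comb xs Q (v - z *\<^sub>R c) * std_normal_density z" for z
    by (simp add: shift_comb_def x algebra_simps)
  have i: "integrable lborel (\<lambda>z. a * (gdens Q ((v - w) - z *\<^sub>R c) * std_normal_density z))"
    by (intro integrable_mult_right gdens_add_rank_one(1)[OF Q])
  show ?case
    unfolding eq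
    using Cons.IH i gdens_add_rank_one(2)[OF Q, of c "v - w"]
    by (subst Bochner_Integration.integral_add) (auto simp: shift_comb_def x)
qed

text \<open>Any Gaussian bound valid for the isotropic density propagates to \<open>sqf s J c\<close>, at the price of a
  factor depending only on the number of rank one terms.\<close>

lemma shift_comb_bound:
  fixes c :: "'b \<Rightarrow> 'a::euclidean_space"
  assumes "finite J" and s: "0 < s" and b: "0 \<le> b" "b * \<kappa> \<le> 1 / 4"
    and c: "\<And>i. i \<in> J \<Longrightarrow> c i \<bullet> c i \<le> \<kappa>"
    and base: "\<And>v. \<bar>shift_comb xs (\<lambda>l. s * (l \<bullet> l)) v\<bar> \<le> B * exp (- b * (v \<bullet> v))"
  shows "\<bar>shift_comb xs (sqf s J c) v\<bar> \<le> sqrt 2 ^ card J * B * exp (- (b / 2 ^ card J) * (v \<bullet> v))"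
  using assms(1) c
proof (induction J arbitrary: v rule: finite_induct)
  case empty
  then show ?case using base by (simp add: sqf_empty)
next
  case (insert i J)
  have "b / 2 ^ card J * (c i \<bullet> c i) \<le> 1 / 4"
  proof -
    have "b / 2 ^ card J \<le> b / 1" using b by (intro divide_left_mono) auto
    then have "b / 2 ^ card J * (c i \<bullet> c i) \<le> b * \<kappa>"
      using b insert.prems[of i] by (intro mult_mono) auto
    then show ?thesis using b(2) by (rule order_trans)
  qed
  then have "\<bar>\<integral>z. shift_comb xs (sqf s J c) (v - z *\<^sub>R c i) * std_normal_density z \<partial>lborel\<bar>
     \<le> sqrt 2 * (sqrt 2 ^ card J * B) * exp (- (b / 2 ^ card J / 2) * (v \<bullet> v))"
    by (intro gaussian_mixing insert.IH) (use insert.prems b in auto)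
  then show ?case
    using insert.hyps shift_comb_rank_one[OF sqf_measurable s sqf_lower, of xs J c v "c i"]
    by (simp add: sqf_insert mult_ac)
qed

text \<open>The dilation and the prefactor that the isotropic Gaussian acquires after \<open>DIM('a)\<close> mixings of forms
  with condition number \<open>\<kappa>\<close>.\<close>

definition gtheta :: "'a::euclidean_space itself \<Rightarrow> real \<Rightarrow> real" where
  "gtheta _ \<kappa> = 2 * \<kappa> * 2 ^ DIM('a)"

definition gconst :: "'a::euclidean_space itself \<Rightarrow> real \<Rightarrow> real" where
  "gconst _ \<kappa> = sqrt 2 ^ DIM('a) * gtheta TYPE('a) \<kappa> powr (real DIM('a) / 2)"

lemma gtheta_pos: "0 < \<kappa> \<Longrightarrow> 0 < gtheta TYPE('a::euclidean_space) \<kappa>"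
  by (simp add: gtheta_def)

lemma gconst_pos: "0 < \<kappa> \<Longrightarrow> 0 < gconst TYPE('a::euclidean_space) \<kappa>"
  using gtheta_pos[of \<kappa>, where ?'a='a] by (simp add: gconst_def)

lemma shift_comb_iso_bound:
  fixes Q :: "'a::euclidean_space \<Rightarrow> real"
  assumes s: "0 < s" and \<kappa>: "1 \<le> \<kappa>" and q: "qform Q"
    and Q: "\<And>l. s * (l \<bullet> l) \<le> Q l" "\<And>l. Q l \<le> \<kappa> * s * (l \<bullet> l)"
    and base: "\<And>v::'a. \<bar>shift_comb xs (\<lambda>l. s * (l \<bullet> l)) v\<bar>
        \<le> A * (2 * pi * s) powr (- real DIM('a) / 2) * exp (- (v \<bullet> v) / (4 * s))"
    and A: "0 \<le> A"
  shows "\<bar>shift_comb xs Q v\<bar> \<le> A * gconst TYPE('a) \<kappa> * iso_gdens (gtheta TYPE('a) \<kappa> * s) v"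
proof -
  have qf: "qform (\<lambda>l. Q l - s * (l \<bullet> l))" by (intro qform_diff q qform_scaled_norm)
  have nn: "0 \<le> Q l - s * (l \<bullet> l)" for l using Q(1)[of l] by simp
  have up: "Q l - s * (l \<bullet> l) \<le> (\<kappa> * s) * (l \<bullet> l)" for l
  proof -
    have "0 \<le> s * (l \<bullet> l)" using s by simp
    then show ?thesis using Q(2)[of l] by linarith
  qed
  obtain c where c: "\<And>l. Q l - s * (l \<bullet> l) = (\<Sum>b\<in>(Basis::'a set). (c b \<bullet> l)\<^sup>2)"
    and cc: "\<And>b::'a. b \<in> Basis \<Longrightarrow> c b \<bullet> c b \<le> \<kappa> * s"
    using qform_psd_sum_squares[OF qf nn up] by blast
  have Qs: "Q = sqf s Basis c"
    using c by (auto simp: sqf_def fun_eq_iff algebra_simps)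
  let ?P = "(2 * pi * s) powr (- real DIM('a) / 2)"
  have "\<bar>shift_comb xs (sqf s Basis c) v\<bar> \<le> sqrt 2 ^ card (Basis::'a set) * (A * ?P)
      * exp (- (1 / (4 * \<kappa> * s) / 2 ^ card (Basis::'a set)) * (v \<bullet> v))"
  proof (rule shift_comb_bound[OF finite_Basis s _ _ cc])
    show "\<bar>shift_comb xs (\<lambda>l. s * (l \<bullet> l)) v\<bar> \<le> A * ?P * exp (- (1 / (4 * \<kappa> * s)) * (v \<bullet> v))" for v :: 'a
    proof -
      have "(v \<bullet> v) / (4 * s) * (1 / \<kappa>) \<le> (v \<bullet> v) / (4 * s) * 1"
        using s \<kappa> by (intro mult_left_mono) auto
      then have "exp (- (v \<bullet> v) / (4 * s)) \<le> exp (- (1 / (4 * \<kappa> * s)) * (v \<bullet> v))"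
        by (simp add: mult_ac)
      then show ?thesis
        using A by (intro order_trans[OF base] mult_left_mono mult_nonneg_nonneg) auto
    qed
    show "1 / (4 * \<kappa> * s) * (\<kappa> * s) \<le> 1 / 4" using s \<kappa> by simp
  qed (use s \<kappa> in auto)
  also have "\<dots> = A * gconst TYPE('a) \<kappa> * iso_gdens (gtheta TYPE('a) \<kappa> * s) v"
  proof -
    let ?th = "gtheta TYPE('a) \<kappa>"
    have th: "0 < ?th" using \<kappa> by (intro gtheta_pos) simp
    have 1: "(2 * pi * (?th * s)) powr (- real DIM('a) / 2) = ?th powr (- (real DIM('a) / 2)) * ?P"
    proof -
      have "2 * pi * (?th * s) = ?th * (2 * pi * s)" by simp
      then show ?thesis using th s by (simp add: powr_mult)
    qed
    have 2: "?th powr (real DIM('a) / 2) * ?th powr (- (real DIM('a) / 2)) = 1"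
      using th by (simp flip: powr_add)
    have 3: "- (1 / (4 * \<kappa> * s) / 2 ^ card (Basis::'a set)) * (v \<bullet> v) = - (v \<bullet> v) / (2 * (?th * s))"
      by (simp add: gtheta_def mult_ac)
    have "A * gconst TYPE('a) \<kappa> * iso_gdens (?th * s) v
       = sqrt 2 ^ DIM('a) * (A * ?P) * exp (- (v \<bullet> v) / (2 * (?th * s))) * (?th powr (real DIM('a) / 2) * ?th powr (- (real DIM('a) / 2)))"
      unfolding gconst_def iso_gdens_def 1 by (simp only: mult_ac)
    then show ?thesis by (simp only: 2 3 mult_1_right)
  qed
  finally show ?thesis by (simp only: Qs)
qed

lemma gdens_upper:
  fixes Q :: "'a::euclidean_space \<Rightarrow> real"
  assumes s: "0 < s" and \<kappa>: "1 \<le> \<kappa>" and q: "qform Q"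
    and Q: "\<And>l. s * (l \<bullet> l) \<le> Q l" "\<And>l. Q l \<le> \<kappa> * s * (l \<bullet> l)"
  shows "\<bar>gdens Q v\<bar> \<le> gconst TYPE('a) \<kappa> * iso_gdens (gtheta TYPE('a) \<kappa> * s) v"
proof -
  have "\<bar>shift_comb [(1, 0)] Q v\<bar> \<le> 1 * gconst TYPE('a) \<kappa> * iso_gdens (gtheta TYPE('a) \<kappa> * s) v"
  proof (rule shift_comb_iso_bound[OF assms])
    show "\<bar>shift_comb [(1, 0)] (\<lambda>l. s * (l \<bullet> l)) v\<bar>
        \<le> 1 * (2 * pi * s) powr (- real DIM('a) / 2) * exp (- (v \<bullet> v) / (4 * s))" for v :: 'a
    proof -
      have "(v \<bullet> v) / (4 * s) \<le> (v \<bullet> v) / (2 * s)"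
        using s by (intro divide_left_mono) auto
      then show ?thesis
        using s by (simp add: shift_comb_def iso_fourier iso_gdens_def abs_mult)
    qed
  qed auto
  then show ?thesis by (simp add: shift_comb_def)
qed

lemma cosh_minus_one_bound: "exp a + exp (- a) - 2 \<le> a\<^sup>2 * exp \<bar>a::real\<bar>"
proof -
  have *: "exp a + exp (- a) - 2 \<le> a\<^sup>2 * exp a" if "0 \<le> a" for a :: real
  proof -
    have 1: "exp (a/2) - exp (- (a/2)) \<le> a * exp (a / 2)"
    proof -
      have "exp (a/2) * (1 - a) \<le> exp (a/2) * exp (- a)"
        using exp_ge_add_one_self[of "- a"] by (intro mult_left_mono) auto
      also have "\<dots> = exp (- (a/2))" by (simp add: mult_exp_exp)
      finally show ?thesis by (simp add: algebra_simps)
    qed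
    have 2: "0 \<le> exp (a/2) - exp (- (a/2))" using that by simp
    have "exp a + exp (- a) - 2 = (exp (a/2) - exp (- (a/2)))\<^sup>2"
      by (simp add: power2_diff exp_double[symmetric] mult_exp_exp)
    also have "\<dots> \<le> (a * exp (a / 2))\<^sup>2" by (intro power_mono 1 2)
    also have "\<dots> = a\<^sup>2 * exp a" by (simp add: power_mult_distrib exp_double[symmetric])
    finally show ?thesis .
  qed
  show ?thesis using *[of a] *[of "- a"] by (cases "0 \<le> a") (auto simp: add.commute)
qed

text \<open>The second difference is of order \<open>w \<bullet> w\<close>, whereas a first difference would only be of order
  \<open>norm w\<close>. Half of the exponent is spent to absorb the mixed term \<open>v \<bullet> w\<close>.\<close>

lemma iso_second_difference:
  fixes v w :: "'a::euclidean_space"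
  assumes s: "0 < s"
  shows "\<bar>iso_gdens s (v - w) + iso_gdens s (v + w) - 2 * iso_gdens s v\<bar>
    \<le> (9 * ((w \<bullet> w) / s) * exp (2 * ((w \<bullet> w) / s))) * (2 * pi * s) powr (- real DIM('a) / 2) * exp (- (v \<bullet> v) / (4 * s))"
proof -
  define X W a where "X = (v \<bullet> v) / s" and "W = (w \<bullet> w) / s" and "a = (v \<bullet> w) / s"
  have X: "0 \<le> X" and W: "0 \<le> W" using s by (auto simp: X_def W_def)
  have a2: "a\<^sup>2 \<le> X * W"
    using Cauchy_Schwarz_ineq[of v w] s by (simp add: a_def X_def W_def power_divide power2_eq_square divide_right_mono)
  have "\<bar>a\<bar> \<le> X / 8 + 2 * W"
  proof (rule power2_le_imp_le)
    have "0 \<le> (X / 8 - 2 * W)\<^sup>2" by simp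
    then have "X * W \<le> (X / 8 + 2 * W)\<^sup>2" by (simp add: power2_eq_square algebra_simps)
    then show "\<bar>a\<bar>\<^sup>2 \<le> (X / 8 + 2 * W)\<^sup>2" using a2 by simp
  qed (use X W in auto)
  then have ea: "exp \<bar>a\<bar> \<le> exp (X / 8) * exp (2 * W)" by (simp add: mult_exp_exp)
  have "\<bar>exp (- W / 2) * (exp a + exp (- a)) - 2\<bar> \<le> X * W * (exp (X / 8) * exp (2 * W)) + W"
  proof -
    have *: "0 \<le> u \<Longrightarrow> u \<le> 1 * r \<Longrightarrow> r \<le> y \<Longrightarrow> 0 \<le> z \<Longrightarrow> z \<le> W / 2 \<Longrightarrow> \<bar>u - 2 * z\<bar> \<le> y + W" for u r y z :: real
      using W by linarith
    have p: "0 \<le> exp a + exp (- a) - 2"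
      using cosh_real_ge_1[of a] by (simp add: cosh_def)
    have e1: "exp (- W / 2) \<le> 1" using W by simp
    have e2: "1 - exp (- W / 2) \<le> W / 2" using exp_ge_add_one_self[of "- W / 2"] by simp
    have "exp (- W / 2) * (exp a + exp (- a) - 2) \<le> 1 * (exp a + exp (- a) - 2)"
      using e1 p by (intro mult_right_mono)
    moreover have "0 \<le> exp (- W / 2) * (exp a + exp (- a) - 2)" using p by simp
    moreover have "exp (- W / 2) * (exp a + exp (- a)) - 2 = exp (- W / 2) * (exp a + exp (- a) - 2) - 2 * (1 - exp (- W / 2))"
      by (simp add: algebra_simps)
    moreover have "exp a + exp (- a) - 2 \<le> X * W * (exp (X / 8) * exp (2 * W))"
    proof (rule order_trans[OF cosh_minus_one_bound])
      show "a\<^sup>2 * exp \<bar>a\<bar> \<le> X * W * (exp (X / 8) * exp (2 * W))"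
        using X W by (intro mult_mono a2 ea) auto
    qed
    moreover have "0 \<le> 1 - exp (- W / 2)" using e1 by simp
    ultimately show ?thesis using e2 *[of "exp (- W / 2) * (exp a + exp (- a) - 2)" "exp a + exp (- a) - 2"
        "X * W * (exp (X / 8) * exp (2 * W))" "1 - exp (- W / 2)"] by metis
  qed
  also have "\<dots> \<le> 9 * W * exp (2 * W) * exp (X / 4)"
  proof -
    have "X / 8 \<le> exp (X / 8)" using exp_ge_add_one_self[of "X / 8"] by linarith
    then have "X * exp (X / 8) \<le> (8 * exp (X / 8)) * exp (X / 8)" by (intro mult_right_mono) auto
    also have "\<dots> = 8 * exp (X / 4)" by (simp add: mult_exp_exp)
    finally have "X * exp (X / 8) * (W * exp (2 * W)) \<le> 8 * exp (X / 4) * (W * exp (2 * W))"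
      using W by (intro mult_right_mono) auto
    moreover have "W * 1 \<le> W * (exp (2 * W) * exp (X / 4))"
    proof -
      have "1 \<le> exp (2 * W + X / 4)" using X W by simp
      then show ?thesis using W by (intro mult_left_mono) (auto simp: exp_add)
    qed
    ultimately show ?thesis by (simp add: algebra_simps)
  qed
  finally have main: "\<bar>exp (- W / 2) * (exp a + exp (- a)) - 2\<bar> \<le> 9 * W * exp (2 * W) * exp (X / 4)" .
  let ?P = "(2 * pi * s) powr (- real DIM('a) / 2)"
  have i0: "iso_gdens s v = ?P * exp (- X / 2)" by (simp add: iso_gdens_def X_def)
  have i1: "iso_gdens s (v - w) = ?P * (exp (- X / 2) * (exp (- W / 2) * exp a))"
  proof -
    have "- ((v - w) \<bullet> (v - w)) / (2 * s) = - X / 2 + (- W / 2 + a)"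
      using s by (simp add: X_def W_def a_def inner_diff_left inner_diff_right inner_commute[of w v] field_simps)
    then show ?thesis by (simp only: iso_gdens_def mult_exp_exp)
  qed
  have i2: "iso_gdens s (v + w) = ?P * (exp (- X / 2) * (exp (- W / 2) * exp (- a)))"
  proof -
    have "- ((v + w) \<bullet> (v + w)) / (2 * s) = - X / 2 + (- W / 2 + - a)"
      using s by (simp add: X_def W_def a_def inner_add_left inner_add_right inner_commute[of w v] field_simps)
    then show ?thesis by (simp only: iso_gdens_def mult_exp_exp)
  qed
  have "iso_gdens s (v - w) + iso_gdens s (v + w) - 2 * iso_gdens s v
     = ?P * exp (- X / 2) * (exp (- W / 2) * (exp a + exp (- a)) - 2)"
    unfolding i0 i1 i2 by (simp add: algebra_simps)
  then have "\<bar>iso_gdens s (v - w) + iso_gdens s (v + w) - 2 * iso_gdens s v\<bar>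
     = ?P * exp (- X / 2) * \<bar>exp (- W / 2) * (exp a + exp (- a)) - 2\<bar>"
    by (simp only: abs_mult abs_exp_cancel) (simp)
  also have "\<dots> \<le> ?P * exp (- X / 2) * (9 * W * exp (2 * W) * exp (X / 4))"
    by (intro mult_left_mono main) auto
  also have "\<dots> = (9 * W * exp (2 * W)) * ?P * (exp (- X / 2) * exp (X / 4))" by (simp only: mult_ac)
  also have "exp (- X / 2) * exp (X / 4) = exp (- (v \<bullet> v) / (4 * s))"
  proof -
    have "- X / 2 + X / 4 = - (v \<bullet> v) / (4 * s)" by (simp add: X_def)
    then show ?thesis by (simp only: mult_exp_exp)
  qed
  finally show ?thesis by (simp only: W_def)
qed

lemma qform_measurable:
  fixes Q :: "'a::euclidean_space \<Rightarrow> real"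
  assumes "qform Q"
  shows "Q \<in> borel_measurable borel"
proof -
  obtain B where B: "bilinear B" "\<And>l. Q l = B l l" using assms unfolding qform_def by blast
  have "continuous_on UNIV Q"
    unfolding B(2)
    using bounded_bilinear.continuous_on[OF bilinear_conv_bounded_bilinear[THEN iffD1, OF B(1)] continuous_on_id continuous_on_id]
    by simp
  then show ?thesis by (rule borel_measurable_continuous_onI)
qed

lemma qform_sqf: "qform (\<lambda>l. (c \<bullet> l)\<^sup>2)"
proof -
  have "bilinear (\<lambda>x y. (c \<bullet> x) * (c \<bullet> y))"
    unfolding bilinear_def by (intro conjI allI linearI) (simp_all add: inner_add_right algebra_simps)
  then show ?thesis
    unfolding qform_def
    by (intro exI[of _ "\<lambda>x y. (c \<bullet> x) * (c \<bullet> y)"] conjI allI mult.commute power2_eq_square)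
qed

lemma iso_gdens_nonneg [simp]: "0 \<le> iso_gdens s v"
  by (simp add: iso_gdens_def)

text \<open>The rank one average is symmetric, so only second differences of the density matter and the
  change of the density is linear in the size \<open>c \<bullet> c\<close> of the added form.\<close>

lemma gdens_rank_one_increment:
  fixes Q :: "'a::euclidean_space \<Rightarrow> real"
  assumes s: "0 < s" and \<kappa>: "1 \<le> \<kappa>" and q: "qform Q"
    and Q: "\<And>l. s * (l \<bullet> l) \<le> Q l" and Q': "\<And>l. Q l + (c \<bullet> l)\<^sup>2 \<le> \<kappa> * s * (l \<bullet> l)"
  shows "\<bar>gdens (\<lambda>l. Q l + (c \<bullet> l)\<^sup>2) v - gdens Q v\<bar>
     \<le> 72 * gconst TYPE('a) \<kappa> * ((c \<bullet> c) / s) * iso_gdens (gtheta TYPE('a) \<kappa> * s) v"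
proof -
  let ?I = "iso_gdens (gtheta TYPE('a) \<kappa> * s) v" and ?G = "gconst TYPE('a) \<kappa>"
  have G: "0 < ?G" using \<kappa> by (intro gconst_pos) simp
  have Qup: "Q l \<le> \<kappa> * s * (l \<bullet> l)" for l
    using Q'[of l] zero_le_power2[of "c \<bullet> l"] by linarith
  note Qm = qform_measurable[OF q]
  show ?thesis
  proof (cases "c \<bullet> c \<le> s / 16")
    case False
    (* For a large increment 72 (c \<bullet> c) / s exceeds 2, and bounding both densities suffices. *)
    have "\<bar>gdens Q v\<bar> \<le> ?G * ?I" by (rule gdens_upper[OF s \<kappa> q Q Qup])
    moreover have "\<bar>gdens (\<lambda>l. Q l + (c \<bullet> l)\<^sup>2) v\<bar> \<le> ?G * ?I"
    proof (rule gdens_upper[OF s \<kappa> _ _ Q'])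
      show "qform (\<lambda>l. Q l + (c \<bullet> l)\<^sup>2)" by (intro qform_add q qform_sqf)
      show "s * (l \<bullet> l) \<le> Q l + (c \<bullet> l)\<^sup>2" for l
        using Q[of l] zero_le_power2[of "c \<bullet> l"] by linarith
    qed
    ultimately have "\<bar>gdens (\<lambda>l. Q l + (c \<bullet> l)\<^sup>2) v - gdens Q v\<bar> \<le> 2 * (?G * ?I)" by linarith
    also have "\<dots> \<le> 72 * ((c \<bullet> c) / s) * (?G * ?I)"
      using False s G by (intro mult_right_mono) (auto simp: field_simps)
    finally show ?thesis by (simp only: mult_ac)
  next
    case True
    (* Averaging over z and - z turns the first difference into a second one. *)
    define D where "D w = gdens Q (v - w) + gdens Q (v + w) - 2 * gdens Q v" for w
    have D: "\<bar>D w\<bar> \<le> (9 * ((w \<bullet> w) / s) * exp (2 * ((w \<bullet> w) / s))) * ?G * ?I" for w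
    proof -
      have "\<bar>shift_comb [(1, w), (1, - w), (- 2, 0)] Q v\<bar> \<le> (9 * ((w \<bullet> w) / s) * exp (2 * ((w \<bullet> w) / s))) * ?G * ?I"
      proof (rule shift_comb_iso_bound[OF s \<kappa> q Q Qup])
        show "\<bar>shift_comb [(1, w), (1, - w), (- 2, 0)] (\<lambda>l. s * (l \<bullet> l)) v\<bar>
          \<le> (9 * ((w \<bullet> w) / s) * exp (2 * ((w \<bullet> w) / s))) * (2 * pi * s) powr (- real DIM('a) / 2) * exp (- (v \<bullet> v) / (4 * s))"
          for v :: 'a
          using iso_second_difference[OF s, of v w] by (simp add: shift_comb_def iso_fourier(2)[OF s])
      qed (use s in auto)
      then show ?thesis by (simp add: shift_comb_def D_def)
    qed
    have i1: "integrable lborel (\<lambda>z. gdens Q (v - z *\<^sub>R c) * std_normal_density z)"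
      by (rule gdens_add_rank_one(1)[OF Qm s Q])
    have i2: "integrable lborel (\<lambda>z. gdens Q (v + z *\<^sub>R c) * std_normal_density z)"
      using gdens_add_rank_one(1)[OF Qm s Q, of v "- c"] by simp
    have i3: "integrable lborel (\<lambda>z. 2 * gdens Q v * std_normal_density z)" by simp
    have eqD: "D (z *\<^sub>R c) * std_normal_density z = gdens Q (v - z *\<^sub>R c) * std_normal_density z
        + gdens Q (v + z *\<^sub>R c) * std_normal_density z - 2 * gdens Q v * std_normal_density z" for z
      by (simp add: D_def algebra_simps)
    have iD: "integrable lborel (\<lambda>z. D (z *\<^sub>R c) * std_normal_density z)"
      unfolding eqD by (intro Bochner_Integration.integrable_diff Bochner_Integration.integrable_add i1 i2 i3)
    have "(\<integral>z. D (z *\<^sub>R c) * std_normal_density z \<partial>lborel)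
        = gdens (\<lambda>l. Q l + (c \<bullet> l)\<^sup>2) v + gdens (\<lambda>l. Q l + (c \<bullet> l)\<^sup>2) v - 2 * gdens Q v"
      unfolding eqD using gdens_add_rank_one(2)[OF Qm s Q, of c v] gdens_add_rank_one(2)[OF Qm s Q, of "- c" v] i1 i2 i3
      by (simp add: Bochner_Integration.integral_diff Bochner_Integration.integral_add)
    then have eq: "2 * (gdens (\<lambda>l. Q l + (c \<bullet> l)\<^sup>2) v - gdens Q v) = (\<integral>z. D (z *\<^sub>R c) * std_normal_density z \<partial>lborel)"
      by simp
    define E where "E = 72 * ((c \<bullet> c) / s) * ?G * ?I"
    have pt: "norm (D (z *\<^sub>R c) * std_normal_density z) \<le> E * (exp (z\<^sup>2 / 4) * std_normal_density z)" for z
    proof -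
      define W where "W = (c \<bullet> c) / s"
      have W: "0 \<le> W" "W \<le> 1 / 16" using True s by (auto simp: W_def field_simps)
      have e: "((z *\<^sub>R c) \<bullet> (z *\<^sub>R c)) / s = z\<^sup>2 * W" by (simp add: W_def power2_eq_square)
      have "z\<^sup>2 / 8 \<le> exp (z\<^sup>2 / 8)" using exp_ge_add_one_self[of "z\<^sup>2 / 8"] by linarith
      moreover have "exp (2 * (z\<^sup>2 * W)) \<le> exp (z\<^sup>2 / 8)"
        using mult_left_mono[OF W(2), of "z\<^sup>2"] by simp
      ultimately have "z\<^sup>2 / 8 * exp (2 * (z\<^sup>2 * W)) \<le> exp (z\<^sup>2 / 8) * exp (z\<^sup>2 / 8)"
        by (intro mult_mono) auto
      then have "z\<^sup>2 * exp (2 * (z\<^sup>2 * W)) \<le> 8 * exp (z\<^sup>2 / 4)" by (simp add: mult_exp_exp)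
      then have "(9 * W) * (z\<^sup>2 * exp (2 * (z\<^sup>2 * W))) \<le> (9 * W) * (8 * exp (z\<^sup>2 / 4))"
        using W by (intro mult_left_mono) auto
      then have "(9 * (z\<^sup>2 * W) * exp (2 * (z\<^sup>2 * W))) * (?G * ?I) \<le> (72 * W * exp (z\<^sup>2 / 4)) * (?G * ?I)"
        using G by (intro mult_right_mono) (auto simp: mult_ac)
      then have "\<bar>D (z *\<^sub>R c)\<bar> \<le> E * exp (z\<^sup>2 / 4)"
        using D[of "z *\<^sub>R c"] unfolding e E_def W_def[symmetric] by (simp add: mult_ac)
      then show ?thesis
        by (simp add: abs_mult mult.assoc[symmetric] mult_right_mono)
    qed
    have "norm (\<integral>z. D (z *\<^sub>R c) * std_normal_density z \<partial>lborel)
      \<le> (\<integral>z. E * (exp (z\<^sup>2 / 4) * std_normal_density z) \<partial>lborel)"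
      by (rule Bochner_Integration.integral_norm_bound_integral[OF iD])
         (intro integrable_mult_right exp_quarter_std_normal pt)+
    also have "\<dots> = E * sqrt 2" by (simp only: integral_mult_right_zero exp_quarter_std_normal)
    also have "\<dots> \<le> E * 2"
      using G s by (intro mult_left_mono) (auto simp: E_def sqrt2_less_2 less_imp_le)
    finally have "\<bar>gdens (\<lambda>l. Q l + (c \<bullet> l)\<^sup>2) v - gdens Q v\<bar> \<le> E"
      unfolding eq[symmetric] by (simp add: abs_mult)
    then show ?thesis by (simp add: E_def mult_ac)
  qed
qed

lemma gdens_increment:
  fixes Q :: "'a::euclidean_space \<Rightarrow> real"
  assumes s: "0 < s" and \<kappa>: "1 \<le> \<kappa>" and q: "qform Q" and J: "finite J"
    and Q: "\<And>l. s * (l \<bullet> l) \<le> Q l" and Q': "\<And>l. Q l + (\<Sum>i\<in>J. (c i \<bullet> l)\<^sup>2) \<le> \<kappa> * s * (l \<bullet> l)"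
  shows "\<bar>gdens (\<lambda>l. Q l + (\<Sum>i\<in>J. (c i \<bullet> l)\<^sup>2)) v - gdens Q v\<bar>
     \<le> 72 * gconst TYPE('a) \<kappa> * ((\<Sum>i\<in>J. c i \<bullet> c i) / s) * iso_gdens (gtheta TYPE('a) \<kappa> * s) v"
  using J Q'
proof (induction J rule: finite_induct)
  case empty
  then show ?case by simp
next
  case (insert i J)
  let ?I = "iso_gdens (gtheta TYPE('a) \<kappa> * s) v" and ?G = "gconst TYPE('a) \<kappa>"
  let ?R = "\<lambda>l. Q l + (\<Sum>i\<in>J. (c i \<bullet> l)\<^sup>2)"
  have ins: "(\<lambda>l. Q l + (\<Sum>i\<in>insert i J. (c i \<bullet> l)\<^sup>2)) = (\<lambda>l. ?R l + (c i \<bullet> l)\<^sup>2)"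
    using insert.hyps by (simp add: fun_eq_iff)
  have up: "?R l + (c i \<bullet> l)\<^sup>2 \<le> \<kappa> * s * (l \<bullet> l)" for l
    using insert.prems[of l] insert.hyps by (simp add: add_ac)
  have up2: "?R l \<le> \<kappa> * s * (l \<bullet> l)" for l
    using up[of l] zero_le_power2[of "c i \<bullet> l"] by linarith
  have "\<bar>gdens (\<lambda>l. ?R l + (c i \<bullet> l)\<^sup>2) v - gdens ?R v\<bar> \<le> 72 * ?G * ((c i \<bullet> c i) / s) * ?I"
  proof (rule gdens_rank_one_increment[OF s \<kappa> _ _ up])
    show "qform ?R" by (intro qform_add q qform_sum qform_sqf)
    show "s * (l \<bullet> l) \<le> ?R l" for l using Q[of l] by (simp add: sum_nonneg add_increasing2)
  qed
  moreover have "\<bar>gdens ?R v - gdens Q v\<bar> \<le> 72 * ?G * ((\<Sum>i\<in>J. c i \<bullet> c i) / s) * ?I"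
    by (rule insert.IH[OF up2])
  moreover have "72 * ?G * ((\<Sum>i\<in>insert i J. c i \<bullet> c i) / s) * ?I
     = 72 * ?G * ((c i \<bullet> c i) / s) * ?I + 72 * ?G * ((\<Sum>i\<in>J. c i \<bullet> c i) / s) * ?I"
    using insert.hyps by (simp add: add_divide_distrib distrib_left distrib_right)
  ultimately show ?case unfolding ins by linarith
qed

text \<open>The difference of ordered forms is again a sum of rank one forms, each of size at most \<open>\<eta>\<close>.\<close>

lemma gdens_ordered_difference:
  fixes Q :: "'a::euclidean_space \<Rightarrow> real"
  assumes s: "0 < s" and \<kappa>: "1 \<le> \<kappa>" and q: "qform Q" "qform R"
    and Q: "\<And>l. s * (l \<bullet> l) \<le> Q l" and R: "\<And>l. R l \<le> \<kappa> * s * (l \<bullet> l)"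
    and QR: "\<And>l. Q l \<le> R l" "\<And>l. R l - Q l \<le> \<eta> * (l \<bullet> l)"
  shows "\<bar>gdens R v - gdens Q v\<bar>
     \<le> 72 * DIM('a) * gconst TYPE('a) \<kappa> * (\<eta> / s) * iso_gdens (gtheta TYPE('a) \<kappa> * s) v"
proof -
  let ?I = "iso_gdens (gtheta TYPE('a) \<kappa> * s) v" and ?G = "gconst TYPE('a) \<kappa>"
  have qf: "qform (\<lambda>l. R l - Q l)" by (intro qform_diff q)
  have nn: "0 \<le> R l - Q l" for l using QR(1)[of l] by simp
  obtain c where c: "\<And>l. R l - Q l = (\<Sum>b\<in>(Basis::'a set). (c b \<bullet> l)\<^sup>2)"
    and cc: "\<And>b::'a. b \<in> Basis \<Longrightarrow> c b \<bullet> c b \<le> \<eta>"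
    using qform_psd_sum_squares[OF qf nn QR(2)] by blast
  have Req: "R = (\<lambda>l. Q l + (\<Sum>b\<in>(Basis::'a set). (c b \<bullet> l)\<^sup>2))"
    using c by (auto simp: fun_eq_iff algebra_simps)
  have "\<bar>gdens (\<lambda>l. Q l + (\<Sum>b\<in>(Basis::'a set). (c b \<bullet> l)\<^sup>2)) v - gdens Q v\<bar>
     \<le> 72 * ?G * ((\<Sum>b\<in>(Basis::'a set). c b \<bullet> c b) / s) * ?I"
    by (rule gdens_increment[OF s \<kappa> q(1) finite_Basis Q]) (use R in \<open>simp only: Req\<close>)
  also have "\<dots> \<le> 72 * ?G * ((DIM('a) * \<eta>) / s) * ?I"
    using s \<kappa> cc sum_bounded_above[of "Basis::'a set" "\<lambda>b. c b \<bullet> c b" \<eta>]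
    by (intro mult_right_mono mult_left_mono divide_right_mono mult_nonneg_nonneg less_imp_le[OF gconst_pos]) auto
  finally show ?thesis by (simp add: Req mult_ac)
qed

text \<open>Constants for the two comparison results below. They use \<open>\<kappa> + 1\<close> because forms are compared
  through a common majorant, which is slightly less elliptic; \<open>216 = 3 * 72\<close> collects two increments,
  of sizes \<open>2 \<eta>\<close> and \<open>\<eta>\<close>.\<close>

definition gaussian_const :: "'a::euclidean_space itself \<Rightarrow> real \<Rightarrow> real" where
  "gaussian_const _ \<kappa> = 216 * real DIM('a) * gconst TYPE('a) (\<kappa> + 1)"

definition gaussian_width :: "'a::euclidean_space itself \<Rightarrow> real \<Rightarrow> real" where
  "gaussian_width _ \<kappa> = gtheta TYPE('a) (\<kappa> + 1)"

lemma gaussian_const_pos: "1 \<le> \<kappa> \<Longrightarrow> 0 < gaussian_const TYPE('a::euclidean_space) \<kappa>"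
  and gaussian_width_pos: "1 \<le> \<kappa> \<Longrightarrow> 0 < gaussian_width TYPE('a) \<kappa>"
  by (auto simp: gaussian_const_def gaussian_width_def intro!: mult_pos_pos gconst_pos gtheta_pos)

lemma gaussian_kernel_upper:
  fixes Q :: "'a::euclidean_space \<Rightarrow> real"
  assumes \<kappa>: "1 \<le> \<kappa>" and s: "0 < s" and q: "qform Q"
    and Q: "\<And>l. s * (l \<bullet> l) \<le> Q l" "\<And>l. Q l \<le> \<kappa> * s * (l \<bullet> l)"
  shows "gdens Q v \<le> gaussian_const TYPE('a) \<kappa> * iso_gdens (gaussian_width TYPE('a) \<kappa> * s) v"
    and "2 * \<bar>gdens Q v\<bar> \<le> gaussian_const TYPE('a) \<kappa> * iso_gdens (gaussian_width TYPE('a) \<kappa> * s) v"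
proof -
  let ?G = "gconst TYPE('a) (\<kappa> + 1)" and ?I = "iso_gdens (gaussian_width TYPE('a) \<kappa> * s) v"
  have G: "0 < ?G" using \<kappa> by (intro gconst_pos) simp
  have D: "1 \<le> real DIM('a)" using DIM_positive[where 'a='a] by linarith
  have "\<bar>gdens Q v\<bar> \<le> ?G * ?I"
    unfolding gaussian_width_def
  proof (rule gdens_upper[OF s _ q Q(1)])
    fix l :: 'a
    have "0 \<le> s * (l \<bullet> l)" using s by simp
    then show "Q l \<le> (\<kappa> + 1) * s * (l \<bullet> l)" using Q(2)[of l] by (simp add: distrib_right)
  qed (use \<kappa> in simp)
  moreover have "2 * ?G \<le> gaussian_const TYPE('a) \<kappa>"
    unfolding gaussian_const_def by (rule mult_right_mono) (use D G in linarith)+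
  then have "2 * ?G * ?I \<le> gaussian_const TYPE('a) \<kappa> * ?I" by (intro mult_right_mono) auto
  ultimately show b: "2 * \<bar>gdens Q v\<bar> \<le> gaussian_const TYPE('a) \<kappa> * ?I" by linarith
  then show "gdens Q v \<le> gaussian_const TYPE('a) \<kappa> * ?I" by linarith
qed

text \<open>The Lipschitz dependence of an elliptic Gaussian density on its covariance, with a Gaussian error.
  For \<open>\<eta> > s\<close> the upper bound for both densities already suffices.\<close>

lemma gaussian_kernel_difference:
  fixes Q Q' :: "'a::euclidean_space \<Rightarrow> real"
  assumes \<kappa>: "1 \<le> \<kappa>" and s: "0 < s"
    and Q: "qform Q" "\<And>l. s * (l \<bullet> l) \<le> Q l" "\<And>l. Q l \<le> \<kappa> * s * (l \<bullet> l)"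
    and Q': "qform Q'" "\<And>l. s * (l \<bullet> l) \<le> Q' l" "\<And>l. Q' l \<le> \<kappa> * s * (l \<bullet> l)"
    and \<eta>: "0 \<le> \<eta>" and QQ: "\<And>l. \<bar>Q l - Q' l\<bar> \<le> \<eta> * (l \<bullet> l)"
  shows "gdens Q v \<le> gdens Q' v + gaussian_const TYPE('a) \<kappa> * (\<eta> / s) * iso_gdens (gaussian_width TYPE('a) \<kappa> * s) v"
proof (cases "\<eta> \<le> s")
  case False
  let ?C = "gaussian_const TYPE('a) \<kappa>" and ?I = "iso_gdens (gaussian_width TYPE('a) \<kappa> * s) v"
  have "gdens Q v - gdens Q' v \<le> 1 * (?C * ?I)"
    using gaussian_kernel_upper(2)[OF \<kappa> s Q, of v] gaussian_kernel_upper(2)[OF \<kappa> s Q', of v] by linarith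
  also have "\<dots> \<le> (\<eta> / s) * (?C * ?I)"
    using False s gaussian_const_pos[OF \<kappa>, where 'a='a] by (intro mult_right_mono mult_nonneg_nonneg) auto
  finally show ?thesis by (simp add: mult_ac)
next
  case True
  let ?G = "gconst TYPE('a) (\<kappa> + 1)" and ?I = "iso_gdens (gtheta TYPE('a) (\<kappa> + 1) * s) v"
  (* Q and Q' need not be comparable with each other, but both lie below R. *)
  define R where "R l = Q' l + \<eta> * (l \<bullet> l)" for l
  have k1: "1 \<le> \<kappa> + 1" using \<kappa> by simp
  have R: "qform R" unfolding R_def by (intro qform_add Q' qform_scaled_norm)
  have Rup: "R l \<le> (\<kappa> + 1) * s * (l \<bullet> l)" for l
  proof -
    have "\<eta> * (l \<bullet> l) \<le> s * (l \<bullet> l)" using True by (intro mult_right_mono) auto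
    then show ?thesis using Q'(3)[of l] by (simp add: R_def distrib_right)
  qed
  have "\<bar>gdens R v - gdens Q v\<bar> \<le> 72 * DIM('a) * ?G * ((2 * \<eta>) / s) * ?I"
  proof (rule gdens_ordered_difference[OF s k1 Q(1) R Q(2) Rup])
    fix l show "Q l \<le> R l" "R l - Q l \<le> 2 * \<eta> * (l \<bullet> l)"
      using QQ[of l] by (auto simp: R_def)
  qed
  moreover have "\<bar>gdens R v - gdens Q' v\<bar> \<le> 72 * DIM('a) * ?G * (\<eta> / s) * ?I"
  proof (rule gdens_ordered_difference[OF s k1 Q'(1) R Q'(2) Rup])
    fix l show "Q' l \<le> R l" "R l - Q' l \<le> \<eta> * (l \<bullet> l)"
      using \<eta> by (auto simp: R_def)
  qed
  moreover have "72 * DIM('a) * ?G * ((2 * \<eta>) / s) * ?I = 2 * (72 * DIM('a) * ?G * (\<eta> / s) * ?I)" by simp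
  moreover have "gaussian_const TYPE('a) \<kappa> * (\<eta> / s) * ?I = 3 * (72 * DIM('a) * ?G * (\<eta> / s) * ?I)"
    by (simp add: gaussian_const_def)
  ultimately show ?thesis unfolding gaussian_width_def by linarith
qed

section \<open>Convolution and total mass\<close>

lemma qform_sqf_rep:
  fixes Q :: "'a::euclidean_space \<Rightarrow> real"
  assumes q: "qform Q" and Q: "\<And>l. s * (l \<bullet> l) \<le> Q l"
  obtains c where "Q = sqf s (Basis :: 'a set) c"
proof -
  have qf: "qform (\<lambda>l. Q l - s * (l \<bullet> l))" by (intro qform_diff q qform_scaled_norm)
  then obtain B where B: "bilinear B" "\<And>l. Q l - s * (l \<bullet> l) = B l l" unfolding qform_def by blast
  obtain \<kappa> where \<kappa>: "\<And>x y. norm (B x y) \<le> \<kappa> * norm x * norm y"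
    using bilinear_bounded[OF B(1)] by blast
  have up: "Q l - s * (l \<bullet> l) \<le> \<kappa> * (l \<bullet> l)" for l
    using \<kappa>[of l l] unfolding B(2) by (simp add: dot_square_norm power2_eq_square mult.assoc)
  have nn: "0 \<le> Q l - s * (l \<bullet> l)" for l using Q[of l] by simp
  obtain c where c: "\<And>l. Q l - s * (l \<bullet> l) = (\<Sum>b\<in>(Basis::'a set). (c b \<bullet> l)\<^sup>2)"
    using qform_psd_sum_squares[OF qf nn up] by blast
  then have "Q = sqf s (Basis :: 'a set) c"
    by (auto simp: sqf_def fun_eq_iff algebra_simps)
  then show thesis by (rule that)
qed

text \<open>Elliptic forms are built from a multiple of the identity by adding rank one forms.\<close>

lemma qform_rank_one_induct [consumes 3, case_names iso rank_one]:
  fixes Q :: "'a::euclidean_space \<Rightarrow> real"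
  assumes s: "0 < s" and q: "qform Q" and Q: "\<And>l. s * (l \<bullet> l) \<le> Q l"
    and iso: "P (\<lambda>l. s * (l \<bullet> l))"
    and step: "\<And>Q c. Q \<in> borel_measurable borel \<Longrightarrow> (\<And>l. s * (l \<bullet> l) \<le> Q l) \<Longrightarrow> P Q \<Longrightarrow> P (\<lambda>l. Q l + (c \<bullet> l)\<^sup>2)"
  shows "P Q"
proof -
  obtain c where c: "Q = sqf s (Basis :: 'a set) c" using qform_sqf_rep[OF q Q] by blast
  have "P (sqf s J c)" if "finite J" for J :: "'a set"
    using that
  proof (induction J rule: finite_induct)
    case empty
    then show ?case using iso by (simp add: sqf_empty)
  next
    case (insert i J)
    then show ?case
      using step[of "sqf s J c" "c i"] by (simp add: sqf_insert sqf_lower)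
  qed
  then show ?thesis by (simp add: c)
qed

lemma gdens_nonneg:
  fixes Q :: "'a::euclidean_space \<Rightarrow> real"
  assumes s: "0 < s" and q: "qform Q" and Q: "\<And>l. s * (l \<bullet> l) \<le> Q l"
  shows "0 \<le> gdens Q v"
proof -
  have "\<forall>v. 0 \<le> gdens Q v"
    using s q Q
  proof (induction rule: qform_rank_one_induct)
    case iso
    then show ?case by (simp add: iso_fourier[OF s])
  next
    case (rank_one Q c)
    then show ?case
      by (auto simp: gdens_add_rank_one(2)[OF rank_one(1) s rank_one(2)] intro!: Bochner_Integration.integral_nonneg)
  qed
  then show ?thesis by simp
qed

lemma gdens_add_rank_one_nn:
  fixes Q :: "'a::euclidean_space \<Rightarrow> real"
  assumes Q: "Q \<in> borel_measurable borel" "0 < s" "\<And>l. s * (l \<bullet> l) \<le> Q l" and nn: "\<And>v. 0 \<le> gdens Q v"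
  shows "ennreal (gdens (\<lambda>l. Q l + (c \<bullet> l)\<^sup>2) v)
    = (\<integral>\<^sup>+z. ennreal (gdens Q (v - z *\<^sub>R c)) * ennreal (std_normal_density z) \<partial>lborel)"
  unfolding gdens_add_rank_one(2)[OF Q]
  by (subst nn_integral_eq_integral[symmetric, OF gdens_add_rank_one(1)[OF Q]])
     (auto simp: nn ennreal_mult)

lemma iso_gdens_prod:
  fixes v :: "'a::euclidean_space"
  assumes "0 < s"
  shows "iso_gdens s v = (\<Prod>b\<in>Basis. normal_density 0 (sqrt s) (v \<bullet> b))"
proof -
  have "(\<Prod>b\<in>(Basis::'a set). normal_density 0 (sqrt s) (v \<bullet> b))
     = (\<Prod>b\<in>(Basis::'a set). 1 / sqrt (2 * pi * s)) * (\<Prod>b\<in>(Basis::'a set). exp (- (v \<bullet> b)\<^sup>2 / (2 * s)))"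
    using assms by (simp add: normal_density_def prod.distrib prod_dividef power_divide)
  also have "(\<Prod>b\<in>(Basis::'a set). exp (- (v \<bullet> b)\<^sup>2 / (2 * s))) = exp (- (v \<bullet> v) / (2 * s))"
    by (subst exp_sum[symmetric])
       (auto simp: euclidean_inner[of v v] sum_negf sum_divide_distrib power2_eq_square)
  also have "(\<Prod>b\<in>(Basis::'a set). 1 / sqrt (2 * pi * s)) = (2 * pi * s) powr (- real DIM('a) / 2)"
  proof -
    have "(\<Prod>b\<in>(Basis::'a set). 1 / sqrt (2 * pi * s)) = ((2 * pi * s) powr (-1/2)) ^ DIM('a)"
      using assms by (simp add: powr_minus powr_half_sqrt inverse_eq_divide)
    also have "\<dots> = ((2 * pi * s) powr (-1/2)) powr real DIM('a)"
      using assms by (subst powr_realpow) auto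
    finally show ?thesis by (simp add: powr_powr)
  qed
  finally show ?thesis by (simp add: iso_gdens_def)
qed

lemma iso_gdens_measurable [measurable]: "iso_gdens s \<in> borel_measurable borel"
  unfolding iso_gdens_def[abs_def] by measurable

lemma nn_integral_lborel_translate:
  fixes f :: "'a::euclidean_space \<Rightarrow> ennreal"
  assumes [measurable]: "f \<in> borel_measurable borel"
  shows "(\<integral>\<^sup>+x. f (a + x) \<partial>lborel) = (\<integral>\<^sup>+x. f x \<partial>lborel)"
    and "(\<integral>\<^sup>+x. f (x - a) \<partial>lborel) = (\<integral>\<^sup>+x. f x \<partial>lborel)"
    and "(\<integral>\<^sup>+x. f (a - x) \<partial>lborel) = (\<integral>\<^sup>+x. f x \<partial>lborel)"
proof -
  have 1: "(\<integral>\<^sup>+x. f (a + x) \<partial>lborel) = (\<integral>\<^sup>+x. f x \<partial>lborel)" for a :: 'a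
    using arg_cong[OF lborel_affine[of 1 a], of "\<lambda>M. integral\<^sup>N M f"]
    by (simp add: density_1 nn_integral_distr)
  show "(\<integral>\<^sup>+x. f (a + x) \<partial>lborel) = (\<integral>\<^sup>+x. f x \<partial>lborel)" by (rule 1)
  show "(\<integral>\<^sup>+x. f (x - a) \<partial>lborel) = (\<integral>\<^sup>+x. f x \<partial>lborel)"
    using 1[of "- a"] by (simp add: add.commute[of "- a"])
  show "(\<integral>\<^sup>+x. f (a - x) \<partial>lborel) = (\<integral>\<^sup>+x. f x \<partial>lborel)"
    using arg_cong[OF lborel_affine[of "-1" a], of "\<lambda>M. integral\<^sup>N M f"]
    by (simp add: density_1 nn_integral_distr)
qed

lemma iso_gdens_convolution:
  fixes v :: "'a::euclidean_space"
  assumes "0 < r" "0 < s"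
  shows "(\<integral>\<^sup>+u. ennreal (iso_gdens r u) * ennreal (iso_gdens s (v - u)) \<partial>lborel) = ennreal (iso_gdens (r + s) v)"
proof -
  have "(\<integral>\<^sup>+u. ennreal (iso_gdens r u) * ennreal (iso_gdens s (v - u)) \<partial>lborel)
     = (\<integral>\<^sup>+u. (\<Prod>b\<in>Basis. ennreal (normal_density 0 (sqrt s) (v \<bullet> b - u \<bullet> b) * normal_density 0 (sqrt r) (u \<bullet> b))) \<partial>lborel)"
    using assms
    by (intro nn_integral_cong)
       (simp add: iso_gdens_prod prod_ennreal prod_nonneg ennreal_mult[symmetric] prod.distrib[symmetric] inner_diff_left mult.commute)
  also have "\<dots> = (\<Prod>b\<in>(Basis::'a set). \<integral>\<^sup>+x. ennreal (normal_density 0 (sqrt s) (v \<bullet> b - x) * normal_density 0 (sqrt r) x) \<partial>lborel)"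
    by (rule nn_integral_lborel_prod) auto
  also have "\<dots> = (\<Prod>b\<in>(Basis::'a set). ennreal (normal_density 0 (sqrt (r + s)) (v \<bullet> b)))"
    using assms by (simp add: fun_cong[OF conv_normal_density_zero_mean] add.commute)
  also have "\<dots> = ennreal (iso_gdens (r + s) v)"
    using assms by (simp add: iso_gdens_prod prod_ennreal)
  finally show ?thesis .
qed

lemma gdens_mass_one:
  fixes Q :: "'a::euclidean_space \<Rightarrow> real"
  assumes s: "0 < s" and q: "qform Q" and Q: "\<And>l. s * (l \<bullet> l) \<le> Q l"
  shows "(\<integral>\<^sup>+v. ennreal (gdens Q v) \<partial>lborel) = 1"
proof -
  have "(\<forall>v. 0 \<le> gdens Q v) \<and> (\<integral>\<^sup>+v. ennreal (gdens Q v) \<partial>lborel) = 1"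
    using s q Q
  proof (induction rule: qform_rank_one_induct)
    case iso
    have "(\<integral>\<^sup>+v. ennreal (iso_gdens s (v::'a)) \<partial>lborel) = (\<integral>\<^sup>+v. (\<Prod>b\<in>Basis. ennreal (normal_density 0 (sqrt s) (v \<bullet> b))) \<partial>(lborel :: 'a measure))"
      using s by (simp add: iso_gdens_prod prod_ennreal)
    also have "\<dots> = (\<Prod>b\<in>(Basis::'a set). \<integral>\<^sup>+x. ennreal (normal_density 0 (sqrt s) x) \<partial>lborel)"
      by (rule nn_integral_lborel_prod) auto
    also have "\<dots> = 1" using s by (simp add: nn_integral_eq_integral)
    finally show ?case by (simp add: iso_fourier[OF s])
  next
    case (rank_one Q c)
    note [measurable] = rank_one(1)
    have nn: "0 \<le> gdens Q v" for v using rank_one(3) by simp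
    note eq = gdens_add_rank_one_nn[OF rank_one(1) s rank_one(2) nn, of c]
    have "(\<integral>\<^sup>+v. ennreal (gdens (\<lambda>l. Q l + (c \<bullet> l)\<^sup>2) v) \<partial>lborel)
       = (\<integral>\<^sup>+z. (\<integral>\<^sup>+v. ennreal (gdens Q (v - z *\<^sub>R c)) * ennreal (std_normal_density z) \<partial>lborel) \<partial>lborel)"
      unfolding eq by (rule lborel_pair.Fubini') measurable
    also have "\<dots> = (\<integral>\<^sup>+z. (\<integral>\<^sup>+v. ennreal (gdens Q (v - z *\<^sub>R c)) \<partial>lborel) * ennreal (std_normal_density z) \<partial>lborel)"
      by (intro nn_integral_cong nn_integral_multc) measurable
    also have "\<dots> = 1"
      using rank_one(3) nn_integral_lborel_translate(2)[of "\<lambda>v. ennreal (gdens Q v)"]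
      by (simp add: nn_integral_eq_integral)
    finally show ?case
      using nn by (auto simp: gdens_add_rank_one(2)[OF rank_one(1) s rank_one(2)] intro!: Bochner_Integration.integral_nonneg)
  qed
  then show ?thesis by simp
qed

lemma gdens_convolution_step:
  fixes Q R :: "'a::euclidean_space \<Rightarrow> real"
  assumes Q: "Q \<in> borel_measurable borel" "0 < s" "\<And>l. s * (l \<bullet> l) \<le> Q l" "\<And>v. 0 \<le> gdens Q v"
    and R[measurable]: "R \<in> borel_measurable borel" "\<And>l. 0 \<le> R l" 
    and RQ: "\<And>v. 0 \<le> gdens (\<lambda>l. R l + Q l) v"
    and IH: "\<And>v. (\<integral>\<^sup>+u. ennreal (gdens R u) * ennreal (gdens Q (v - u)) \<partial>lborel) = ennreal (gdens (\<lambda>l. R l + Q l) v)"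
  shows "(\<integral>\<^sup>+u. ennreal (gdens R u) * ennreal (gdens (\<lambda>l. Q l + (c \<bullet> l)\<^sup>2) (v - u)) \<partial>lborel)
    = ennreal (gdens (\<lambda>l. R l + (Q l + (c \<bullet> l)\<^sup>2)) v)"
proof -
  note [measurable] = Q(1)
  have lo: "s * (l \<bullet> l) \<le> R l + Q l" for l using Q(3)[of l] R(2)[of l] by simp
  have "(\<integral>\<^sup>+u. ennreal (gdens R u) * ennreal (gdens (\<lambda>l. Q l + (c \<bullet> l)\<^sup>2) (v - u)) \<partial>lborel)
     = (\<integral>\<^sup>+u. (\<integral>\<^sup>+z. ennreal (gdens R u) * (ennreal (gdens Q (v - u - z *\<^sub>R c)) * ennreal (std_normal_density z)) \<partial>lborel) \<partial>lborel)"
    unfolding gdens_add_rank_one_nn[OF Q]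
    by (intro nn_integral_cong nn_integral_cmult[symmetric]) measurable
  also have "\<dots> = (\<integral>\<^sup>+z. (\<integral>\<^sup>+u. ennreal (gdens R u) * (ennreal (gdens Q (v - u - z *\<^sub>R c)) * ennreal (std_normal_density z)) \<partial>lborel) \<partial>lborel)"
    by (rule lborel_pair.Fubini') measurable
  also have "\<dots> = (\<integral>\<^sup>+z. (\<integral>\<^sup>+u. ennreal (gdens R u) * ennreal (gdens Q ((v - z *\<^sub>R c) - u)) \<partial>lborel) * ennreal (std_normal_density z) \<partial>lborel)"
    by (subst nn_integral_multc[symmetric]) (auto simp: algebra_simps mult.assoc)
  also have "\<dots> = (\<integral>\<^sup>+z. ennreal (gdens (\<lambda>l. R l + Q l) (v - z *\<^sub>R c)) * ennreal (std_normal_density z) \<partial>lborel)"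
    by (simp only: IH)
  also have "\<dots> = ennreal (gdens (\<lambda>l. (R l + Q l) + (c \<bullet> l)\<^sup>2) v)"
    by (subst gdens_add_rank_one_nn[OF _ Q(2) lo RQ]) auto
  finally show ?thesis by (simp only: add.assoc)
qed

text \<open>Independent centred Gaussian vectors add up; induction over the rank one terms of \<open>Q\<close>.\<close>

lemma gdens_convolution:
  fixes Q R :: "'a::euclidean_space \<Rightarrow> real"
  assumes r: "0 < r" and R: "qform R" "\<And>l. r * (l \<bullet> l) \<le> R l"
    and s: "0 < s" and Q: "qform Q" "\<And>l. s * (l \<bullet> l) \<le> Q l"
  shows "(\<integral>\<^sup>+u. ennreal (gdens R u) * ennreal (gdens Q (v - u)) \<partial>lborel) = ennreal (gdens (\<lambda>l. R l + Q l) v)"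
proof -
  have main: "\<forall>v. (\<integral>\<^sup>+u. ennreal (gdens R u) * ennreal (gdens Q (v - u)) \<partial>lborel) = ennreal (gdens (\<lambda>l. R l + Q l) v)"
    if R: "0 < r" "qform R" "\<And>l. r * (l \<bullet> l) \<le> R l" and Q: "0 < s" "qform Q" "\<And>l. s * (l \<bullet> l) \<le> Q l"
      and base: "\<And>v. (\<integral>\<^sup>+u. ennreal (gdens R u) * ennreal (iso_gdens s (v - u)) \<partial>lborel)
        = ennreal (gdens (\<lambda>l. R l + s * (l \<bullet> l)) v)"
    for R Q :: "'a \<Rightarrow> real" and r s
  proof -
    have Rnn: "0 \<le> R l" for l
    proof -
      have "0 \<le> r * (l \<bullet> l)" using R(1) by simp
      then show ?thesis using R(3)[of l] by linarith
    qed
    have "(\<forall>v. 0 \<le> gdens Q v \<and> 0 \<le> gdens (\<lambda>l. R l + Q l) v) \<and>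
      (\<forall>v. (\<integral>\<^sup>+u. ennreal (gdens R u) * ennreal (gdens Q (v - u)) \<partial>lborel) = ennreal (gdens (\<lambda>l. R l + Q l) v))"
      using Q
    proof (induction rule: qform_rank_one_induct)
      case iso
      have "0 \<le> gdens (\<lambda>l. R l + s * (l \<bullet> l)) v" for v
      proof (rule gdens_nonneg[OF R(1)])
        show "qform (\<lambda>l. R l + s * (l \<bullet> l))" by (intro qform_add R qform_scaled_norm)
        show "r * (l \<bullet> l) \<le> R l + s * (l \<bullet> l)" for l
        proof -
          have "0 \<le> s * (l \<bullet> l)" using Q(1) by simp
          then show ?thesis using R(3)[of l] by linarith
        qed
      qed
      then show ?case using base by (simp add: iso_fourier[OF Q(1)])
    next
      case (rank_one Q c)
      then have nn: "0 \<le> gdens Q v" "0 \<le> gdens (\<lambda>l. R l + Q l) v" for v by auto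
      have lo: "s * (l \<bullet> l) \<le> R l + Q l" for l using rank_one(2)[of l] Rnn[of l] by simp
      have m: "(\<lambda>l. R l + Q l) \<in> borel_measurable borel"
        using rank_one(1) qform_measurable[OF R(2)] by simp
      have "0 \<le> gdens (\<lambda>l. Q l + (c \<bullet> l)\<^sup>2) v" for v
        using nn by (auto simp: gdens_add_rank_one(2)[OF rank_one(1) Q(1) rank_one(2)] intro!: Bochner_Integration.integral_nonneg)
      moreover have "0 \<le> gdens (\<lambda>l. (R l + Q l) + (c \<bullet> l)\<^sup>2) v" for v
        using nn by (auto simp: gdens_add_rank_one(2)[OF m Q(1) lo] intro!: Bochner_Integration.integral_nonneg)
      ultimately show ?case
        using gdens_convolution_step[OF rank_one(1) Q(1) rank_one(2) nn(1) qform_measurable[OF R(2)] Rnn nn(2)] rank_one(3)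
        by (simp add: add.assoc)
    qed
    then show ?thesis by blast
  qed
  have refl: "(\<integral>\<^sup>+u. ennreal (gdens A u) * ennreal (gdens B (v - u)) \<partial>lborel)
     = (\<integral>\<^sup>+u. ennreal (gdens B u) * ennreal (gdens A (v - u)) \<partial>lborel)"
    if "qform A" "qform B" for A B and v :: 'a
    using nn_integral_lborel_translate(3)[of "\<lambda>u. ennreal (gdens A u) * ennreal (gdens B (v - u))" v]
      gdens_measurable[OF qform_measurable[OF that(1)]] gdens_measurable[OF qform_measurable[OF that(2)]]
    by (simp add: mult.commute)
  have isoR: "\<forall>v. (\<integral>\<^sup>+u. ennreal (gdens (\<lambda>l::'a. s * (l \<bullet> l)) u) * ennreal (gdens R (v - u)) \<partial>lborel)
        = ennreal (gdens (\<lambda>l. s * (l \<bullet> l) + R l) v)"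
    by (rule main[OF s qform_scaled_norm order_refl r R])
       (simp add: iso_fourier(2)[of s] iso_fourier(2)[of r] iso_fourier(2)[of "s + r"] s r iso_gdens_convolution add_pos_pos flip: distrib_right)
  have "(\<integral>\<^sup>+u. ennreal (gdens R u) * ennreal (iso_gdens s (v - u)) \<partial>lborel)
        = ennreal (gdens (\<lambda>l. R l + s * (l \<bullet> l)) v)" for v
    using isoR refl[OF R(1) qform_scaled_norm, of s v] by (simp add: iso_fourier s add.commute)
  then show ?thesis
    using main[OF r R s Q] by blast
qed

section \<open>Measures are determined by their Gaussian mollifications\<close>

lemma iso_gdens_mass_one:
  assumes "0 < s"
  shows "(\<integral>\<^sup>+v. ennreal (iso_gdens s (v :: 'a::euclidean_space)) \<partial>lborel) = 1"
  using gdens_mass_one[OF assms qform_scaled_norm order_refl, where ?'a='a] by (simp add: iso_fourier[OF assms])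

lemma nn_integral_iso_gdens_scale:
  fixes g :: "'a::euclidean_space \<Rightarrow> ennreal"
  assumes [measurable]: "g \<in> borel_measurable borel" and s: "0 < s"
  shows "(\<integral>\<^sup>+y. g y * ennreal (iso_gdens s (y - x)) \<partial>lborel)
     = (\<integral>\<^sup>+z. g (x + sqrt s *\<^sub>R z) * ennreal (iso_gdens 1 z) \<partial>lborel)"
proof -
  have c: "sqrt s \<noteq> 0" using s by simp
  have *: "iso_gdens s (sqrt s *\<^sub>R z) * sqrt s ^ DIM('a) = iso_gdens 1 z" for z :: 'a
  proof -
    have a: "sqrt s ^ DIM('a) = s powr (real DIM('a) / 2)"
      using s by (simp add: powr_half_sqrt[symmetric] powr_powr flip: powr_realpow)
    have b: "(2 * pi * s) powr (- real DIM('a) / 2) = (2 * pi) powr (- real DIM('a) / 2) * s powr (- (real DIM('a) / 2))"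
      using s by (simp add: powr_mult)
    have c: "s powr (- (real DIM('a) / 2)) * s powr (real DIM('a) / 2) = 1"
      using s by (simp flip: powr_add)
    have d: "- ((sqrt s *\<^sub>R z) \<bullet> (sqrt s *\<^sub>R z)) / (2 * s) = - (z \<bullet> z) / 2"
      using s by (simp add: power2_eq_square[symmetric] flip: mult.assoc)
    have "iso_gdens s (sqrt s *\<^sub>R z) * sqrt s ^ DIM('a)
       = (2 * pi) powr (- real DIM('a) / 2) * exp (- (z \<bullet> z) / 2) * (s powr (- (real DIM('a) / 2)) * s powr (real DIM('a) / 2))"
      unfolding iso_gdens_def a b d by (simp only: mult_ac)
    then show ?thesis by (simp add: iso_gdens_def c)
  qed
  have "(\<integral>\<^sup>+y. g y * ennreal (iso_gdens s (y - x)) \<partial>lborel)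
     = (\<integral>\<^sup>+z. ennreal (\<bar>sqrt s\<bar> ^ DIM('a)) * (g (x + sqrt s *\<^sub>R z) * ennreal (iso_gdens s (x + sqrt s *\<^sub>R z - x))) \<partial>lborel)"
    by (subst lborel_affine[OF c, of x]) (simp add: nn_integral_density nn_integral_distr)
  also have "\<dots> = (\<integral>\<^sup>+z. g (x + sqrt s *\<^sub>R z) * ennreal (iso_gdens 1 z) \<partial>lborel)"
    using s by (intro nn_integral_cong) (simp add: *[symmetric] ennreal_mult mult_ac)
  finally show ?thesis .
qed

lemma gaussian_smoothing_tendsto:
  fixes g :: "'a::euclidean_space \<Rightarrow> real"
  assumes g: "continuous_on UNIV g" "\<And>x. 0 \<le> g x" "\<And>x. g x \<le> 1"
    and M: "finite_measure M" "sets M = sets borel"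
  shows "(\<lambda>n. \<integral>\<^sup>+y. ennreal (g y) * (\<integral>\<^sup>+x. ennreal (iso_gdens (1 / Suc n) (y - x)) \<partial>M) \<partial>lborel)
      \<longlonglongrightarrow> (\<integral>\<^sup>+x. ennreal (g x) \<partial>M)"
proof -
  interpret finite_measure M by (rule M)
  interpret P: pair_sigma_finite M "lborel :: 'a measure" ..
  have gm[measurable]: "g \<in> borel_measurable borel" by (rule borel_measurable_continuous_onI[OF g(1)])
  have [measurable_cong]: "sets M = sets borel" by (rule M)
  define G where "G n x = (\<integral>\<^sup>+z. ennreal (g (x + sqrt (1 / Suc n) *\<^sub>R z)) * ennreal (iso_gdens 1 z) \<partial>lborel)" for n :: nat and x :: 'a
  have Gm[measurable]: "G n \<in> borel_measurable M" for n unfolding G_def by measurable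
  have eq: "(\<integral>\<^sup>+y. ennreal (g y) * (\<integral>\<^sup>+x. ennreal (iso_gdens (1 / Suc n) (y - x)) \<partial>M) \<partial>lborel) = (\<integral>\<^sup>+x. G n x \<partial>M)" for n
  proof -
    have "(\<integral>\<^sup>+y. ennreal (g y) * (\<integral>\<^sup>+x. ennreal (iso_gdens (1 / Suc n) (y - x)) \<partial>M) \<partial>lborel)
      = (\<integral>\<^sup>+y. (\<integral>\<^sup>+x. ennreal (g y) * ennreal (iso_gdens (1 / Suc n) (y - x)) \<partial>M) \<partial>lborel)"
      by (intro nn_integral_cong nn_integral_cmult[symmetric]) measurable
    also have "\<dots> = (\<integral>\<^sup>+x. (\<integral>\<^sup>+y. ennreal (g y) * ennreal (iso_gdens (1 / Suc n) (y - x)) \<partial>lborel) \<partial>M)"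
      by (rule P.Fubini') measurable
    also have "\<dots> = (\<integral>\<^sup>+x. G n x \<partial>M)"
      unfolding G_def by (intro nn_integral_cong nn_integral_iso_gdens_scale) auto
    finally show ?thesis .
  qed
  have s0: "(\<lambda>n. sqrt (1 / Suc n)) \<longlonglongrightarrow> 0"
    using tendsto_real_sqrt[OF LIMSEQ_inverse_real_of_nat] by (simp add: inverse_eq_divide)
  have Gle: "G n x \<le> 1" for n x
  proof -
    have "G n x \<le> (\<integral>\<^sup>+z. 1 * ennreal (iso_gdens 1 (z::'a)) \<partial>lborel)"
      unfolding G_def using g by (intro nn_integral_mono mult_right_mono) auto
    then show ?thesis by (simp add: iso_gdens_mass_one)
  qed
  have Glim: "(\<lambda>n. G n x) \<longlonglongrightarrow> ennreal (g x)" for x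
  proof -
    have "(\<lambda>n. \<integral>\<^sup>+z. ennreal (g (x + sqrt (1 / Suc n) *\<^sub>R z)) * ennreal (iso_gdens 1 z) \<partial>lborel)
       \<longlonglongrightarrow> (\<integral>\<^sup>+z. ennreal (g x) * ennreal (iso_gdens 1 (z::'a)) \<partial>lborel)"
    proof (rule nn_integral_dominated_convergence[where w="\<lambda>z. ennreal (iso_gdens 1 z)"])
      show "AE z in lborel. ennreal (g (x + sqrt (1 / Suc n) *\<^sub>R z)) * ennreal (iso_gdens 1 z) \<le> ennreal (iso_gdens 1 z)" for n
      proof (rule AE_I2)
        fix z :: 'a
        show "ennreal (g (x + sqrt (1 / Suc n) *\<^sub>R z)) * ennreal (iso_gdens 1 z) \<le> ennreal (iso_gdens 1 z)"
          using mult_right_mono[of "ennreal (g (x + sqrt (1 / Suc n) *\<^sub>R z))" 1 "ennreal (iso_gdens 1 z)"] g(3) by simp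
      qed
      show "AE z in lborel. (\<lambda>n. ennreal (g (x + sqrt (1 / Suc n) *\<^sub>R z)) * ennreal (iso_gdens 1 z)) \<longlonglongrightarrow> ennreal (g x) * ennreal (iso_gdens 1 z)"
      proof (rule AE_I2)
        fix z :: 'a
        have "(\<lambda>n. x + sqrt (1 / Suc n) *\<^sub>R z) \<longlonglongrightarrow> x + 0 *\<^sub>R z"
          by (intro tendsto_intros s0)
        then have "(\<lambda>n. g (x + sqrt (1 / Suc n) *\<^sub>R z)) \<longlonglongrightarrow> g x"
          using g(1) by (intro continuous_on_tendsto_compose[OF g(1)]) auto
        then have "(\<lambda>n. ennreal (g (x + sqrt (1 / Suc n) *\<^sub>R z) * iso_gdens 1 z)) \<longlonglongrightarrow> ennreal (g x * iso_gdens 1 z)"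
          by (intro tendsto_ennrealI tendsto_intros)
        then show "(\<lambda>n. ennreal (g (x + sqrt (1 / Suc n) *\<^sub>R z)) * ennreal (iso_gdens 1 z)) \<longlonglongrightarrow> ennreal (g x) * ennreal (iso_gdens 1 z)"
          using g by (simp add: ennreal_mult)
      qed
    qed (auto simp: iso_gdens_mass_one)
    then show ?thesis by (simp add: G_def nn_integral_cmult iso_gdens_mass_one)
  qed
  have "(\<lambda>n. \<integral>\<^sup>+x. G n x \<partial>M) \<longlonglongrightarrow> (\<integral>\<^sup>+x. ennreal (g x) \<partial>M)"
    by (rule nn_integral_dominated_convergence[where w="\<lambda>_. 1"])
       (use Gle Glim emeasure_finite[of "space M"] in \<open>auto simp: less_top[symmetric]\<close>)
  then show ?thesis by (simp only: eq)
qed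

text \<open>Mollified densities are all that the Fourier argument for the Euler step will provide. Letting the
  variance tend to 0 recovers the integrals of bounded continuous functions.\<close>

lemma measure_eqI_gaussian_smoothing:
  fixes M N :: "'a::euclidean_space measure"
  assumes M: "finite_measure M" "sets M = sets borel" and N: "finite_measure N" "sets N = sets borel"
    and eq: "\<And>s y. 0 < s \<Longrightarrow> (\<integral>\<^sup>+x. ennreal (iso_gdens s (y - x)) \<partial>M) = (\<integral>\<^sup>+x. ennreal (iso_gdens s (y - x)) \<partial>N)"
  shows "M = N"
proof -
  have cont: "(\<integral>\<^sup>+x. ennreal (g x) \<partial>M) = (\<integral>\<^sup>+x. ennreal (g x) \<partial>N)"
    if "continuous_on UNIV g" "\<And>x. 0 \<le> g x" "\<And>x. g x \<le> 1" for g
    using gaussian_smoothing_tendsto[OF that M] gaussian_smoothing_tendsto[OF that N]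
    by (simp add: eq LIMSEQ_unique)
  define h :: "'a set \<Rightarrow> nat \<Rightarrow> 'a \<Rightarrow> real" where "h C n x = max 0 (1 - real n * infdist x C)" for C n x
  have lim: "(\<lambda>n. \<integral>\<^sup>+x. ennreal (h C n x) \<partial>L) \<longlonglongrightarrow> emeasure L C"
    if C: "closed C" "C \<noteq> {}" and L: "finite_measure L" "sets L = sets borel" for C and L :: "'a measure"
  proof -
    have [measurable_cong]: "sets L = sets borel" by (rule L)
    have Cm: "C \<in> sets L" using C L by simp
    have hm: "h C n \<in> borel_measurable L" for n
    proof -
      have "h C n \<in> borel_measurable borel"
        unfolding h_def by (intro borel_measurable_continuous_onI continuous_intros)
      then show ?thesis by (simp cong: measurable_cong_sets)
    qed
    have "(\<lambda>n. \<integral>\<^sup>+x. ennreal (h C n x) \<partial>L) \<longlonglongrightarrow> (\<integral>\<^sup>+x. indicator C x \<partial>L)"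
    proof (rule nn_integral_dominated_convergence[where w="\<lambda>_. 1"])
      show "AE x in L. (\<lambda>n. ennreal (h C n x)) \<longlonglongrightarrow> indicator C x"
      proof (rule AE_I2)
        fix x
        show "(\<lambda>n. ennreal (h C n x)) \<longlonglongrightarrow> indicator C x"
        proof (cases "x \<in> C")
          case True
          then show ?thesis using C by (simp add: h_def)
        next
          case False
          then have pos: "0 < infdist x C"
            using C in_closed_iff_infdist_zero[of C x] infdist_nonneg[of x C] by force
          have "eventually (\<lambda>n. h C n x = 0) sequentially"
          proof -
            obtain n0 :: nat where n0: "1 / infdist x C < real n0" using reals_Archimedean2 by blast
            show ?thesis
            proof (rule eventually_sequentiallyI[of n0])
              fix n assume "n0 \<le> n"
              then have "1 / infdist x C \<le> real n" using n0 by linarith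
              then show "h C n x = 0" using pos by (simp add: h_def field_simps max_def)
            qed
          qed
          then show ?thesis
            using False by (intro tendsto_eventually) (auto elim: eventually_mono)
        qed
      qed
      show "(\<integral>\<^sup>+x. 1 \<partial>L) < \<infinity>"
        using finite_measure.emeasure_finite[OF L(1)] by (simp add: less_top)
      show "AE x in L. ennreal (h C n x) \<le> 1" for n
        by (rule AE_I2) (simp add: h_def infdist_nonneg)
    qed (use hm Cm in auto)
    then show ?thesis using Cm by simp
  qed
  have closed: "emeasure M C = emeasure N C" if "closed C" for C
  proof (cases "C = {}")
    case False
    have "(\<integral>\<^sup>+x. ennreal (h C n x) \<partial>M) = (\<integral>\<^sup>+x. ennreal (h C n x) \<partial>N)" for n
      by (rule cont) (auto simp: h_def infdist_nonneg intro!: continuous_intros)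
    then show ?thesis
      using lim[OF that False M] lim[OF that False N] by (simp add: LIMSEQ_unique)
  qed simp
  show ?thesis
  proof (rule measure_eqI_generator_eq[where E="Collect closed" and \<Omega>=UNIV and A="\<lambda>_. UNIV"])
    show "Int_stable (Collect (closed :: 'a set \<Rightarrow> bool))" by (auto simp: Int_stable_def)
    show "sets M = sigma_sets UNIV (Collect closed)" "sets N = sigma_sets UNIV (Collect closed)"
      using M(2) N(2) by (simp_all add: borel_eq_closed)
    show "emeasure M UNIV \<noteq> \<infinity>" using finite_measure.emeasure_finite[OF M(1)] by simp
  qed (use closed in auto)
qed

section \<open>Fourier transforms of Brownian increments\<close>

lemma filtration_measurable:
  assumes "filtration_on M F" "0 \<le> r" "r \<le> s" "f \<in> measurable (F r) N"
  shows "f \<in> measurable (F s) N"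
proof -
  have "subalgebra (F s) (F r)"
    using assms(1-3) unfolding filtration_on_def subalgebra_def by force
  then show ?thesis using measurable_from_subalg assms(4) by blast
qed

lemma filtration_measurable_M:
  assumes "filtration_on M F" "0 \<le> r" "f \<in> measurable (F r) N"
  shows "f \<in> measurable M N"
  using assms measurable_from_subalg[of M "F r"] unfolding filtration_on_def by blast

lemma normal_density_char:
  assumes "0 < r"
  shows "integrable lborel (\<lambda>z. normal_density 0 (sqrt r) z *\<^sub>R cis (t * z))"
    and "(\<integral>z. normal_density 0 (sqrt r) z *\<^sub>R cis (t * z) \<partial>lborel) = complex_of_real (exp (- r * t\<^sup>2 / 2))"
proof -
  have eq: "normal_density 0 (sqrt r) z *\<^sub>R cis (t * z)
     = complex_of_real (1 / sqrt (2 * pi * r)) * (cis (z * t) * complex_of_real (exp (- (1 / r) * z\<^sup>2 / 2)))" for z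
    using assms by (simp add: normal_density_def scaleR_conv_of_real mult_ac)
  have r: "0 < 1 / r" using assms by simp
  show "integrable lborel (\<lambda>z. normal_density 0 (sqrt r) z *\<^sub>R cis (t * z))"
    unfolding eq by (intro integrable_mult_right gaussian_fourier_1d(1) r)
  have c: "1 / sqrt (2 * pi * r) * sqrt (2 * pi / (1 / r)) = 1" using assms by simp
  have "(\<integral>z. normal_density 0 (sqrt r) z *\<^sub>R cis (t * z) \<partial>lborel)
     = complex_of_real (1 / sqrt (2 * pi * r)) * complex_of_real (sqrt (2 * pi / (1 / r)) * exp (- t\<^sup>2 / (2 * (1 / r))))"
    unfolding eq by (simp only: integral_mult_right_zero gaussian_fourier_1d(2)[OF r])
  also have "\<dots> = complex_of_real ((1 / sqrt (2 * pi * r) * sqrt (2 * pi / (1 / r))) * exp (- t\<^sup>2 / (2 * (1 / r))))"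
    by (simp only: of_real_mult mult.assoc)
  also have "\<dots> = complex_of_real (exp (- r * t\<^sup>2 / 2))"
    unfolding c using assms by (simp add: mult.commute)
  finally show "(\<integral>z. normal_density 0 (sqrt r) z *\<^sub>R cis (t * z) \<partial>lborel) = complex_of_real (exp (- r * t\<^sup>2 / 2))" .
qed

lemma cis_measurable [measurable]: "cis \<in> borel_measurable borel"
  by (intro borel_measurable_continuous_onI continuous_intros)

text \<open>The coefficients \<open>c k\<close> are random but known at the time \<open>r\<close>, and the increments are independent
  of \<open>F r\<close>: integrate the increments first with the past frozen.\<close>

lemma wiener_increment_char:
  fixes G :: "'w \<Rightarrow> complex"
  assumes W: "wiener_process M F m W" and r: "0 \<le> r" "r \<le> s"
    and G: "G \<in> borel_measurable (F r)" "\<And>\<omega>. norm (G \<omega>) \<le> 1"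
    and c: "\<And>k. k < m \<Longrightarrow> c k \<in> borel_measurable (F r)"
  shows "(\<integral>\<omega>. G \<omega> * cis (\<Sum>k<m. c k \<omega> * (W k s \<omega> - W k r \<omega>)) \<partial>M)
    = (\<integral>\<omega>. G \<omega> * complex_of_real (exp (- ((s - r) * (\<Sum>k<m. (c k \<omega>)\<^sup>2)) / 2)) \<partial>M)"
proof (cases "r = s")
  case True
  then show ?thesis by (simp add: cis_zero)
next
  case False
  then have rs: "r < s" using r by simp
  define V where "V = (\<Pi>\<^sub>M k\<in>{..<m}. (borel :: real measure))"
  define D where "D = (\<lambda>\<omega>. \<lambda>k\<in>{..<m}. W k s \<omega> - W k r \<omega>)"
  let ?n = "density lborel (\<lambda>z. ennreal (normal_density 0 (sqrt (s - r)) z))"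
  have P: "prob_space M" and fil: "filtration_on M F"
    and Wm: "\<And>k r. k < m \<Longrightarrow> 0 \<le> r \<Longrightarrow> W k r \<in> borel_measurable (F r)"
    using W by (auto simp: wiener_process_def)
  have ind: "prob_space.indep_set M (sets (F r)) {D -` B \<inter> space M | B. B \<in> sets V}"
    and dist: "distr M V D = (\<Pi>\<^sub>M k\<in>{..<m}. ?n)"
    using W r rs unfolding wiener_process_def V_def D_def Let_def by blast+
  interpret prob_space M by (rule P)
  have sub: "subalgebra M (F r)" using fil r unfolding filtration_on_def by blast
  then have sp: "space (F r) = space M" and ss: "sets (F r) \<subseteq> sets M" by (auto simp: subalgebra_def)
  have WM: "W k r' \<in> borel_measurable M" if "k < m" "0 \<le> r'" for k r'
    using filtration_measurable_M[OF fil that(2) Wm[OF that]] .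
  have Dm[measurable]: "D \<in> measurable M V"
    unfolding D_def V_def using WM r rs by (intro measurable_restrict borel_measurable_diff) auto
  have idm[measurable]: "(\<lambda>\<omega>. \<omega>) \<in> measurable M (F r)"
    using sp ss by (auto simp: measurable_def)
  have joint: "distr M (F r) (\<lambda>\<omega>. \<omega>) \<Otimes>\<^sub>M distr M V D = distr M (F r \<Otimes>\<^sub>M V) (\<lambda>\<omega>. (\<omega>, D \<omega>))"
  proof (rule pair_measure_eqI)
    show "sigma_finite_measure (distr M (F r) (\<lambda>\<omega>. \<omega>))" "sigma_finite_measure (distr M V D)"
      by (auto intro!: prob_space_imp_sigma_finite prob_space_distr)
    show "sets (distr M (F r) (\<lambda>\<omega>. \<omega>) \<Otimes>\<^sub>M distr M V D) = sets (distr M (F r \<Otimes>\<^sub>M V) (\<lambda>\<omega>. (\<omega>, D \<omega>)))"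
      by (simp cong: sets_pair_measure_cong)
    fix A B assume "A \<in> sets (distr M (F r) (\<lambda>\<omega>. \<omega>))" "B \<in> sets (distr M V D)"
    then have A: "A \<in> sets (F r)" and B: "B \<in> sets V" by auto
    have Asp: "A \<subseteq> space M" using sets.sets_into_space[OF A] sp by simp
    have "prob (A \<inter> (D -` B \<inter> space M)) = prob A * prob (D -` B \<inter> space M)"
      using ind A B unfolding indep_sets2_eq by blast
    moreover have "(\<lambda>\<omega>. (\<omega>, D \<omega>)) -` (A \<times> B) \<inter> space M = A \<inter> (D -` B \<inter> space M)" using Asp by auto
    moreover have "(\<lambda>\<omega>. \<omega>) -` A \<inter> space M = A" using Asp by auto
    ultimately show "emeasure (distr M (F r) (\<lambda>\<omega>. \<omega>)) A * emeasure (distr M V D) B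
        = emeasure (distr M (F r \<Otimes>\<^sub>M V) (\<lambda>\<omega>. (\<omega>, D \<omega>))) (A \<times> B)"
      using A B by (simp add: emeasure_distr emeasure_eq_measure ennreal_mult)
  qed
  define \<Phi> where "\<Phi> = (\<lambda>(\<omega>, v). G \<omega> * cis (\<Sum>k<m. c k \<omega> * v k))"
  have \<Phi>[measurable]: "\<Phi> \<in> borel_measurable (F r \<Otimes>\<^sub>M V)"
    unfolding \<Phi>_def V_def using G(1) c by measurable
  interpret A: prob_space "distr M (F r) (\<lambda>\<omega>. \<omega>)" by (rule prob_space_distr[OF idm])
  interpret B: prob_space "distr M V D" by (rule prob_space_distr[OF Dm])
  interpret AB: pair_prob_space "distr M (F r) (\<lambda>\<omega>. \<omega>)" "distr M V D" ..
  have int: "integrable (distr M (F r) (\<lambda>\<omega>. \<omega>) \<Otimes>\<^sub>M distr M V D) \<Phi>"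
  proof (rule AB.integrable_const_bound[of _ 1])
    have "norm (\<Phi> x) \<le> 1" for x using G(2) by (cases x) (simp add: \<Phi>_def norm_mult)
    then show "AE x in distr M (F r) (\<lambda>\<omega>. \<omega>) \<Otimes>\<^sub>M distr M V D. norm (\<Phi> x) \<le> 1" by simp
    show "\<Phi> \<in> borel_measurable (distr M (F r) (\<lambda>\<omega>. \<omega>) \<Otimes>\<^sub>M distr M V D)"
      using \<Phi> by (simp cong: measurable_cong_sets sets_pair_measure_cong)
  qed
  interpret N: prob_space ?n using rs by (intro prob_space_normal_density) simp
  interpret PN: product_prob_space "\<lambda>_::nat. ?n" "{..<m}" ..
  have inner: "(\<integral>v. \<Phi> (\<omega>, v) \<partial>distr M V D) = G \<omega> * complex_of_real (exp (- ((s - r) * (\<Sum>k<m. (c k \<omega>)\<^sup>2)) / 2))" for \<omega>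
  proof -
    have one: "integrable ?n (\<lambda>z. cis (t * z))" "(\<integral>z. cis (t * z) \<partial>?n) = complex_of_real (exp (- (s - r) * t\<^sup>2 / 2))" for t
    proof -
      have [measurable]: "(\<lambda>z. cis (t * z)) \<in> borel_measurable lborel" by measurable
      show "integrable ?n (\<lambda>z. cis (t * z))"
        by (rule N.integrable_const_bound[of _ 1]) auto
      show "(\<integral>z. cis (t * z) \<partial>?n) = complex_of_real (exp (- (s - r) * t\<^sup>2 / 2))"
        using rs by (subst integral_density) (auto simp: normal_density_char(2))
    qed
    have "(\<integral>v. \<Phi> (\<omega>, v) \<partial>distr M V D) = (\<integral>v. G \<omega> * (\<Prod>k<m. cis (c k \<omega> * v k)) \<partial>(\<Pi>\<^sub>M k\<in>{..<m}. ?n))"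
      unfolding dist \<Phi>_def by (simp add: cis_conv_exp sum_distrib_left exp_sum)
    also have "\<dots> = G \<omega> * (\<integral>v. (\<Prod>k<m. cis (c k \<omega> * v k)) \<partial>(\<Pi>\<^sub>M k\<in>{..<m}. ?n))"
      by (rule integral_mult_right_zero)
    also have "(\<integral>v. (\<Prod>k<m. cis (c k \<omega> * v k)) \<partial>(\<Pi>\<^sub>M k\<in>{..<m}. ?n)) = (\<Prod>k<m. \<integral>z. cis (c k \<omega> * z) \<partial>?n)"
      by (rule PN.product_integral_prod) (auto simp: one(1))
    also have "\<dots> = complex_of_real (exp (- ((s - r) * (\<Sum>k<m. (c k \<omega>)\<^sup>2)) / 2))"
    proof -
      have "- ((s - r) * (\<Sum>k<m. (c k \<omega>)\<^sup>2)) / 2 = (\<Sum>k<m. - (s - r) * (c k \<omega>)\<^sup>2 / 2)"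
        by (simp only: sum_distrib_left sum_negf[symmetric] sum_divide_distrib mult_minus_left)
      then show ?thesis unfolding one(2) by (simp only: exp_sum[OF finite_lessThan] of_real_prod)
    qed
    finally show ?thesis .
  qed
  have "(\<integral>\<omega>. G \<omega> * cis (\<Sum>k<m. c k \<omega> * (W k s \<omega> - W k r \<omega>)) \<partial>M) = (\<integral>\<omega>. \<Phi> (\<omega>, D \<omega>) \<partial>M)"
    by (simp add: \<Phi>_def D_def)
  also have "\<dots> = (\<integral>x. \<Phi> x \<partial>distr M (F r \<Otimes>\<^sub>M V) (\<lambda>\<omega>. (\<omega>, D \<omega>)))"
    by (subst integral_distr) auto
  also have "\<dots> = (\<integral>\<omega>. (\<integral>v. \<Phi> (\<omega>, v) \<partial>distr M V D) \<partial>distr M (F r) (\<lambda>\<omega>. \<omega>))"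
    unfolding joint[symmetric] by (rule AB.integral_fst'[OF int, symmetric])
  also have "\<dots> = (\<integral>\<omega>. G \<omega> * complex_of_real (exp (- ((s - r) * (\<Sum>k<m. (c k \<omega>)\<^sup>2)) / 2)) \<partial>M)"
    unfolding inner using G(1) c by (subst integral_distr) (auto intro!: measurable_compose[OF idm])
  finally show ?thesis .
qed

lemma exp_neg_lipschitz:
  fixes a b :: real
  assumes "0 \<le> a" "0 \<le> b"
  shows "\<bar>exp (- a / 2) - exp (- b / 2)\<bar> \<le> \<bar>a - b\<bar>"
proof -
  have *: "exp (- x / 2) - exp (- y / 2) \<le> y - x" if "0 \<le> x" "x \<le> y" for x y :: real
  proof -
    have "1 + - (y - x) / 2 \<le> exp (- (y - x) / 2)" by (rule exp_ge_add_one_self)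
    then have "1 - exp (- (y - x) / 2) \<le> (y - x) / 2" by linarith
    then have "exp (- x / 2) * (1 - exp (- (y - x) / 2)) \<le> 1 * ((y - x) / 2)"
      using that by (intro mult_mono) auto
    moreover have "exp (- x / 2) * (1 - exp (- (y - x) / 2)) = exp (- x / 2) - exp (- y / 2)"
      by (simp add: right_diff_distrib mult_exp_exp diff_divide_distrib)
    ultimately have "exp (- x / 2) - exp (- y / 2) \<le> (y - x) / 2" by (simp only: mult_1)
    also have "\<dots> \<le> y - x" using that by simp
    finally show ?thesis .
  qed
  show ?thesis
    using *[of a b] *[of b a] assms by (cases "a \<le> b") auto
qed

lemma ennreal_norm_triangle:
  fixes a b c :: "'a::real_normed_vector"
  shows "ennreal (norm (a - c)) \<le> ennreal (norm (a - b)) + ennreal (norm (b - c))"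
proof -
  have "ennreal (norm (a - c)) \<le> ennreal (norm (a - b) + norm (b - c))"
    using norm_triangle_ineq[of "a - b" "b - c"] by (intro ennreal_leI) simp
  also have "\<dots> = ennreal (norm (a - b)) + ennreal (norm (b - c))" by (rule ennreal_plus) auto
  finally show ?thesis .
qed

text \<open>For a simple integrand the conditional variance of the integral is random, and only the last
  increment can be integrated out directly. Peeling off the increments one at a time replaces each
  random variance by a prescribed \<open>F (u 0)\<close>-measurable \<open>Q r\<close>; every replacement costs at most the
  expected difference, because all other factors have modulus at most 1.\<close>

lemma fourier_partition_bound:
  fixes u :: "nat \<Rightarrow> real" and Z :: "'w \<Rightarrow> complex"
  assumes W: "wiener_process M F m W"
    and u: "0 \<le> u 0" "\<And>r. r < L \<Longrightarrow> u r \<le> u (Suc r)"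
    and c: "\<And>r k. r < L \<Longrightarrow> k < m \<Longrightarrow> c r k \<in> borel_measurable (F (u r))"
    and Q: "\<And>r. r < L \<Longrightarrow> Q r \<in> borel_measurable (F (u 0))" "\<And>r \<omega>. 0 \<le> Q r \<omega>"
    and Z: "Z \<in> borel_measurable (F (u 0))" "\<And>\<omega>. norm (Z \<omega>) \<le> 1"
  shows "ennreal (norm ((\<integral>\<omega>. Z \<omega> * cis (\<Sum>r<L. \<Sum>k<m. c r k \<omega> * (W k (u (Suc r)) \<omega> - W k (u r) \<omega>)) \<partial>M)
       - (\<integral>\<omega>. Z \<omega> * complex_of_real (exp (- (\<Sum>r<L. Q r \<omega>) / 2)) \<partial>M)))
    \<le> (\<integral>\<^sup>+\<omega>. (\<Sum>r<L. ennreal \<bar>(u (Suc r) - u r) * (\<Sum>k<m. (c r k \<omega>)\<^sup>2) - Q r \<omega>\<bar>) \<partial>M)"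
  using u(2) c Q(1) Z
proof (induction L arbitrary: Z)
  case 0
  then show ?case by simp
next
  case (Suc L)
  have P: "prob_space M" and fil: "filtration_on M F"
    and Wm: "\<And>k r. k < m \<Longrightarrow> 0 \<le> r \<Longrightarrow> W k r \<in> borel_measurable (F r)"
    using W by (auto simp: wiener_process_def)
  interpret prob_space M by (rule P)
  have umono: "u r \<le> u r'" if "r \<le> r'" "r' \<le> Suc L" for r r'
    using that(1,2)
  proof (induction r' rule: dec_induct)
    case (step n)
    then show ?case using Suc.prems(1)[of n] by simp
  qed simp
  have u0: "0 \<le> u r" if "r \<le> Suc L" for r using u(1) umono[of 0 r] that by simp
  have WM: "W k (u r) \<in> borel_measurable (F (u L))" if "k < m" "r \<le> L" for k r
    using filtration_measurable[OF fil u0 umono Wm[OF that(1) u0]] that by simp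
  have cM: "c r k \<in> borel_measurable (F (u L))" if "r \<le> L" "k < m" for r k
    using filtration_measurable[OF fil u0 umono Suc.prems(2)] that by simp
  have QM: "Q r \<in> borel_measurable (F (u L))" if "r \<le> L" for r
    using filtration_measurable[OF fil u0 umono[of 0 L] Suc.prems(3)] that by simp
  have ZM: "Z \<in> borel_measurable (F (u L))"
    using filtration_measurable[OF fil u0 umono[of 0 L] Suc.prems(4)] by simp
  have uL: "0 \<le> u L" using u0[of L] by simp
  let ?e = "\<lambda>r \<omega>. ennreal \<bar>(u (Suc r) - u r) * (\<Sum>k<m. (c r k \<omega>)\<^sup>2) - Q r \<omega>\<bar>"
  note toM = filtration_measurable_M[OF fil uL]
  define I where "I \<omega> = (\<Sum>r<L. \<Sum>k<m. c r k \<omega> * (W k (u (Suc r)) \<omega> - W k (u r) \<omega>))" for \<omega>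
  define v where "v \<omega> = (u (Suc L) - u L) * (\<Sum>k<m. (c L k \<omega>)\<^sup>2)" for \<omega>
  have Im: "I \<in> borel_measurable (F (u L))"
    unfolding I_def using WM cM by (intro borel_measurable_sum borel_measurable_times borel_measurable_diff) auto
  have vm: "v \<in> borel_measurable (F (u L))"
    unfolding v_def using cM by (intro borel_measurable_sum borel_measurable_times borel_measurable_power) auto
  have vnn: "0 \<le> v \<omega>" for \<omega>
    using Suc.prems(1)[of L] unfolding v_def by (intro mult_nonneg_nonneg sum_nonneg) auto
  note [measurable] = toM[OF Im] toM[OF vm] toM[OF QM[of L]] toM[OF ZM]
  (* Given F (u L), the last increment is Gaussian with the known variance v. *)
  have step: "(\<integral>\<omega>. Z \<omega> * cis (\<Sum>r<Suc L. \<Sum>k<m. c r k \<omega> * (W k (u (Suc r)) \<omega> - W k (u r) \<omega>)) \<partial>M)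
     = (\<integral>\<omega>. (Z \<omega> * cis (I \<omega>)) * complex_of_real (exp (- v \<omega> / 2)) \<partial>M)"
  proof -
    have "(\<integral>\<omega>. (Z \<omega> * cis (I \<omega>)) * cis (\<Sum>k<m. c L k \<omega> * (W k (u (Suc L)) \<omega> - W k (u L) \<omega>)) \<partial>M)
       = (\<integral>\<omega>. (Z \<omega> * cis (I \<omega>)) * complex_of_real (exp (- v \<omega> / 2)) \<partial>M)"
      unfolding v_def
    proof (rule wiener_increment_char[OF W])
      show "(\<lambda>\<omega>. Z \<omega> * cis (I \<omega>)) \<in> borel_measurable (F (u L))"
        using ZM Im by measurable
    qed (use u0 Suc.prems cM in \<open>auto simp: norm_mult\<close>)
    then show ?thesis by (simp add: I_def mult.assoc cis_mult)
  qed
  (* The factor with Q L is known at the time u 0 and is absorbed into the weight for the other L increments. *)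
  define Z' where "Z' \<omega> = Z \<omega> * complex_of_real (exp (- Q L \<omega> / 2))" for \<omega>
  have Z'm: "Z' \<in> borel_measurable (F (u 0))"
    unfolding Z'_def using Suc.prems(3)[of L] Suc.prems(4) by measurable
  have Z'n: "norm (Z' \<omega>) \<le> 1" for \<omega>
    using Suc.prems(5)[of \<omega>] Q(2)[of L \<omega>] by (auto simp: Z'_def norm_mult intro!: mult_le_one)
  have e1: "(\<integral>\<omega>. Z \<omega> * complex_of_real (exp (- (\<Sum>r<Suc L. Q r \<omega>) / 2)) \<partial>M)
     = (\<integral>\<omega>. Z' \<omega> * complex_of_real (exp (- (\<Sum>r<L. Q r \<omega>) / 2)) \<partial>M)"
  proof (intro Bochner_Integration.integral_cong refl)
    fix \<omega>
    have "- (\<Sum>r<Suc L. Q r \<omega>) / 2 = - Q L \<omega> / 2 + - (\<Sum>r<L. Q r \<omega>) / 2" by simp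
    then have "exp (- (\<Sum>r<Suc L. Q r \<omega>) / 2) = exp (- Q L \<omega> / 2) * exp (- (\<Sum>r<L. Q r \<omega>) / 2)"
      by (simp only: exp_add)
    then show "Z \<omega> * complex_of_real (exp (- (\<Sum>r<Suc L. Q r \<omega>) / 2)) = Z' \<omega> * complex_of_real (exp (- (\<Sum>r<L. Q r \<omega>) / 2))"
      by (simp only: Z'_def of_real_mult mult.assoc)
  qed
  have ZZ: "norm (Z \<omega> * cis (I \<omega>)) \<le> 1" for \<omega> using Suc.prems(5)[of \<omega>] by (simp add: norm_mult)
  have bnd: "norm (Z \<omega> * cis (I \<omega>) * complex_of_real (exp (- y / 2))) \<le> 1" if "0 \<le> y" for \<omega> y
    using ZZ[of \<omega>] that by (auto simp: norm_mult intro!: mult_le_one)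
  have i1: "integrable M (\<lambda>\<omega>. Z \<omega> * cis (I \<omega>) * complex_of_real (exp (- v \<omega> / 2)))"
    by (rule integrable_const_bound[of _ 1]) (use bnd[OF vnn] in auto)
  have i2: "integrable M (\<lambda>\<omega>. Z \<omega> * cis (I \<omega>) * complex_of_real (exp (- Q L \<omega> / 2)))"
    by (rule integrable_const_bound[of _ 1]) (use bnd[OF Q(2)] in auto)
  let ?A = "\<integral>\<omega>. Z \<omega> * cis (I \<omega>) * complex_of_real (exp (- v \<omega> / 2)) \<partial>M"
  let ?B = "\<integral>\<omega>. Z \<omega> * cis (I \<omega>) * complex_of_real (exp (- Q L \<omega> / 2)) \<partial>M"
  let ?C = "\<integral>\<omega>. Z' \<omega> * complex_of_real (exp (- (\<Sum>r<L. Q r \<omega>) / 2)) \<partial>M"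
  have AB: "ennreal (norm (?A - ?B)) \<le> (\<integral>\<^sup>+\<omega>. ennreal \<bar>v \<omega> - Q L \<omega>\<bar> \<partial>M)"
  proof -
    have "ennreal (norm (?A - ?B)) = ennreal (norm (\<integral>\<omega>. Z \<omega> * cis (I \<omega>) * complex_of_real (exp (- v \<omega> / 2)) - Z \<omega> * cis (I \<omega>) * complex_of_real (exp (- Q L \<omega> / 2)) \<partial>M))"
      using i1 i2 by simp
    also have "\<dots> \<le> (\<integral>\<^sup>+\<omega>. ennreal (norm (Z \<omega> * cis (I \<omega>) * complex_of_real (exp (- v \<omega> / 2)) - Z \<omega> * cis (I \<omega>) * complex_of_real (exp (- Q L \<omega> / 2)))) \<partial>M)"
      by (rule integral_norm_bound_ennreal) (intro Bochner_Integration.integrable_diff i1 i2)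
    also have "\<dots> \<le> (\<integral>\<^sup>+\<omega>. ennreal \<bar>v \<omega> - Q L \<omega>\<bar> \<partial>M)"
    proof (intro nn_integral_mono ennreal_leI)
      fix \<omega>
      have "norm (Z \<omega> * cis (I \<omega>) * complex_of_real (exp (- v \<omega> / 2)) - Z \<omega> * cis (I \<omega>) * complex_of_real (exp (- Q L \<omega> / 2)))
         = norm (Z \<omega> * cis (I \<omega>)) * \<bar>exp (- v \<omega> / 2) - exp (- Q L \<omega> / 2)\<bar>"
        by (simp only: right_diff_distrib[symmetric] of_real_diff[symmetric] norm_mult norm_of_real)
      also have "\<dots> \<le> 1 * \<bar>v \<omega> - Q L \<omega>\<bar>"
        by (intro mult_mono ZZ exp_neg_lipschitz vnn Q(2)) auto
      finally show "norm (Z \<omega> * cis (I \<omega>) * complex_of_real (exp (- v \<omega> / 2)) - Z \<omega> * cis (I \<omega>) * complex_of_real (exp (- Q L \<omega> / 2)))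
          \<le> \<bar>v \<omega> - Q L \<omega>\<bar>" by simp
    qed
    finally show ?thesis .
  qed
  have BC: "ennreal (norm (?B - ?C)) \<le> (\<integral>\<^sup>+\<omega>. (\<Sum>r<L. ?e r \<omega>) \<partial>M)"
  proof -
    have "?B = (\<integral>\<omega>. Z' \<omega> * cis (\<Sum>r<L. \<Sum>k<m. c r k \<omega> * (W k (u (Suc r)) \<omega> - W k (u r) \<omega>)) \<partial>M)"
      by (intro Bochner_Integration.integral_cong refl) (simp add: Z'_def I_def mult_ac)
    then show ?thesis
      using Suc.IH[of Z'] Suc.prems(1-3) Z'm Z'n by simp
  qed
  have "ennreal (norm (?A - ?C)) \<le> ennreal (norm (?A - ?B)) + ennreal (norm (?B - ?C))"
    by (rule ennreal_norm_triangle)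
  also have "\<dots> \<le> (\<integral>\<^sup>+\<omega>. ennreal \<bar>v \<omega> - Q L \<omega>\<bar> \<partial>M)
      + (\<integral>\<^sup>+\<omega>. (\<Sum>r<L. ?e r \<omega>) \<partial>M)"
    by (intro add_mono AB BC)
  also have "\<dots> = (\<integral>\<^sup>+\<omega>. (\<Sum>r<Suc L. ?e r \<omega>) \<partial>M)"
  proof -
    have [measurable]: "(\<lambda>\<omega>. \<Sum>r<L. ?e r \<omega>) \<in> borel_measurable M"
    proof (intro borel_measurable_sum)
      fix r assume "r \<in> {..<L}"
      then have "(\<lambda>\<omega>. (u (Suc r) - u r) * (\<Sum>k<m. (c r k \<omega>)\<^sup>2) - Q r \<omega>) \<in> borel_measurable (F (u L))"
        using cM QM by (intro borel_measurable_diff borel_measurable_sum borel_measurable_times borel_measurable_power) auto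
      then show "(\<lambda>\<omega>. ?e r \<omega>) \<in> borel_measurable M"
        using toM by (intro measurable_compose[OF borel_measurable_abs]) auto
    qed
    have "(\<integral>\<^sup>+\<omega>. ennreal \<bar>v \<omega> - Q L \<omega>\<bar> \<partial>M)
        + (\<integral>\<^sup>+\<omega>. (\<Sum>r<L. ?e r \<omega>) \<partial>M)
      = (\<integral>\<^sup>+\<omega>. ennreal \<bar>v \<omega> - Q L \<omega>\<bar> + (\<Sum>r<L. ?e r \<omega>) \<partial>M)"
      by (rule nn_integral_add[symmetric]) measurable
    then show ?thesis unfolding v_def by (simp only: sum.lessThan_Suc add.commute)
  qed
  finally show ?case unfolding step e1 .
qed

section \<open>Simple processes on a common partition\<close>

lemma sorted_partition_nth:
  fixes P :: "real set"
  assumes P: "finite P" and u: "u = (\<lambda>r. sorted_list_of_set P ! r)"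
  shows "\<And>x. x \<in> P \<Longrightarrow> \<exists>p < card P. u p = x"
    and "\<And>p q. p < card P \<Longrightarrow> q < card P \<Longrightarrow> (u p < u q) = (p < q)"
    and "\<And>p. p < card P \<Longrightarrow> u p \<in> P"
proof -
  have s: "sorted_wrt (<) (sorted_list_of_set P)" by (rule strict_sorted_list_of_set)
  have l: "length (sorted_list_of_set P) = card P" by simp
  have st: "set (sorted_list_of_set P) = P" using P by simp
  show "\<exists>p < card P. u p = x" if "x \<in> P" for x
    using that st l unfolding u by (metis in_set_conv_nth)
  show "u p \<in> P" if "p < card P" for p
    using that st l unfolding u by (metis nth_mem)
  have lt: "u p < u q" if "p < q" "q < card P" for p q
    using sorted_wrt_nth_less[OF s that(1)] that(2) l unfolding u by simp
  show "(u p < u q) = (p < q)" if "p < card P" "q < card P" for p q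
    using lt[of p q] lt[of q p] that by (metis less_asym linorder_neqE_nat order_less_irrefl)
qed

lemma partition_telescope:
  fixes P :: "real set" and f :: "real \<Rightarrow> real"
  assumes P: "finite P" and u: "u = (\<lambda>r. sorted_list_of_set P ! r)"
    and xy: "x \<in> P" "y \<in> P" "x \<le> y"
  shows "f y - f x = (\<Sum>r<card P - 1. indicat_real {x<..y} (u (Suc r)) * (f (u (Suc r)) - f (u r)))"
proof -
  note n = sorted_partition_nth[OF P u]
  obtain p q where p: "p < card P" "u p = x" and q: "q < card P" "u q = y" using n(1) xy by metis
  have pq: "p \<le> q" using n(2)[OF q(1) p(1)] p q xy by auto
  have ind: "indicat_real {x<..y} (u (Suc r)) = (if r \<in> {p..<q} then 1 else 0)" if "r < card P - 1" for r
    using n(2)[OF p(1), of "Suc r"] n(2)[OF q(1), of "Suc r"] that p q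
    by (auto simp: indicator_def not_less[symmetric])
  have "(\<Sum>r<card P - 1. indicat_real {x<..y} (u (Suc r)) * (f (u (Suc r)) - f (u r)))
     = (\<Sum>r<card P - 1. if r \<in> {p..<q} then f (u (Suc r)) - f (u r) else 0)"
    by (intro sum.cong refl) (simp add: ind)
  also have "\<dots> = (\<Sum>r\<in>{..<card P - 1} \<inter> {p..<q}. f (u (Suc r)) - f (u r))"
    by (simp add: sum.inter_restrict)
  also have "{..<card P - 1} \<inter> {p..<q} = {p..<q}" using q by auto
  also have "(\<Sum>r\<in>{p..<q}. f (u (Suc r)) - f (u r)) = f (u q) - f (u p)"
    using sum_Suc_diff'[OF pq, of "\<lambda>r. f (u r)"] by simp
  finally show ?thesis using p q by simp
qed

text \<open>The jump times of \<open>S\<close> are clamped to \<open>{a..b}\<close>, so that jumps outside the interval do no harm.\<close>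

definition partition_refines :: "real set \<Rightarrow> real \<Rightarrow> real \<Rightarrow> ('w, 'b::euclidean_space) simple_proc \<Rightarrow> bool" where
  "partition_refines P a b S \<longleftrightarrow> finite P \<and> a \<in> P \<and> b \<in> P \<and> P \<subseteq> {a..b} \<and>
     (case S of (l, s, \<xi>) \<Rightarrow> \<forall>j\<le>l. max a (min (s j) b) \<in> P)"

lemma simple_ito_increment_partition:
  fixes S :: "('w, 'b::euclidean_space) simple_proc"
  assumes S: "is_simple_proc F S" and P: "partition_refines P a b S" and ab: "a \<le> b"
    and u: "u = (\<lambda>r. sorted_list_of_set P ! r)"
  shows "simple_ito B S b \<omega> - simple_ito B S a \<omega>
    = (\<Sum>r<card P - 1. (B (u (Suc r)) \<omega> - B (u r) \<omega>) *\<^sub>R simple_val S (u (Suc r)) \<omega>)"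
proof -
  obtain l s \<xi> where Se: "S = (l, s, \<xi>)" by (cases S) auto
  have mono: "mono s" using S by (simp add: is_simple_proc_def Se)
  have Pf: "finite P" and PP: "P \<subseteq> {a..b}" and aP: "a \<in> P" and cl: "\<And>j. j \<le> l \<Longrightarrow> max a (min (s j) b) \<in> P"
    using P by (auto simp: partition_refines_def Se)
  note n = sorted_partition_nth[OF Pf u]
  have ua: "a < u (Suc r) \<and> u (Suc r) \<le> b" if "r < card P - 1" for r
  proof -
    obtain p where p: "p < card P" "u p = a" using n(1)[OF aP] by blast
    have "u 0 < u (Suc r)" using n(2)[of 0 "Suc r"] that by simp
    moreover have "a \<le> u 0"
    proof -
      have "u 0 \<in> P" by (rule n(3)) (use that in simp)
      then show ?thesis using PP by auto
    qed
    moreover have "u (Suc r) \<in> P" by (rule n(3)) (use that in linarith)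
    ultimately show ?thesis using PP by auto
  qed
  have br: "(B (min (s (Suc j)) b) \<omega> - B (min (s j) b) \<omega>) - (B (min (s (Suc j)) a) \<omega> - B (min (s j) a) \<omega>)
     = (\<Sum>r<card P - 1. indicat_real {s j<..s (Suc j)} (u (Suc r)) * (B (u (Suc r)) \<omega> - B (u r) \<omega>))" if j: "j < l" for j
  proof -
    let ?c = "\<lambda>x. max a (min x b)"
    have c: "B (min x b) \<omega> - B (min x a) \<omega> = B (?c x) \<omega> - B a \<omega>" for x
      using ab by (cases "x \<le> a") (auto simp: max_def min_def)
    have "(B (min (s (Suc j)) b) \<omega> - B (min (s j) b) \<omega>) - (B (min (s (Suc j)) a) \<omega> - B (min (s j) a) \<omega>)
      = B (?c (s (Suc j))) \<omega> - B (?c (s j)) \<omega>"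
      using c[of "s (Suc j)"] c[of "s j"] by linarith
    also have "\<dots> = (\<Sum>r<card P - 1. indicat_real {?c (s j)<..?c (s (Suc j))} (u (Suc r)) * (B (u (Suc r)) \<omega> - B (u r) \<omega>))"
      using j monoD[OF mono, of j "Suc j"]
      by (intro partition_telescope[OF Pf u, where f="\<lambda>x. B x \<omega>"] cl) auto
    also have "\<dots> = (\<Sum>r<card P - 1. indicat_real {s j<..s (Suc j)} (u (Suc r)) * (B (u (Suc r)) \<omega> - B (u r) \<omega>))"
    proof (intro sum.cong refl)
      fix r assume "r \<in> {..<card P - 1}"
      then have "a < u (Suc r)" "u (Suc r) \<le> b" using ua[of r] by auto
      then show "indicat_real {?c (s j)<..?c (s (Suc j))} (u (Suc r)) * (B (u (Suc r)) \<omega> - B (u r) \<omega>)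
          = indicat_real {s j<..s (Suc j)} (u (Suc r)) * (B (u (Suc r)) \<omega> - B (u r) \<omega>)"
        by (auto simp: indicator_def max_def min_def split: if_splits)
    qed
    finally show ?thesis .
  qed
  have "simple_ito B S b \<omega> - simple_ito B S a \<omega>
     = (\<Sum>j<l. ((B (min (s (Suc j)) b) \<omega> - B (min (s j) b) \<omega>) - (B (min (s (Suc j)) a) \<omega> - B (min (s j) a) \<omega>)) *\<^sub>R \<xi> j \<omega>)"
    by (simp add: simple_ito_def Se sum_subtractf scaleR_left_diff_distrib)
  also have "\<dots> = (\<Sum>j<l. \<Sum>r<card P - 1. (indicat_real {s j<..s (Suc j)} (u (Suc r)) * (B (u (Suc r)) \<omega> - B (u r) \<omega>)) *\<^sub>R \<xi> j \<omega>)"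
    by (intro sum.cong refl) (simp only: lessThan_iff br scaleR_left.sum)
  also have "\<dots> = (\<Sum>r<card P - 1. \<Sum>j<l. (indicat_real {s j<..s (Suc j)} (u (Suc r)) * (B (u (Suc r)) \<omega> - B (u r) \<omega>)) *\<^sub>R \<xi> j \<omega>)"
    by (rule sum.swap)
  also have "\<dots> = (\<Sum>r<card P - 1. (B (u (Suc r)) \<omega> - B (u r) \<omega>) *\<^sub>R simple_val S (u (Suc r)) \<omega>)"
    unfolding simple_val_def Se prod.case scaleR_sum_right scaleR_scaleR
    by (intro sum.cong refl) (simp only: mult.commute)
  finally show ?thesis .
qed

lemma partition_gap:
  fixes S :: "('w, 'b::euclidean_space) simple_proc"
  assumes P: "partition_refines P a b (l, s, \<xi>)" and u: "u = (\<lambda>r. sorted_list_of_set P ! r)"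
    and r: "Suc r < card P" and x: "u r < x" "x \<le> u (Suc r)" and j: "j \<le> l"
  shows "(s j < x) = (s j \<le> u r)" 
proof -
  have Pf: "finite P" and PP: "P \<subseteq> {a..b}" and cl: "max a (min (s j) b) \<in> P"
    using P j by (auto simp: partition_refines_def)
  note n = sorted_partition_nth[OF Pf u]
  have ur: "a \<le> u r" "u (Suc r) \<le> b" using n(3)[of r] n(3)[of "Suc r"] r PP by auto
  show ?thesis
  proof
    assume sx: "s j < x"
    obtain p where p: "p < card P" "u p = max a (min (s j) b)" using n(1)[OF cl] by blast
    have "u p < x" using sx x ur p by auto
    then have "u p < u (Suc r)" using x by simp
    then have "p < Suc r" using n(2)[OF p(1) r] by simp
    then have "u p \<le> u r" using n(2)[of r p] p r by force
    then show "s j \<le> u r" using sx x ur p by auto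
  qed (use x in auto)
qed

lemma simple_val_partition_const:
  fixes S :: "('w, 'b::euclidean_space) simple_proc"
  assumes P: "partition_refines P a b S" and u: "u = (\<lambda>r. sorted_list_of_set P ! r)"
    and r: "Suc r < card P" and x: "u r < x" "x \<le> u (Suc r)"
  shows "simple_val S x \<omega> = simple_val S (u (Suc r)) \<omega>"
proof -
  obtain l s \<xi> where Se: "S = (l, s, \<xi>)" by (cases S) auto
  have lt: "u r < u (Suc r)" using x by simp
  have "(s j < x) = (s j < u (Suc r))" if "j \<le> l" for j
    using partition_gap[OF P[unfolded Se] u r x that] partition_gap[OF P[unfolded Se] u r lt order_refl that] by simp
  then have "indicat_real {s j<..s (Suc j)} x = indicat_real {s j<..s (Suc j)} (u (Suc r))" if "j < l" for j
    using that by (auto simp: indicator_def not_less[symmetric])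
  then show ?thesis
    unfolding simple_val_def Se prod.case by (intro sum.cong refl) (simp only: lessThan_iff)
qed

lemma simple_val_partition_measurable:
  fixes S :: "('w, 'b::euclidean_space) simple_proc"
  assumes fil: "filtration_on M F" and S: "is_simple_proc F S"
    and P: "partition_refines P a b S" and u: "u = (\<lambda>r. sorted_list_of_set P ! r)"
    and r: "Suc r < card P"
  shows "simple_val S (u (Suc r)) \<in> borel_measurable (F (u r))"
proof -
  obtain l s \<xi> where Se: "S = (l, s, \<xi>)" by (cases S) auto
  have Pf: "finite P" using P by (simp add: partition_refines_def)
  have lt: "u r < u (Suc r)" using sorted_partition_nth(2)[OF Pf u, of r "Suc r"] r by simp
  have s0: "0 \<le> s 0" and mono: "mono s" and \<xi>: "\<And>j. j < l \<Longrightarrow> \<xi> j \<in> borel_measurable (F (s j))"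
    using S by (auto simp: is_simple_proc_def Se)
  have "(\<lambda>\<omega>. indicat_real {s j<..s (Suc j)} (u (Suc r)) *\<^sub>R \<xi> j \<omega>) \<in> borel_measurable (F (u r))" if j: "j < l" for j
  proof (cases "s j < u (Suc r)")
    case True
    then have "s j \<le> u r" using partition_gap[OF P[unfolded Se] u r lt order_refl, of j] j by simp
    moreover have "0 \<le> s j" using s0 monoD[OF mono, of 0 j] by simp
    ultimately have "\<xi> j \<in> borel_measurable (F (u r))"
      using filtration_measurable[OF fil _ _ \<xi>[OF j]] by blast
    then show ?thesis by measurable
  qed simp
  then show ?thesis
    unfolding simple_val_def Se prod.case by (intro borel_measurable_sum) (simp only: lessThan_iff)
qed

lemma simple_val_measurable_time:
  "(\<lambda>s. simple_val S s \<omega>) \<in> borel_measurable borel"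
proof -
  obtain l s \<xi> where S: "S = (l, s, \<xi>)" by (cases S) auto
  show ?thesis unfolding simple_val_def S prod.case by measurable
qed

lemma simple_proc_common_partition:
  fixes S :: "'e \<Rightarrow> ('w, 'b::euclidean_space) simple_proc"
  assumes E: "finite E" and ab: "a \<le> b"
  obtains P where "\<And>e. e \<in> E \<Longrightarrow> partition_refines P a b (S e)" "finite P" "a \<in> P" "b \<in> P" "P \<subseteq> {a..b}"
proof -
  define P where "P = {a, b} \<union> (\<Union>e\<in>E. (\<lambda>j. max a (min (fst (snd (S e)) j) b)) ` {..fst (S e)})"
  have "finite P" "a \<in> P" "b \<in> P" "P \<subseteq> {a..b}" using E ab by (auto simp: P_def)
  moreover from this have "partition_refines P a b (S e)" if "e \<in> E" for e
    using that by (cases "S e") (force simp: partition_refines_def P_def)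
  ultimately show thesis using that by blast
qed

text \<open>The simple processes in a finite family \<open>E\<close>, each with its own Wiener coordinate \<open>kk e\<close>, live on
  different partitions; on a common refinement they form one simple integrand, to which the bound
  for partitions applies.\<close>

lemma fourier_simple_processes:
  fixes S :: "'e \<Rightarrow> ('w, 'b::euclidean_space) simple_proc" and lam :: "'e \<Rightarrow> 'b" and Z :: "'w \<Rightarrow> complex"
  assumes W: "wiener_process M F m W" and ab: "0 \<le> a" "a \<le> b"
    and E: "finite E" "\<And>e. e \<in> E \<Longrightarrow> is_simple_proc F (S e)" "\<And>e. e \<in> E \<Longrightarrow> kk e < m"
    and q: "(\<lambda>(\<omega>, s). q s \<omega>) \<in> borel_measurable (F a \<Otimes>\<^sub>M borel)" "\<And>s \<omega>. 0 \<le> q s \<omega>" "\<And>s \<omega>. q s \<omega> \<le> C"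
    and Z: "Z \<in> borel_measurable (F a)" "\<And>\<omega>. norm (Z \<omega>) \<le> 1"
  shows "ennreal (norm ((\<integral>\<omega>. Z \<omega> * cis (\<Sum>e\<in>E. lam e \<bullet> (simple_ito (W (kk e)) (S e) b \<omega> - simple_ito (W (kk e)) (S e) a \<omega>)) \<partial>M)
       - (\<integral>\<omega>. Z \<omega> * complex_of_real (exp (- (LINT s:{a<..b}|lborel. q s \<omega>) / 2)) \<partial>M)))
    \<le> (\<integral>\<^sup>+\<omega>. (\<integral>\<^sup>+s\<in>{a<..b}. ennreal \<bar>(\<Sum>k<m. (\<Sum>e\<in>{e\<in>E. kk e = k}. lam e \<bullet> simple_val (S e) s \<omega>)\<^sup>2) - q s \<omega>\<bar> \<partial>lborel) \<partial>M)"
proof -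
  have fil: "filtration_on M F" using W by (simp add: wiener_process_def)
  obtain P where P: "\<And>e. e \<in> E \<Longrightarrow> partition_refines P a b (S e)" and Pf: "finite P" and aP: "a \<in> P" and bP: "b \<in> P" and PP: "P \<subseteq> {a..b}"
    using simple_proc_common_partition[OF E(1) ab(2), of S] by blast
  define u where "u = (\<lambda>r. sorted_list_of_set P ! r)"
  define L where "L = card P - 1"
  let ?dW = "\<lambda>e r \<omega>. W (kk e) (u (Suc r)) \<omega> - W (kk e) (u r) \<omega>"
  let ?v = "\<lambda>e r \<omega>. lam e \<bullet> simple_val (S e) (u (Suc r)) \<omega>"
  note n = sorted_partition_nth[OF Pf u_def]
  have "card P \<noteq> 0" using aP Pf by auto
  then have cP: "card P = Suc L" by (simp add: L_def)
  have u0: "u 0 = a"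
  proof (rule ccontr)
    assume "u 0 \<noteq> a"
    moreover obtain p where "p < card P" "u p = a" using n(1)[OF aP] by blast
    ultimately have "u 0 < a" using n(2)[of 0 p] by (cases "p = 0") auto
    then show False using n(3)[of 0] cP PP by auto
  qed
  have uL: "u L = b"
  proof (rule ccontr)
    assume "u L \<noteq> b"
    moreover obtain p where "p < card P" "u p = b" using n(1)[OF bP] by blast
    ultimately have "b < u L" using n(2)[of p L] cP by (cases "p = L") auto
    then show False using n(3)[of L] cP PP by auto
  qed
  have lt: "u r < u (Suc r)" if "r < L" for r using n(2)[of r "Suc r"] that cP by simp
  have ua: "a \<le> u r" if "r \<le> L" for r using n(3)[of r] that cP PP by auto
  define x where "x k s \<omega> = (\<Sum>e\<in>{e\<in>E. kk e = k}. lam e \<bullet> simple_val (S e) s \<omega>)" for k s \<omega>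
  define c where "c r k \<omega> = x k (u (Suc r)) \<omega>" for r k \<omega>
  define Q where "Q r \<omega> = (LINT s:{u r<..u (Suc r)}|lborel. q s \<omega>)" for r \<omega>
  have cm: "c r k \<in> borel_measurable (F (u r))" if "r < L" "k < m" for r k
  proof -
    have "simple_val (S e) (u (Suc r)) \<in> borel_measurable (F (u r))" if "e \<in> E" for e
      using simple_val_partition_measurable[OF fil E(2)[OF that] P[OF that] u_def, of r] \<open>r < L\<close> cP by simp
    then show ?thesis unfolding c_def x_def by (intro borel_measurable_sum borel_measurable_inner) auto
  qed
  have Qm: "Q r \<in> borel_measurable (F (u 0))" for r
  proof -
    have [measurable]: "(\<lambda>(\<omega>, s). q s \<omega>) \<in> borel_measurable (F a \<Otimes>\<^sub>M lborel)"
      using q(1) by (simp cong: measurable_cong_sets sets_pair_measure_cong)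
    show ?thesis
      unfolding Q_def u0 set_lebesgue_integral_def
      by (rule lborel.borel_measurable_lebesgue_integral) measurable
  qed
  have Qnn: "0 \<le> Q r \<omega>" for r \<omega>
    unfolding Q_def set_lebesgue_integral_def using q(2) by (intro Bochner_Integration.integral_nonneg) simp
  have qint: "set_integrable lborel {y<..z} (\<lambda>s. q s \<omega>)" if "\<omega> \<in> space M" for y z \<omega>
  proof -
    have sp: "\<omega> \<in> space (F a)" using that fil ab(1) by (auto simp: filtration_on_def subalgebra_def)
    have m: "(\<lambda>s. q s \<omega>) \<in> borel_measurable borel"
      using measurable_compose[OF measurable_Pair1'[OF sp] q(1)] by simp
    have "emeasure lborel {y<..z} < \<infinity>" by (cases "y \<le> z") auto
    then show ?thesis
      unfolding set_integrable_def
      by (intro integrableI_bounded_set_indicator[where B=C]) (use m q in auto)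
  qed
  have Qsum: "(\<Sum>r<n. Q r \<omega>) = (LINT s:{a<..u n}|lborel. q s \<omega>)" if "n \<le> L" "\<omega> \<in> space M" for n \<omega>
    using that(1)
  proof (induction n)
    case 0
    then show ?case by (simp add: u0 set_lebesgue_integral_def)
  next
    case (Suc n)
    have "{a<..u (Suc n)} = {a<..u n} \<union> {u n<..u (Suc n)}"
      using ua[of n] lt[of n] Suc.prems by auto
    then have "(LINT s:{a<..u (Suc n)}|lborel. q s \<omega>) = (LINT s:{a<..u n}|lborel. q s \<omega>) + (LINT s:{u n<..u (Suc n)}|lborel. q s \<omega>)"
      using qint[OF that(2)] by (simp add: set_integral_Un)
    then show ?case using Suc by (simp add: Q_def)
  qed
  have I: "(\<Sum>e\<in>E. lam e \<bullet> (simple_ito (W (kk e)) (S e) b \<omega> - simple_ito (W (kk e)) (S e) a \<omega>))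
     = (\<Sum>r<L. \<Sum>k<m. c r k \<omega> * (W k (u (Suc r)) \<omega> - W k (u r) \<omega>))" for \<omega>
  proof -
    have "(\<Sum>e\<in>E. lam e \<bullet> (simple_ito (W (kk e)) (S e) b \<omega> - simple_ito (W (kk e)) (S e) a \<omega>))
       = (\<Sum>e\<in>E. \<Sum>r<L. (?dW e r \<omega>) * (?v e r \<omega>))"
    proof (intro sum.cong refl)
      fix e assume e: "e \<in> E"
      show "lam e \<bullet> (simple_ito (W (kk e)) (S e) b \<omega> - simple_ito (W (kk e)) (S e) a \<omega>)
        = (\<Sum>r<L. (?dW e r \<omega>) * (?v e r \<omega>))"
        unfolding simple_ito_increment_partition[OF E(2)[OF e] P[OF e] ab(2) u_def] L_def
        by (simp add: inner_sum_right)
    qed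
    also have "\<dots> = (\<Sum>r<L. \<Sum>e\<in>E. (?dW e r \<omega>) * (?v e r \<omega>))"
      by (rule sum.swap)
    also have "\<dots> = (\<Sum>r<L. \<Sum>k<m. c r k \<omega> * (W k (u (Suc r)) \<omega> - W k (u r) \<omega>))"
    proof (intro sum.cong refl)
      fix r
      have "(\<Sum>k<m. c r k \<omega> * (W k (u (Suc r)) \<omega> - W k (u r) \<omega>))
        = (\<Sum>k<m. \<Sum>e\<in>{e\<in>E. kk e = k}. (?dW e r \<omega>) * (?v e r \<omega>))"
        unfolding c_def x_def sum_distrib_right by (intro sum.cong refl) (auto simp: mult.commute)
      also have "\<dots> = (\<Sum>e\<in>E. (?dW e r \<omega>) * (?v e r \<omega>))"
        by (rule sum.group) (use E in auto)
      finally show "(\<Sum>e\<in>E. (?dW e r \<omega>) * (?v e r \<omega>))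
        = (\<Sum>k<m. c r k \<omega> * (W k (u (Suc r)) \<omega> - W k (u r) \<omega>))" by simp
    qed
    finally show ?thesis .
  qed
  have bound: "(\<Sum>r<L. ennreal \<bar>(u (Suc r) - u r) * (\<Sum>k<m. (c r k \<omega>)\<^sup>2) - Q r \<omega>\<bar>)
      \<le> (\<integral>\<^sup>+s\<in>{a<..b}. ennreal \<bar>(\<Sum>k<m. (x k s \<omega>)\<^sup>2) - q s \<omega>\<bar> \<partial>lborel)" if om: "\<omega> \<in> space M" for \<omega>
  proof -
    let ?g = "\<lambda>s. ennreal \<bar>(\<Sum>k<m. (x k s \<omega>)\<^sup>2) - q s \<omega>\<bar>"
    have sp: "\<omega> \<in> space (F a)" using om fil ab(1) by (auto simp: filtration_on_def subalgebra_def)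
    have [measurable]: "(\<lambda>s. q s \<omega>) \<in> borel_measurable borel"
      using measurable_compose[OF measurable_Pair1'[OF sp] q(1)] by simp
    have [measurable]: "(\<lambda>s. x k s \<omega>) \<in> borel_measurable borel" for k
      unfolding x_def by (intro borel_measurable_sum borel_measurable_inner simple_val_measurable_time) auto
    have gm: "?g \<in> borel_measurable lborel" by measurable
    have piece: "ennreal \<bar>(u (Suc r) - u r) * (\<Sum>k<m. (c r k \<omega>)\<^sup>2) - Q r \<omega>\<bar>
        \<le> (\<integral>\<^sup>+s\<in>{u r<..u (Suc r)}. ?g s \<partial>lborel)" if r: "r < L" for r
    proof -
      let ?v = "\<Sum>k<m. (c r k \<omega>)\<^sup>2"
      have ci: "set_integrable lborel {u r<..u (Suc r)} (\<lambda>_. ?v)"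
        unfolding set_integrable_def using lt[OF r] by (intro integrable_scaleR_left) auto
      have "(LINT s:{u r<..u (Suc r)}|lborel. ?v - q s \<omega>) = (u (Suc r) - u r) * ?v - Q r \<omega>"
        using ci qint[OF om] lt[OF r] by (subst set_integral_diff) (auto simp: Q_def set_integral_const)
      then have "ennreal \<bar>(u (Suc r) - u r) * ?v - Q r \<omega>\<bar>
          = ennreal (norm (\<integral>s. indicat_real {u r<..u (Suc r)} s *\<^sub>R (?v - q s \<omega>) \<partial>lborel))"
        by (simp add: set_lebesgue_integral_def)
      also have "\<dots> \<le> (\<integral>\<^sup>+s. ennreal (norm (indicat_real {u r<..u (Suc r)} s *\<^sub>R (?v - q s \<omega>))) \<partial>lborel)"
        using set_integral_diff(1)[OF ci qint[OF om]] unfolding set_integrable_def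
        by (rule integral_norm_bound_ennreal)
      also have "\<dots> = (\<integral>\<^sup>+s\<in>{u r<..u (Suc r)}. ?g s \<partial>lborel)"
      proof (intro nn_integral_cong)
        fix s
        have "x k s \<omega> = c r k \<omega>" if "u r < s" "s \<le> u (Suc r)" for k
          unfolding x_def c_def
          using simple_val_partition_const[OF P u_def _ that] r cP by (intro sum.cong refl arg_cong[where f="inner _"]) auto
        then show "ennreal (norm (indicat_real {u r<..u (Suc r)} s *\<^sub>R (?v - q s \<omega>))) = ?g s * indicator {u r<..u (Suc r)} s"
          by (auto simp: indicator_def)
      qed
      finally show ?thesis .
    qed
    have "(\<Sum>r<n. \<integral>\<^sup>+s\<in>{u r<..u (Suc r)}. ?g s \<partial>lborel) = (\<integral>\<^sup>+s\<in>{a<..u n}. ?g s \<partial>lborel)" if "n \<le> L" for n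
      using that
    proof (induction n)
      case 0
      then show ?case by (simp add: u0)
    next
      case (Suc n)
      have "{a<..u (Suc n)} = {a<..u n} \<union> {u n<..u (Suc n)}"
        using ua[of n] lt[of n] Suc.prems by auto
      then have "(\<integral>\<^sup>+s\<in>{a<..u (Suc n)}. ?g s \<partial>lborel) = (\<integral>\<^sup>+s\<in>{a<..u n}. ?g s \<partial>lborel) + (\<integral>\<^sup>+s\<in>{u n<..u (Suc n)}. ?g s \<partial>lborel)"
        by (simp only:) (rule nn_integral_disjoint_pair[OF gm], auto)
      then show ?case using Suc by simp
    qed
    from this[of L] show ?thesis
      using sum_mono[OF piece, of "{..<L}" "\<lambda>r. r"] by (simp add: uL)
  qed
  have "ennreal (norm ((\<integral>\<omega>. Z \<omega> * cis (\<Sum>r<L. \<Sum>k<m. c r k \<omega> * (W k (u (Suc r)) \<omega> - W k (u r) \<omega>)) \<partial>M)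
       - (\<integral>\<omega>. Z \<omega> * complex_of_real (exp (- (\<Sum>r<L. Q r \<omega>) / 2)) \<partial>M)))
    \<le> (\<integral>\<^sup>+\<omega>. (\<Sum>r<L. ennreal \<bar>(u (Suc r) - u r) * (\<Sum>k<m. (c r k \<omega>)\<^sup>2) - Q r \<omega>\<bar>) \<partial>M)"
    by (rule fourier_partition_bound[OF W _ less_imp_le[OF lt] cm Qm Qnn]) (use Z ab u0 in auto)
  also have "\<dots> \<le> (\<integral>\<^sup>+\<omega>. (\<integral>\<^sup>+s\<in>{a<..b}. ennreal \<bar>(\<Sum>k<m. (x k s \<omega>)\<^sup>2) - q s \<omega>\<bar> \<partial>lborel) \<partial>M)"
    by (rule nn_integral_mono) (rule bound)
  also have "(\<integral>\<omega>. Z \<omega> * complex_of_real (exp (- (\<Sum>r<L. Q r \<omega>) / 2)) \<partial>M)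
     = (\<integral>\<omega>. Z \<omega> * complex_of_real (exp (- (LINT s:{a<..b}|lborel. q s \<omega>) / 2)) \<partial>M)"
    by (intro Bochner_Integration.integral_cong refl) (simp only: Qsum[OF order_refl] uL)
  finally show ?thesis unfolding I x_def .
qed

section \<open>Convergence in mean and measurability\<close>

lemma ennreal_tendsto_0I:
  fixes f :: "'i \<Rightarrow> ennreal"
  assumes "\<And>r::real. 0 < r \<Longrightarrow> eventually (\<lambda>j. f j \<le> ennreal r) F"
  shows "(f \<longlongrightarrow> 0) F"
proof (rule order_tendstoI)
  fix a :: ennreal assume "0 < a"
  then obtain r where r: "0 < r" "ennreal r < a"
  proof (cases a)
    case (real x)
    then show thesis using \<open>0 < a\<close> that[of "x / 2"] by (auto simp: ennreal_less_iff)
  next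
    case top
    then show thesis using that[of 1] by simp
  qed
  show "eventually (\<lambda>j. f j < a) F"
    using assms[OF r(1)] by eventually_elim (use r in \<open>auto intro: le_less_trans\<close>)
qed simp

lemma ennreal_tendsto_0D:
  fixes f :: "'i \<Rightarrow> ennreal"
  assumes "(f \<longlongrightarrow> 0) F" "0 < r"
  shows "eventually (\<lambda>j. f j \<le> ennreal r) F"
  using order_tendstoD(2)[OF assms(1), of "ennreal r"] assms(2) by (auto elim: eventually_mono)

lemma first_moment_tendsto:
  fixes f :: "nat \<Rightarrow> 'w \<Rightarrow> real"
  assumes P: "prob_space M" and m: "\<And>j. f j \<in> borel_measurable M" and nn: "\<And>j \<omega>. 0 \<le> f j \<omega>"
    and l: "(\<lambda>j. \<integral>\<^sup>+\<omega>. ennreal ((f j \<omega>)\<^sup>2) \<partial>M) \<longlonglongrightarrow> 0"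
  shows "(\<lambda>j. \<integral>\<^sup>+\<omega>. ennreal (f j \<omega>) \<partial>M) \<longlonglongrightarrow> 0"
proof (rule ennreal_tendsto_0I)
  interpret prob_space M by (rule P)
  fix r :: real assume r: "0 < r"
  note [measurable] = m
  have "eventually (\<lambda>j. (\<integral>\<^sup>+\<omega>. ennreal ((f j \<omega>)\<^sup>2) \<partial>M) \<le> ennreal ((r / 2)\<^sup>2)) sequentially"
    by (rule ennreal_tendsto_0D[OF l]) (use r in simp)
  then show "eventually (\<lambda>j. (\<integral>\<^sup>+\<omega>. ennreal (f j \<omega>) \<partial>M) \<le> ennreal r) sequentially"
  proof eventually_elim
    fix j assume j: "(\<integral>\<^sup>+\<omega>. ennreal ((f j \<omega>)\<^sup>2) \<partial>M) \<le> ennreal ((r / 2)\<^sup>2)"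
    have pt: "f j \<omega> \<le> r / 2 + (2 / r) * (f j \<omega>)\<^sup>2" for \<omega>
    proof (cases "f j \<omega> \<le> r / 2")
      case False
      then have "1 * f j \<omega> \<le> (2 / r * f j \<omega>) * f j \<omega>" using r nn by (intro mult_right_mono) (auto simp: field_simps)
      then show ?thesis using r by (simp add: power2_eq_square)
    qed (use r in \<open>auto intro: add_increasing2\<close>)
    have "(\<integral>\<^sup>+\<omega>. ennreal (f j \<omega>) \<partial>M) \<le> (\<integral>\<^sup>+\<omega>. ennreal (r / 2) + ennreal (2 / r) * ennreal ((f j \<omega>)\<^sup>2) \<partial>M)"
    proof (rule nn_integral_mono)
      fix \<omega>
      have "ennreal (f j \<omega>) \<le> ennreal (r / 2 + (2 / r) * (f j \<omega>)\<^sup>2)" by (rule ennreal_leI[OF pt])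
      also have "\<dots> = ennreal (r / 2) + ennreal (2 / r) * ennreal ((f j \<omega>)\<^sup>2)"
        using r nn by (subst ennreal_plus) (auto simp: ennreal_mult[symmetric])
      finally show "ennreal (f j \<omega>) \<le> \<dots>" .
    qed
    also have "\<dots> = ennreal (r / 2) + ennreal (2 / r) * (\<integral>\<^sup>+\<omega>. ennreal ((f j \<omega>)\<^sup>2) \<partial>M)"
      by (simp add: nn_integral_add nn_integral_cmult emeasure_space_1)
    also have "\<dots> \<le> ennreal (r / 2) + ennreal (2 / r) * ennreal ((r / 2)\<^sup>2)"
      by (intro add_left_mono mult_left_mono j) auto
    also have "\<dots> = ennreal r"
      using r by (subst ennreal_mult[symmetric]) (auto simp: power2_eq_square ennreal_plus[symmetric] simp del: ennreal_plus)
    finally show "(\<integral>\<^sup>+\<omega>. ennreal (f j \<omega>) \<partial>M) \<le> ennreal r" .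
  qed
qed

lemma norm_cis_diff_le: "norm (cis x - cis y) \<le> \<bar>x - y\<bar>"
proof -
  have "norm (cis x - cis y) = norm (cis y * (cis (x - y) - 1))" by (simp add: right_diff_distrib cis_mult)
  also have "\<dots> = norm (iexp (x - y) - 1)" by (simp add: norm_mult cis_conv_exp)
  also have "\<dots> \<le> \<bar>x - y\<bar>" using iexp_approx1[of "x - y" 0] by simp
  finally show ?thesis .
qed

lemma norm_cis_minus_one_square: "(norm (cis x - 1))\<^sup>2 = 2 - 2 * cos x"
proof -
  have "(norm (cis x - 1))\<^sup>2 = (cos x - 1)\<^sup>2 + (sin x)\<^sup>2" by (simp add: cmod_power2)
  also have "\<dots> = 2 - 2 * cos x" using sin_cos_squared_add[of x] by (simp add: power2_diff)
  finally show ?thesis .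
qed

lemma prob_norm_expectation_diff:
  fixes f g :: "'w \<Rightarrow> complex"
  assumes P: "prob_space M" and m: "f \<in> borel_measurable M" "g \<in> borel_measurable M" 
    and b: "\<And>\<omega>. norm (f \<omega>) \<le> 1" "\<And>\<omega>. norm (g \<omega>) \<le> 1" and h: "AE \<omega> in M. norm (f \<omega> - g \<omega>) \<le> h \<omega>"
  shows "ennreal (norm ((\<integral>\<omega>. f \<omega> \<partial>M) - (\<integral>\<omega>. g \<omega> \<partial>M))) \<le> (\<integral>\<^sup>+\<omega>. ennreal (h \<omega>) \<partial>M)"
proof -
  interpret prob_space M by (rule P)
  have i: "integrable M f" "integrable M g"
    by (rule integrable_const_bound[of _ 1], use m b in auto)+
  have "ennreal (norm ((\<integral>\<omega>. f \<omega> \<partial>M) - (\<integral>\<omega>. g \<omega> \<partial>M))) = ennreal (norm (\<integral>\<omega>. f \<omega> - g \<omega> \<partial>M))"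
    using i by simp
  also have "\<dots> \<le> (\<integral>\<^sup>+\<omega>. ennreal (norm (f \<omega> - g \<omega>)) \<partial>M)"
    by (rule integral_norm_bound_ennreal) (use i in simp)
  also have "\<dots> \<le> (\<integral>\<^sup>+\<omega>. ennreal (h \<omega>) \<partial>M)"
    by (rule nn_integral_mono_AE) (use h in \<open>auto elim: eventually_mono intro: ennreal_leI\<close>)
  finally show ?thesis .
qed

lemma simple_ito_measurable:
  assumes W: "wiener_process M F m W" and k: "k < m" and S: "is_simple_proc F S" and t: "0 \<le> t"
  shows "simple_ito (W k) S t \<in> borel_measurable M"
proof -
  obtain l s \<xi> where Se: "S = (l, s, \<xi>)" by (cases S) auto
  have fil: "filtration_on M F" and Wm: "\<And>r. 0 \<le> r \<Longrightarrow> W k r \<in> borel_measurable (F r)"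
    using W k by (auto simp: wiener_process_def)
  have WM: "W k r \<in> borel_measurable M" if "0 \<le> r" for r
    using filtration_measurable_M[OF fil that Wm[OF that]] .
  have s: "0 \<le> s j" for j using S monoD[of s 0 j] by (auto simp: is_simple_proc_def Se intro: order_trans)
  have \<xi>: "\<xi> j \<in> borel_measurable M" if "j < l" for j
    using S that filtration_measurable_M[OF fil s, of "\<xi> j" j] by (auto simp: is_simple_proc_def Se)
  show ?thesis
    unfolding simple_ito_def Se prod.case
    by (intro borel_measurable_sum borel_measurable_scaleR borel_measurable_diff WM \<xi>) (use s t in auto)
qed

lemma simple_val_measurable_pair:
  assumes fil: "filtration_on M F" and S: "is_simple_proc F S"
  shows "(\<lambda>(\<omega>, s). simple_val S s \<omega>) \<in> borel_measurable (M \<Otimes>\<^sub>M borel)"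
proof -
  obtain l s \<xi> where Se: "S = (l, s, \<xi>)" by (cases S) auto
  have s: "0 \<le> s j" for j using S monoD[of s 0 j] by (auto simp: is_simple_proc_def Se intro: order_trans)
  have \<xi>: "\<xi> j \<in> borel_measurable M" if "j < l" for j
    using S that filtration_measurable_M[OF fil s, of "\<xi> j" j] by (auto simp: is_simple_proc_def Se)
  have "(\<lambda>x. \<Sum>j<l. indicat_real {s j<..s (Suc j)} (snd x) *\<^sub>R \<xi> j (fst x)) \<in> borel_measurable (M \<Otimes>\<^sub>M borel)"
    by (intro borel_measurable_sum borel_measurable_scaleR measurable_compose[OF measurable_fst \<xi>]) auto
  then show ?thesis by (simp add: simple_val_def Se split_beta')
qed

lemma progressive_clamp_measurable:
  assumes fil: "filtration_on M F" and H: "progressively_measurable F b H" and b: "0 \<le> b"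
  shows "(\<lambda>(\<omega>, s). H (max 0 (min s b)) \<omega>) \<in> borel_measurable (M \<Otimes>\<^sub>M borel)"
proof -
  have "(\<lambda>(r, \<omega>). H r \<omega>) \<in> borel_measurable (restrict_space borel {0..b} \<Otimes>\<^sub>M F b)"
    using H b by (auto simp: progressively_measurable_def)
  moreover have "(\<lambda>x. (max 0 (min (snd x) b), fst x)) \<in> measurable (M \<Otimes>\<^sub>M borel) (restrict_space borel {0..b} \<Otimes>\<^sub>M F b)"
  proof (rule measurable_Pair)
    show "(\<lambda>x. max 0 (min (snd x) b)) \<in> measurable (M \<Otimes>\<^sub>M borel) (restrict_space borel {0..b})"
      by (rule measurable_restrict_space2) (use b in auto)
    have "(\<lambda>\<omega>. \<omega>) \<in> measurable M (F b)"
      using filtration_measurable_M[OF fil b, of "\<lambda>\<omega>. \<omega>" "F b"] by simp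
    then show "fst \<in> measurable (M \<Otimes>\<^sub>M borel) (F b)" by (rule measurable_compose[OF measurable_fst])
  qed
  ultimately have "(\<lambda>x. case (max 0 (min (snd x) b), fst x) of (r, \<omega>) \<Rightarrow> H r \<omega>) \<in> borel_measurable (M \<Otimes>\<^sub>M borel)"
    by (rule measurable_compose[rotated])
  then show ?thesis by (simp add: split_beta')
qed

section \<open>Increments of Ito integrals\<close>

lemma diff_squares_bound:
  fixes x y \<eta> :: real
  assumes "0 < \<eta>"
  shows "\<bar>x\<^sup>2 - y\<^sup>2\<bar> \<le> (1 + 1 / \<eta>) * (x - y)\<^sup>2 + \<eta> * y\<^sup>2"
proof -
  have e: "x\<^sup>2 - y\<^sup>2 = (x - y)\<^sup>2 + 2 * (y * (x - y))" by (simp add: power2_eq_square algebra_simps)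
  have "0 \<le> (\<bar>x - y\<bar> / sqrt \<eta> - sqrt \<eta> * \<bar>y\<bar>)\<^sup>2" by simp
  also have "\<dots> = (x - y)\<^sup>2 / \<eta> + \<eta> * y\<^sup>2 - 2 * (\<bar>y\<bar> * \<bar>x - y\<bar>)"
    using assms by (simp add: power2_diff power_mult_distrib power_divide)
  finally have "2 * \<bar>y * (x - y)\<bar> \<le> (x - y)\<^sup>2 / \<eta> + \<eta> * y\<^sup>2" by (simp add: abs_mult)
  then have "\<bar>x\<^sup>2 - y\<^sup>2\<bar> \<le> (x - y)\<^sup>2 + ((x - y)\<^sup>2 / \<eta> + \<eta> * y\<^sup>2)"
    unfolding e by (intro order_trans[OF abs_triangle_ineq]) (simp add: abs_mult)
  then show ?thesis by (simp add: distrib_right)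
qed

lemma inner_square_le: "(v \<bullet> w)\<^sup>2 \<le> (norm v)\<^sup>2 * (norm w)\<^sup>2" for v w :: "'b::real_inner"
  using Cauchy_Schwarz_ineq[of v w] by (simp add: dot_square_norm)

lemma two_norm_squares: "(norm (x + y))\<^sup>2 \<le> 2 * (norm x)\<^sup>2 + 2 * (norm y)\<^sup>2" for x y :: "'b::real_inner"
proof -
  have "0 \<le> (norm (x - y))\<^sup>2" by simp
  then show ?thesis
    by (simp add: dot_square_norm[symmetric] inner_add_left inner_add_right inner_diff_left inner_diff_right inner_commute[of y x])
qed

text \<open>The increment over \<open>{a..b}\<close> of a vector Ito integral, whose values at the two times are given by
  separate approximations \<open>Sa\<close> and \<open>Sb\<close>, so that the difference of the integrals is not by itself the
  limit of integrals over \<open>{a..b}\<close>. The function \<open>q\<close> is the conditional variance rate in the direction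
  \<open>lam\<close>; it is known at the time \<open>a\<close>, which is what the Euler scheme provides.\<close>

locale ito_increment =
  fixes M :: "'w measure" and F m W and a b :: real and G :: "nat \<Rightarrow> real \<Rightarrow> 'w \<Rightarrow> 'b::euclidean_space"
    and Za Zb :: "nat \<Rightarrow> 'w \<Rightarrow> 'b" and lam :: 'b and Sa Sb :: "nat \<Rightarrow> nat \<Rightarrow> ('w, 'b) simple_proc"
    and q :: "real \<Rightarrow> 'w \<Rightarrow> real" and C :: real and Z :: "'w \<Rightarrow> complex"
  assumes W: "wiener_process M F m W" and ab: "0 \<le> a" "a < b"
    and prog: "\<And>k. k < m \<Longrightarrow> progressively_measurable F b (G k)"
    and Zm: "\<And>k. k < m \<Longrightarrow> Za k \<in> borel_measurable M" "\<And>k. k < m \<Longrightarrow> Zb k \<in> borel_measurable M"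
    and Ss: "\<And>k j. k < m \<Longrightarrow> is_simple_proc F (Sa k j)" "\<And>k j. k < m \<Longrightarrow> is_simple_proc F (Sb k j)"
    and lim: "\<And>k. k < m \<Longrightarrow> (\<lambda>j. \<integral>\<^sup>+ \<omega>. (\<integral>\<^sup>+ r\<in>{0..a}. ennreal ((norm (simple_val (Sa k j) r \<omega> - G k r \<omega>))\<^sup>2) \<partial>lborel) \<partial>M) \<longlonglongrightarrow> 0"
      "\<And>k. k < m \<Longrightarrow> (\<lambda>j. \<integral>\<^sup>+ \<omega>. (\<integral>\<^sup>+ r\<in>{0..b}. ennreal ((norm (simple_val (Sb k j) r \<omega> - G k r \<omega>))\<^sup>2) \<partial>lborel) \<partial>M) \<longlonglongrightarrow> 0"
      "\<And>k. k < m \<Longrightarrow> (\<lambda>j. \<integral>\<^sup>+ \<omega>. ennreal ((norm (simple_ito (W k) (Sa k j) a \<omega> - Za k \<omega>))\<^sup>2) \<partial>M) \<longlonglongrightarrow> 0"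
      "\<And>k. k < m \<Longrightarrow> (\<lambda>j. \<integral>\<^sup>+ \<omega>. ennreal ((norm (simple_ito (W k) (Sb k j) b \<omega> - Zb k \<omega>))\<^sup>2) \<partial>M) \<longlonglongrightarrow> 0"
    and q: "(\<lambda>(\<omega>, s). q s \<omega>) \<in> borel_measurable (F a \<Otimes>\<^sub>M borel)" "\<And>s \<omega>. 0 \<le> q s \<omega>" "\<And>s \<omega>. q s \<omega> \<le> C"
    and qG: "\<And>s \<omega>. a < s \<Longrightarrow> s < b \<Longrightarrow> q s \<omega> = (\<Sum>k<m. (lam \<bullet> G k s \<omega>)\<^sup>2)"
    and Z: "Z \<in> borel_measurable (F a)" "\<And>\<omega>. norm (Z \<omega>) \<le> 1"
begin

lemma fil: "filtration_on M F" and P: "prob_space M"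
  using W by (auto simp: wiener_process_def)

sublocale prob_space M by (rule P)

lemma itoM: "k < m \<Longrightarrow> 0 \<le> t \<Longrightarrow> simple_ito (W k) (Sa k j) t \<in> borel_measurable M"
  "k < m \<Longrightarrow> 0 \<le> t \<Longrightarrow> simple_ito (W k) (Sb k j) t \<in> borel_measurable M"
  by (rule simple_ito_measurable[OF W _ Ss(1)], assumption+) (rule simple_ito_measurable[OF W _ Ss(2)], assumption+)

text \<open>\<open>R\<close> is the mismatch of the two approximations at the time \<open>a\<close>; \<open>D\<close> is the integral over \<open>{a..b}\<close>.\<close>

definition "R j \<omega> = (\<Sum>k<m. lam \<bullet> (simple_ito (W k) (Sb k j) a \<omega> - simple_ito (W k) (Sa k j) a \<omega>))"
definition "D j \<omega> = (\<Sum>k<m. lam \<bullet> (simple_ito (W k) (Sb k j) b \<omega> - simple_ito (W k) (Sb k j) a \<omega>))"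

lemma Rm [measurable]: "R j \<in> borel_measurable M"
  unfolding R_def by (intro borel_measurable_sum borel_measurable_inner borel_measurable_diff borel_measurable_const itoM) (use ab in auto)

lemma Dm [measurable]: "D j \<in> borel_measurable M"
  unfolding D_def by (intro borel_measurable_sum borel_measurable_inner borel_measurable_diff borel_measurable_const itoM) (use ab in auto)

lemma ZM [measurable]: "Z \<in> borel_measurable M"
  using filtration_measurable_M[OF fil ab(1) Z(1)] .

text \<open>The clamped time makes \<open>G\<close> jointly measurable on the whole line, as progressive measurability
  refers to \<open>{0..b}\<close> only.\<close>

definition "ea k j \<omega> s = ennreal ((norm (simple_val (Sa k j) s \<omega> - G k (max 0 (min s b)) \<omega>))\<^sup>2)"
definition "eb k j \<omega> s = ennreal ((norm (simple_val (Sb k j) s \<omega> - G k (max 0 (min s b)) \<omega>))\<^sup>2)"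

lemma eM: "k < m \<Longrightarrow> (\<lambda>(\<omega>, s). ea k j \<omega> s) \<in> borel_measurable (M \<Otimes>\<^sub>M lborel)"
  "k < m \<Longrightarrow> (\<lambda>(\<omega>, s). eb k j \<omega> s) \<in> borel_measurable (M \<Otimes>\<^sub>M lborel)"
proof -
  assume k: "k < m"
  have c: "borel_measurable (M \<Otimes>\<^sub>M lborel) = borel_measurable (M \<Otimes>\<^sub>M borel)"
    by (intro measurable_cong_sets sets_pair_measure_cong) auto
  have b: "0 \<le> b" using ab by simp
  note [measurable] = simple_val_measurable_pair[OF fil Ss(1)[OF k], of j] simple_val_measurable_pair[OF fil Ss(2)[OF k], of j]
    progressive_clamp_measurable[OF fil prog[OF k] b]
  show "(\<lambda>(\<omega>, s). ea k j \<omega> s) \<in> borel_measurable (M \<Otimes>\<^sub>M lborel)" unfolding ea_def c by measurable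
  show "(\<lambda>(\<omega>, s). eb k j \<omega> s) \<in> borel_measurable (M \<Otimes>\<^sub>M lborel)" unfolding eb_def c by measurable
qed

abbreviation "mean_ea k j \<equiv> \<integral>\<^sup>+ \<omega>. (\<integral>\<^sup>+ s\<in>{0<..a}. ea k j \<omega> s \<partial>lborel) \<partial>M"
abbreviation "mean_eb k j \<equiv> \<integral>\<^sup>+ \<omega>. (\<integral>\<^sup>+ s\<in>{0<..b}. eb k j \<omega> s \<partial>lborel) \<partial>M"
abbreviation "target \<equiv> \<integral>\<omega>. Z \<omega> * complex_of_real (exp (- (LINT s:{a<..b}|lborel. q s \<omega>) / 2)) \<partial>M"

lemma lim_ea: "k < m \<Longrightarrow> (\<lambda>j. \<integral>\<^sup>+ \<omega>. (\<integral>\<^sup>+ s\<in>{0<..a}. ea k j \<omega> s \<partial>lborel) \<partial>M) \<longlonglongrightarrow> 0"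
proof (rule tendsto_sandwich[OF _ _ tendsto_const lim(1)])
  show "\<forall>\<^sub>F j in sequentially. mean_ea k j
      \<le> (\<integral>\<^sup>+ \<omega>. (\<integral>\<^sup>+ r\<in>{0..a}. ennreal ((norm (simple_val (Sa k j) r \<omega> - G k r \<omega>))\<^sup>2) \<partial>lborel) \<partial>M)"
    using ab by (intro always_eventually allI nn_integral_mono) (auto simp: ea_def indicator_def)
qed auto

lemma lim_eb: "k < m \<Longrightarrow> (\<lambda>j. \<integral>\<^sup>+ \<omega>. (\<integral>\<^sup>+ s\<in>{0<..b}. eb k j \<omega> s \<partial>lborel) \<partial>M) \<longlonglongrightarrow> 0"
proof (rule tendsto_sandwich[OF _ _ tendsto_const lim(2)])
  show "\<forall>\<^sub>F j in sequentially. mean_eb k j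
      \<le> (\<integral>\<^sup>+ \<omega>. (\<integral>\<^sup>+ r\<in>{0..b}. ennreal ((norm (simple_val (Sb k j) r \<omega> - G k r \<omega>))\<^sup>2) \<partial>lborel) \<partial>M)"
    using ab by (intro always_eventually allI nn_integral_mono) (auto simp: eb_def indicator_def)
qed auto

lemma double_nn_integral_sum:
  assumes "\<And>k. k < m \<Longrightarrow> (\<lambda>(\<omega>, s). f k \<omega> s) \<in> borel_measurable (M \<Otimes>\<^sub>M lborel)"
  shows "(\<integral>\<^sup>+\<omega>. (\<integral>\<^sup>+s\<in>{c<..d::real}. (\<Sum>k<m. f k \<omega> s) \<partial>lborel) \<partial>M) = (\<Sum>k<m. \<integral>\<^sup>+\<omega>. (\<integral>\<^sup>+s\<in>{c<..d}. f k \<omega> s \<partial>lborel) \<partial>M)"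
proof -
  have 1: "(\<integral>\<^sup>+s\<in>{c<..d}. (\<Sum>k<m. f k \<omega> s) \<partial>lborel) = (\<Sum>k<m. \<integral>\<^sup>+s\<in>{c<..d}. f k \<omega> s \<partial>lborel)" if "\<omega> \<in> space M" for \<omega>
  proof -
    have [measurable]: "f k \<omega> \<in> borel_measurable lborel" if "k < m" for k
      using measurable_compose[OF measurable_Pair1'[OF \<open>\<omega> \<in> space M\<close>] assms[OF that]] by simp
    show ?thesis
      unfolding sum_distrib_right by (subst nn_integral_sum) auto
  qed
  have "(\<integral>\<^sup>+\<omega>. (\<integral>\<^sup>+s\<in>{c<..d}. (\<Sum>k<m. f k \<omega> s) \<partial>lborel) \<partial>M) = (\<integral>\<^sup>+\<omega>. (\<Sum>k<m. \<integral>\<^sup>+s\<in>{c<..d}. f k \<omega> s \<partial>lborel) \<partial>M)"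
    by (intro nn_integral_cong 1)
  also have "\<dots> = (\<Sum>k<m. \<integral>\<^sup>+\<omega>. (\<integral>\<^sup>+s\<in>{c<..d}. f k \<omega> s \<partial>lborel) \<partial>M)"
  proof (rule nn_integral_sum)
    fix k assume "k \<in> {..<m}"
    then have [measurable]: "(\<lambda>(\<omega>, s). f k \<omega> s) \<in> borel_measurable (M \<Otimes>\<^sub>M lborel)" using assms by auto
    show "(\<lambda>\<omega>. \<integral>\<^sup>+s\<in>{c<..d}. f k \<omega> s \<partial>lborel) \<in> borel_measurable M" by measurable
  qed
  finally show ?thesis .
qed

text \<open>On \<open>{0..a}\<close> both families approximate the same integrand, so the bound for simple processes with
  the variance 0 shows that the mismatch is negligible in the limit.\<close>

lemma lim_R: "(\<lambda>j. ennreal (norm ((\<integral>\<omega>. cis (R j \<omega>) \<partial>M) - 1))) \<longlonglongrightarrow> 0"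
proof -
  define e where "e j = ennreal (2 * (norm lam)\<^sup>2) * (\<Sum>k<m. mean_eb k j
      + mean_ea k j)" for j
  have "e \<longlonglongrightarrow> ennreal (2 * (norm lam)\<^sup>2) * (\<Sum>k<m. 0 + 0)"
    unfolding e_def by (intro ennreal_tendsto_cmult tendsto_sum tendsto_add lim_ea lim_eb) auto
  then have e0: "e \<longlonglongrightarrow> 0" by simp
  have "ennreal (norm ((\<integral>\<omega>. cis (R j \<omega>) \<partial>M) - 1)) \<le> e j" for j
  proof -
    (* Both approximations form one family, with the sign of each member in la. *)
    define E where "E = {..<m} \<times> (UNIV :: bool set)"
    define S where "S p = (if snd p then Sb (fst p) j else Sa (fst p) j)" for p :: "nat \<times> bool"
    define la where "la p = (if snd p then lam else - lam)" for p :: "nat \<times> bool"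
    let ?xi = "\<lambda>k s \<omega>. \<Sum>p\<in>{p\<in>E. fst p = k}. la p \<bullet> simple_val (S p) s \<omega>"
    let ?I = "\<lambda>\<omega>. \<Sum>p\<in>E. la p \<bullet> (simple_ito (W (fst p)) (S p) a \<omega> - simple_ito (W (fst p)) (S p) 0 \<omega>)"
    let ?c = "ennreal (2 * (norm lam)\<^sup>2)"
    have E: "finite E" by (simp add: E_def)
    have ito0: "simple_ito (W k) (S (k, c)) 0 \<omega> = 0" if "k < m" for k c \<omega>
    proof -
      obtain l s \<xi> where Se: "S (k, c) = (l, s, \<xi>)" by (cases "S (k, c)") auto
      have "is_simple_proc F (S (k, c))" using Ss that by (simp add: S_def)
      then have "0 \<le> s i" for i using monoD[of s 0 i] by (auto simp: is_simple_proc_def Se intro: order_trans)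
      then show ?thesis by (simp add: simple_ito_def Se min_absorb2)
    qed
    have I: "(?I \<omega>) = R j \<omega>" for \<omega>
    proof -
      have "(?I \<omega>)
        = (\<Sum>k<m. \<Sum>c\<in>UNIV. la (k, c) \<bullet> (simple_ito (W k) (S (k, c)) a \<omega> - simple_ito (W k) (S (k, c)) 0 \<omega>))"
        unfolding E_def by (simp add: sum.cartesian_product split_beta')
      also have "\<dots> = R j \<omega>"
        unfolding R_def
      proof (intro sum.cong refl)
        fix k assume "k \<in> {..<m}"
        then show "(\<Sum>c\<in>UNIV. la (k, c) \<bullet> (simple_ito (W k) (S (k, c)) a \<omega> - simple_ito (W k) (S (k, c)) 0 \<omega>))
          = lam \<bullet> (simple_ito (W k) (Sb k j) a \<omega> - simple_ito (W k) (Sa k j) a \<omega>)"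
          using ito0 by (simp add: UNIV_bool la_def S_def inner_diff_right)
      qed
      finally show ?thesis .
    qed
    have x: "(?xi k s \<omega>) = lam \<bullet> (simple_val (Sb k j) s \<omega> - simple_val (Sa k j) s \<omega>)"
      if "k < m" for k s \<omega>
    proof -
      have "{p\<in>E. fst p = k} = {(k, True), (k, False)}" using that by (auto simp: E_def)
      then show ?thesis by (simp add: la_def S_def inner_diff_right)
    qed
    have "ennreal (norm ((\<integral>\<omega>. 1 * cis (?I \<omega>) \<partial>M)
       - (\<integral>\<omega>. 1 * complex_of_real (exp (- (LINT s:{0<..a}|lborel. 0) / 2)) \<partial>M)))
      \<le> (\<integral>\<^sup>+\<omega>. (\<integral>\<^sup>+s\<in>{0<..a}. ennreal \<bar>(\<Sum>k<m. (?xi k s \<omega>)\<^sup>2) - 0\<bar> \<partial>lborel) \<partial>M)"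
      by (rule fourier_simple_processes[OF W order_refl ab(1) E, where C=1])
         (use Ss in \<open>auto simp: S_def E_def\<close>)
    then have "ennreal (norm ((\<integral>\<omega>. cis (R j \<omega>) \<partial>M) - 1))
      \<le> (\<integral>\<^sup>+\<omega>. (\<integral>\<^sup>+s\<in>{0<..a}. ennreal \<bar>(\<Sum>k<m. (?xi k s \<omega>)\<^sup>2) - 0\<bar> \<partial>lborel) \<partial>M)"
      unfolding I by (simp add: prob_space)
    also have "\<dots> \<le> (\<integral>\<^sup>+\<omega>. (\<integral>\<^sup>+s\<in>{0<..a}. (\<Sum>k<m. ?c * (eb k j \<omega> s + ea k j \<omega> s)) \<partial>lborel) \<partial>M)"
    proof (intro nn_integral_mono mult_right_mono)
      fix \<omega> s
      have "ennreal \<bar>(\<Sum>k<m. (?xi k s \<omega>)\<^sup>2) - 0\<bar>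
        = (\<Sum>k<m. ennreal ((?xi k s \<omega>)\<^sup>2))"
        by (subst sum_ennreal) (auto simp: sum_nonneg)
      also have "\<dots> \<le> (\<Sum>k<m. ?c * (eb k j \<omega> s + ea k j \<omega> s))"
      proof (rule sum_mono)
        fix k assume k: "k \<in> {..<m}"
        let ?g = "G k (max 0 (min s b)) \<omega>" and ?x = "simple_val (Sb k j) s \<omega>" and ?y = "simple_val (Sa k j) s \<omega>"
        have "(lam \<bullet> (?x - ?y))\<^sup>2 \<le> (norm lam)\<^sup>2 * (norm (?x - ?y))\<^sup>2" by (rule inner_square_le)
        also have "\<dots> \<le> (norm lam)\<^sup>2 * (2 * (norm (?x - ?g))\<^sup>2 + 2 * (norm (?y - ?g))\<^sup>2)"
          using two_norm_squares[of "?x - ?g" "?g - ?y"] by (intro mult_left_mono) (auto simp: norm_minus_commute)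
        finally have "(lam \<bullet> (?x - ?y))\<^sup>2 \<le> 2 * (norm lam)\<^sup>2 * ((norm (?x - ?g))\<^sup>2 + (norm (?y - ?g))\<^sup>2)"
          by (simp add: algebra_simps)
        then have "ennreal ((lam \<bullet> (?x - ?y))\<^sup>2) \<le> ennreal (2 * (norm lam)\<^sup>2 * ((norm (?x - ?g))\<^sup>2 + (norm (?y - ?g))\<^sup>2))"
          by (rule ennreal_leI)
        also have "\<dots> = ?c * (eb k j \<omega> s + ea k j \<omega> s)"
          by (simp add: eb_def ea_def ennreal_mult)
        finally show "ennreal ((?xi k s \<omega>)\<^sup>2)
           \<le> ?c * (eb k j \<omega> s + ea k j \<omega> s)"
          using k by (simp add: x)
      qed
      finally show "ennreal \<bar>(\<Sum>k<m. (?xi k s \<omega>)\<^sup>2) - 0\<bar> \<le> \<dots>" .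
    qed simp
    also have "\<dots> = (\<Sum>k<m. \<integral>\<^sup>+\<omega>. (\<integral>\<^sup>+s\<in>{0<..a}. ?c * (eb k j \<omega> s + ea k j \<omega> s) \<partial>lborel) \<partial>M)"
    proof (rule double_nn_integral_sum)
      fix k assume "k < m"
      note [measurable] = eM[OF this, of j]
      show "(\<lambda>(\<omega>, s). ?c * (eb k j \<omega> s + ea k j \<omega> s)) \<in> borel_measurable (M \<Otimes>\<^sub>M lborel)"
        by measurable
    qed
    also have "\<dots> \<le> e j"
      unfolding e_def sum_distrib_left
    proof (rule sum_mono)
      fix k assume "k \<in> {..<m}"
      then have k: "k < m" by simp
      note [measurable] = eM[OF k, of j]
      have "(\<integral>\<^sup>+\<omega>. (\<integral>\<^sup>+s\<in>{0<..a}. ?c * (eb k j \<omega> s + ea k j \<omega> s) \<partial>lborel) \<partial>M)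
         = (\<integral>\<^sup>+\<omega>. ?c * ((\<integral>\<^sup>+s\<in>{0<..a}. eb k j \<omega> s \<partial>lborel) + (\<integral>\<^sup>+s\<in>{0<..a}. ea k j \<omega> s \<partial>lborel)) \<partial>M)"
      proof (intro nn_integral_cong)
        fix \<omega> assume om: "\<omega> \<in> space M"
        have [measurable]: "ea k j \<omega> \<in> borel_measurable lborel" "eb k j \<omega> \<in> borel_measurable lborel"
          using measurable_compose[OF measurable_Pair1'[OF om] eM(1)[OF k, of j]]
            measurable_compose[OF measurable_Pair1'[OF om] eM(2)[OF k, of j]] by simp_all
        show "(\<integral>\<^sup>+s\<in>{0<..a}. ?c * (eb k j \<omega> s + ea k j \<omega> s) \<partial>lborel)
          = ?c * ((\<integral>\<^sup>+s\<in>{0<..a}. eb k j \<omega> s \<partial>lborel) + (\<integral>\<^sup>+s\<in>{0<..a}. ea k j \<omega> s \<partial>lborel))"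
          by (subst nn_integral_add[symmetric]) (auto simp: nn_integral_cmult[symmetric] distrib_right mult.assoc)
      qed
      also have "\<dots> = ?c * ((\<integral>\<^sup>+\<omega>. (\<integral>\<^sup>+s\<in>{0<..a}. eb k j \<omega> s \<partial>lborel) \<partial>M) + mean_ea k j)"
        by (subst nn_integral_add[symmetric]) (auto simp: nn_integral_cmult[symmetric])
      also have "\<dots> \<le> ?c * (mean_eb k j + mean_ea k j)"
        using ab by (intro mult_left_mono add_right_mono nn_integral_mono) (auto simp: indicator_def)
      finally show "(\<integral>\<^sup>+\<omega>. (\<integral>\<^sup>+s\<in>{0<..a}. ?c * (eb k j \<omega> s + ea k j \<omega> s) \<partial>lborel) \<partial>M) \<le> \<dots>" .
    qed
    finally show ?thesis .
  qed
  then show ?thesis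
    by (intro tendsto_sandwich[OF _ _ tendsto_const e0]) auto
qed

text \<open>The integrands of \<open>D j\<close> approximate \<open>G\<close> in mean square, so their conditional variances approach
  \<open>q\<close> in the mean.\<close>

lemma lim_D:
  "(\<lambda>j. ennreal (norm ((\<integral>\<omega>. Z \<omega> * cis (D j \<omega>) \<partial>M)
     - target))) \<longlonglongrightarrow> 0"
proof (rule ennreal_tendsto_0I)
  fix r :: real assume r: "0 < r"
  define C' where "C' = \<bar>C\<bar> + 1"
  have C': "0 < C'" "\<And>s \<omega>. q s \<omega> \<le> C'" using q(3) by (auto simp: C'_def intro: order_trans[OF q(3)])
  (* With this \<eta> the term \<eta> * q contributes at most r / 2 over {a<..b}. *)
  define \<eta> where "\<eta> = r / (2 * C' * (b - a))"
  have \<eta>: "0 < \<eta>" using r C' ab by (simp add: \<eta>_def)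
  define c where "c = (1 + 1 / \<eta>) * (norm lam)\<^sup>2"
  have c: "0 \<le> c" using \<eta> by (simp add: c_def)
  define e where "e j = ennreal c * (\<Sum>k<m. mean_eb k j)" for j
  have "e \<longlonglongrightarrow> ennreal c * (\<Sum>k<m. 0)"
    unfolding e_def by (intro ennreal_tendsto_cmult tendsto_sum lim_eb) auto
  then have e0: "e \<longlonglongrightarrow> 0" by simp
  have main: "ennreal (norm ((\<integral>\<omega>. Z \<omega> * cis (D j \<omega>) \<partial>M)
     - target)) \<le> e j + ennreal (r / 2)" for j
  proof -
    let ?x = "\<lambda>k s \<omega>. lam \<bullet> simple_val (Sb k j) s \<omega>"
    let ?S = "\<lambda>\<omega>. \<integral>\<^sup>+s\<in>{a<..b}. (\<Sum>k<m. ennreal c * eb k j \<omega> s) \<partial>lborel"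
    let ?d = "\<lambda>k s \<omega>. norm (simple_val (Sb k j) s \<omega> - G k s \<omega>)"
    have x: "(\<Sum>k' | k' < m \<and> k' = k. ?x k' s \<omega>) = ?x k s \<omega>" if "k < m" for k s \<omega>
    proof -
      have "{k'. k' < m \<and> k' = k} = {k}" using that by auto
      then show ?thesis by simp
    qed
    have "ennreal (norm ((\<integral>\<omega>. Z \<omega> * cis (\<Sum>k<m. lam \<bullet> (simple_ito (W k) (Sb k j) b \<omega> - simple_ito (W k) (Sb k j) a \<omega>)) \<partial>M)
       - target))
      \<le> (\<integral>\<^sup>+\<omega>. (\<integral>\<^sup>+s\<in>{a<..b}. ennreal \<bar>(\<Sum>k<m. (\<Sum>k'\<in>{k'\<in>{..<m}. k' = k}. ?x k' s \<omega>)\<^sup>2) - q s \<omega>\<bar> \<partial>lborel) \<partial>M)"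
      by (rule fourier_simple_processes[OF W ab(1) less_imp_le[OF ab(2)] finite_lessThan, where C=C and kk="\<lambda>k. k"])
         (use Ss q Z in auto)
    also have "\<dots> = (\<integral>\<^sup>+\<omega>. (\<integral>\<^sup>+s\<in>{a<..b}. ennreal \<bar>(\<Sum>k<m. (?x k s \<omega>)\<^sup>2) - q s \<omega>\<bar> \<partial>lborel) \<partial>M)"
      by (intro nn_integral_cong arg_cong2[where f="(*)"] arg_cong[where f=ennreal] arg_cong[where f=abs] arg_cong2[where f="(-)"] sum.cong refl)
         (simp only: lessThan_iff x)
    also have "\<dots> \<le> (\<integral>\<^sup>+\<omega>. (?S \<omega>) + ennreal (r / 2) \<partial>M)"
    proof (rule nn_integral_mono)
      fix \<omega> assume om: "\<omega> \<in> space M"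
      have [measurable]: "eb k j \<omega> \<in> borel_measurable lborel" if "k < m" for k
        using measurable_compose[OF measurable_Pair1'[OF om] eM(2)[OF that, of j]] by simp
      have "(\<integral>\<^sup>+s\<in>{a<..b}. ennreal \<bar>(\<Sum>k<m. (?x k s \<omega>)\<^sup>2) - q s \<omega>\<bar> \<partial>lborel)
         \<le> (\<integral>\<^sup>+s. (\<Sum>k<m. ennreal c * eb k j \<omega> s) * indicator {a<..b} s + ennreal (\<eta> * C') * indicator {a<..b} s \<partial>lborel)"
      proof (rule nn_integral_mono_AE)
        have "AE s in lborel. s \<noteq> b" by (rule AE_lborel_singleton)
        then show "AE s in lborel. ennreal \<bar>(\<Sum>k<m. (?x k s \<omega>)\<^sup>2) - q s \<omega>\<bar> * indicator {a<..b} s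
            \<le> (\<Sum>k<m. ennreal c * eb k j \<omega> s) * indicator {a<..b} s + ennreal (\<eta> * C') * indicator {a<..b} s"
        proof eventually_elim
          fix s assume "s \<noteq> b"
          show "ennreal \<bar>(\<Sum>k<m. (?x k s \<omega>)\<^sup>2) - q s \<omega>\<bar> * indicator {a<..b} s
            \<le> (\<Sum>k<m. ennreal c * eb k j \<omega> s) * indicator {a<..b} s + ennreal (\<eta> * C') * indicator {a<..b} s"
          proof (cases "s \<in> {a<..b}")
            case True
            then have s: "a < s" "s < b" using \<open>s \<noteq> b\<close> by auto
            have cl: "max 0 (min s b) = s" using s ab by auto
            let ?y = "\<lambda>k. lam \<bullet> G k s \<omega>"
            have "\<bar>(\<Sum>k<m. (?x k s \<omega>)\<^sup>2) - q s \<omega>\<bar> = \<bar>\<Sum>k<m. ((?x k s \<omega>)\<^sup>2 - (?y k)\<^sup>2)\<bar>"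
              by (simp add: qG[OF s] sum_subtractf)
            also have "\<dots> \<le> (\<Sum>k<m. \<bar>(?x k s \<omega>)\<^sup>2 - (?y k)\<^sup>2\<bar>)" by (rule sum_abs)
            also have "\<dots> \<le> (\<Sum>k<m. c * (?d k s \<omega>)\<^sup>2 + \<eta> * (?y k)\<^sup>2)"
            proof (rule sum_mono)
              fix k
              have "\<bar>(?x k s \<omega>)\<^sup>2 - (?y k)\<^sup>2\<bar> \<le> (1 + 1 / \<eta>) * (?x k s \<omega> - ?y k)\<^sup>2 + \<eta> * (?y k)\<^sup>2"
                by (rule diff_squares_bound[OF \<eta>])
              also have "\<dots> \<le> (1 + 1 / \<eta>) * ((norm lam)\<^sup>2 * (?d k s \<omega>)\<^sup>2) + \<eta> * (?y k)\<^sup>2"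
                unfolding inner_diff_right[symmetric]
                using \<eta> by (intro add_right_mono mult_left_mono inner_square_le) auto
              finally show "\<bar>(?x k s \<omega>)\<^sup>2 - (?y k)\<^sup>2\<bar> \<le> c * (?d k s \<omega>)\<^sup>2 + \<eta> * (?y k)\<^sup>2"
                using \<eta> by (simp add: c_def mult.assoc)
            qed
            also have "\<dots> = (\<Sum>k<m. c * (?d k s \<omega>)\<^sup>2) + \<eta> * q s \<omega>"
              by (simp add: qG[OF s] sum.distrib sum_distrib_left)
            also have "\<dots> \<le> (\<Sum>k<m. c * (?d k s \<omega>)\<^sup>2) + \<eta> * C'"
              using \<eta> C' by (intro add_left_mono mult_left_mono) auto
            finally have "ennreal \<bar>(\<Sum>k<m. (?x k s \<omega>)\<^sup>2) - q s \<omega>\<bar>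
               \<le> ennreal ((\<Sum>k<m. c * (?d k s \<omega>)\<^sup>2) + \<eta> * C')"
              by (rule ennreal_leI)
            also have "\<dots> = (\<Sum>k<m. ennreal c * eb k j \<omega> s) + ennreal (\<eta> * C')"
            proof -
              have "ennreal (\<Sum>k<m. c * (?d k s \<omega>)\<^sup>2) = (\<Sum>k<m. ennreal c * eb k j \<omega> s)"
                using c by (subst sum_ennreal[symmetric]) (auto simp: eb_def cl ennreal_mult)
              then show ?thesis using c \<eta> C' by (subst ennreal_plus) (auto intro!: sum_nonneg)
            qed
            finally show ?thesis using True by simp
          qed simp
        qed
      qed
      also have "\<dots> = (?S \<omega>) + ennreal (\<eta> * C') * emeasure lborel {a<..b}"
        by (subst nn_integral_add) (auto simp: nn_integral_cmult)
      also have "ennreal (\<eta> * C') * emeasure lborel {a<..b} = ennreal (r / 2)"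
      proof -
        have "emeasure lborel {a<..b} = ennreal (b - a)" using ab by simp
        moreover have "\<eta> * C' * (b - a) = r / 2"
        proof -
          have *: "x \<noteq> 0 \<Longrightarrow> d \<noteq> 0 \<Longrightarrow> r / (2 * x * d) * x * d = r / 2" for x d :: real by simp
          show ?thesis unfolding \<eta>_def by (rule *) (use C' ab in auto)
        qed
        moreover have "ennreal (\<eta> * C') * ennreal (b - a) = ennreal (\<eta> * C' * (b - a))"
          by (rule ennreal_mult[symmetric]) (use \<eta> C' ab in auto)
        ultimately show ?thesis by (simp only:)
      qed
      finally show "(\<integral>\<^sup>+s\<in>{a<..b}. ennreal \<bar>(\<Sum>k<m. (?x k s \<omega>)\<^sup>2) - q s \<omega>\<bar> \<partial>lborel)
        \<le> (?S \<omega>) + ennreal (r / 2)" .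
    qed
    also have "\<dots> = (\<integral>\<^sup>+\<omega>. (?S \<omega>) \<partial>M) + ennreal (r / 2)"
    proof (subst nn_integral_add)
      have [measurable]: "(\<lambda>(\<omega>, s). \<Sum>k<m. ennreal c * eb k j \<omega> s) \<in> borel_measurable (M \<Otimes>\<^sub>M lborel)"
        unfolding split_beta' using eM(2)[unfolded split_beta'] by (intro borel_measurable_sum borel_measurable_times) auto
      show "(\<lambda>\<omega>. ?S \<omega>) \<in> borel_measurable M" by measurable
    qed (auto simp: emeasure_space_1)
    also have "(\<integral>\<^sup>+\<omega>. (?S \<omega>) \<partial>M)
       = (\<Sum>k<m. \<integral>\<^sup>+\<omega>. (\<integral>\<^sup>+s\<in>{a<..b}. ennreal c * eb k j \<omega> s \<partial>lborel) \<partial>M)"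
    proof (rule double_nn_integral_sum)
      fix k assume "k < m"
      note [measurable] = eM(2)[OF this, of j]
      show "(\<lambda>(\<omega>, s). ennreal c * eb k j \<omega> s) \<in> borel_measurable (M \<Otimes>\<^sub>M lborel)" by measurable
    qed
    also have "\<dots> \<le> e j"
      unfolding e_def sum_distrib_left
    proof (rule sum_mono)
      fix k assume "k \<in> {..<m}"
      then have k: "k < m" by simp
      note [measurable] = eM(2)[OF k, of j]
      have "(\<integral>\<^sup>+\<omega>. (\<integral>\<^sup>+s\<in>{a<..b}. ennreal c * eb k j \<omega> s \<partial>lborel) \<partial>M)
         \<le> (\<integral>\<^sup>+\<omega>. (\<integral>\<^sup>+s. ennreal c * (eb k j \<omega> s * indicator {0<..b} s) \<partial>lborel) \<partial>M)"
        using ab by (intro nn_integral_mono) (auto simp: indicator_def)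
      also have "\<dots> = (\<integral>\<^sup>+\<omega>. ennreal c * (\<integral>\<^sup>+s\<in>{0<..b}. eb k j \<omega> s \<partial>lborel) \<partial>M)"
      proof (intro nn_integral_cong nn_integral_cmult)
        fix \<omega> assume om: "\<omega> \<in> space M"
        have [measurable]: "eb k j \<omega> \<in> borel_measurable lborel"
          using measurable_compose[OF measurable_Pair1'[OF om] eM(2)[OF k, of j]] by simp
        show "(\<lambda>s. eb k j \<omega> s * indicator {0<..b} s) \<in> borel_measurable lborel" by measurable
      qed
      also have "\<dots> = ennreal c * mean_eb k j"
        by (rule nn_integral_cmult) measurable
      finally show "(\<integral>\<^sup>+\<omega>. (\<integral>\<^sup>+s\<in>{a<..b}. ennreal c * eb k j \<omega> s \<partial>lborel) \<partial>M)
        \<le> ennreal c * mean_eb k j" .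
    qed
    finally show ?thesis by (simp add: D_def)
  qed
  have "eventually (\<lambda>j. e j \<le> ennreal (r / 2)) sequentially"
    by (rule ennreal_tendsto_0D[OF e0]) (use r in simp)
  then show "eventually (\<lambda>j. ennreal (norm ((\<integral>\<omega>. Z \<omega> * cis (D j \<omega>) \<partial>M)
     - target)) \<le> ennreal r) sequentially"
  proof eventually_elim
    fix j assume "e j \<le> ennreal (r / 2)"
    then have "e j + ennreal (r / 2) \<le> ennreal (r / 2) + ennreal (r / 2)" by (rule add_right_mono)
    also have "\<dots> = ennreal r" using r by (simp flip: ennreal_plus)
    finally show "ennreal (norm ((\<integral>\<omega>. Z \<omega> * cis (D j \<omega>) \<partial>M)
     - target)) \<le> ennreal r"
      using main[of j] by (rule order_trans[rotated])
  qed
qed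

definition "Y \<omega> = (\<Sum>k<m. lam \<bullet> (Zb k \<omega> - Za k \<omega>))"

lemma Ym [measurable]: "Y \<in> borel_measurable M"
  unfolding Y_def using Zm by (intro borel_measurable_sum borel_measurable_inner borel_measurable_diff) auto

lemma Zcis_norm: "norm (Z \<omega> * cis x) \<le> 1"
  using Z(2) by (simp add: norm_mult)

lemma lim_Y:
  "(\<lambda>j. ennreal (norm ((\<integral>\<omega>. Z \<omega> * cis (Y \<omega>) \<partial>M) - (\<integral>\<omega>. Z \<omega> * cis (D j \<omega> + R j \<omega>) \<partial>M)))) \<longlonglongrightarrow> 0"
proof -
  define fa fb where "fa k j \<omega> = norm (simple_ito (W k) (Sa k j) a \<omega> - Za k \<omega>)"
    and "fb k j \<omega> = norm (simple_ito (W k) (Sb k j) b \<omega> - Zb k \<omega>)" for k j \<omega>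
  have fm[measurable]: "fa k j \<in> borel_measurable M" "fb k j \<in> borel_measurable M" if "k < m" for k j
    unfolding fa_def fb_def using that ab Zm itoM by (auto intro!: borel_measurable_norm borel_measurable_diff)
  have l: "(\<lambda>j. \<integral>\<^sup>+\<omega>. ennreal (fa k j \<omega>) \<partial>M) \<longlonglongrightarrow> 0" "(\<lambda>j. \<integral>\<^sup>+\<omega>. ennreal (fb k j \<omega>) \<partial>M) \<longlonglongrightarrow> 0" if "k < m" for k
    by (rule first_moment_tendsto[OF P fm(1)[OF that]], use lim(3)[OF that] in \<open>auto simp: fa_def\<close>)
       (rule first_moment_tendsto[OF P fm(2)[OF that]], use lim(4)[OF that] in \<open>auto simp: fb_def\<close>)
  define e where "e j = ennreal (norm lam) * (\<Sum>k<m. (\<integral>\<^sup>+\<omega>. ennreal (fa k j \<omega>) \<partial>M) + (\<integral>\<^sup>+\<omega>. ennreal (fb k j \<omega>) \<partial>M))" for j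
  have "e \<longlonglongrightarrow> ennreal (norm lam) * (\<Sum>k<m. 0 + 0)"
    unfolding e_def by (intro ennreal_tendsto_cmult tendsto_sum tendsto_add l) auto
  then have e0: "e \<longlonglongrightarrow> 0" by simp
  have "ennreal (norm ((\<integral>\<omega>. Z \<omega> * cis (Y \<omega>) \<partial>M) - (\<integral>\<omega>. Z \<omega> * cis (D j \<omega> + R j \<omega>) \<partial>M))) \<le> e j" for j
  proof -
    define h where "h \<omega> = norm lam * (\<Sum>k<m. fa k j \<omega> + fb k j \<omega>)" for \<omega>
    let ?f = "\<lambda>\<omega>. \<Sum>k<m. ennreal (fa k j \<omega>) + ennreal (fb k j \<omega>)"
    have "ennreal (norm ((\<integral>\<omega>. Z \<omega> * cis (Y \<omega>) \<partial>M) - (\<integral>\<omega>. Z \<omega> * cis (D j \<omega> + R j \<omega>) \<partial>M))) \<le> (\<integral>\<^sup>+\<omega>. ennreal (h \<omega>) \<partial>M)"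
    proof (rule prob_norm_expectation_diff[OF P _ _ Zcis_norm Zcis_norm])
      show "AE \<omega> in M. norm (Z \<omega> * cis (Y \<omega>) - Z \<omega> * cis (D j \<omega> + R j \<omega>)) \<le> h \<omega>"
      proof (rule AE_I2)
        fix \<omega>
        have "norm (Z \<omega> * cis (Y \<omega>) - Z \<omega> * cis (D j \<omega> + R j \<omega>)) = norm (Z \<omega>) * norm (cis (Y \<omega>) - cis (D j \<omega> + R j \<omega>))"
          by (simp add: norm_mult flip: right_diff_distrib)
        also have "\<dots> \<le> 1 * \<bar>Y \<omega> - (D j \<omega> + R j \<omega>)\<bar>"
          by (intro mult_mono Z norm_cis_diff_le) auto
        also have "Y \<omega> - (D j \<omega> + R j \<omega>)
           = (\<Sum>k<m. lam \<bullet> ((simple_ito (W k) (Sa k j) a \<omega> - Za k \<omega>) - (simple_ito (W k) (Sb k j) b \<omega> - Zb k \<omega>)))"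
          by (simp add: Y_def D_def R_def inner_diff_right sum_subtractf)
        also have "1 * \<bar>\<dots>\<bar> \<le> (\<Sum>k<m. norm lam * (fa k j \<omega> + fb k j \<omega>))"
        proof -
          have "\<bar>lam \<bullet> ((simple_ito (W k) (Sa k j) a \<omega> - Za k \<omega>) - (simple_ito (W k) (Sb k j) b \<omega> - Zb k \<omega>))\<bar>
            \<le> norm lam * (fa k j \<omega> + fb k j \<omega>)" for k
            by (rule order_trans[OF Cauchy_Schwarz_ineq2]) (auto simp: fa_def fb_def intro!: mult_left_mono norm_triangle_ineq4)
          then show ?thesis by (auto intro!: order_trans[OF sum_abs] sum_mono)
        qed
        also have "\<dots> = h \<omega>" by (simp add: h_def sum_distrib_left)
        finally show "norm (Z \<omega> * cis (Y \<omega>) - Z \<omega> * cis (D j \<omega> + R j \<omega>)) \<le> h \<omega>" .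
      qed
    qed measurable
    also have "(\<integral>\<^sup>+\<omega>. ennreal (h \<omega>) \<partial>M) = (\<integral>\<^sup>+\<omega>. ennreal (norm lam) * (?f \<omega>) \<partial>M)"
    proof (intro nn_integral_cong)
      fix \<omega>
      have "(?f \<omega>) = (\<Sum>k<m. ennreal (fa k j \<omega> + fb k j \<omega>))"
        by (intro sum.cong refl ennreal_plus[symmetric]) (auto simp: fa_def fb_def)
      also have "\<dots> = ennreal (\<Sum>k<m. fa k j \<omega> + fb k j \<omega>)"
        by (rule sum_ennreal) (auto simp: fa_def fb_def)
      finally show "ennreal (h \<omega>) = ennreal (norm lam) * (?f \<omega>)"
        by (simp add: h_def ennreal_mult' )
    qed
    also have "\<dots> = ennreal (norm lam) * (\<integral>\<^sup>+\<omega>. (?f \<omega>) \<partial>M)"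
      using fm by (intro nn_integral_cmult borel_measurable_sum borel_measurable_add measurable_compose[OF _ measurable_ennreal]) auto
    also have "(\<integral>\<^sup>+\<omega>. (?f \<omega>) \<partial>M)
       = (\<Sum>k<m. \<integral>\<^sup>+\<omega>. ennreal (fa k j \<omega>) + ennreal (fb k j \<omega>) \<partial>M)"
      using fm by (intro nn_integral_sum borel_measurable_add measurable_compose[OF _ measurable_ennreal]) auto
    also have "\<dots> = (\<Sum>k<m. (\<integral>\<^sup>+\<omega>. ennreal (fa k j \<omega>) \<partial>M) + (\<integral>\<^sup>+\<omega>. ennreal (fb k j \<omega>) \<partial>M))"
      using fm by (intro sum.cong refl nn_integral_add measurable_compose[OF _ measurable_ennreal]) auto
    finally show ?thesis by (simp add: e_def)
  qed
  then show ?thesis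
    by (intro tendsto_sandwich[OF _ _ tendsto_const e0]) auto
qed

lemma lim_DR:
  "(\<lambda>j. ennreal (norm ((\<integral>\<omega>. Z \<omega> * cis (D j \<omega> + R j \<omega>) \<partial>M) - (\<integral>\<omega>. Z \<omega> * cis (D j \<omega>) \<partial>M)))) \<longlonglongrightarrow> 0"
proof -
  define f where "f j \<omega> = norm (cis (R j \<omega>) - 1)" for j \<omega>
  have fm[measurable]: "f j \<in> borel_measurable M" for j unfolding f_def by measurable
  let ?c = "\<lambda>j. \<integral>\<omega>. cis (R j \<omega>) \<partial>M"
  have sq: "(\<integral>\<^sup>+\<omega>. ennreal ((f j \<omega>)\<^sup>2) \<partial>M) \<le> 2 * ennreal (norm ((?c j) - 1))" for j
  proof -
    have i1: "integrable M (\<lambda>\<omega>. cis (R j \<omega>))" by (rule integrable_const_bound[of _ 1]) auto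
    have i2: "integrable M (\<lambda>\<omega>. cos (R j \<omega>))" by (rule integrable_const_bound[of _ 1]) auto
    have "(\<integral>\<^sup>+\<omega>. ennreal ((f j \<omega>)\<^sup>2) \<partial>M) = (\<integral>\<^sup>+\<omega>. ennreal (2 - 2 * cos (R j \<omega>)) \<partial>M)"
      by (simp add: f_def norm_cis_minus_one_square)
    also have "\<dots> = ennreal (\<integral>\<omega>. 2 - 2 * cos (R j \<omega>) \<partial>M)"
      by (rule nn_integral_eq_integral) (use i2 in auto)
    also have "(\<integral>\<omega>. 2 - 2 * cos (R j \<omega>) \<partial>M) = 2 * (1 - (\<integral>\<omega>. cos (R j \<omega>) \<partial>M))"
      using i2 by (simp add: prob_space)
    also have "(\<integral>\<omega>. cos (R j \<omega>) \<partial>M) = Re (?c j)"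
      using integral_Re[OF i1] by simp
    also have "ennreal (2 * (1 - Re (?c j))) \<le> ennreal (2 * norm ((?c j) - 1))"
      using abs_Re_le_cmod[of "(?c j) - 1"] by (intro ennreal_leI) auto
    also have "\<dots> = 2 * ennreal (norm ((?c j) - 1))" by (simp add: ennreal_mult)
    finally show ?thesis .
  qed
  have "(\<lambda>j. 2 * ennreal (norm ((?c j) - 1))) \<longlonglongrightarrow> 2 * 0"
    by (intro ennreal_tendsto_cmult lim_R) simp
  then have l0: "(\<lambda>j. 2 * ennreal (norm ((?c j) - 1))) \<longlonglongrightarrow> 0" by simp
  have l2: "(\<lambda>j. \<integral>\<^sup>+\<omega>. ennreal ((f j \<omega>)\<^sup>2) \<partial>M) \<longlonglongrightarrow> 0"
    by (rule tendsto_sandwich[OF always_eventually always_eventually tendsto_const l0]) (intro allI zero_le sq)+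
  have l1: "(\<lambda>j. \<integral>\<^sup>+\<omega>. ennreal (f j \<omega>) \<partial>M) \<longlonglongrightarrow> 0"
    by (rule first_moment_tendsto[OF P fm _ l2]) (simp add: f_def)
  have "ennreal (norm ((\<integral>\<omega>. Z \<omega> * cis (D j \<omega> + R j \<omega>) \<partial>M) - (\<integral>\<omega>. Z \<omega> * cis (D j \<omega>) \<partial>M))) \<le> (\<integral>\<^sup>+\<omega>. ennreal (f j \<omega>) \<partial>M)" for j
  proof (rule prob_norm_expectation_diff[OF P _ _ Zcis_norm Zcis_norm])
    show "AE \<omega> in M. norm (Z \<omega> * cis (D j \<omega> + R j \<omega>) - Z \<omega> * cis (D j \<omega>)) \<le> f j \<omega>"
    proof (rule AE_I2)
      fix \<omega>
      have "Z \<omega> * cis (D j \<omega> + R j \<omega>) - Z \<omega> * cis (D j \<omega>) = (Z \<omega> * cis (D j \<omega>)) * (cis (R j \<omega>) - 1)"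
        by (simp add: cis_mult[symmetric] algebra_simps)
      then show "norm (Z \<omega> * cis (D j \<omega> + R j \<omega>) - Z \<omega> * cis (D j \<omega>)) \<le> f j \<omega>"
        using mult_right_mono[OF Zcis_norm, of "norm (cis (R j \<omega>) - 1)"] by (simp add: f_def norm_mult)
    qed
  qed measurable
  then show ?thesis
    by (intro tendsto_sandwich[OF _ _ tendsto_const l1]) auto
qed

text \<open>Given the past at the time \<open>a\<close>, the increment is Gaussian with variance \<open>\<integral> q\<close>: pass from \<open>Y\<close> to
  \<open>D + R\<close>, to \<open>D\<close> and to the limit.\<close>

theorem ito_increment_char:
  "(\<integral>\<omega>. Z \<omega> * cis (Y \<omega>) \<partial>M) = (\<integral>\<omega>. Z \<omega> * complex_of_real (exp (- (LINT s:{a<..b}|lborel. q s \<omega>) / 2)) \<partial>M)"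
  (is "?A = ?B")
proof -
  let ?E1 = "\<lambda>j. \<integral>\<omega>. Z \<omega> * cis (D j \<omega> + R j \<omega>) \<partial>M" and ?E2 = "\<lambda>j. \<integral>\<omega>. Z \<omega> * cis (D j \<omega>) \<partial>M"
  have "ennreal (norm (?A - ?B)) \<le> ennreal (norm (?A - ?E1 j)) + (ennreal (norm (?E1 j - ?E2 j)) + ennreal (norm (?E2 j - ?B)))" for j
    by (intro order_trans[OF ennreal_norm_triangle[of ?A ?B "?E1 j"]] add_left_mono ennreal_norm_triangle)
  moreover have "(\<lambda>j. ennreal (norm (?A - ?E1 j)) + (ennreal (norm (?E1 j - ?E2 j)) + ennreal (norm (?E2 j - ?B)))) \<longlonglongrightarrow> 0 + (0 + 0)"
    by (intro tendsto_add lim_Y lim_DR lim_D)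
  ultimately have "ennreal (norm (?A - ?B)) \<le> 0"
    by (intro tendsto_lowerbound[where F=sequentially]) auto
  then show ?thesis by simp
qed

end

section \<open>The covariance of one step\<close>

lemma mat_AAt_quadratic: "v \<bullet> (mat_AAt m A *v v) = (\<Sum>k<m. (v \<bullet> A k)\<^sup>2)"
proof -
  have "v \<bullet> (mat_AAt m A *v v) = (\<Sum>i\<in>UNIV. v $ i * (\<Sum>j\<in>UNIV. (\<Sum>k<m. A k $ i * A k $ j) * v $ j))"
    by (simp add: inner_vec_def matrix_vector_mult_def mat_AAt_def)
  also have "\<dots> = (\<Sum>i\<in>UNIV. \<Sum>j\<in>UNIV. \<Sum>k<m. (v $ i * A k $ i) * (v $ j * A k $ j))"
    by (simp add: sum_distrib_left sum_distrib_right mult_ac)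
  also have "\<dots> = (\<Sum>i\<in>UNIV. \<Sum>k<m. \<Sum>j\<in>UNIV. (v $ i * A k $ i) * (v $ j * A k $ j))"
    by (intro sum.cong refl sum.swap)
  also have "\<dots> = (\<Sum>k<m. \<Sum>i\<in>UNIV. \<Sum>j\<in>UNIV. (v $ i * A k $ i) * (v $ j * A k $ j))"
    by (rule sum.swap)
  also have "\<dots> = (\<Sum>k<m. (v \<bullet> A k)\<^sup>2)"
    by (simp add: inner_vec_def power2_eq_square sum_product)
  finally show ?thesis .
qed

lemma scaled_identity_quadratic: "v \<bullet> ((c *\<^sub>R mat 1) *v v) = c * (v \<bullet> v)" for v :: "real ^ 'd"
proof -
  have "(c *\<^sub>R mat 1) *v v = c *\<^sub>R v"
    by (simp add: scaleR_matrix_vector_assoc[symmetric])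
  then show ?thesis by simp
qed

lemma halfspace_measurable:
  fixes g :: "real \<Rightarrow> real ^ 'd \<Rightarrow> 'b::euclidean_space"
  assumes "borel_on_halfspace g"
  shows "(\<lambda>p. indicat_real {0..} (fst p) *\<^sub>R g (fst p) (snd p)) \<in> borel_measurable (borel \<Otimes>\<^sub>M borel)"
proof -
  have m: "{0..} \<times> UNIV \<inter> space (borel :: (real \<times> (real ^ 'd)) measure) \<in> sets borel"
    by (simp add: closed_Times borel_closed)
  have "(\<lambda>p. indicat_real ({0..} \<times> UNIV) p *\<^sub>R (case p of (s, y) \<Rightarrow> g s y)) \<in> borel_measurable (borel :: (real \<times> (real ^ 'd)) measure)"
    using assms unfolding borel_on_halfspace_def
    using borel_measurable_restrict_space_iff[OF m, of "\<lambda>(s, y). g s y"] by simp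
  moreover have "(\<lambda>p. indicat_real ({0..} \<times> UNIV) p *\<^sub>R (case p of (s, y) \<Rightarrow> g s y))
     = (\<lambda>p. indicat_real {0..} (fst p) *\<^sub>R g (fst p) (snd p))"
    by (auto simp: fun_eq_iff indicator_def split: prod.split)
  ultimately show ?thesis by (simp add: borel_prod)
qed

text \<open>The matrix is given by its columns; \<open>sq s x\<close> below is the quadratic form of \<open>\<sigma> \<sigma>\<^sup>*\<close>.\<close>

locale diffusion_coefficient =
  fixes m :: nat and \<sigma> :: "real \<Rightarrow> real ^ 'd \<Rightarrow> nat \<Rightarrow> real ^ 'd" and \<epsilon> K \<alpha> :: real
  assumes pos: "0 < \<epsilon>" "0 < K"
    and \<sigma>_borel: "\<And>k. k < m \<Longrightarrow> borel_on_halfspace (\<lambda>s y. \<sigma> s y k)"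
    and ell: "\<And>s y. 0 < s \<Longrightarrow> psd_le (\<epsilon> *\<^sub>R mat 1) (mat_AAt m (\<sigma> s y))"
      "\<And>s y. 0 < s \<Longrightarrow> psd_le (mat_AAt m (\<sigma> s y)) (K *\<^sub>R mat 1)"
    and hol: "\<And>s y z. 0 < s \<Longrightarrow> mat_dist m (\<sigma> s y) (\<sigma> s z) \<le> K * norm (y - z) powr \<alpha>"
begin

definition "sq s x l = (\<Sum>k<m. (l \<bullet> \<sigma> s x k)\<^sup>2)"

lemma sq_bounds: "0 < s \<Longrightarrow> \<epsilon> * (l \<bullet> l) \<le> sq s x l" "0 < s \<Longrightarrow> sq s x l \<le> K * (l \<bullet> l)" "0 \<le> sq s x l"
  using ell[of s x] unfolding psd_le_def mat_AAt_quadratic scaled_identity_quadratic sq_def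
  by (auto intro: sum_nonneg)

lemma eps_le_K: "\<epsilon> \<le> K"
  using sq_bounds(1,2)[where s=1 and l="axis undefined 1" and x=0] by (auto simp: inner_axis_axis)

text \<open>Factor \<open>p\<^sup>2 - r\<^sup>2\<close> and use Cauchy--Schwarz: one factor is Hoelder continuous, the other is bounded by
  ellipticity.\<close>

lemma sq_holder:
  assumes s: "0 < s"
  shows "\<bar>sq s x l - sq s y l\<bar> \<le> 2 * sqrt K * K * norm (x - y) powr \<alpha> * (l \<bullet> l)"
proof -
  define p r where "p k = l \<bullet> \<sigma> s x k" and "r k = l \<bullet> \<sigma> s y k" for k
  have "sq s x l - sq s y l = (\<Sum>k<m. (p k - r k) * (p k + r k))"
    by (simp add: sq_def p_def r_def sum_subtractf[symmetric] power2_eq_square algebra_simps)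
  also have "\<bar>\<dots>\<bar> \<le> (\<Sum>k<m. \<bar>p k - r k\<bar> * \<bar>p k + r k\<bar>)"
    using sum_abs[of "\<lambda>k. (p k - r k) * (p k + r k)" "{..<m}"] by (simp add: abs_mult)
  also have "\<dots> \<le> L2_set (\<lambda>k. p k - r k) {..<m} * L2_set (\<lambda>k. p k + r k) {..<m}"
    by (rule L2_set_mult_ineq)
  also have "\<dots> \<le> (norm l * (K * norm (x - y) powr \<alpha>)) * (2 * sqrt K * norm l)"
  proof (rule mult_mono)
    have "L2_set (\<lambda>k. p k - r k) {..<m} \<le> L2_set (\<lambda>k. norm l * norm (\<sigma> s x k - \<sigma> s y k)) {..<m}"
    proof -
      have "L2_set (\<lambda>k. p k - r k) {..<m} = L2_set (\<lambda>k. \<bar>p k - r k\<bar>) {..<m}" by (simp add: L2_set_def)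
      also have "\<dots> \<le> L2_set (\<lambda>k. norm l * norm (\<sigma> s x k - \<sigma> s y k)) {..<m}"
        by (rule L2_set_mono) (auto simp: p_def r_def inner_diff_right[symmetric] intro: Cauchy_Schwarz_ineq2)
      finally show ?thesis .
    qed
    also have "\<dots> = norm l * mat_dist m (\<sigma> s x) (\<sigma> s y)"
      unfolding mat_dist_def by (rule L2_set_right_distrib[symmetric]) simp
    also have "\<dots> \<le> norm l * (K * norm (x - y) powr \<alpha>)"
      by (intro mult_left_mono hol[OF s]) simp
    finally show "L2_set (\<lambda>k. p k - r k) {..<m} \<le> norm l * (K * norm (x - y) powr \<alpha>)" .
    have L: "L2_set f {..<m} \<le> sqrt K * norm l" if "(\<Sum>k<m. (f k)\<^sup>2) \<le> K * (l \<bullet> l)" for f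
    proof -
      have "L2_set f {..<m} \<le> sqrt (K * (l \<bullet> l))" using that by (simp add: L2_set_def)
      then show ?thesis by (simp add: real_sqrt_mult norm_eq_sqrt_inner)
    qed
    have "L2_set (\<lambda>k. p k + r k) {..<m} \<le> L2_set p {..<m} + L2_set r {..<m}" by (rule L2_set_triangle_ineq)
    also have "\<dots> \<le> sqrt K * norm l + sqrt K * norm l"
      using sq_bounds(2)[OF s, of x l] sq_bounds(2)[OF s, of y l]
      by (intro add_mono L) (auto simp: sq_def p_def r_def)
    finally show "L2_set (\<lambda>k. p k + r k) {..<m} \<le> 2 * sqrt K * norm l" by simp
  qed (use pos in \<open>auto simp: L2_set_nonneg\<close>)
  also have "\<dots> = 2 * sqrt K * K * norm (x - y) powr \<alpha> * (l \<bullet> l)"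
    by (simp add: dot_square_norm power2_eq_square)
  finally show ?thesis .
qed

lemma sq_measurable:
  assumes a: "0 \<le> a"
    and f[measurable]: "f \<in> borel_measurable N" "g \<in> borel_measurable N" "h \<in> borel_measurable N"
  shows "(\<lambda>z. indicat_real {a<..b} (f z) * sq (f z) (g z) (h z)) \<in> borel_measurable N"
proof -
  have eq: "indicat_real {a<..b} (f z) * sq (f z) (g z) (h z)
     = indicat_real {a<..b} (f z) * (\<Sum>k<m. (h z \<bullet> (indicat_real {0..} (f z) *\<^sub>R \<sigma> (f z) (g z) k))\<^sup>2)" for z
    using a by (auto simp: sq_def indicator_def)
  have "(\<lambda>z. indicat_real {0..} (f z) *\<^sub>R \<sigma> (f z) (g z) k) \<in> borel_measurable N" if "k < m" for k
    using measurable_compose[OF measurable_Pair[OF f(1,2)] halfspace_measurable[OF \<sigma>_borel[OF that]]] by simp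
  then show ?thesis
    unfolding eq
    by (intro borel_measurable_times borel_measurable_sum borel_measurable_power borel_measurable_inner f(3)) auto
qed

definition cov :: "real \<Rightarrow> real \<Rightarrow> real ^ 'd \<Rightarrow> real ^ 'd \<Rightarrow> real" where
  "cov a b x l = (LINT s:{a<..b}|lborel. sq s x l)"

lemma sq_integrable:
  assumes "0 \<le> a"
  shows "set_integrable lborel {a<..b} (\<lambda>s. sq s x l)"
proof -
  have fin: "emeasure lborel {a<..b} < \<infinity>" by (cases "a \<le> b") auto
  have m: "(\<lambda>s. indicat_real {a<..b} s * sq s x l) \<in> borel_measurable lborel"
    using sq_measurable[OF assms, of "\<lambda>s. s" lborel "\<lambda>_. x" "\<lambda>_. l" b] by simp
  have "integrable lborel (\<lambda>s. indicat_real {a<..b} s * sq s x l)"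
  proof (rule Bochner_Integration.integrable_bound[where f="\<lambda>s. indicat_real {a<..b} s * (K * (l \<bullet> l))"])
    show "integrable lborel (\<lambda>s. indicat_real {a<..b} s * (K * (l \<bullet> l)))"
      using fin by (intro integrable_mult_left) auto
    show "AE s in lborel. norm (indicat_real {a<..b} s * sq s x l) \<le> norm (indicat_real {a<..b} s * (K * (l \<bullet> l)))"
      using sq_bounds(2,3) pos assms by (intro AE_I2) (auto simp: indicator_def abs_of_nonneg)
  qed (rule m)
  then show ?thesis by (simp add: set_integrable_def)
qed

lemma cov_const: "a \<le> b \<Longrightarrow> (LINT s:{a<..b}|lborel. c) = (b - a) * c" for c :: real
  by (subst set_integral_const) auto

lemma const_integrable: "set_integrable lborel {a<..b} (\<lambda>s. c::real)" for a b :: real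
  unfolding set_integrable_def by (cases "a \<le> b") (auto intro!: integrable_scaleR_left)

lemma cov_bounds:
  assumes "0 \<le> a" "a \<le> b"
  shows "\<epsilon> * (b - a) * (l \<bullet> l) \<le> cov a b x l" "cov a b x l \<le> K * (b - a) * (l \<bullet> l)"
proof -
  have "(LINT s:{a<..b}|lborel. \<epsilon> * (l \<bullet> l)) \<le> cov a b x l"
    unfolding cov_def by (rule set_integral_mono[OF const_integrable sq_integrable[OF assms(1)]]) (use assms sq_bounds(1) in auto)
  then show "\<epsilon> * (b - a) * (l \<bullet> l) \<le> cov a b x l" by (simp add: cov_const[OF assms(2)] mult_ac)
  have "cov a b x l \<le> (LINT s:{a<..b}|lborel. K * (l \<bullet> l))"
    unfolding cov_def by (rule set_integral_mono[OF sq_integrable[OF assms(1)] const_integrable]) (use assms sq_bounds(2) in auto)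
  then show "cov a b x l \<le> K * (b - a) * (l \<bullet> l)" by (simp add: cov_const[OF assms(2)] mult_ac)
qed

lemma cov_holder:
  assumes "0 \<le> a" "a \<le> b"
  shows "\<bar>cov a b x l - cov a b y l\<bar> \<le> 2 * sqrt K * K * (b - a) * norm (x - y) powr \<alpha> * (l \<bullet> l)"
proof -
  let ?c = "2 * sqrt K * K * norm (x - y) powr \<alpha> * (l \<bullet> l)"
  have d: "cov a b x l - cov a b y l = (LINT s:{a<..b}|lborel. sq s x l - sq s y l)"
    unfolding cov_def by (rule set_integral_diff(2)[symmetric]) (intro sq_integrable assms)+
  have di: "set_integrable lborel {a<..b} (\<lambda>s. sq s x l - sq s y l)"
    by (intro set_integral_diff(1) sq_integrable assms)
  have h: "sq s x l - sq s y l \<le> ?c" "- ?c \<le> sq s x l - sq s y l" if "s \<in> {a<..b}" for s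
    using sq_holder[of s x l y] that assms by (auto simp: abs_le_iff)
  have "cov a b x l - cov a b y l \<le> (LINT s:{a<..b}|lborel. ?c)"
    unfolding d by (rule set_integral_mono[OF di const_integrable]) (rule h)
  moreover have "(LINT s:{a<..b}|lborel. - ?c) \<le> cov a b x l - cov a b y l"
    unfolding d by (rule set_integral_mono[OF const_integrable di]) (rule h)
  ultimately show ?thesis
    unfolding cov_const[OF assms(2)]
  proof -
    assume u: "cov a b x l - cov a b y l \<le> (b - a) * ?c" and v: "(b - a) * - ?c \<le> cov a b x l - cov a b y l"
    have "\<bar>cov a b x l - cov a b y l\<bar> \<le> (b - a) * ?c"
      using u v unfolding mult_minus_right by (rule abs_leI[OF _ minus_le_iff[THEN iffD1]])
    also have "\<dots> = 2 * sqrt K * K * (b - a) * norm (x - y) powr \<alpha> * (l \<bullet> l)" by (simp only: mult_ac)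
    finally show ?thesis .
  qed
qed

lemma cov_qform:
  assumes a: "0 \<le> a"
  shows "qform (cov a b x)"
proof -
  define B where "B l l' = (cov a b x (l + l') - cov a b x l - cov a b x l') / 2" for l l'
  define p where "p s l l' = (\<Sum>k<m. (l \<bullet> \<sigma> s x k) * (l' \<bullet> \<sigma> s x k))" for s l l'
  have pol: "p s l l' = (sq s x (l + l') - sq s x l - sq s x l') / 2" for s l l'
  proof -
    have "sq s x (l + l') = (\<Sum>k<m. (l \<bullet> \<sigma> s x k)\<^sup>2 + (l' \<bullet> \<sigma> s x k)\<^sup>2 + 2 * ((l \<bullet> \<sigma> s x k) * (l' \<bullet> \<sigma> s x k)))"
      unfolding sq_def by (intro sum.cong refl) (simp add: inner_add_left power2_sum)
    then show ?thesis by (simp add: sq_def p_def sum.distrib flip: sum_distrib_left)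
  qed
  have pi: "set_integrable lborel {a<..b} (\<lambda>s. p s l l')" for l l'
    unfolding pol by (intro set_integrable_divide set_integral_diff(1) sq_integrable a)
  have B: "B l l' = (LINT s:{a<..b}|lborel. p s l l')" for l l'
    unfolding pol B_def cov_def
    by (simp add: set_integral_diff set_integrable_divide sq_integrable[OF a])
  have bil: "bilinear B"
    unfolding bilinear_def
  proof (intro conjI allI linearI)
    fix l l1 l2 :: "real ^ 'd" and c :: real
    have e1: "p s l (l1 + l2) = p s l l1 + p s l l2" "p s (l1 + l2) l = p s l1 l + p s l2 l"
      "p s l (c *\<^sub>R l1) = c * p s l l1" "p s (c *\<^sub>R l1) l = c * p s l1 l" for s
      by (simp_all add: p_def inner_add_left algebra_simps sum.distrib sum_distrib_left)
    show "B l (l1 + l2) = B l l1 + B l l2" "B (l1 + l2) l = B l1 l + B l2 l"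
      unfolding B e1 by (rule set_integral_add(2)[OF pi pi])+
    show "B l (c *\<^sub>R l1) = c *\<^sub>R B l l1" "B (c *\<^sub>R l1) l = c *\<^sub>R B l1 l"
      unfolding B e1 by simp_all
  qed
  have sym: "B l l' = B l' l" for l l' by (simp add: B_def add.commute)
  have "cov a b x l = B l l" for l
  proof -
    have "p s l l = sq s x l" for s by (simp add: p_def sq_def power2_eq_square)
    then show ?thesis by (simp add: B cov_def)
  qed
  then show ?thesis unfolding qform_def using bil sym by blast
qed

lemma cov_measurable:
  assumes a: "0 \<le> a" and [measurable]: "g \<in> borel_measurable N" "h \<in> borel_measurable N"
  shows "(\<lambda>z. cov a b (g z) (h z)) \<in> borel_measurable N"
proof -
  have "(\<lambda>(z, s). indicat_real {a<..b} s *\<^sub>R sq s (g z) (h z)) \<in> borel_measurable (N \<Otimes>\<^sub>M lborel)"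
    using sq_measurable[OF a, of snd "N \<Otimes>\<^sub>M lborel" "\<lambda>p. g (fst p)" "\<lambda>p. h (fst p)" b] by (simp add: split_beta')
  then show ?thesis
    unfolding cov_def set_lebesgue_integral_def by (rule lborel.borel_measurable_lebesgue_integral)
qed

definition dens :: "real \<Rightarrow> real \<Rightarrow> real ^ 'd \<Rightarrow> real ^ 'd \<Rightarrow> real" where
  "dens a b x y = gdens (cov a b x) (y - x)"

lemma dens_measurable:
  assumes a: "0 \<le> a" and [measurable]: "g \<in> borel_measurable N" "h \<in> borel_measurable N"
  shows "(\<lambda>z. dens a b (g z) (h z)) \<in> borel_measurable N"
proof -
  have [measurable]: "(\<lambda>p. cov a b (g (fst p)) (snd p)) \<in> borel_measurable (N \<Otimes>\<^sub>M lborel)"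
    by (rule cov_measurable[OF a]) measurable
  have "(\<lambda>(z, l). cos (l \<bullet> (h z - g z)) * exp (- cov a b (g z) l / 2)) \<in> borel_measurable (N \<Otimes>\<^sub>M lborel)"
    unfolding split_beta' by measurable
  then show ?thesis
    unfolding dens_def gdens_def
    by (intro borel_measurable_times borel_measurable_const lborel.borel_measurable_lebesgue_integral)
qed

end

section \<open>The law of one step of the Euler scheme\<close>

lemma kappa_eq:
  assumes "strict_mono \<tau>" "\<tau> i \<le> r" "r < \<tau> (Suc i)"
  shows "kappa \<tau> r = \<tau> i"
proof -
  have "(THE j. \<tau> j \<le> r \<and> r < \<tau> (Suc j)) = i"
  proof (rule the_equality)
    show "\<tau> i \<le> r \<and> r < \<tau> (Suc i)" using assms by simp
    fix j assume j: "\<tau> j \<le> r \<and> r < \<tau> (Suc j)"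
    then have "\<tau> j < \<tau> (Suc i)" "\<tau> i < \<tau> (Suc j)" using assms by linarith+
    then show "j = i" using assms(1) by (simp add: strict_mono_less)
  qed
  then show ?thesis by (simp add: kappa_def)
qed

locale euler_step = diffusion_coefficient m \<sigma> \<epsilon> K \<alpha>
  for m and \<sigma> :: "real \<Rightarrow> real ^ 'd \<Rightarrow> nat \<Rightarrow> real ^ 'd" and \<epsilon> K \<alpha> +
  fixes M :: "'w measure" and F W and x0 :: "real ^ 'd" and \<tau> :: "nat \<Rightarrow> real" and X :: "real \<Rightarrow> 'w \<Rightarrow> real ^ 'd" and i :: nat
  assumes W: "wiener_process M F m W" and \<tau>: "partition_seq \<tau>"
    and X: "euler_approx M F m W \<sigma> x0 \<tau> X"
begin

abbreviation "a \<equiv> \<tau> i"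
abbreviation "b \<equiv> \<tau> (Suc i)"

lemma ab: "0 \<le> a" "a < b" "0 \<le> b"
proof -
  have "\<tau> 0 \<le> \<tau> i" "\<tau> i < \<tau> (Suc i)"
    using \<tau> strict_mono_less_eq[of \<tau> 0 i] strict_mono_less[of \<tau> i "Suc i"] by (auto simp: partition_seq_def)
  then show "0 \<le> a" "a < b" "0 \<le> b" using \<tau> by (auto simp: partition_seq_def)
qed

lemma fil: "filtration_on M F" and P: "prob_space M"
  using W by (auto simp: wiener_process_def)

sublocale prob_space M by (rule P)

lemma Xa: "X a \<in> borel_measurable (F a)" and Xb: "X b \<in> borel_measurable (F b)"
  using X ab by (auto simp: euler_approx_def)

lemma XaM [measurable]: "X a \<in> borel_measurable M" and XbM [measurable]: "X b \<in> borel_measurable M"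
  using filtration_measurable_M[OF fil ab(1) Xa] filtration_measurable_M[OF fil ab(3) Xb] .

text \<open>On the interval the integrand is \<open>\<sigma> s (X a)\<close>, which is known at the time \<open>a\<close>.\<close>

lemma increment_char:
  fixes Z :: "'w \<Rightarrow> complex"
  assumes Z: "Z \<in> borel_measurable (F a)" "\<And>\<omega>. norm (Z \<omega>) \<le> 1"
  shows "(\<integral>\<omega>. Z \<omega> * cis (lam \<bullet> (X b \<omega> - X a \<omega>)) \<partial>M)
    = (\<integral>\<omega>. Z \<omega> * complex_of_real (exp (- cov a b (X a \<omega>) lam / 2)) \<partial>M)"
proof -
  define G where "G k s \<omega> = \<sigma> s (X (kappa \<tau> s) \<omega>) k" for k s \<omega>
  have ito: "has_vector_ito_integral M F m W G r (\<lambda>\<omega>. X r \<omega> - x0)" if "0 \<le> r" for r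
    using X that unfolding euler_approx_def G_def by blast
  obtain Za where Za: "\<And>k. k < m \<Longrightarrow> has_ito_integral M F (W k) (G k) a (Za k)" "AE \<omega> in M. X a \<omega> - x0 = (\<Sum>k<m. Za k \<omega>)"
    using ito[OF ab(1)] unfolding has_vector_ito_integral_def by blast
  obtain Zb where Zb: "\<And>k. k < m \<Longrightarrow> has_ito_integral M F (W k) (G k) b (Zb k)" "AE \<omega> in M. X b \<omega> - x0 = (\<Sum>k<m. Zb k \<omega>)"
    using ito[OF ab(3)] unfolding has_vector_ito_integral_def by blast
  define approx where "approx k t Y S \<longleftrightarrow> (\<forall>j::nat. is_simple_proc F (S j)) \<and>
        ((\<lambda>j. \<integral>\<^sup>+ \<omega>. (\<integral>\<^sup>+ r\<in>{0..t}. ennreal ((norm (simple_val (S j) r \<omega> - G k r \<omega>))\<^sup>2) \<partial>lborel) \<partial>M) \<longlonglongrightarrow> 0) \<and>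
        ((\<lambda>j. \<integral>\<^sup>+ \<omega>. ennreal ((norm (simple_ito (W k) (S j) t \<omega> - Y \<omega>))\<^sup>2) \<partial>M) \<longlonglongrightarrow> 0)"
    for k t and Y :: "'w \<Rightarrow> real ^ 'd" and S
  define Sa where "Sa k = (SOME S. approx k a (Za k) S)" for k
  define Sb where "Sb k = (SOME S. approx k b (Zb k) S)" for k
  have Sa: "approx k a (Za k) (Sa k)" if "k < m" for k
  proof -
    have "\<exists>S. approx k a (Za k) S" using Za(1)[OF that] unfolding has_ito_integral_def approx_def by blast
    then show ?thesis unfolding Sa_def by (rule someI_ex)
  qed
  have Sb: "approx k b (Zb k) (Sb k)" if "k < m" for k
  proof -
    have "\<exists>S. approx k b (Zb k) S" using Zb(1)[OF that] unfolding has_ito_integral_def approx_def by blast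
    then show ?thesis unfolding Sb_def by (rule someI_ex)
  qed
  (* At the time b the state has already been updated, hence the open interval. *)
  define q where "q s \<omega> = indicat_real {a<..<b} s * sq s (X a \<omega>) lam" for s \<omega>
  have q_eq: "q s \<omega> = indicat_real {a<..<b} s * (indicat_real {a<..b} s * sq s (X a \<omega>) lam)" for s \<omega>
    by (simp add: q_def indicator_def)
  have qm: "(\<lambda>(\<omega>, s). q s \<omega>) \<in> borel_measurable (F a \<Otimes>\<^sub>M borel)"
  proof -
    have "(\<lambda>p. X a (fst p)) \<in> borel_measurable (F a \<Otimes>\<^sub>M borel)"
      by (rule measurable_compose[OF measurable_fst Xa])
    then have "(\<lambda>p. indicat_real {a<..b} (snd p) * sq (snd p) (X a (fst p)) lam) \<in> borel_measurable (F a \<Otimes>\<^sub>M borel)"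
      using sq_measurable[OF ab(1), of snd "F a \<Otimes>\<^sub>M borel" "\<lambda>p. X a (fst p)" "\<lambda>_. lam" b] by simp
    then show ?thesis unfolding q_eq split_beta' by measurable
  qed
  have "ito_increment M F m W a b G Za Zb lam Sa Sb q (K * (lam \<bullet> lam)) Z"
  proof
    show "q s \<omega> = (\<Sum>k<m. (lam \<bullet> G k s \<omega>)\<^sup>2)" if "a < s" "s < b" for s \<omega>
      using that kappa_eq[of \<tau> i s] \<tau> by (simp add: q_def sq_def G_def partition_seq_def)
    show "q s \<omega> \<le> K * (lam \<bullet> lam)" for s \<omega>
      using sq_bounds(2)[of s "X a \<omega>" lam] ab pos by (auto simp: q_def indicator_def)
    show "0 \<le> q s \<omega>" for s \<omega> using sq_bounds(3) by (simp add: q_def)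
  qed (use W ab Za Zb Sa Sb qm Z in \<open>auto simp: has_ito_integral_def approx_def\<close>)
  then interpret I: ito_increment M F m W a b G Za Zb lam Sa Sb q "K * (lam \<bullet> lam)" Z .
  have "(\<integral>\<omega>. Z \<omega> * cis (lam \<bullet> (X b \<omega> - X a \<omega>)) \<partial>M) = (\<integral>\<omega>. Z \<omega> * cis (I.Y \<omega>) \<partial>M)"
  proof (rule integral_cong_AE)
    have "AE \<omega> in M. lam \<bullet> (X b \<omega> - X a \<omega>) = I.Y \<omega>"
      using Za(2) Zb(2)
    proof eventually_elim
      fix \<omega> assume "X a \<omega> - x0 = (\<Sum>k<m. Za k \<omega>)" "X b \<omega> - x0 = (\<Sum>k<m. Zb k \<omega>)"
      moreover have "X b \<omega> - X a \<omega> = (X b \<omega> - x0) - (X a \<omega> - x0)" by simp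
      ultimately have "X b \<omega> - X a \<omega> = (\<Sum>k<m. Zb k \<omega>) - (\<Sum>k<m. Za k \<omega>)" by (simp only:)
      then show "lam \<bullet> (X b \<omega> - X a \<omega>) = I.Y \<omega>"
        by (simp add: I.Y_def sum_subtractf[symmetric] inner_sum_right)
    qed
    then show "AE \<omega> in M. Z \<omega> * cis (lam \<bullet> (X b \<omega> - X a \<omega>)) = Z \<omega> * cis (I.Y \<omega>)"
      by eventually_elim simp
    note [measurable] = I.ZM I.Ym
    show "(\<lambda>\<omega>. Z \<omega> * cis (lam \<bullet> (X b \<omega> - X a \<omega>))) \<in> borel_measurable M" by measurable
    show "(\<lambda>\<omega>. Z \<omega> * cis (I.Y \<omega>)) \<in> borel_measurable M" by measurable
  qed
  also have "\<dots> = (\<integral>\<omega>. Z \<omega> * complex_of_real (exp (- (LINT s:{a<..b}|lborel. q s \<omega>) / 2)) \<partial>M)"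
    by (rule I.ito_increment_char)
  also have "\<dots> = (\<integral>\<omega>. Z \<omega> * complex_of_real (exp (- cov a b (X a \<omega>) lam / 2)) \<partial>M)"
  proof -
    have "(LINT s:{a<..b}|lborel. q s \<omega>) = cov a b (X a \<omega>) lam" if om: "\<omega> \<in> space M" for \<omega>
      unfolding cov_def set_lebesgue_integral_def
    proof (rule integral_cong_AE)
      have m: "(\<lambda>s. indicat_real {a<..b} s * sq s (X a \<omega>) lam) \<in> borel_measurable lborel"
        using sq_measurable[OF ab(1), of "\<lambda>s. s" lborel "\<lambda>_. X a \<omega>" "\<lambda>_. lam" b] by simp
      then show "(\<lambda>s. indicat_real {a<..b} s *\<^sub>R sq s (X a \<omega>) lam) \<in> borel_measurable lborel" by simp
      show "(\<lambda>s. indicat_real {a<..b} s *\<^sub>R q s \<omega>) \<in> borel_measurable lborel"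
        unfolding q_eq using m by measurable
      have "AE s in lborel. s \<noteq> b" by (rule AE_lborel_singleton)
      then show "AE s in lborel. indicat_real {a<..b} s *\<^sub>R q s \<omega> = indicat_real {a<..b} s *\<^sub>R sq s (X a \<omega>) lam"
        by eventually_elim (auto simp: q_def indicator_def)
    qed
    then show ?thesis by (intro Bochner_Integration.integral_cong refl) (simp only:)
  qed
  finally show ?thesis .
qed

lemma smoothing_fubini:
  fixes Q :: "'w \<Rightarrow> real ^ 'd \<Rightarrow> real" and U :: "'w \<Rightarrow> real ^ 'd"
  assumes A: "A \<in> sets M" and s: "0 < s" and [measurable]: "U \<in> borel_measurable M"
    and Q[measurable]: "(\<lambda>(\<omega>, l). Q \<omega> l) \<in> borel_measurable (M \<Otimes>\<^sub>M lborel)" and Qnn: "\<And>\<omega> l. 0 \<le> Q \<omega> l"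
  shows "(\<integral>\<omega>. indicat_real A \<omega> * gdens (\<lambda>l. Q \<omega> l + s * (l \<bullet> l)) (U \<omega>) \<partial>M)
    = (1 / (2 * pi) ^ DIM(real ^ 'd)) * (\<integral>l. exp (- (s * (l \<bullet> l)) / 2) * (\<integral>\<omega>. indicat_real A \<omega> * (cos (l \<bullet> U \<omega>) * exp (- Q \<omega> l / 2)) \<partial>M) \<partial>lborel)"
proof -
  interpret PM: pair_sigma_finite M "lborel :: (real ^ 'd) measure" ..
  note [measurable] = A
  let ?H = "\<lambda>\<omega> l. exp (- (s * (l \<bullet> l)) / 2) * (indicat_real A \<omega> * (cos (l \<bullet> U \<omega>) * exp (- Q \<omega> l / 2)))"
  have Hm: "(\<lambda>(\<omega>, l). ?H \<omega> l) \<in> borel_measurable (M \<Otimes>\<^sub>M lborel)"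
    using Q by (simp add: split_beta')
  have Hb: "\<bar>?H \<omega> l\<bar> \<le> exp (- (s * (l \<bullet> l)) / 2)" for \<omega> l
  proof -
    have "\<bar>indicat_real A \<omega> * (cos (l \<bullet> U \<omega>) * exp (- Q \<omega> l / 2))\<bar> \<le> 1 * (1 * 1)"
      unfolding abs_mult using Qnn[of \<omega> l] by (intro mult_mono) auto
    then show ?thesis unfolding abs_mult by (simp add: mult_left_le)
  qed
  have iG: "integrable lborel (\<lambda>l::real ^ 'd. exp (- (s * (l \<bullet> l)) / 2))" by (rule iso_fourier(1)[OF s])
  have H: "integrable (M \<Otimes>\<^sub>M lborel) (\<lambda>(\<omega>, l). ?H \<omega> l)"
  proof (rule Bochner_Integration.integrable_bound)
    show "integrable (M \<Otimes>\<^sub>M lborel) (\<lambda>(\<omega>, l::real ^ 'd). exp (- (s * (l \<bullet> l)) / 2))"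
      by (rule PM.Fubini_integrable) (use iG in auto)
    show "AE p in M \<Otimes>\<^sub>M lborel. norm (case p of (\<omega>, l) \<Rightarrow> ?H \<omega> l) \<le> norm (case p of (\<omega>, l::real ^ 'd) \<Rightarrow> exp (- (s * (l \<bullet> l)) / 2))"
      using Hb by (intro AE_I2) (auto split: prod.split)
  qed (rule Hm)
  have "(\<integral>\<omega>. indicat_real A \<omega> * gdens (\<lambda>l. Q \<omega> l + s * (l \<bullet> l)) (U \<omega>) \<partial>M)
     = (\<integral>\<omega>. (1 / (2 * pi) ^ DIM(real ^ 'd)) * (\<integral>l. ?H \<omega> l \<partial>lborel) \<partial>M)"
  proof (intro Bochner_Integration.integral_cong refl)
    fix \<omega>
    have "cos (l \<bullet> U \<omega>) * exp (- (Q \<omega> l + s * (l \<bullet> l)) / 2) = exp (- (s * (l \<bullet> l)) / 2) * (cos (l \<bullet> U \<omega>) * exp (- Q \<omega> l / 2))" for l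
    proof -
      have "- (Q \<omega> l + s * (l \<bullet> l)) / 2 = - (s * (l \<bullet> l)) / 2 + - Q \<omega> l / 2" by simp
      then show ?thesis by (simp only: exp_add mult_ac)
    qed
    then have "indicat_real A \<omega> * gdens (\<lambda>l. Q \<omega> l + s * (l \<bullet> l)) (U \<omega>)
       = (1 / (2 * pi) ^ DIM(real ^ 'd)) * (indicat_real A \<omega> * (\<integral>l. exp (- (s * (l \<bullet> l)) / 2) * (cos (l \<bullet> U \<omega>) * exp (- Q \<omega> l / 2)) \<partial>lborel))"
      unfolding gdens_def by (simp only: mult_ac)
    also have "indicat_real A \<omega> * (\<integral>l. exp (- (s * (l \<bullet> l)) / 2) * (cos (l \<bullet> U \<omega>) * exp (- Q \<omega> l / 2)) \<partial>lborel) = (\<integral>l. ?H \<omega> l \<partial>lborel)"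
      by (subst integral_mult_right_zero[symmetric]) (simp only: mult.left_commute)
    finally show "indicat_real A \<omega> * gdens (\<lambda>l. Q \<omega> l + s * (l \<bullet> l)) (U \<omega>) = (1 / (2 * pi) ^ DIM(real ^ 'd)) * (\<integral>l. ?H \<omega> l \<partial>lborel)" .
  qed
  also have "\<dots> = (1 / (2 * pi) ^ DIM(real ^ 'd)) * (\<integral>\<omega>. (\<integral>l. ?H \<omega> l \<partial>lborel) \<partial>M)" by (rule integral_mult_right_zero)
  also have "(\<integral>\<omega>. (\<integral>l. ?H \<omega> l \<partial>lborel) \<partial>M) = (\<integral>l. (\<integral>\<omega>. ?H \<omega> l \<partial>M) \<partial>lborel)"
    by (rule PM.Fubini_integral[OF H, symmetric])
  also have "\<dots> = (\<integral>l. exp (- (s * (l \<bullet> l)) / 2) * (\<integral>\<omega>. indicat_real A \<omega> * (cos (l \<bullet> U \<omega>) * exp (- Q \<omega> l / 2)) \<partial>M) \<partial>lborel)"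
    by (simp only: integral_mult_right_zero)
  finally show ?thesis .
qed

text \<open>Integrating the characteristic function against \<open>exp (- s (l \<bullet> l) / 2)\<close> inverts the Fourier transform
  of the law after mollification, where all integrals converge absolutely.\<close>

lemma smoothed_law:
  assumes A: "A \<in> sets (F a)" and s: "0 < s"
  shows "(\<integral>\<omega>. indicat_real A \<omega> * iso_gdens s (y - X b \<omega>) \<partial>M)
    = (\<integral>\<omega>. indicat_real A \<omega> * gdens (\<lambda>l. cov a b (X a \<omega>) l + s * (l \<bullet> l)) (y - X a \<omega>) \<partial>M)"
proof -
  have AM: "A \<in> sets M" using A fil ab(1) by (auto simp: filtration_on_def subalgebra_def)
  note [measurable] = AM
  have eq: "(\<integral>\<omega>. indicat_real A \<omega> * (cos (l \<bullet> (y - X b \<omega>)) * exp (- 0 / 2)) \<partial>M)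
     = (\<integral>\<omega>. indicat_real A \<omega> * (cos (l \<bullet> (y - X a \<omega>)) * exp (- cov a b (X a \<omega>) l / 2)) \<partial>M)" for l
  proof -
    define Z where "Z \<omega> = complex_of_real (indicat_real A \<omega>) * cis (l \<bullet> (X a \<omega> - y))" for \<omega>
    have Zm: "Z \<in> borel_measurable (F a)" unfolding Z_def using A Xa by measurable
    have Zn: "norm (Z \<omega>) \<le> 1" for \<omega> by (simp add: Z_def norm_mult indicator_def)
    have ZM[measurable]: "Z \<in> borel_measurable M" using filtration_measurable_M[OF fil ab(1) Zm] .
    have [measurable]: "(\<lambda>\<omega>. cov a b (X a \<omega>) l) \<in> borel_measurable M" by (rule cov_measurable[OF ab(1)]) measurable
    have cn: "0 \<le> cov a b (X a \<omega>) l" for \<omega>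
      using cov_bounds(1)[OF ab(1) less_imp_le[OF ab(2)], of l "X a \<omega>"] pos ab
      by (intro order_trans[OF _ cov_bounds(1)[OF ab(1) less_imp_le[OF ab(2)]]] mult_nonneg_nonneg) auto
    have i1: "integrable M (\<lambda>\<omega>. Z \<omega> * cis (l \<bullet> (X b \<omega> - X a \<omega>)))"
      by (rule integrable_const_bound[of _ 1]) (use Zn in \<open>auto simp: norm_mult\<close>)
    have i2: "integrable M (\<lambda>\<omega>. Z \<omega> * complex_of_real (exp (- cov a b (X a \<omega>) l / 2)))"
      by (rule integrable_const_bound[of _ 1]) (use Zn cn in \<open>auto simp: norm_mult intro!: mult_le_one\<close>)
    have "(\<integral>\<omega>. indicat_real A \<omega> * (cos (l \<bullet> (y - X b \<omega>)) * exp (- 0 / 2)) \<partial>M) = (\<integral>\<omega>. Re (Z \<omega> * cis (l \<bullet> (X b \<omega> - X a \<omega>))) \<partial>M)"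
    proof (intro Bochner_Integration.integral_cong refl)
      fix \<omega>
      have "Z \<omega> * cis (l \<bullet> (X b \<omega> - X a \<omega>)) = complex_of_real (indicat_real A \<omega>) * cis (l \<bullet> (X a \<omega> - y) + l \<bullet> (X b \<omega> - X a \<omega>))"
        by (simp add: Z_def mult.assoc cis_mult)
      also have "l \<bullet> (X a \<omega> - y) + l \<bullet> (X b \<omega> - X a \<omega>) = - (l \<bullet> (y - X b \<omega>))" by (simp add: inner_diff_right)
      finally show "indicat_real A \<omega> * (cos (l \<bullet> (y - X b \<omega>)) * exp (- 0 / 2)) = Re (Z \<omega> * cis (l \<bullet> (X b \<omega> - X a \<omega>)))" by simp
    qed
    also have "\<dots> = Re (\<integral>\<omega>. Z \<omega> * cis (l \<bullet> (X b \<omega> - X a \<omega>)) \<partial>M)" by (rule integral_Re[OF i1])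
    also have "\<dots> = Re (\<integral>\<omega>. Z \<omega> * complex_of_real (exp (- cov a b (X a \<omega>) l / 2)) \<partial>M)"
      by (simp only: increment_char[OF Zm Zn])
    also have "\<dots> = (\<integral>\<omega>. Re (Z \<omega> * complex_of_real (exp (- cov a b (X a \<omega>) l / 2))) \<partial>M)" by (rule integral_Re[OF i2, symmetric])
    also have "\<dots> = (\<integral>\<omega>. indicat_real A \<omega> * (cos (l \<bullet> (y - X a \<omega>)) * exp (- cov a b (X a \<omega>) l / 2)) \<partial>M)"
    proof (intro Bochner_Integration.integral_cong refl)
      fix \<omega>
      have "l \<bullet> (X a \<omega> - y) = - (l \<bullet> (y - X a \<omega>))" by (simp add: inner_diff_right)
      then show "Re (Z \<omega> * complex_of_real (exp (- cov a b (X a \<omega>) l / 2)))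
         = indicat_real A \<omega> * (cos (l \<bullet> (y - X a \<omega>)) * exp (- cov a b (X a \<omega>) l / 2))"
        by (simp add: Z_def)
    qed
    finally show ?thesis .
  qed
  have cm: "(\<lambda>(\<omega>, l). cov a b (X a \<omega>) l) \<in> borel_measurable (M \<Otimes>\<^sub>M lborel)"
    unfolding split_beta' by (rule cov_measurable[OF ab(1)]) measurable
  have cn: "0 \<le> cov a b (X a \<omega>) l" for \<omega> l
    using pos ab by (intro order_trans[OF _ cov_bounds(1)[OF ab(1) less_imp_le[OF ab(2)]]] mult_nonneg_nonneg) auto
  have "(\<integral>\<omega>. indicat_real A \<omega> * iso_gdens s (y - X b \<omega>) \<partial>M)
    = (\<integral>\<omega>. indicat_real A \<omega> * gdens (\<lambda>l. 0 + s * (l \<bullet> l)) (y - X b \<omega>) \<partial>M)"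
    by (simp add: iso_fourier(2)[OF s])
  also have "\<dots> = (\<integral>\<omega>. indicat_real A \<omega> * gdens (\<lambda>l. cov a b (X a \<omega>) l + s * (l \<bullet> l)) (y - X a \<omega>) \<partial>M)"
    by (subst (1 2) smoothing_fubini[OF AM s]) (use cm cn in \<open>simp_all only: eq, simp_all\<close>)
  finally show ?thesis .
qed

lemma cov_lower: "\<epsilon> * (b - a) * (l \<bullet> l) \<le> cov a b x l"
  by (rule cov_bounds(1)[OF ab(1) less_imp_le[OF ab(2)]])

lemma eps_pos: "0 < \<epsilon> * (b - a)"
  using pos ab by simp

lemma dens_mass: "(\<integral>\<^sup>+y. ennreal (dens a b x y) \<partial>lborel) = 1"
proof -
  have "gdens (cov a b x) \<in> borel_measurable borel"
    by (rule gdens_measurable[OF qform_measurable[OF cov_qform[OF ab(1)]]])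
  then have "(\<integral>\<^sup>+y. ennreal (gdens (cov a b x) (y - x)) \<partial>lborel) = (\<integral>\<^sup>+y. ennreal (gdens (cov a b x) y) \<partial>lborel)"
    by (intro nn_integral_lborel_translate(2)) simp
  also have "\<dots> = 1" by (rule gdens_mass_one[OF eps_pos cov_qform[OF ab(1)] cov_lower])
  finally show ?thesis by (simp add: dens_def)
qed

lemma dens_smoothing:
  assumes s: "0 < s"
  shows "(\<integral>\<^sup>+x. ennreal (dens a b z x) * ennreal (iso_gdens s (y - x)) \<partial>lborel)
     = ennreal (gdens (\<lambda>l. cov a b z l + s * (l \<bullet> l)) (y - z))"
proof -
  have m[measurable]: "gdens (cov a b z) \<in> borel_measurable borel"
    by (rule gdens_measurable[OF qform_measurable[OF cov_qform[OF ab(1)]]])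
  have "(\<integral>\<^sup>+x. ennreal (dens a b z x) * ennreal (iso_gdens s (y - x)) \<partial>lborel)
    = (\<integral>\<^sup>+x. ennreal (gdens (cov a b z) (x - z)) * ennreal (iso_gdens s ((y - z) - (x - z))) \<partial>lborel)"
    by (simp add: dens_def)
  also have "\<dots> = (\<integral>\<^sup>+u. ennreal (gdens (cov a b z) u) * ennreal (iso_gdens s ((y - z) - u)) \<partial>lborel)"
    by (rule nn_integral_lborel_translate(2)) measurable
  also have "\<dots> = ennreal (gdens (\<lambda>l. cov a b z l + s * (l \<bullet> l)) (y - z))"
    using gdens_convolution[OF eps_pos cov_qform[OF ab(1)] cov_lower s qform_scaled_norm order_refl, of z "y - z"]
    by (simp add: iso_fourier(2)[OF s])
  finally show ?thesis .
qed

text \<open>Both sides are integrals of \<open>g\<close> against finite measures with the same Gaussian mollifications.\<close>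

lemma one_step_law_indicator:
  assumes A: "A \<in> sets (F a)" and g: "g \<in> borel_measurable borel"
  shows "(\<integral>\<^sup>+\<omega>. indicator A \<omega> * g (X b \<omega>) \<partial>M)
    = (\<integral>\<^sup>+\<omega>. indicator A \<omega> * (\<integral>\<^sup>+y. ennreal (dens a b (X a \<omega>) y) * g y \<partial>lborel) \<partial>M)"
proof -
  have AM[measurable]: "A \<in> sets M" using A fil ab(1) by (auto simp: filtration_on_def subalgebra_def)
  interpret PM: pair_sigma_finite M "lborel :: (real ^ 'd) measure" ..
  have dm[measurable]: "(\<lambda>p. dens a b (X a (fst p)) (snd p)) \<in> borel_measurable (M \<Otimes>\<^sub>M lborel)"
    by (rule dens_measurable[OF ab(1)]) measurable
  define \<nu>1 where "\<nu>1 = distr (density M (indicator A)) borel (X b)"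
  define h where "h y = (\<integral>\<^sup>+\<omega>. indicator A \<omega> * ennreal (dens a b (X a \<omega>) y) \<partial>M)" for y
  have hm[measurable]: "h \<in> borel_measurable lborel"
  proof -
    have "(\<lambda>(y, \<omega>). indicator A \<omega> * ennreal (dens a b (X a \<omega>) y)) \<in> borel_measurable (lborel \<Otimes>\<^sub>M M)"
      using measurable_compose[OF measurable_pair_swap' dm] by (simp add: split_beta')
    then show ?thesis unfolding h_def by (rule borel_measurable_nn_integral)
  qed
  define \<nu>2 where "\<nu>2 = density lborel h"
  have hint: "(\<integral>\<^sup>+y. h y * f y \<partial>lborel) = (\<integral>\<^sup>+\<omega>. indicator A \<omega> * (\<integral>\<^sup>+y. ennreal (dens a b (X a \<omega>) y) * f y \<partial>lborel) \<partial>M)"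
    if f[measurable]: "f \<in> borel_measurable borel" for f
  proof -
    have "(\<integral>\<^sup>+y. h y * f y \<partial>lborel) = (\<integral>\<^sup>+y. (\<integral>\<^sup>+\<omega>. indicator A \<omega> * ennreal (dens a b (X a \<omega>) y) * f y \<partial>M) \<partial>lborel)"
      unfolding h_def
    proof (intro nn_integral_cong nn_integral_multc[symmetric])
      fix y
      have [measurable]: "(\<lambda>\<omega>. dens a b (X a \<omega>) y) \<in> borel_measurable M" by (rule dens_measurable[OF ab(1)]) measurable
      show "(\<lambda>\<omega>. indicator A \<omega> * ennreal (dens a b (X a \<omega>) y)) \<in> borel_measurable M" by measurable
    qed
    also have "\<dots> = (\<integral>\<^sup>+\<omega>. (\<integral>\<^sup>+y. indicator A \<omega> * ennreal (dens a b (X a \<omega>) y) * f y \<partial>lborel) \<partial>M)"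
      by (rule PM.Fubini') (use dm in \<open>simp add: split_beta'\<close>)
    also have "\<dots> = (\<integral>\<^sup>+\<omega>. indicator A \<omega> * (\<integral>\<^sup>+y. ennreal (dens a b (X a \<omega>) y) * f y \<partial>lborel) \<partial>M)"
      by (intro nn_integral_cong) (auto simp: indicator_def)
    finally show ?thesis .
  qed
  have "\<nu>1 = \<nu>2"
  proof (rule measure_eqI_gaussian_smoothing)
    show "sets \<nu>1 = sets borel" "sets \<nu>2 = sets borel" by (simp_all add: \<nu>1_def \<nu>2_def)
    show "finite_measure \<nu>1"
    proof
      have "emeasure \<nu>1 (space \<nu>1) = emeasure M A"
        by (simp add: \<nu>1_def emeasure_distr emeasure_density)
      then show "emeasure \<nu>1 (space \<nu>1) \<noteq> \<infinity>" by simp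
    qed
    show "finite_measure \<nu>2"
    proof
      have "emeasure \<nu>2 (space \<nu>2) = (\<integral>\<^sup>+\<omega>. indicator A \<omega> * (\<integral>\<^sup>+y. ennreal (dens a b (X a \<omega>) y) * 1 \<partial>lborel) \<partial>M)"
        using hint[of "\<lambda>_. 1"] by (simp add: \<nu>2_def emeasure_density)
      also have "\<dots> = emeasure M A" by (simp add: dens_mass)
      finally show "emeasure \<nu>2 (space \<nu>2) \<noteq> \<infinity>" by simp
    qed
    fix s :: real and y assume s: "0 < s"
    have gm[measurable]: "(\<lambda>\<omega>. gdens (\<lambda>l. cov a b (X a \<omega>) l + s * (l \<bullet> l)) (y - X a \<omega>)) \<in> borel_measurable M"
    proof -
      have [measurable]: "(\<lambda>p. cov a b (X a (fst p)) (snd p)) \<in> borel_measurable (M \<Otimes>\<^sub>M lborel)"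
        by (rule cov_measurable[OF ab(1)]) measurable
      have "(\<lambda>(\<omega>, l). cos (l \<bullet> (y - X a \<omega>)) * exp (- (cov a b (X a \<omega>) l + s * (l \<bullet> l)) / 2)) \<in> borel_measurable (M \<Otimes>\<^sub>M lborel)"
        unfolding split_beta' by measurable
      then show ?thesis
        unfolding gdens_def by (intro borel_measurable_times borel_measurable_const lborel.borel_measurable_lebesgue_integral)
    qed
    have s2: "s * (l \<bullet> l) \<le> cov a b x l + s * (l \<bullet> l)" for x l
      using cov_lower[of l x] mult_nonneg_nonneg[OF less_imp_le[OF eps_pos], of "l \<bullet> l"] by simp
    have q2: "qform (\<lambda>l. cov a b x l + s * (l \<bullet> l))" for x
      by (intro qform_add cov_qform[OF ab(1)] qform_scaled_norm)
    have gnn: "0 \<le> gdens (\<lambda>l. cov a b x l + s * (l \<bullet> l)) v" for x v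
      by (rule gdens_nonneg[OF s q2 s2])
    have gle: "gdens (\<lambda>l. cov a b x l + s * (l \<bullet> l)) v \<le> iso_gdens s (0 :: real ^ 'd)" for x v
    proof -
      have "\<bar>gdens (\<lambda>l. cov a b x l + s * (l \<bullet> l)) v\<bar> \<le> gdens (\<lambda>l. cov a b x l + s * (l \<bullet> l)) 0"
        by (rule gdens_bounded[OF qform_measurable[OF q2] s s2])
      also have "\<dots> \<le> gdens (\<lambda>l. s * (l \<bullet> l)) (0 :: real ^ 'd)"
        unfolding gdens_def
        using gdens_integrable(1)[OF qform_measurable[OF q2] s s2, of x] iso_fourier(1)[OF s, where ?'a="real ^ 'd"] s2
        by (intro mult_left_mono Bochner_Integration.integral_mono) auto
      finally show ?thesis by (simp add: iso_fourier(2)[OF s])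
    qed
    have "(\<integral>\<^sup>+x. ennreal (iso_gdens s (y - x)) \<partial>\<nu>1) = (\<integral>\<^sup>+\<omega>. ennreal (indicat_real A \<omega> * iso_gdens s (y - X b \<omega>)) \<partial>M)"
      unfolding \<nu>1_def
      by (simp add: nn_integral_distr nn_integral_density ennreal_mult ennreal_indicator)
    also have "\<dots> = ennreal (\<integral>\<omega>. indicat_real A \<omega> * iso_gdens s (y - X b \<omega>) \<partial>M)"
    proof (rule nn_integral_eq_integral)
      have "iso_gdens s v \<le> iso_gdens s (0 :: real ^ 'd)" for v :: "real ^ 'd" using s by (simp add: iso_gdens_def)
      then show "integrable M (\<lambda>\<omega>. indicat_real A \<omega> * iso_gdens s (y - X b \<omega>))"
        by (intro integrable_const_bound[of _ "iso_gdens s (0 :: real ^ 'd)"]) (auto simp: indicator_def)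
    qed auto
    also have "(\<integral>\<omega>. indicat_real A \<omega> * iso_gdens s (y - X b \<omega>) \<partial>M)
       = (\<integral>\<omega>. indicat_real A \<omega> * gdens (\<lambda>l. cov a b (X a \<omega>) l + s * (l \<bullet> l)) (y - X a \<omega>) \<partial>M)"
      by (rule smoothed_law[OF A s])
    also have "ennreal \<dots> = (\<integral>\<^sup>+\<omega>. ennreal (indicat_real A \<omega> * gdens (\<lambda>l. cov a b (X a \<omega>) l + s * (l \<bullet> l)) (y - X a \<omega>)) \<partial>M)"
    proof (rule nn_integral_eq_integral[symmetric])
      show "integrable M (\<lambda>\<omega>. indicat_real A \<omega> * gdens (\<lambda>l. cov a b (X a \<omega>) l + s * (l \<bullet> l)) (y - X a \<omega>))"
        using gnn gle by (intro integrable_const_bound[of _ "iso_gdens s (0 :: real ^ 'd)"]) (auto simp: indicator_def)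
    qed (use gnn in auto)
    also have "\<dots> = (\<integral>\<^sup>+\<omega>. indicator A \<omega> * (\<integral>\<^sup>+x. ennreal (dens a b (X a \<omega>) x) * ennreal (iso_gdens s (y - x)) \<partial>lborel) \<partial>M)"
      by (intro nn_integral_cong) (simp add: dens_smoothing[OF s] ennreal_mult' ennreal_indicator gnn)
    also have "\<dots> = (\<integral>\<^sup>+x. h x * ennreal (iso_gdens s (y - x)) \<partial>lborel)"
      by (rule hint[symmetric]) measurable
    also have "\<dots> = (\<integral>\<^sup>+x. ennreal (iso_gdens s (y - x)) \<partial>\<nu>2)"
      unfolding \<nu>2_def by (simp add: nn_integral_density)
    finally show "(\<integral>\<^sup>+x. ennreal (iso_gdens s (y - x)) \<partial>\<nu>1) = (\<integral>\<^sup>+x. ennreal (iso_gdens s (y - x)) \<partial>\<nu>2)" .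
  qed
  note [measurable] = g
  have "(\<integral>\<^sup>+\<omega>. indicator A \<omega> * g (X b \<omega>) \<partial>M) = (\<integral>\<^sup>+x. g x \<partial>\<nu>1)"
    unfolding \<nu>1_def by (simp add: nn_integral_distr nn_integral_density)
  also have "\<dots> = (\<integral>\<^sup>+y. h y * g y \<partial>lborel)"
    unfolding \<open>\<nu>1 = \<nu>2\<close> \<nu>2_def by (simp add: nn_integral_density)
  also have "\<dots> = (\<integral>\<^sup>+\<omega>. indicator A \<omega> * (\<integral>\<^sup>+y. ennreal (dens a b (X a \<omega>) y) * g y \<partial>lborel) \<partial>M)"
    by (rule hint[OF g])
  finally show ?thesis .
qed

theorem one_step_law:
  fixes Z :: "'w \<Rightarrow> ennreal"
  assumes Z: "Z \<in> borel_measurable (F a)" and g[measurable]: "g \<in> borel_measurable borel"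
  shows "(\<integral>\<^sup>+\<omega>. Z \<omega> * g (X b \<omega>) \<partial>M)
    = (\<integral>\<^sup>+\<omega>. Z \<omega> * (\<integral>\<^sup>+y. ennreal (dens a b (X a \<omega>) y) * g y \<partial>lborel) \<partial>M)"
proof -
  define k where "k \<omega> = (\<integral>\<^sup>+y. ennreal (dens a b (X a \<omega>) y) * g y \<partial>lborel)" for \<omega>
  have km[measurable]: "k \<in> borel_measurable M"
  proof -
    have [measurable]: "(\<lambda>p. dens a b (X a (fst p)) (snd p)) \<in> borel_measurable (M \<Otimes>\<^sub>M lborel)"
      by (rule dens_measurable[OF ab(1)]) measurable
    have "(\<lambda>(\<omega>, y). ennreal (dens a b (X a \<omega>) y) * g y) \<in> borel_measurable (M \<Otimes>\<^sub>M lborel)"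
      unfolding split_beta' by measurable
    then show ?thesis unfolding k_def by (rule lborel.borel_measurable_nn_integral)
  qed
  have toM: "Y \<in> borel_measurable M" if "Y \<in> borel_measurable (F a)" for Y :: "'w \<Rightarrow> ennreal"
    using filtration_measurable_M[OF fil ab(1) that] .
  have sp: "space (F a) = space M" using fil ab(1) by (auto simp: filtration_on_def subalgebra_def)
  from Z show ?thesis unfolding k_def[symmetric]
  proof (induction rule: borel_measurable_induct)
    case (cong f h)
    then have "\<And>\<omega>. \<omega> \<in> space M \<Longrightarrow> f \<omega> = h \<omega>" using sp by simp
    then show ?case using cong(4) by (simp cong: nn_integral_cong)
  next
    case (set A)
    then show ?case using one_step_law_indicator[OF set g] by (simp add: k_def)
  next
    case (mult u c)
    note [measurable] = toM[OF mult(2)]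
    show ?case using mult(4) by (simp add: mult.assoc nn_integral_cmult)
  next
    case (add u v)
    have "u \<in> borel_measurable (F a)" "v \<in> borel_measurable (F a)" using add by blast+
    note [measurable] = this[THEN toM]
    show ?case using add by (simp add: distrib_right nn_integral_add)
  next
    case (seq U)
    have Um: "U i \<in> borel_measurable M" for i using toM seq by blast
    have sup: "(\<integral>\<^sup>+\<omega>. (SUP i. U i) \<omega> * f \<omega> \<partial>M) = (SUP i. \<integral>\<^sup>+\<omega>. U i \<omega> * f \<omega> \<partial>M)"
      if [measurable]: "f \<in> borel_measurable M" for f
    proof -
      note [measurable] = Um
      have "(\<integral>\<^sup>+\<omega>. (SUP i. U i) \<omega> * f \<omega> \<partial>M) = (\<integral>\<^sup>+\<omega>. (SUP i. U i \<omega> * f \<omega>) \<partial>M)"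
        by (simp add: SUP_mult_right_ennreal image_comp)
      also have "\<dots> = (SUP i. \<integral>\<^sup>+\<omega>. U i \<omega> * f \<omega> \<partial>M)"
        by (rule nn_integral_monotone_convergence_SUP)
           (use \<open>incseq U\<close> in \<open>auto simp: incseq_def le_fun_def intro!: mult_right_mono\<close>)
      finally show ?thesis .
    qed
    have gX: "(\<lambda>\<omega>. g (X b \<omega>)) \<in> borel_measurable M" by measurable
    have "(\<integral>\<^sup>+\<omega>. U i \<omega> * g (X b \<omega>) \<partial>M) = (\<integral>\<^sup>+\<omega>. U i \<omega> * k \<omega> \<partial>M)" for i
      using seq by blast
    then show ?case unfolding sup[OF km] sup[OF gX] by (simp only:)
  qed
qed

end

section \<open>Powers, kernels and sums over a partition\<close>

lemma ennreal_powr_real: "0 \<le> x \<Longrightarrow> ennreal_powr (ennreal x) a = ennreal (x powr a)"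
  by (simp add: ennreal_powr_def)

lemma ennreal_powr_top [simp]: "ennreal_powr \<top> a = \<top>"
  by (simp add: ennreal_powr_def)

lemma ennreal_powr_measurable [measurable]: "(\<lambda>x. ennreal_powr x a) \<in> borel_measurable borel"
  unfolding ennreal_powr_def by measurable

lemma ennreal_powr_mono:
  assumes "x \<le> y" "0 \<le> a"
  shows "ennreal_powr x a \<le> ennreal_powr y a"
proof (cases y)
  case (real r)
  with assms obtain s where "x = ennreal s" "0 \<le> s" "s \<le> r" by (cases x) (auto simp: top_unique)
  then show ?thesis using real assms by (auto simp: ennreal_powr_real intro!: ennreal_leI powr_mono2)
qed simp

lemma ennreal_powr_powr_inverse:
  assumes "0 < a"
  shows "ennreal_powr (ennreal_powr x (1 / a)) a = x"
proof (cases x)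
  case (real r)
  then show ?thesis using assms by (simp add: ennreal_powr_real powr_powr)
qed simp

text \<open>The convex function \<open>x powr p\<close> lies above its tangent at \<open>c\<close>. Choosing the point of tangency
  afterwards makes this a substitute for the inequalities of Jensen and Hoelder.\<close>

lemma power_tangent:
  fixes x c p :: real
  assumes p: "1 < p" and x: "0 \<le> x" and c: "0 < c"
  shows "x \<le> (p - 1) / p * c + c powr (1 - p) / p * x powr p"
proof -
  define q where "q = p / (p - 1)"
  have pq: "1 / p + 1 / q = 1" using p by (simp add: q_def field_simps)
  have q: "1 < q" using p by (simp add: q_def)
  define a b where "a = x * c powr (- ((p - 1) / p))" and "b = c powr ((p - 1) / p)"
  have "a * b \<le> a powr p / p + b powr q / q"
    by (rule Youngs_inequality) (use p q pq x in \<open>auto simp: a_def b_def\<close>)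
  also have "a * b = x" using c by (simp add: a_def b_def mult.assoc flip: powr_add)
  also have "a powr p = x powr p * c powr (1 - p)"
    using x c p by (simp add: a_def powr_mult powr_powr)
  also have "b powr q = c" using c p by (simp add: b_def powr_powr q_def)
  finally show ?thesis using p by (simp add: q_def field_simps)
qed

lemma ennreal_power_tangent:
  assumes p: "1 < p" and c: "0 < c"
  shows "x \<le> ennreal ((p - 1) / p * c) + ennreal (c powr (1 - p) / p) * ennreal_powr x p"
proof (cases x)
  case (real r)
  have "ennreal r \<le> ennreal ((p - 1) / p * c + c powr (1 - p) / p * r powr p)"
    by (rule ennreal_leI[OF power_tangent[OF p real(1) c]])
  also have "\<dots> = ennreal ((p - 1) / p * c) + ennreal (c powr (1 - p) / p * r powr p)"
    by (rule ennreal_plus) (use p c in auto)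
  also have "ennreal (c powr (1 - p) / p * r powr p) = ennreal (c powr (1 - p) / p) * ennreal (r powr p)"
    by (rule ennreal_mult) (use p in auto)
  finally show ?thesis using real by (simp add: ennreal_powr_real)
next
  case top
  then show ?thesis using p c by (simp add: ennreal_mult_top)
qed

lemma kernel_average_le:
  fixes f :: "'a::euclidean_space \<Rightarrow> real" and g :: "'a \<Rightarrow> ennreal"
  assumes p: "1 < p" and f[measurable]: "f \<in> borel_measurable borel" and mass: "(\<integral>\<^sup>+y. ennreal (f y) \<partial>lborel) = 1"
    and g[measurable]: "g \<in> borel_measurable borel" and c: "0 < c"
    and le: "(\<integral>\<^sup>+y. ennreal (f y) * ennreal_powr (g y) p \<partial>lborel) \<le> ennreal (c powr p)"
  shows "(\<integral>\<^sup>+y. ennreal (f y) * g y \<partial>lborel) \<le> ennreal c"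
proof -
  have "(\<integral>\<^sup>+y. ennreal (f y) * g y \<partial>lborel)
     \<le> (\<integral>\<^sup>+y. ennreal ((p - 1) / p * c) * ennreal (f y) + ennreal (c powr (1 - p) / p) * (ennreal (f y) * ennreal_powr (g y) p) \<partial>lborel)"
  proof (rule nn_integral_mono)
    fix y
    show "ennreal (f y) * g y \<le> ennreal ((p - 1) / p * c) * ennreal (f y) + ennreal (c powr (1 - p) / p) * (ennreal (f y) * ennreal_powr (g y) p)"
      using mult_left_mono[OF ennreal_power_tangent[OF p c, of "g y"], of "ennreal (f y)"]
      by (simp add: distrib_left mult_ac)
  qed
  also have "\<dots> = ennreal ((p - 1) / p * c) + ennreal (c powr (1 - p) / p) * (\<integral>\<^sup>+y. ennreal (f y) * ennreal_powr (g y) p \<partial>lborel)"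
    by (simp add: nn_integral_add nn_integral_cmult mass)
  also have "\<dots> \<le> ennreal ((p - 1) / p * c) + ennreal (c powr (1 - p) / p) * ennreal (c powr p)"
    by (intro add_left_mono mult_left_mono le) auto
  also have "\<dots> = ennreal ((p - 1) / p * c + c powr (1 - p) / p * c powr p)"
  proof -
    have "ennreal (c powr (1 - p) / p * c powr p) = ennreal (c powr (1 - p) / p) * ennreal (c powr p)"
      by (rule ennreal_mult) (use p in auto)
    moreover have "ennreal ((p - 1) / p * c + c powr (1 - p) / p * c powr p)
      = ennreal ((p - 1) / p * c) + ennreal (c powr (1 - p) / p * c powr p)"
      by (rule ennreal_plus) (use p c in auto)
    ultimately show ?thesis by (simp only:)
  qed
  also have "(p - 1) / p * c + c powr (1 - p) / p * c powr p = c"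
  proof -
    have "c powr (1 - p) * c powr p = c" using c by (simp flip: powr_add)
    then have "c powr (1 - p) / p * c powr p = c / p" by simp
    then show ?thesis using p by (simp add: field_simps)
  qed
  finally show ?thesis .
qed

lemma kernel_jensen:
  fixes f :: "'a::euclidean_space \<Rightarrow> real" and g :: "'a \<Rightarrow> ennreal"
  assumes p: "1 < p" and f[measurable]: "f \<in> borel_measurable borel" and mass: "(\<integral>\<^sup>+y. ennreal (f y) \<partial>lborel) = 1"
    and g[measurable]: "g \<in> borel_measurable borel"
  shows "ennreal_powr (\<integral>\<^sup>+y. ennreal (f y) * g y \<partial>lborel) p \<le> (\<integral>\<^sup>+y. ennreal (f y) * ennreal_powr (g y) p \<partial>lborel)"
    (is "ennreal_powr ?I p \<le> ?J")
proof (cases ?J)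
  case (real r)
  have *: "ennreal_powr ?I p \<le> ennreal s" if "r < s" for s
  proof -
    have s: "0 < s" using real that by simp
    have "?I \<le> ennreal (s powr (1 / p))"
      by (rule kernel_average_le[OF p f mass g]) (use s p that real in \<open>auto simp: powr_powr intro!: ennreal_leI\<close>)
    then have "ennreal_powr ?I p \<le> ennreal_powr (ennreal (s powr (1 / p))) p"
      using p by (intro ennreal_powr_mono) auto
    then show ?thesis using p s by (simp add: ennreal_powr_real powr_powr)
  qed
  then obtain z where z: "ennreal_powr ?I p = ennreal z" "0 \<le> z"
    using *[of "r + 1"] by (cases "ennreal_powr ?I p") (auto simp: top_unique)
  have "z \<le> r"
  proof (rule dense_ge)
    fix s assume "r < s"
    then show "z \<le> s" using *[of s] real by (auto simp: z ennreal_le_iff)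
  qed
  then show ?thesis using real z by (simp add: ennreal_leI)
qed simp

lemma convolution_Lp_contraction:
  fixes f :: "'a::euclidean_space \<Rightarrow> real" and g :: "'a \<Rightarrow> ennreal"
  assumes p: "1 < p" and f[measurable]: "f \<in> borel_measurable borel" and mass: "(\<integral>\<^sup>+y. ennreal (f y) \<partial>lborel) = 1"
    and g[measurable]: "g \<in> borel_measurable borel"
  shows "(\<integral>\<^sup>+x. ennreal_powr (\<integral>\<^sup>+y. ennreal (f (y - x)) * g y \<partial>lborel) p \<partial>lborel) \<le> (\<integral>\<^sup>+y. ennreal_powr (g y) p \<partial>lborel)"
proof -
  have m1: "(\<integral>\<^sup>+y. ennreal (f (y - x)) \<partial>lborel) = 1" for x
    using nn_integral_lborel_translate(2)[of "\<lambda>y. ennreal (f y)" x] mass by simp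
  have m2: "(\<integral>\<^sup>+x. ennreal (f (y - x)) \<partial>lborel) = 1" for y
    using nn_integral_lborel_translate(3)[of "\<lambda>y. ennreal (f y)" y] mass by simp
  have "(\<integral>\<^sup>+x. ennreal_powr (\<integral>\<^sup>+y. ennreal (f (y - x)) * g y \<partial>lborel) p \<partial>lborel)
     \<le> (\<integral>\<^sup>+x. (\<integral>\<^sup>+y. ennreal (f (y - x)) * ennreal_powr (g y) p \<partial>lborel) \<partial>lborel)"
    by (intro nn_integral_mono kernel_jensen[OF p _ m1 g]) measurable
  also have "\<dots> = (\<integral>\<^sup>+y. (\<integral>\<^sup>+x. ennreal (f (y - x)) * ennreal_powr (g y) p \<partial>lborel) \<partial>lborel)"
    by (rule lborel_pair.Fubini') measurable
  also have "\<dots> = (\<integral>\<^sup>+y. ennreal_powr (g y) p \<partial>lborel)"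
    by (intro nn_integral_cong) (simp add: nn_integral_multc m2)
  finally show ?thesis .
qed

text \<open>The norm of convolution with a probability density bounded by \<open>B\<close>, from \<open>L\<^sub>p\<close> into bounded
  functions.\<close>

lemma convolution_sup_bound:
  fixes f :: "'a::euclidean_space \<Rightarrow> real" and g :: "'a \<Rightarrow> ennreal"
  assumes p: "1 < p" and f[measurable]: "f \<in> borel_measurable borel" and mass: "(\<integral>\<^sup>+y. ennreal (f y) \<partial>lborel) = 1"
    and fB: "\<And>y. f y \<le> B" and B: "0 < B"
    and g[measurable]: "g \<in> borel_measurable borel" and c: "0 < c"
    and gc: "(\<integral>\<^sup>+y. ennreal_powr (g y) p \<partial>lborel) \<le> ennreal (c powr p)"
  shows "(\<integral>\<^sup>+y. ennreal (f (y - x)) * g y \<partial>lborel) \<le> ennreal (B powr (1 / p) * c)"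
proof (rule kernel_average_le[OF p _ _ g])
  show "(\<integral>\<^sup>+y. ennreal (f (y - x)) \<partial>lborel) = 1"
    using nn_integral_lborel_translate(2)[of "\<lambda>y. ennreal (f y)" x] mass by simp
  have "(\<integral>\<^sup>+y. ennreal (f (y - x)) * ennreal_powr (g y) p \<partial>lborel) \<le> (\<integral>\<^sup>+y. ennreal B * ennreal_powr (g y) p \<partial>lborel)"
    by (intro nn_integral_mono mult_right_mono ennreal_leI fB) auto
  also have "\<dots> = ennreal B * (\<integral>\<^sup>+y. ennreal_powr (g y) p \<partial>lborel)" by (rule nn_integral_cmult) measurable
  also have "\<dots> \<le> ennreal B * ennreal (c powr p)" by (intro mult_left_mono gc) auto
  also have "\<dots> = ennreal ((B powr (1 / p) * c) powr p)"
    using B c p by (simp add: powr_mult powr_powr ennreal_mult')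
  finally show "(\<integral>\<^sup>+y. ennreal (f (y - x)) * ennreal_powr (g y) p \<partial>lborel) \<le> ennreal ((B powr (1 / p) * c) powr p)" .
qed (use B c in auto)

lemma concave_power_step:
  fixes x y \<gamma> :: real
  assumes "0 \<le> y" "y \<le> x" "0 < x" "0 < \<gamma>" "\<gamma> \<le> 1"
  shows "(x - y) * x powr (\<gamma> - 1) \<le> (x powr \<gamma> - y powr \<gamma>) / \<gamma>"
proof -
  have "(y / x) powr \<gamma> * 1 powr (1 - \<gamma>) \<le> \<gamma> * (y / x) + (1 - \<gamma>) * 1"
  proof (cases "y = 0")
    case False
    then show ?thesis using assms by (intro Youngs_inequality_0) auto
  qed (use assms in auto)
  then have "(y / x) powr \<gamma> \<le> 1 - \<gamma> * (1 - y / x)" by (simp add: algebra_simps)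
  then have "(y / x) powr \<gamma> * x powr \<gamma> \<le> (1 - \<gamma> * (1 - y / x)) * x powr \<gamma>" by (intro mult_right_mono) auto
  moreover have "(y / x) powr \<gamma> * x powr \<gamma> = y powr \<gamma>" using assms by (simp add: powr_divide)
  moreover have "x powr \<gamma> = x * x powr (\<gamma> - 1)" using assms by (simp add: powr_diff)
  moreover have "(1 - y / x) * (x * x powr (\<gamma> - 1)) = (x - y) * x powr (\<gamma> - 1)"
  proof -
    have "(1 - y / x) * x = x - y" using assms by (simp add: field_simps)
    then show ?thesis by (simp only: mult.assoc[symmetric])
  qed
  ultimately have "\<gamma> * ((x - y) * x powr (\<gamma> - 1)) \<le> x powr \<gamma> - y powr \<gamma>"
    by (simp add: left_diff_distrib mult.assoc)
  then show ?thesis using assms by (simp add: pos_le_divide_eq mult.commute)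
qed

lemma backward_power_sum:
  fixes t :: "nat \<Rightarrow> real"
  assumes t: "\<And>l. i \<le> l \<Longrightarrow> l < j \<Longrightarrow> t l < t (Suc l)" and \<gamma>: "0 < \<gamma>" "\<gamma> \<le> 1" and ij: "i \<le> j"
  shows "(\<Sum>l\<in>{i..<j}. (t (Suc l) - t l) * (t j - t l) powr (\<gamma> - 1)) \<le> (t j - t i) powr \<gamma> / \<gamma>"
proof -
  have mono: "t l \<le> t j" if "i \<le> l" "l \<le> j" for l
    using that(2,1) by (induction rule: inc_induct) (auto intro: order_trans less_imp_le t)
  have "(\<Sum>l\<in>{i..<j}. (t (Suc l) - t l) * (t j - t l) powr (\<gamma> - 1))
     \<le> (\<Sum>l\<in>{i..<j}. - ((t j - t (Suc l)) powr \<gamma> / \<gamma>) - (- ((t j - t l) powr \<gamma> / \<gamma>)))"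
  proof (rule sum_mono)
    fix l assume l: "l \<in> {i..<j}"
    then have "t l < t (Suc l)" "t (Suc l) \<le> t j" using t mono by auto
    then show "(t (Suc l) - t l) * (t j - t l) powr (\<gamma> - 1) \<le> - ((t j - t (Suc l)) powr \<gamma> / \<gamma>) - (- ((t j - t l) powr \<gamma> / \<gamma>))"
      using concave_power_step[of "t j - t (Suc l)" "t j - t l" \<gamma>] \<gamma> by (simp add: diff_divide_distrib)
  qed
  also have "\<dots> = - ((t j - t j) powr \<gamma> / \<gamma>) - (- ((t j - t i) powr \<gamma> / \<gamma>))"
    by (rule sum_Suc_diff'[OF ij])
  finally show ?thesis by simp
qed

text \<open>The summand \<open>l = i\<close> would be singular and is left out. A step is at most \<open>\<rho>\<close> times its predecessor,
  over which \<open>(s - t i) powr (- \<beta>)\<close> is at least its value at the right end point.\<close>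

lemma forward_power_sum:
  fixes t :: "nat \<Rightarrow> real"
  assumes t: "\<And>l. i \<le> l \<Longrightarrow> l < j \<Longrightarrow> t l < t (Suc l)" and b: "0 \<le> \<beta>" "\<beta> < 1" and ij: "i < j"
    and \<rho>: "0 \<le> \<rho>" "\<And>l. i \<le> l \<Longrightarrow> Suc l < j \<Longrightarrow> t (Suc (Suc l)) - t (Suc l) \<le> \<rho> * (t (Suc l) - t l)"
  shows "(\<Sum>l\<in>{Suc i..<j}. (t (Suc l) - t l) * (t l - t i) powr (- \<beta>)) \<le> \<rho> * ((t j - t i) powr (1 - \<beta>) / (1 - \<beta>))"
proof -
  have mono: "t l \<le> t l'" if "i \<le> l" "l \<le> l'" "l' \<le> j" for l l'
    using that(2,1,3)
  proof (induction rule: dec_induct)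
    case (step n)
    then have "t l \<le> t n" "t n < t (Suc n)" using t[of n] by auto
    then show ?case by simp
  qed simp
  have "(\<Sum>l\<in>{Suc i..<j}. (t (Suc l) - t l) * (t l - t i) powr (- \<beta>))
     = (\<Sum>l\<in>{i..<j - 1}. (t (Suc (Suc l)) - t (Suc l)) * (t (Suc l) - t i) powr (- \<beta>))"
    using sum.shift_bounds_Suc_ivl[of "\<lambda>l. (t (Suc l) - t l) * (t l - t i) powr (- \<beta>)" i "j - 1"] ij by simp
  also have "\<dots> \<le> (\<Sum>l\<in>{i..<j - 1}. \<rho> * ((t (Suc l) - t i) powr (1 - \<beta>) / (1 - \<beta>)) - \<rho> * ((t l - t i) powr (1 - \<beta>) / (1 - \<beta>)))"
  proof (rule sum_mono)
    fix l assume l: "l \<in> {i..<j - 1}"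
    then have l': "i \<le> l" "Suc l < j" by auto
    have "(t (Suc (Suc l)) - t (Suc l)) * (t (Suc l) - t i) powr (- \<beta>)
        \<le> \<rho> * (t (Suc l) - t l) * (t (Suc l) - t i) powr (- \<beta>)"
      by (intro mult_right_mono \<rho>(2) l') auto
    also have "\<dots> = \<rho> * ((t (Suc l) - t l) * (t (Suc l) - t i) powr (- \<beta>))" by simp
    also have "\<dots> \<le> \<rho> * (((t (Suc l) - t i) powr (1 - \<beta>) - (t l - t i) powr (1 - \<beta>)) / (1 - \<beta>))"
    proof (rule mult_left_mono[OF _ \<rho>(1)])
      have "t i \<le> t l" "t l < t (Suc l)" using mono[of i l] t[of l] l' by auto
      then show "(t (Suc l) - t l) * (t (Suc l) - t i) powr (- \<beta>) \<le> ((t (Suc l) - t i) powr (1 - \<beta>) - (t l - t i) powr (1 - \<beta>)) / (1 - \<beta>)"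
        using concave_power_step[of "t l - t i" "t (Suc l) - t i" "1 - \<beta>"] b by simp
    qed
    finally show "(t (Suc (Suc l)) - t (Suc l)) * (t (Suc l) - t i) powr (- \<beta>)
      \<le> \<rho> * ((t (Suc l) - t i) powr (1 - \<beta>) / (1 - \<beta>)) - \<rho> * ((t l - t i) powr (1 - \<beta>) / (1 - \<beta>))"
      by (simp add: diff_divide_distrib right_diff_distrib)
  qed
  also have "\<dots> = \<rho> * ((t (j - 1) - t i) powr (1 - \<beta>) / (1 - \<beta>)) - \<rho> * ((t i - t i) powr (1 - \<beta>) / (1 - \<beta>))"
    using ij by (intro sum_Suc_diff') simp
  also have "\<dots> \<le> \<rho> * ((t j - t i) powr (1 - \<beta>) / (1 - \<beta>))"
    using mono[of i "j - 1"] mono[of "j - 1" j] ij b \<rho>(1)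
    by (auto intro!: mult_left_mono divide_right_mono powr_mono2)
  finally show ?thesis .
qed

text \<open>A discrete Beta integral. At each \<open>l\<close> one of the two distances is at least half of \<open>t j - t i\<close>, which
  takes that power out of the sum and leaves one of the two sums above.\<close>

lemma beta_type_sum:
  fixes t :: "nat \<Rightarrow> real"
  assumes t: "\<And>l. i \<le> l \<Longrightarrow> l < j \<Longrightarrow> t l < t (Suc l)" and b: "0 \<le> \<beta>" "\<beta> < 1" and \<gamma>: "0 < \<gamma>" "\<gamma> \<le> 1" and ij: "i < j"
    and \<rho>: "0 \<le> \<rho>" "\<And>l. i \<le> l \<Longrightarrow> Suc l < j \<Longrightarrow> t (Suc (Suc l)) - t (Suc l) \<le> \<rho> * (t (Suc l) - t l)"
  shows "(\<Sum>l\<in>{Suc i..<j}. (t (Suc l) - t l) * (t j - t l) powr (\<gamma> - 1) * (t l - t i) powr (- \<beta>))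
     \<le> (2 / \<gamma> + 2 * \<rho> / (1 - \<beta>)) * (t j - t i) powr (\<gamma> - \<beta>)"
proof -
  have mono: "t l < t l'" if "i \<le> l" "l < l'" "l' \<le> j" for l l'
    using that(2,1,3) by (induction rule: less_Suc_induct) (auto intro: t)
  define \<tau> where "\<tau> = t j - t i"
  have \<tau>: "0 < \<tau>" using mono[of i j] ij by (simp add: \<tau>_def)
  have summand: "(t (Suc l) - t l) * (t j - t l) powr (\<gamma> - 1) * (t l - t i) powr (- \<beta>)
     \<le> 2 * \<tau> powr (- \<beta>) * ((t (Suc l) - t l) * (t j - t l) powr (\<gamma> - 1))
      + 2 * \<tau> powr (\<gamma> - 1) * ((t (Suc l) - t l) * (t l - t i) powr (- \<beta>))" if l: "l \<in> {Suc i..<j}" for l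
  proof -
    have h: "0 < t (Suc l) - t l" and x: "0 < t j - t l" and y: "0 < t l - t i"
      using mono[of l "Suc l"] mono[of l j] mono[of i l] l by auto
    have half: "(\<tau> / 2) powr (- e) \<le> 2 * \<tau> powr (- e)" if "0 \<le> e" "e \<le> 1" for e
    proof -
      have "(\<tau> / 2) powr (- e) = 2 powr e * \<tau> powr (- e)"
        using \<tau> by (simp add: powr_divide powr_minus field_simps)
      also have "\<dots> \<le> 2 powr 1 * \<tau> powr (- e)" using that by (intro mult_right_mono powr_mono) auto
      finally show ?thesis by simp
    qed
    show ?thesis
    proof (cases "\<tau> / 2 \<le> t l - t i")
      case True
      have "(t l - t i) powr (- \<beta>) \<le> (\<tau> / 2) powr (- \<beta>)"
        using True \<tau> b by (intro powr_mono2') auto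
      also have "\<dots> \<le> 2 * \<tau> powr (- \<beta>)" using b by (intro half) auto
      finally have "(t (Suc l) - t l) * (t j - t l) powr (\<gamma> - 1) * (t l - t i) powr (- \<beta>)
          \<le> (t (Suc l) - t l) * (t j - t l) powr (\<gamma> - 1) * (2 * \<tau> powr (- \<beta>))"
        using h by (intro mult_left_mono) auto
      also have "\<dots> = 2 * \<tau> powr (- \<beta>) * ((t (Suc l) - t l) * (t j - t l) powr (\<gamma> - 1))" by simp
      finally show ?thesis using h by (intro add_increasing2) auto
    next
      case False
      then have "\<tau> / 2 \<le> t j - t l" by (simp add: \<tau>_def field_simps)
      then have "(t j - t l) powr (\<gamma> - 1) \<le> (\<tau> / 2) powr (\<gamma> - 1)"
        using \<tau> \<gamma> by (intro powr_mono2') auto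
      also have "\<dots> \<le> 2 * \<tau> powr (\<gamma> - 1)" using half[of "1 - \<gamma>"] \<gamma> by simp
      finally have "(t j - t l) powr (\<gamma> - 1) * ((t (Suc l) - t l) * (t l - t i) powr (- \<beta>))
          \<le> 2 * \<tau> powr (\<gamma> - 1) * ((t (Suc l) - t l) * (t l - t i) powr (- \<beta>))"
        using h by (intro mult_right_mono) auto
      then show ?thesis using h by (intro add_increasing) (auto simp: mult_ac)
    qed
  qed
  have "(\<Sum>l\<in>{Suc i..<j}. (t (Suc l) - t l) * (t j - t l) powr (\<gamma> - 1) * (t l - t i) powr (- \<beta>))
     \<le> (\<Sum>l\<in>{Suc i..<j}. 2 * \<tau> powr (- \<beta>) * ((t (Suc l) - t l) * (t j - t l) powr (\<gamma> - 1))
      + 2 * \<tau> powr (\<gamma> - 1) * ((t (Suc l) - t l) * (t l - t i) powr (- \<beta>)))"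
    by (rule sum_mono[OF summand])
  also have "\<dots> = 2 * \<tau> powr (- \<beta>) * (\<Sum>l\<in>{Suc i..<j}. (t (Suc l) - t l) * (t j - t l) powr (\<gamma> - 1))
      + 2 * \<tau> powr (\<gamma> - 1) * (\<Sum>l\<in>{Suc i..<j}. (t (Suc l) - t l) * (t l - t i) powr (- \<beta>))"
    by (simp add: sum.distrib sum_distrib_left)
  also have "\<dots> \<le> 2 * \<tau> powr (- \<beta>) * (\<tau> powr \<gamma> / \<gamma>) + 2 * \<tau> powr (\<gamma> - 1) * (\<rho> * (\<tau> powr (1 - \<beta>) / (1 - \<beta>)))"
  proof (intro add_mono mult_left_mono)
    have "(\<Sum>l\<in>{Suc i..<j}. (t (Suc l) - t l) * (t j - t l) powr (\<gamma> - 1)) \<le> (t j - t (Suc i)) powr \<gamma> / \<gamma>"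
      by (rule backward_power_sum) (use t \<gamma> ij in auto)
    also have "\<dots> \<le> \<tau> powr \<gamma> / \<gamma>"
    proof -
      have "t (Suc i) \<le> t j" using mono[of "Suc i" j] ij by (cases "Suc i = j") auto
      then show ?thesis using t[of i] ij \<gamma> unfolding \<tau>_def by (intro divide_right_mono powr_mono2) auto
    qed
    finally show "(\<Sum>l\<in>{Suc i..<j}. (t (Suc l) - t l) * (t j - t l) powr (\<gamma> - 1)) \<le> \<tau> powr \<gamma> / \<gamma>" .
    show "(\<Sum>l\<in>{Suc i..<j}. (t (Suc l) - t l) * (t l - t i) powr (- \<beta>)) \<le> \<rho> * (\<tau> powr (1 - \<beta>) / (1 - \<beta>))"
      unfolding \<tau>_def by (rule forward_power_sum[where t=t and i=i and j=j, OF t b ij \<rho>])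
  qed auto
  also have "\<dots> = (2 / \<gamma> + 2 * \<rho> / (1 - \<beta>)) * \<tau> powr (\<gamma> - \<beta>)"
  proof -
    have 1: "\<tau> powr (- \<beta>) * \<tau> powr \<gamma> = \<tau> powr (\<gamma> - \<beta>)" by (simp flip: powr_add)
    have 2: "\<tau> powr (\<gamma> - 1) * \<tau> powr (1 - \<beta>) = \<tau> powr (\<gamma> - \<beta>)" by (simp flip: powr_add)
    have "2 * \<tau> powr (- \<beta>) * (\<tau> powr \<gamma> / \<gamma>) + 2 * \<tau> powr (\<gamma> - 1) * (\<rho> * (\<tau> powr (1 - \<beta>) / (1 - \<beta>)))
       = 2 / \<gamma> * (\<tau> powr (- \<beta>) * \<tau> powr \<gamma>) + 2 * \<rho> / (1 - \<beta>) * (\<tau> powr (\<gamma> - 1) * \<tau> powr (1 - \<beta>))" by (simp add: mult_ac)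
    then show ?thesis unfolding 1 2 by (simp add: distrib_right)
  qed
  finally show ?thesis by (simp add: \<tau>_def)
qed

section \<open>Gaussian chains and the parametrix\<close>

text \<open>A factor \<open>norm v powr a\<close> is paid for by doubling the variance and gains \<open>s powr (a / 2)\<close>.\<close>

lemma iso_gdens_double:
  assumes "0 < s"
  shows "iso_gdens s v \<le> 2 powr (real DIM('a) / 2) * iso_gdens (2 * s) (v :: 'a::euclidean_space)"
    and "0 \<le> a \<Longrightarrow> a \<le> 1 \<Longrightarrow> norm v powr a * iso_gdens s v \<le> 2 powr (real DIM('a) / 2) * (4 * s) powr (a / 2) * iso_gdens (2 * s) v"
proof -
  define X where "X = (v \<bullet> v) / (4 * s)"
  have X: "0 \<le> X" using assms by (simp add: X_def)
  have P: "(2 * pi * s) powr (- real DIM('a) / 2) = 2 powr (real DIM('a) / 2) * (2 * pi * (2 * s)) powr (- real DIM('a) / 2)"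
  proof -
    have "(2 * pi * (2 * s)) powr (- real DIM('a) / 2) = 2 powr (- real DIM('a) / 2) * (2 * pi * s) powr (- real DIM('a) / 2)"
      using assms by (subst powr_mult[symmetric]) (auto simp: mult_ac)
    moreover have "2 powr (real DIM('a) / 2) * 2 powr (- real DIM('a) / 2) = (1::real)" by (simp flip: powr_add)
    ultimately show ?thesis by (metis mult.assoc mult_1)
  qed
  have e1: "- (v \<bullet> v) / (2 * s) = - X + - X" and e2: "- (v \<bullet> v) / (2 * (2 * s)) = - X" by (simp_all add: X_def)
  have i1: "iso_gdens s v = 2 powr (real DIM('a) / 2) * iso_gdens (2 * s) v * exp (- X)"
    unfolding iso_gdens_def P e1 e2 exp_add by simp
  show "iso_gdens s v \<le> 2 powr (real DIM('a) / 2) * iso_gdens (2 * s) v"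
    unfolding i1 using X by (intro mult_left_le) auto
  assume a: "0 \<le> a" "a \<le> 1"
  have "norm v powr a = (4 * s * X) powr (a / 2)"
  proof -
    have "4 * s * X = (norm v) powr 2" using assms by (simp add: X_def dot_square_norm)
    then have "(4 * s * X) powr (a / 2) = (norm v powr 2) powr (a / 2)" by (simp only:)
    then show ?thesis by (simp only: powr_powr) simp
  qed
  also have "\<dots> = (4 * s) powr (a / 2) * X powr (a / 2)" using assms X by (simp add: powr_mult)
  finally have nv: "norm v powr a = (4 * s) powr (a / 2) * X powr (a / 2)" .
  have "X powr (a / 2) \<le> exp X"
  proof (cases "X \<le> 1")
    case True
    then have "X powr (a / 2) \<le> 1" using X a by (intro powr_le1) auto
    also have "1 \<le> exp X" using X by simp
    finally show ?thesis .
  next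
    case False
    then have "X powr (a / 2) \<le> X powr 1" using a by (intro powr_mono) auto
    also have "X powr 1 = X" using X by simp
    also have "X \<le> exp X" using exp_ge_add_one_self[of X] by linarith
    finally show ?thesis .
  qed
  then have "X powr (a / 2) * exp (- X) \<le> exp X * exp (- X)" by (intro mult_right_mono) auto
  then have le1: "X powr (a / 2) * exp (- X) \<le> 1" by (simp add: exp_minus)
  have "norm v powr a * iso_gdens s v
     = (2 powr (real DIM('a) / 2) * (4 * s) powr (a / 2) * iso_gdens (2 * s) v) * (X powr (a / 2) * exp (- X))"
    unfolding nv i1 by simp
  also have "\<dots> \<le> 2 powr (real DIM('a) / 2) * (4 * s) powr (a / 2) * iso_gdens (2 * s) v"
    by (rule mult_left_le[OF le1]) auto
  finally show "norm v powr a * iso_gdens s v \<le> 2 powr (real DIM('a) / 2) * (4 * s) powr (a / 2) * iso_gdens (2 * s) v" .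
qed

text \<open>A chain with the times \<open>t 0, \<dots>, t n\<close> and the Gaussian transition densities with covariance \<open>A j x\<close>.
  The Euler chain is an instance with \<open>A j x\<close> the integral of \<open>\<sigma> \<sigma>\<^sup>*\<close> at \<open>x\<close>; abstractly only ellipticity,
  Hoelder continuity and comparable steps matter.\<close>

locale kernel_chain =
  fixes t :: "nat \<Rightarrow> real" and n :: nat and A :: "nat \<Rightarrow> 'a::euclidean_space \<Rightarrow> 'a \<Rightarrow> real"
    and \<epsilon> K L \<alpha> \<rho> p :: real
  assumes params: "0 < \<epsilon>" "\<epsilon> \<le> K" "0 \<le> L" "0 < \<alpha>" "\<alpha> \<le> 1" "1 \<le> \<rho>" and p: "real DIM('a) < p"
    and t_less: "\<And>j. j < n \<Longrightarrow> t j < t (Suc j)"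
    and ratio: "\<And>j. Suc j < n \<Longrightarrow> t (Suc (Suc j)) - t (Suc j) \<le> \<rho> * (t (Suc j) - t j)"
      "\<And>j. Suc j < n \<Longrightarrow> t (Suc j) - t j \<le> \<rho> * (t (Suc (Suc j)) - t (Suc j))"
    and A_qform: "\<And>j x. j < n \<Longrightarrow> qform (A j x)"
    and A_lower: "\<And>j x l. j < n \<Longrightarrow> \<epsilon> * (t (Suc j) - t j) * (l \<bullet> l) \<le> A j x l"
    and A_upper: "\<And>j x l. j < n \<Longrightarrow> A j x l \<le> K * (t (Suc j) - t j) * (l \<bullet> l)"
    and A_holder: "\<And>j x y l. j < n \<Longrightarrow> \<bar>A j x l - A j y l\<bar> \<le> L * (t (Suc j) - t j) * norm (x - y) powr \<alpha> * (l \<bullet> l)"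
    and A_measurable: "\<And>j. j < n \<Longrightarrow> (\<lambda>z. A j (fst z) (snd z)) \<in> borel_measurable (borel \<Otimes>\<^sub>M borel)"
begin

definition "C = gaussian_const TYPE('a) (K / \<epsilon>)"
definition "\<theta> = gaussian_width TYPE('a) (K / \<epsilon>)"

lemma condition_number: "1 \<le> K / \<epsilon>"
  using params by simp

lemma pos: "0 < \<epsilon>" "0 \<le> L" "0 < \<alpha>" "\<alpha> \<le> 1" "1 \<le> \<rho>" "0 < C" "0 < \<theta>"
  using params gaussian_const_pos[OF condition_number, where 'a='a] gaussian_width_pos[OF condition_number, where 'a='a]
  by (simp_all add: C_def \<theta>_def)

lemmas upper_bound = gaussian_kernel_upper(1)[where 'a='a, OF condition_number, folded C_def \<theta>_def]
lemmas difference_bound = gaussian_kernel_difference[where 'a='a, OF condition_number, folded C_def \<theta>_def]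

lemma p1: "1 < p"
  using p DIM_positive[where 'a='a] by linarith

lemma t_strict: "i < j \<Longrightarrow> j \<le> n \<Longrightarrow> t i < t j"
proof (induction rule: less_Suc_induct)
  case (1 i)
  then show ?case by (simp add: t_less)
next
  case (2 i j k)
  then show ?case by simp
qed

definition "step j g x = (\<integral>\<^sup>+y. ennreal (gdens (A j x) (y - x)) * g y \<partial>lborel)"

primrec steps :: "nat \<Rightarrow> nat \<Rightarrow> ('a \<Rightarrow> ennreal) \<Rightarrow> 'a \<Rightarrow> ennreal" where
  "steps i 0 g = g"
| "steps i (Suc k) g = step i (steps (Suc i) k g)"

lemma A_pos: "j < n \<Longrightarrow> 0 < \<epsilon> * (t (Suc j) - t j)"
  using pos t_less[of j] by simp

lemma kern_measurable:
  assumes j: "j < n"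
  shows "(\<lambda>z. gdens (A j (fst z)) (snd z - fst z)) \<in> borel_measurable (borel \<Otimes>\<^sub>M borel)"
proof -
  have "(\<lambda>z. A j (fst (fst z)) (snd z)) \<in> borel_measurable ((borel \<Otimes>\<^sub>M borel) \<Otimes>\<^sub>M lborel)"
    using measurable_compose[OF _ A_measurable[OF j], of "\<lambda>z. (fst (fst z), snd z)" "(borel \<Otimes>\<^sub>M borel) \<Otimes>\<^sub>M lborel"] by simp
  then have "(\<lambda>(z, l). cos (l \<bullet> (snd z - fst z)) * exp (- A j (fst z) l / 2)) \<in> borel_measurable ((borel \<Otimes>\<^sub>M borel) \<Otimes>\<^sub>M lborel)"
    unfolding split_beta' by measurable
  then show ?thesis
    unfolding gdens_def by (intro borel_measurable_times borel_measurable_const lborel.borel_measurable_lebesgue_integral)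
qed

lemma kern_section_measurable: "j < n \<Longrightarrow> (\<lambda>y. gdens (A j x) (y - x)) \<in> borel_measurable borel"
  using gdens_measurable[OF qform_measurable[OF A_qform]] by simp

lemma kern_mass: "j < n \<Longrightarrow> (\<integral>\<^sup>+y. ennreal (gdens (A j x) (y - x)) \<partial>lborel) = 1"
  using nn_integral_lborel_translate(2)[of "\<lambda>y. ennreal (gdens (A j x) y)" x] gdens_measurable[OF qform_measurable[OF A_qform]]
    gdens_mass_one[OF A_pos A_qform A_lower] by simp

lemma step_measurable [measurable]:
  assumes "j < n" "g \<in> borel_measurable borel"
  shows "step j g \<in> borel_measurable borel"
proof -
  note [measurable] = assms(2)
  have [measurable]: "(\<lambda>z. gdens (A j (fst z)) (snd z - fst z)) \<in> borel_measurable (borel \<Otimes>\<^sub>M lborel)"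
    using kern_measurable[OF assms(1)] by (simp cong: measurable_cong_sets sets_pair_measure_cong)
  have "(\<lambda>(x, y). ennreal (gdens (A j x) (y - x)) * g y) \<in> borel_measurable (borel \<Otimes>\<^sub>M lborel)"
    unfolding split_beta' by measurable
  then show ?thesis unfolding step_def by (rule lborel.borel_measurable_nn_integral)
qed

lemma steps_measurable: "i + k \<le> n \<Longrightarrow> g \<in> borel_measurable borel \<Longrightarrow> steps i k g \<in> borel_measurable borel"
  by (induction k arbitrary: i) (auto intro!: step_measurable)

lemma step_mono: "(\<And>y. g y \<le> h y) \<Longrightarrow> step j g x \<le> step j h x"
  unfolding step_def by (intro nn_integral_mono mult_left_mono) auto

lemma step_cmult: "j < n \<Longrightarrow> g \<in> borel_measurable borel \<Longrightarrow> step j (\<lambda>y. c * g y) x = c * step j g x"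
  unfolding step_def using kern_section_measurable[of j x]
  by (subst nn_integral_cmult[symmetric]) (auto simp: mult_ac)

lemma step_add: "j < n \<Longrightarrow> g \<in> borel_measurable borel \<Longrightarrow> h \<in> borel_measurable borel \<Longrightarrow>
    step j (\<lambda>y. g y + h y) x = step j g x + step j h x"
  unfolding step_def using kern_section_measurable[of j x]
  by (subst nn_integral_add[symmetric]) (auto simp: distrib_left)

lemma step_sum:
  assumes "j < n" "\<And>i. i \<in> I \<Longrightarrow> g i \<in> borel_measurable borel"
  shows "step j (\<lambda>y. \<Sum>i\<in>I. g i y) x = (\<Sum>i\<in>I. step j (g i) x)"
  unfolding step_def sum_distrib_left using kern_section_measurable[OF assms(1), of x] assms(2)
  by (subst nn_integral_sum[symmetric]) auto

lemma step_le_const: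
  assumes "j < n" "\<And>y. g y \<le> c"
  shows "step j g x \<le> c"
proof -
  have "step j g x \<le> (\<integral>\<^sup>+y. ennreal (gdens (A j x) (y - x)) * c \<partial>lborel)"
    unfolding step_def by (intro nn_integral_mono mult_left_mono assms) auto
  also have "\<dots> = c"
    using kern_section_measurable[OF assms(1), of x] kern_mass[OF assms(1), of x] by (simp add: nn_integral_multc)
  finally show ?thesis .
qed

lemma steps_le_const: "i + k \<le> n \<Longrightarrow> (\<And>y. g y \<le> c) \<Longrightarrow> steps i k g x \<le> c"
  by (induction k arbitrary: i x) (auto intro!: step_le_const)

lemma steps_append: "steps i (k + l) g = steps i k (steps (i + k) l g)"
  by (induction k arbitrary: i) auto

text \<open>The covariance of the steps \<open>l, \<dots>, j - 1\<close> all frozen at \<open>y\<close>. Freezing at the end point makes it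
  independent of the path, so that frozen densities convolve to frozen densities.\<close>

definition frozen :: "nat \<Rightarrow> nat \<Rightarrow> 'a \<Rightarrow> 'a \<Rightarrow> real" where
  "frozen l j y v = (\<Sum>i\<in>{l..<j}. A i y v)"

lemma frozen_Suc: "l < j \<Longrightarrow> frozen l j y v = A l y v + frozen (Suc l) j y v"
  unfolding frozen_def by (simp add: sum.atLeast_Suc_lessThan)

lemma frozen_bounds:
  assumes "l \<le> j" "j \<le> n"
  shows "\<epsilon> * (t j - t l) * (v \<bullet> v) \<le> frozen l j y v" "frozen l j y v \<le> K * (t j - t l) * (v \<bullet> v)"
proof -
  have s: "(\<Sum>i\<in>{l..<j}. c * (t (Suc i) - t i) * (v \<bullet> v)) = c * (t j - t l) * (v \<bullet> v)" for c
    by (simp add: sum_Suc_diff'[OF assms(1)] flip: sum_distrib_left sum_distrib_right)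
  show "\<epsilon> * (t j - t l) * (v \<bullet> v) \<le> frozen l j y v"
    unfolding s[symmetric] frozen_def using assms by (intro sum_mono A_lower) auto
  show "frozen l j y v \<le> K * (t j - t l) * (v \<bullet> v)"
    unfolding s[symmetric] frozen_def using assms by (intro sum_mono A_upper) auto
qed

lemma frozen_qform: "j \<le> n \<Longrightarrow> qform (frozen l j y)"
  unfolding frozen_def by (intro qform_sum A_qform) auto

text \<open>One isotropic Gaussian dominates both the frozen densities and the errors; its doubled variance
  leaves room for the factor \<open>norm v powr \<alpha>\<close>.\<close>

definition "ker \<tau> v = iso_gdens (2 * (\<theta> * (\<epsilon> * \<tau>))) (v :: 'a)"
definition "C0 = C * 2 powr (real DIM('a) / 2)"
definition "C1 = C * (L / \<epsilon>) * (2 powr (real DIM('a) / 2) * (4 * (\<theta> * \<epsilon>)) powr (\<alpha> / 2))"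

lemma C0_pos: "0 < C0" and C1_nonneg: "0 \<le> C1"
  using pos by (auto simp: C0_def C1_def)

lemma frozen_upper:
  assumes "l < j" "j \<le> n"
  shows "gdens (frozen l j y) v \<le> C0 * ker (t j - t l) v"
proof -
  have \<tau>: "0 < t j - t l" using t_strict assms by simp
  have s: "0 < \<epsilon> * (t j - t l)" using \<tau> pos by simp
  have "gdens (frozen l j y) v \<le> C * iso_gdens (\<theta> * (\<epsilon> * (t j - t l))) v"
  proof (rule upper_bound[OF s frozen_qform[OF assms(2)]])
    have Ke: "K / \<epsilon> * (\<epsilon> * (t j - t l)) = K * (t j - t l)" using pos by simp
    fix v
    show "\<epsilon> * (t j - t l) * (v \<bullet> v) \<le> frozen l j y v" using assms by (intro frozen_bounds) auto
    show "frozen l j y v \<le> K / \<epsilon> * (\<epsilon> * (t j - t l)) * (v \<bullet> v)"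
      unfolding Ke using assms by (intro frozen_bounds) auto
  qed
  also have "\<dots> \<le> C * (2 powr (real DIM('a) / 2) * ker (t j - t l) v)"
    unfolding ker_def using pos s by (intro mult_left_mono iso_gdens_double) auto
  finally show ?thesis by (simp add: C0_def)
qed

text \<open>One true step followed by frozen ones, against frozen steps throughout. The covariances differ by
  \<open>h * norm (w - y) powr \<alpha>\<close> relative to a total of order \<open>\<tau> = t j - t l\<close>, and under the Gaussian
  \<open>norm (w - y)\<close> is of order \<open>sqrt \<tau>\<close>; together \<open>h * \<tau> powr (\<alpha> / 2 - 1)\<close>.\<close>

lemma frozen_difference:
  assumes l: "l < j" "j \<le> n"
  shows "gdens (\<lambda>v. A l w v + frozen (Suc l) j y v) (y - w)
    \<le> gdens (frozen l j y) (y - w) + C1 * ((t (Suc l) - t l) * (t j - t l) powr (\<alpha> / 2 - 1)) * ker (t j - t l) (y - w)"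
proof -
  define \<tau> h where "\<tau> = t j - t l" and "h = t (Suc l) - t l"
  have \<tau>: "0 < \<tau>" using t_strict l by (simp add: \<tau>_def)
  have h: "0 < h" using t_less[of l] l by (simp add: h_def)
  have s: "0 < \<epsilon> * \<tau>" using \<tau> pos by simp
  define \<eta> where "\<eta> = L * h * norm (w - y) powr \<alpha>"
  have \<eta>: "0 \<le> \<eta>" using pos h by (simp add: \<eta>_def)
  have Ke: "K / \<epsilon> * (\<epsilon> * \<tau>) = K * \<tau>" using pos by simp
  have sp: "c * \<tau> * r = c * h * r + c * (t j - t (Suc l)) * r" for c r
    by (simp add: \<tau>_def h_def algebra_simps)
  have "gdens (\<lambda>v. A l w v + frozen (Suc l) j y v) (y - w) \<le> gdens (frozen l j y) (y - w) + C * (\<eta> / (\<epsilon> * \<tau>)) * iso_gdens (\<theta> * (\<epsilon> * \<tau>)) (y - w)"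
  proof (rule difference_bound[OF s _ _ _ _ _ _ \<eta>])
    show "qform (\<lambda>v. A l w v + frozen (Suc l) j y v)" using l by (intro qform_add A_qform frozen_qform) auto
    show "qform (frozen l j y)" using l by (intro frozen_qform) auto
    fix v
    show "\<epsilon> * \<tau> * (v \<bullet> v) \<le> A l w v + frozen (Suc l) j y v"
      unfolding sp h_def using l by (intro add_mono A_lower frozen_bounds) auto
    show "A l w v + frozen (Suc l) j y v \<le> K / \<epsilon> * (\<epsilon> * \<tau>) * (v \<bullet> v)"
      unfolding Ke sp h_def using l by (intro add_mono A_upper frozen_bounds) auto
    show "\<epsilon> * \<tau> * (v \<bullet> v) \<le> frozen l j y v"
      unfolding \<tau>_def using l by (intro frozen_bounds) auto
    show "frozen l j y v \<le> K / \<epsilon> * (\<epsilon> * \<tau>) * (v \<bullet> v)"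
      unfolding Ke unfolding \<tau>_def using l by (intro frozen_bounds) auto
    show "\<bar>A l w v + frozen (Suc l) j y v - frozen l j y v\<bar> \<le> \<eta> * (v \<bullet> v)"
      using A_holder[of l w v y] l by (simp add: frozen_Suc \<eta>_def h_def)
  qed
  also have "C * (\<eta> / (\<epsilon> * \<tau>)) * iso_gdens (\<theta> * (\<epsilon> * \<tau>)) (y - w)
     = C * (L / \<epsilon>) * (h / \<tau>) * (norm (y - w) powr \<alpha> * iso_gdens (\<theta> * (\<epsilon> * \<tau>)) (y - w))"
    by (simp add: \<eta>_def norm_minus_commute)
  also have "\<dots> \<le> C * (L / \<epsilon>) * (h / \<tau>) * (2 powr (real DIM('a) / 2) * (4 * (\<theta> * (\<epsilon> * \<tau>))) powr (\<alpha> / 2) * ker \<tau> (y - w))"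
    unfolding ker_def using pos s h \<tau> by (intro mult_left_mono iso_gdens_double) auto
  also have "(4 * (\<theta> * (\<epsilon> * \<tau>))) powr (\<alpha> / 2) = (4 * (\<theta> * \<epsilon>)) powr (\<alpha> / 2) * \<tau> powr (\<alpha> / 2)"
  proof -
    have "4 * (\<theta> * (\<epsilon> * \<tau>)) = (4 * (\<theta> * \<epsilon>)) * \<tau>" by simp
    then show ?thesis using pos \<tau> by (simp only: powr_mult)
  qed
  also have "C * (L / \<epsilon>) * (h / \<tau>) * (2 powr (real DIM('a) / 2) * ((4 * (\<theta> * \<epsilon>)) powr (\<alpha> / 2) * \<tau> powr (\<alpha> / 2)) * ker \<tau> (y - w))
     = C1 * (h * \<tau> powr (\<alpha> / 2 - 1)) * ker \<tau> (y - w)"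
    using \<tau> by (simp add: C1_def powr_diff)
  finally show ?thesis by (simp add: \<tau>_def h_def)
qed

lemma ker_measurable [measurable]: "ker \<tau> \<in> borel_measurable borel"
  unfolding ker_def by measurable

lemma ker_nonneg [simp]: "0 \<le> ker \<tau> v"
  by (simp add: ker_def)

lemma ker_mass: "0 < \<tau> \<Longrightarrow> (\<integral>\<^sup>+v. ennreal (ker \<tau> v) \<partial>lborel) = 1"
  unfolding ker_def using pos by (intro iso_gdens_mass_one) simp

definition "smooth \<tau> g w = (\<integral>\<^sup>+y. ennreal (ker \<tau> (y - w)) * g y \<partial>lborel)"

lemma smooth_measurable [measurable]:
  assumes [measurable]: "g \<in> borel_measurable borel"
  shows "smooth \<tau> g \<in> borel_measurable borel"
  unfolding smooth_def by measurable

text \<open>As a function of \<open>y\<close> the frozen density is not a probability density, since \<open>y\<close> also determines the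
  covariance; so this is not a convolution, and its norm is estimated through \<open>ker\<close>.\<close>

definition "fsmooth l j g w = (\<integral>\<^sup>+y. ennreal (gdens (frozen l j y) (y - w)) * g y \<partial>lborel)"

definition "coef l j = C1 * ((t (Suc l) - t l) * (t j - t l) powr (\<alpha> / 2 - 1))"

lemma coef_nonneg: "l < j \<Longrightarrow> j \<le> n \<Longrightarrow> 0 \<le> coef l j"
  unfolding coef_def using C1_nonneg t_less[of l] by (intro mult_nonneg_nonneg) auto

lemma frozen_density_measurable:
  assumes "j \<le> n"
  shows "(\<lambda>z. gdens (frozen l j (snd z)) (snd z - fst z)) \<in> borel_measurable (borel \<Otimes>\<^sub>M borel)"
proof -
  have "(\<lambda>z. frozen l j (snd (fst z)) (snd z)) \<in> borel_measurable ((borel \<Otimes>\<^sub>M borel) \<Otimes>\<^sub>M lborel)"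
    unfolding frozen_def
  proof (rule borel_measurable_sum)
    fix i assume "i \<in> {l..<j}"
    then have i: "i < n" using assms by simp
    show "(\<lambda>z. A i (snd (fst z)) (snd z)) \<in> borel_measurable ((borel \<Otimes>\<^sub>M borel) \<Otimes>\<^sub>M lborel)"
      using measurable_compose[OF _ A_measurable[OF i], of "\<lambda>z. (snd (fst z), snd z)" "(borel \<Otimes>\<^sub>M borel) \<Otimes>\<^sub>M lborel"] by simp
  qed
  then have "(\<lambda>(z, v). cos (v \<bullet> (snd z - fst z)) * exp (- frozen l j (snd z) v / 2)) \<in> borel_measurable ((borel \<Otimes>\<^sub>M borel) \<Otimes>\<^sub>M lborel)"
    unfolding split_beta' by measurable
  then show ?thesis
    unfolding gdens_def by (intro borel_measurable_times borel_measurable_const lborel.borel_measurable_lebesgue_integral)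
qed

lemma fsmooth_measurable [measurable]:
  assumes "j \<le> n" "g \<in> borel_measurable borel"
  shows "fsmooth l j g \<in> borel_measurable borel"
proof -
  note [measurable] = assms(2)
  have [measurable]: "(\<lambda>z. gdens (frozen l j (snd z)) (snd z - fst z)) \<in> borel_measurable (borel \<Otimes>\<^sub>M lborel)"
    using frozen_density_measurable[OF assms(1)] by (simp cong: measurable_cong_sets sets_pair_measure_cong)
  have "(\<lambda>(x, y). ennreal (gdens (frozen l j y) (y - x)) * g y) \<in> borel_measurable (borel \<Otimes>\<^sub>M lborel)"
    unfolding split_beta' by measurable
  then show ?thesis unfolding fsmooth_def by (rule lborel.borel_measurable_nn_integral)
qed

lemma frozen_step_integral:
  assumes l: "l < j" "j \<le> n" and g[measurable]: "g \<in> borel_measurable borel"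
  shows "(\<integral>\<^sup>+y. ennreal (gdens (\<lambda>v. A l w v + frozen (Suc l) j y v) (y - w)) * g y \<partial>lborel)
    \<le> fsmooth l j g w + ennreal (coef l j) * smooth (t j - t l) g w"
proof -
  have \<tau>: "0 < t j - t l" using t_strict l by simp
  have [measurable]: "(\<lambda>y. gdens (frozen l j y) (y - w)) \<in> borel_measurable borel"
    using measurable_compose[OF measurable_Pair1' frozen_density_measurable[OF l(2), of l], of w] by simp
  have nn: "0 \<le> gdens (frozen l j y) v" for y v
  proof (rule gdens_nonneg[OF _ frozen_qform[OF l(2)]])
    show "0 < \<epsilon> * (t j - t l)" using pos \<tau> by simp
    show "\<epsilon> * (t j - t l) * (v \<bullet> v) \<le> frozen l j y v" for v using l by (intro frozen_bounds) auto
  qed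
  have "(\<integral>\<^sup>+y. ennreal (gdens (\<lambda>v. A l w v + frozen (Suc l) j y v) (y - w)) * g y \<partial>lborel)
     \<le> (\<integral>\<^sup>+y. ennreal (gdens (frozen l j y) (y - w)) * g y + ennreal (coef l j) * (ennreal (ker (t j - t l) (y - w)) * g y) \<partial>lborel)"
  proof (rule nn_integral_mono)
    fix y
    have "ennreal (gdens (\<lambda>v. A l w v + frozen (Suc l) j y v) (y - w))
      \<le> ennreal (gdens (frozen l j y) (y - w) + coef l j * ker (t j - t l) (y - w))"
      using frozen_difference[OF l, of w y] by (intro ennreal_leI) (simp add: coef_def)
    also have "\<dots> = ennreal (gdens (frozen l j y) (y - w)) + ennreal (coef l j) * ennreal (ker (t j - t l) (y - w))"
      using nn coef_nonneg[OF l] by (simp add: ennreal_plus ennreal_mult)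
    finally show "ennreal (gdens (\<lambda>v. A l w v + frozen (Suc l) j y v) (y - w)) * g y
      \<le> ennreal (gdens (frozen l j y) (y - w)) * g y + ennreal (coef l j) * (ennreal (ker (t j - t l) (y - w)) * g y)"
      using mult_right_mono by (fastforce simp: distrib_right mult.assoc)
  qed
  also have "\<dots> = fsmooth l j g w + ennreal (coef l j) * smooth (t j - t l) g w"
    unfolding fsmooth_def smooth_def by (simp add: nn_integral_add nn_integral_cmult)
  finally show ?thesis .
qed

text \<open>The true step has covariance \<open>A l w\<close> and does not depend on \<open>y\<close>, so for each \<open>y\<close> it convolves with
  the frozen rest.\<close>

lemma step_frozen:
  assumes l: "Suc l < j" "j \<le> n" and g[measurable]: "g \<in> borel_measurable borel"
  shows "step l (fsmooth (Suc l) j g) w \<le> fsmooth l j g w + ennreal (coef l j) * smooth (t j - t l) g w"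
proof -
  have ln: "l < n" using l by simp
  have [measurable]: "(\<lambda>x. gdens (A l w) (x - w)) \<in> borel_measurable borel"
    by (rule kern_section_measurable[OF ln])
  have [measurable]: "(\<lambda>z. gdens (frozen (Suc l) j (snd z)) (snd z - fst z)) \<in> borel_measurable (lborel \<Otimes>\<^sub>M lborel)"
    using frozen_density_measurable[OF l(2), of "Suc l"] by (simp cong: measurable_cong_sets sets_pair_measure_cong)
  have conv: "(\<integral>\<^sup>+x. ennreal (gdens (A l w) (x - w)) * ennreal (gdens (frozen (Suc l) j y) (y - x)) \<partial>lborel)
     = ennreal (gdens (\<lambda>v. A l w v + frozen (Suc l) j y v) (y - w))" for y
  proof -
    have s: "0 < \<epsilon> * (t j - t (Suc l))" using pos t_strict[of "Suc l" j] l by simp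
    have [measurable]: "gdens (A l w) \<in> borel_measurable borel" "gdens (frozen (Suc l) j y) \<in> borel_measurable borel"
      by (rule gdens_measurable[OF qform_measurable[OF A_qform[OF ln]]], rule gdens_measurable[OF qform_measurable[OF frozen_qform[OF l(2)]]])
    have "(\<integral>\<^sup>+x. ennreal (gdens (A l w) (x - w)) * ennreal (gdens (frozen (Suc l) j y) (y - x)) \<partial>lborel)
      = (\<integral>\<^sup>+x. ennreal (gdens (A l w) (x - w)) * ennreal (gdens (frozen (Suc l) j y) ((y - w) - (x - w))) \<partial>lborel)"
      by simp
    also have "\<dots> = (\<integral>\<^sup>+u. ennreal (gdens (A l w) u) * ennreal (gdens (frozen (Suc l) j y) ((y - w) - u)) \<partial>lborel)"
      by (rule nn_integral_lborel_translate(2)) measurable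
    also have "\<dots> = ennreal (gdens (\<lambda>v. A l w v + frozen (Suc l) j y v) (y - w))"
      by (rule gdens_convolution[OF A_pos[OF ln] A_qform[OF ln] A_lower[OF ln] s frozen_qform[OF l(2)]])
         (use l in \<open>auto intro!: frozen_bounds\<close>)
    finally show ?thesis .
  qed
  have "step l (fsmooth (Suc l) j g) w
     = (\<integral>\<^sup>+x. (\<integral>\<^sup>+y. ennreal (gdens (A l w) (x - w)) * (ennreal (gdens (frozen (Suc l) j y) (y - x)) * g y) \<partial>lborel) \<partial>lborel)"
    unfolding step_def fsmooth_def
  proof (intro nn_integral_cong nn_integral_cmult[symmetric])
    fix x
    have "(\<lambda>y. gdens (frozen (Suc l) j y) (y - x)) \<in> borel_measurable borel"
      using measurable_compose[OF measurable_Pair1' frozen_density_measurable[OF l(2), of "Suc l"], of x] by simp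
    then show "(\<lambda>y. ennreal (gdens (frozen (Suc l) j y) (y - x)) * g y) \<in> borel_measurable lborel" by simp
  qed
  also have "\<dots> = (\<integral>\<^sup>+y. (\<integral>\<^sup>+x. ennreal (gdens (A l w) (x - w)) * (ennreal (gdens (frozen (Suc l) j y) (y - x)) * g y) \<partial>lborel) \<partial>lborel)"
  proof (rule lborel_pair.Fubini'[symmetric])
    have "(\<lambda>z. ennreal (gdens (A l w) (fst z - w)) * (ennreal (gdens (frozen (Suc l) j (snd z)) (snd z - fst z)) * g (snd z)))
        \<in> borel_measurable (lborel \<Otimes>\<^sub>M lborel)"
      by measurable
    then show "(\<lambda>(x, y). ennreal (gdens (A l w) (x - w)) * (ennreal (gdens (frozen (Suc l) j y) (y - x)) * g y)) \<in> borel_measurable (lborel \<Otimes>\<^sub>M lborel)"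
      by (simp add: split_beta')
  qed
  also have "\<dots> = (\<integral>\<^sup>+y. ennreal (gdens (\<lambda>v. A l w v + frozen (Suc l) j y v) (y - w)) * g y \<partial>lborel)"
  proof (intro nn_integral_cong)
    fix y
    have [measurable]: "gdens (frozen (Suc l) j y) \<in> borel_measurable borel"
      by (rule gdens_measurable[OF qform_measurable[OF frozen_qform[OF l(2)]]])
    show "(\<integral>\<^sup>+x. ennreal (gdens (A l w) (x - w)) * (ennreal (gdens (frozen (Suc l) j y) (y - x)) * g y) \<partial>lborel)
       = ennreal (gdens (\<lambda>v. A l w v + frozen (Suc l) j y v) (y - w)) * g y"
      unfolding mult.assoc[symmetric] by (subst nn_integral_multc) (auto simp: conv)
  qed
  also have "\<dots> \<le> fsmooth l j g w + ennreal (coef l j) * smooth (t j - t l) g w"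
    by (rule frozen_step_integral) (use l in auto)
  finally show ?thesis .
qed

lemma step_last:
  assumes l: "Suc l \<le> n" and g[measurable]: "g \<in> borel_measurable borel"
  shows "step l g w \<le> fsmooth l (Suc l) g w + ennreal (coef l (Suc l)) * smooth (t (Suc l) - t l) g w"
proof -
  have "(\<lambda>v. A l w v + frozen (Suc l) (Suc l) y v) = A l w" for y by (simp add: frozen_def)
  then show ?thesis
    using frozen_step_integral[of l "Suc l" g w] l by (simp add: step_def)
qed

text \<open>Replace the true steps by frozen ones, from the last to the first. Each replacement leaves an error
  that is an isotropic smoothing of \<open>g\<close>, transported by the remaining true steps.\<close>

lemma parametrix:
  assumes g[measurable]: "g \<in> borel_measurable borel"
  shows "i + Suc k \<le> n \<Longrightarrow> steps i (Suc k) g x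
    \<le> fsmooth i (i + Suc k) g x + (\<Sum>r\<le>k. ennreal (coef (i + r) (i + Suc k)) * steps i r (smooth (t (i + Suc k) - t (i + r)) g) x)"
proof (induction k arbitrary: i x)
  case 0
  then show ?case using step_last[of i g x] by simp
next
  case (Suc k)
  let ?j = "i + Suc (Suc k)"
  let ?S = "\<lambda>r. smooth (t ?j - t (i + r)) g"
  have j: "Suc i + Suc k = ?j" by simp
  have in': "i < n" using Suc.prems by simp
  have st: "(\<lambda>x. ennreal (coef (i + Suc r) ?j) * steps (Suc i) r (?S (Suc r)) x) \<in> borel_measurable borel" if "r \<in> {..k}" for r
    by (rule borel_measurable_times_ennreal[OF borel_measurable_const steps_measurable]) (use that Suc.prems in auto)
  have fm: "fsmooth (Suc i) ?j g \<in> borel_measurable borel"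
    by (rule fsmooth_measurable) (use Suc.prems g in auto)
  have "steps i (Suc (Suc k)) g x = step i (steps (Suc i) (Suc k) g) x" by simp
  also have "\<dots> \<le> step i (\<lambda>x. fsmooth (Suc i) ?j g x + (\<Sum>r\<le>k. ennreal (coef (i + Suc r) ?j) * steps (Suc i) r (?S (Suc r)) x)) x"
    using Suc.IH[of "Suc i"] Suc.prems by (intro step_mono) (simp del: steps.simps)
  also have "\<dots> = step i (fsmooth (Suc i) ?j g) x + step i (\<lambda>x. \<Sum>r\<le>k. ennreal (coef (i + Suc r) ?j) * steps (Suc i) r (?S (Suc r)) x) x"
    by (rule step_add[OF in' fm borel_measurable_sum[OF st]])
  also have "step i (\<lambda>x. \<Sum>r\<le>k. ennreal (coef (i + Suc r) ?j) * steps (Suc i) r (?S (Suc r)) x) x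
     = (\<Sum>r\<le>k. step i (\<lambda>x. ennreal (coef (i + Suc r) ?j) * steps (Suc i) r (?S (Suc r)) x) x)"
    by (rule step_sum[OF in' st])
  also have "\<dots> = (\<Sum>r\<le>k. ennreal (coef (i + Suc r) ?j) * steps i (Suc r) (?S (Suc r)) x)"
    using Suc.prems by (intro sum.cong refl) (subst step_cmult[OF in'], auto intro!: steps_measurable)
  also have "step i (fsmooth (Suc i) ?j g) x \<le> fsmooth i ?j g x + ennreal (coef i ?j) * ?S 0 x"
    using step_frozen[of i ?j g x] Suc.prems by simp
  finally have "steps i (Suc (Suc k)) g x
     \<le> fsmooth i ?j g x + ennreal (coef i ?j) * ?S 0 x + (\<Sum>r\<le>k. ennreal (coef (i + Suc r) ?j) * steps i (Suc r) (?S (Suc r)) x)"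
    by (simp add: add_right_mono del: steps.simps)
  also have "\<dots> = fsmooth i ?j g x + (\<Sum>r\<le>Suc k. ennreal (coef (i + r) ?j) * steps i r (?S r) x)"
    by (subst sum.atMost_Suc_shift) (simp add: add.assoc)
  finally show ?case .
qed

text \<open>The exponent of the smoothing from \<open>L\<^sub>p\<close> into bounded functions.\<close>

definition "\<beta> = real DIM('a) / (2 * p)"
definition "C3 = (4 * pi * (\<theta> * \<epsilon>)) powr (- \<beta>)"

lemma \<beta>: "0 < \<beta>" "\<beta> < 1 / 2"
proof -
  have d: "0 < real DIM('a)" using DIM_positive by simp
  show "0 < \<beta>" using d p1 by (simp add: \<beta>_def)
  show "\<beta> < 1 / 2" using d p p1 by (simp add: \<beta>_def field_simps)
qed

lemma C3_pos: "0 < C3"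
  using pos by (simp add: C3_def)

lemma smooth_sup:
  assumes \<tau>: "0 < \<tau>" and g: "g \<in> borel_measurable borel" and c: "0 < c"
    and gc: "(\<integral>\<^sup>+y. ennreal_powr (g y) p \<partial>lborel) \<le> ennreal (c powr p)"
  shows "smooth \<tau> g x \<le> ennreal (C3 * \<tau> powr (- \<beta>) * c)"
proof -
  let ?s = "2 * (\<theta> * (\<epsilon> * \<tau>))"
  define B where "B = (2 * pi * ?s) powr (- real DIM('a) / 2)"
  have s: "0 < ?s" using pos \<tau> by simp
  have B: "0 < B" using pos \<tau> by (simp add: B_def)
  have kB: "ker \<tau> v \<le> B" for v
  proof -
    have "B * exp (- (v \<bullet> v) / (2 * ?s)) \<le> B * 1"
      using B s pos \<tau> by (intro mult_left_mono) auto
    then show ?thesis by (simp add: ker_def iso_gdens_def B_def)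
  qed
  have "smooth \<tau> g x \<le> ennreal (B powr (1 / p) * c)"
    unfolding smooth_def by (rule convolution_sup_bound[OF p1 ker_measurable ker_mass[OF \<tau>] kB B g c gc])
  also have "B powr (1 / p) = C3 * \<tau> powr (- \<beta>)"
  proof -
    have "2 * pi * ?s = (4 * pi * (\<theta> * \<epsilon>)) * \<tau>" by simp
    moreover have "- real DIM('a) / 2 * (1 / p) = - \<beta>" by (simp add: \<beta>_def)
    ultimately have "B powr (1 / p) = ((4 * pi * (\<theta> * \<epsilon>)) * \<tau>) powr (- \<beta>)"
      unfolding B_def by (simp only: powr_powr)
    then show ?thesis using pos \<tau> by (simp only: powr_mult C3_def)
  qed
  finally show ?thesis .
qed

lemma smooth_Lp:
  assumes "0 < \<tau>" "g \<in> borel_measurable borel"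
  shows "(\<integral>\<^sup>+x. ennreal_powr (smooth \<tau> g x) p \<partial>lborel) \<le> (\<integral>\<^sup>+y. ennreal_powr (g y) p \<partial>lborel)"
  unfolding smooth_def by (rule convolution_Lp_contraction[OF p1 ker_measurable ker_mass[OF assms(1)] assms(2)])

lemma fsmooth_sup:
  assumes l: "l < j" "j \<le> n" and g[measurable]: "g \<in> borel_measurable borel" and c: "0 < c"
    and gc: "(\<integral>\<^sup>+y. ennreal_powr (g y) p \<partial>lborel) \<le> ennreal (c powr p)"
  shows "fsmooth l j g x \<le> ennreal (C0 * C3 * (t j - t l) powr (- \<beta>) * c)"
proof -
  have \<tau>: "0 < t j - t l" using t_strict l by simp
  have "fsmooth l j g x \<le> (\<integral>\<^sup>+y. ennreal C0 * (ennreal (ker (t j - t l) (y - x)) * g y) \<partial>lborel)"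
    unfolding fsmooth_def mult.assoc[symmetric] using frozen_upper[OF l] C0_pos
    by (intro nn_integral_mono mult_right_mono) (auto simp: ennreal_mult[symmetric] intro!: ennreal_leI)
  also have "\<dots> = ennreal C0 * smooth (t j - t l) g x"
    unfolding smooth_def by (rule nn_integral_cmult) measurable
  also have "\<dots> \<le> ennreal C0 * ennreal (C3 * (t j - t l) powr (- \<beta>) * c)"
    by (intro mult_left_mono smooth_sup[OF \<tau> g c gc]) auto
  also have "\<dots> = ennreal (C0 * C3 * (t j - t l) powr (- \<beta>) * c)"
    using C0_pos by (simp add: ennreal_mult'[symmetric] mult.assoc)
  finally show ?thesis .
qed

section \<open>The smoothing estimate\<close>

text \<open>\<open>C4\<close> is the constant of the discrete Beta integral for \<open>\<gamma> = \<alpha> / 2\<close>. Up to the time \<open>T0\<close> the errors in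
  the parametrix are at most half of the claimed bound, and \<open>U0\<close> is twice the bound for the rest.\<close>

definition "C4 = 4 / \<alpha> + 2 * \<rho> / (1 - \<beta>)"

lemma C4_pos: "0 < C4"
proof -
  have "0 < 4 / \<alpha>" "0 \<le> 2 * \<rho> / (1 - \<beta>)" using pos \<beta> by auto
  then show ?thesis unfolding C4_def by linarith
qed

definition "T0 = (1 / (1 + 2 * C1 * C4)) powr (2 / \<alpha>)"
definition "U0 = 2 * (C0 * C3 + C1 * C3)"

lemma T0: "0 < T0" "C1 * C4 * T0 powr (\<alpha> / 2) \<le> 1 / 2" "T0 powr (\<alpha> / 2) \<le> 1"
proof -
  let ?x = "1 / (1 + 2 * C1 * C4)"
  have nn: "0 \<le> C1 * C4" using C1_nonneg C4_pos by simp
  then have x: "0 < ?x" by (simp add: add_pos_nonneg)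
  then show "0 < T0" by (simp add: T0_def)
  have nn': "0 \<le> C4 * C1" using nn by (simp add: mult.commute)
  have e: "T0 powr (\<alpha> / 2) = ?x" using x pos by (simp add: T0_def powr_powr)
  show "T0 powr (\<alpha> / 2) \<le> 1" unfolding e using nn nn' by simp
  have *: "z * (1 / (1 + 2 * z)) \<le> 1 / 2" if "0 \<le> z" for z :: real
    using that by (simp add: divide_simps)
  show "C1 * C4 * T0 powr (\<alpha> / 2) \<le> 1 / 2"
    unfolding e using *[OF nn] by (simp only: mult.assoc)
qed

lemma U0_pos: "0 < U0"
  using C0_pos C1_nonneg C3_pos by (simp add: U0_def add_pos_nonneg)

lemma scaled_Lp:
  assumes [measurable]: "g \<in> borel_measurable borel" and gc: "(\<integral>\<^sup>+y. ennreal_powr (g y) p \<partial>lborel) \<le> ennreal (c powr p)"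
    and \<tau>: "0 < \<tau>"
  shows "(\<integral>\<^sup>+y. ennreal_powr (smooth \<tau> g y) p \<partial>lborel) \<le> ennreal (c powr p)"
  using smooth_Lp[OF \<tau> assms(1)] gc by (rule order_trans)

text \<open>Strong induction on the number of steps: in the parametrix the error with \<open>r > 0\<close> contains fewer true
  steps, applied to a smoothing of \<open>g\<close>, whose \<open>L\<^sub>p\<close>-norm is not larger.\<close>

lemma short_time_bound:
  assumes "g \<in> borel_measurable borel" "0 < c" "(\<integral>\<^sup>+y. ennreal_powr (g y) p \<partial>lborel) \<le> ennreal (c powr p)"
    and "0 < k" "i + k \<le> n" "t (i + k) - t i \<le> T0"
  shows "steps i k g x \<le> ennreal (U0 * (t (i + k) - t i) powr (- \<beta>) * c)"
  using assms
proof (induction k arbitrary: g x rule: less_induct)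
  case (less k)
  note g[measurable] = less.prems(1) and c = less.prems(2) and gc = less.prems(3)
  obtain k' where k: "k = Suc k'" using less.prems(4) by (cases k) auto
  define j where "j = i + k"
  have j: "j \<le> n" "i < j" "i + Suc k' = j" using less.prems k by (auto simp: j_def)
  define \<tau> where "\<tau> = t j - t i"
  have \<tau>: "0 < \<tau>" "\<tau> \<le> T0" using t_strict[OF j(2,1)] less.prems(6) by (auto simp: \<tau>_def j_def)
  have gpow: "\<tau> powr (\<alpha> / 2) \<le> T0 powr (\<alpha> / 2)" using \<tau> pos by (intro powr_mono2) auto
  let ?B = "\<Sum>l\<in>{Suc i..<j}. (t (Suc l) - t l) * (t j - t l) powr (\<alpha> / 2 - 1) * (t l - t i) powr (- \<beta>)"
  let ?E = "\<Sum>r\<le>k'. ennreal (coef (i + r) j) * steps i r (smooth (t j - t (i + r)) g) x"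
  have p1: "steps i k g x \<le> fsmooth i j g x + ?E"
    using parametrix[OF g, of i k' x] j by (simp add: k del: steps.simps)
  have "?E
     = ennreal (coef i j) * smooth \<tau> g x + (\<Sum>r<k'. ennreal (coef (i + Suc r) j) * steps i (Suc r) (smooth (t j - t (i + Suc r)) g) x)"
    by (simp add: sum.atMost_shift \<tau>_def del: steps.simps(2))
  also have "\<dots> \<le> ennreal (coef i j * (C3 * \<tau> powr (- \<beta>) * c))
     + (\<Sum>r<k'. ennreal (coef (i + Suc r) j * (U0 * (t (i + Suc r) - t i) powr (- \<beta>) * c)))"
  proof (intro add_mono sum_mono)
    show "ennreal (coef i j) * smooth \<tau> g x \<le> ennreal (coef i j * (C3 * \<tau> powr (- \<beta>) * c))"
      using coef_nonneg[of i j] j smooth_sup[OF \<tau>(1) g c gc, of x]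
      by (simp add: ennreal_mult' mult_left_mono)
    fix r assume "r \<in> {..<k'}"
    then have r: "Suc r < k" "i + Suc r < j" by (auto simp: k j_def)
    have tr: "0 < t j - t (i + Suc r)" using t_strict[OF r(2) j(1)] by simp
    have "steps i (Suc r) (smooth (t j - t (i + Suc r)) g) x \<le> ennreal (U0 * (t (i + Suc r) - t i) powr (- \<beta>) * c)"
    proof (rule less.IH[OF r(1)])
      show "(\<integral>\<^sup>+y. ennreal_powr (smooth (t j - t (i + Suc r)) g y) p \<partial>lborel) \<le> ennreal (c powr p)"
        by (rule scaled_Lp[OF g gc tr])
      show "t (i + Suc r) - t i \<le> T0" using tr \<tau> by (simp add: \<tau>_def)
      show "i + Suc r \<le> n" using r j by simp
    qed (use c in auto)
    then show "ennreal (coef (i + Suc r) j) * steps i (Suc r) (smooth (t j - t (i + Suc r)) g) x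
       \<le> ennreal (coef (i + Suc r) j * (U0 * (t (i + Suc r) - t i) powr (- \<beta>) * c))"
      using coef_nonneg[OF r(2) j(1)] by (simp add: ennreal_mult' mult_left_mono)
  qed
  also have "(\<Sum>r<k'. ennreal (coef (i + Suc r) j * (U0 * (t (i + Suc r) - t i) powr (- \<beta>) * c)))
     = ennreal (\<Sum>r<k'. coef (i + Suc r) j * (U0 * (t (i + Suc r) - t i) powr (- \<beta>) * c))"
    using coef_nonneg[of _ j] j U0_pos c by (intro sum_ennreal mult_nonneg_nonneg) auto
  also have "(\<Sum>r<k'. coef (i + Suc r) j * (U0 * (t (i + Suc r) - t i) powr (- \<beta>) * c))
     = C1 * U0 * c * ?B"
  proof -
    have "?B
      = (\<Sum>r<k'. (t (Suc (i + Suc r)) - t (i + Suc r)) * (t j - t (i + Suc r)) powr (\<alpha> / 2 - 1) * (t (i + Suc r) - t i) powr (- \<beta>))"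
      by (rule sum.reindex_bij_witness[of _ "\<lambda>r. i + Suc r" "\<lambda>l. l - Suc i"]) (auto simp: j_def k)
    then show ?thesis by (simp add: sum_distrib_left coef_def mult_ac)
  qed
  also have "ennreal (C1 * U0 * c * ?B)
     \<le> ennreal (1 / 2 * U0 * c * \<tau> powr (- \<beta>))"
  proof (rule ennreal_leI)
    have "?B
       \<le> (2 / (\<alpha> / 2) + 2 * \<rho> / (1 - \<beta>)) * (t j - t i) powr (\<alpha> / 2 - \<beta>)"
      by (rule beta_type_sum) (use t_less ratio \<beta> pos j in auto)
    also have "\<dots> = C4 * (\<tau> powr (\<alpha> / 2) * \<tau> powr (- \<beta>))"
      by (simp add: C4_def \<tau>_def flip: powr_add)
    finally have "C1 * U0 * c * ?B
       \<le> C1 * U0 * c * (C4 * (\<tau> powr (\<alpha> / 2) * \<tau> powr (- \<beta>)))"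
      using C1_nonneg U0_pos c by (intro mult_left_mono mult_nonneg_nonneg) auto
    also have "\<dots> = (C1 * C4 * \<tau> powr (\<alpha> / 2)) * (U0 * c * \<tau> powr (- \<beta>))" by simp
    also have "\<dots> \<le> (1 / 2) * (U0 * c * \<tau> powr (- \<beta>))"
    proof (rule mult_right_mono)
      have "C1 * C4 * \<tau> powr (\<alpha> / 2) \<le> C1 * C4 * T0 powr (\<alpha> / 2)"
        using gpow C1_nonneg C4_pos by (intro mult_left_mono) auto
      then show "C1 * C4 * \<tau> powr (\<alpha> / 2) \<le> 1 / 2" using T0(2) by linarith
    qed (use U0_pos c in auto)
    finally show "C1 * U0 * c * ?B
       \<le> 1 / 2 * U0 * c * \<tau> powr (- \<beta>)" by simp
  qed
  (* The error of the first step contains no further true step and needs only h \<le> \<tau>. *)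
  also have "ennreal (coef i j * (C3 * \<tau> powr (- \<beta>) * c)) \<le> ennreal (C1 * C3 * \<tau> powr (- \<beta>) * c)"
  proof (rule ennreal_leI)
    have "t (Suc i) \<le> t j" using t_strict[of "Suc i" j] j by (cases "Suc i = j") auto
    then have "(t (Suc i) - t i) * \<tau> powr (\<alpha> / 2 - 1) \<le> \<tau> * \<tau> powr (\<alpha> / 2 - 1)"
      by (intro mult_right_mono) (auto simp: \<tau>_def)
    also have "\<dots> = \<tau> powr (\<alpha> / 2)" using \<tau> by (simp add: powr_diff)
    also have "\<dots> \<le> 1" using gpow T0(3) by linarith
    finally have "coef i j \<le> C1 * 1" unfolding coef_def \<tau>_def using C1_nonneg by (intro mult_left_mono)
    then have "coef i j * (C3 * \<tau> powr (- \<beta>) * c) \<le> C1 * 1 * (C3 * \<tau> powr (- \<beta>) * c)"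
      using C3_pos c by (intro mult_right_mono) auto
    then show "coef i j * (C3 * \<tau> powr (- \<beta>) * c) \<le> C1 * C3 * \<tau> powr (- \<beta>) * c" by (simp add: mult.assoc)
  qed
  finally have s: "?E
     \<le> ennreal (C1 * C3 * \<tau> powr (- \<beta>) * c) + ennreal (1 / 2 * U0 * c * \<tau> powr (- \<beta>))"
    by (simp add: add_mono)
  have "steps i k g x \<le> ennreal (C0 * C3 * \<tau> powr (- \<beta>) * c)
      + (ennreal (C1 * C3 * \<tau> powr (- \<beta>) * c) + ennreal (1 / 2 * U0 * c * \<tau> powr (- \<beta>)))"
    using fsmooth_sup[OF j(2,1) g c gc, of x] by (intro order_trans[OF p1] add_mono s) (simp add: \<tau>_def)
  also have "\<dots> = ennreal (C0 * C3 * \<tau> powr (- \<beta>) * c + (C1 * C3 * \<tau> powr (- \<beta>) * c + 1 / 2 * U0 * c * \<tau> powr (- \<beta>)))"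
    using C0_pos C1_nonneg C3_pos U0_pos c by (simp add: ennreal_plus)
  also have "C0 * C3 * \<tau> powr (- \<beta>) * c + (C1 * C3 * \<tau> powr (- \<beta>) * c + 1 / 2 * U0 * c * \<tau> powr (- \<beta>))
      = U0 * \<tau> powr (- \<beta>) * c"
    by (simp add: U0_def algebra_simps)
  finally show ?case by (simp add: \<tau>_def j_def)
qed

lemma single_step_bound:
  assumes g: "g \<in> borel_measurable borel" and c: "0 < c" and gc: "(\<integral>\<^sup>+y. ennreal_powr (g y) p \<partial>lborel) \<le> ennreal (c powr p)"
    and l: "l < n"
  shows "step l g x \<le> ennreal (U0 * (t (Suc l) - t l) powr (- \<beta>) * c)"
proof -
  define \<tau> where "\<tau> = t (Suc l) - t l"
  have \<tau>: "0 < \<tau>" using t_less[OF l] by (simp add: \<tau>_def)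
  note [measurable] = g
  have gm: "(\<lambda>y. ennreal (ker \<tau> (y - x)) * g y) \<in> borel_measurable lborel" by measurable
  have up: "gdens (A l x) v \<le> C0 * ker \<tau> v" for v
  proof -
    have "frozen l (Suc l) x = A l x" by (simp add: frozen_def fun_eq_iff)
    then show ?thesis using frozen_upper[of l "Suc l" x v] l by (simp add: \<tau>_def)
  qed
  have "step l g x \<le> (\<integral>\<^sup>+y. ennreal C0 * (ennreal (ker \<tau> (y - x)) * g y) \<partial>lborel)"
    unfolding step_def mult.assoc[symmetric] using up C0_pos
    by (intro nn_integral_mono mult_right_mono) (auto simp: ennreal_mult[symmetric] intro!: ennreal_leI)
  also have "\<dots> = ennreal C0 * smooth \<tau> g x"
    unfolding smooth_def by (rule nn_integral_cmult[OF gm])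
  also have "\<dots> \<le> ennreal C0 * ennreal (C3 * \<tau> powr (- \<beta>) * c)"
    by (intro mult_left_mono smooth_sup[OF \<tau> g c gc]) auto
  also have "\<dots> = ennreal (C0 * C3 * (\<tau> powr (- \<beta>) * c))"
    using C0_pos by (simp add: ennreal_mult'[symmetric] mult.assoc)
  also have "\<dots> \<le> ennreal (U0 * (\<tau> powr (- \<beta>) * c))"
  proof (intro ennreal_leI mult_right_mono)
    have *: "0 \<le> u \<Longrightarrow> 0 \<le> v \<Longrightarrow> u \<le> 2 * (u + v)" for u v :: real by simp
    show "C0 * C3 \<le> U0" unfolding U0_def by (rule *) (use C0_pos C1_nonneg C3_pos in auto)
  qed (use c in auto)
  finally show ?thesis by (simp add: \<tau>_def mult.assoc)
qed

definition "U1 Tm = U0 * (1 + (Tm * (1 + \<rho>) / T0) powr \<beta>)"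

lemma U1_ge: "U0 \<le> U1 Tm"
  using U0_pos by (simp add: U1_def algebra_simps)

text \<open>For long times apply the short time bound to the last steps only: the preceding ones are averages
  and do not increase the supremum.\<close>

theorem steps_sup_bound:
  assumes g: "g \<in> borel_measurable borel" and c: "0 < c" and gc: "(\<integral>\<^sup>+y. ennreal_powr (g y) p \<partial>lborel) \<le> ennreal (c powr p)"
    and k: "0 < k" "i + k \<le> n" and Tm: "t (i + k) - t i \<le> Tm"
  shows "steps i k g x \<le> ennreal (U1 Tm * (t (i + k) - t i) powr (- \<beta>) * c)"
proof -
  define j where "j = i + k"
  define \<tau> where "\<tau> = t j - t i"
  have j: "i < j" "j \<le> n" using k by (auto simp: j_def)
  have \<tau>: "0 < \<tau>" "\<tau> \<le> Tm" using t_strict[OF j] Tm by (auto simp: \<tau>_def j_def)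
  have \<rho>: "0 < 1 + \<rho>" "1 \<le> 1 + \<rho>" using pos by auto
  have big: "U0 * s powr (- \<beta>) * c \<le> U1 Tm * \<tau> powr (- \<beta>) * c" if s: "T0 / (1 + \<rho>) \<le> s" for s
  proof -
    have r: "0 < T0 / (1 + \<rho>)" using T0(1) \<rho> by simp
    have "s powr (- \<beta>) \<le> (T0 / (1 + \<rho>)) powr (- \<beta>)" using s r \<beta> by (intro powr_mono2') auto
    also have "\<dots> = (Tm * (1 + \<rho>) / T0) powr \<beta> * Tm powr (- \<beta>)"
    proof -
      have "(Tm * (1 + \<rho>) / T0) powr \<beta> * Tm powr (- \<beta>) = ((1 + \<rho>) / T0) powr \<beta> * (Tm powr \<beta> * Tm powr (- \<beta>))"
        using \<tau> T0(1) \<rho> by (simp add: powr_mult powr_divide)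
      also have "Tm powr \<beta> * Tm powr (- \<beta>) = 1" using \<tau> by (simp flip: powr_add)
      also have "((1 + \<rho>) / T0) powr \<beta> * 1 = (T0 / (1 + \<rho>)) powr (- \<beta>)"
        using T0(1) \<rho> by (simp add: powr_divide powr_minus_divide)
      finally show ?thesis by simp
    qed
    also have "\<dots> \<le> (Tm * (1 + \<rho>) / T0) powr \<beta> * \<tau> powr (- \<beta>)"
      using \<tau> \<beta> by (intro mult_left_mono powr_mono2') auto
    also have "\<dots> \<le> (1 + (Tm * (1 + \<rho>) / T0) powr \<beta>) * \<tau> powr (- \<beta>)" by (intro mult_right_mono) auto
    finally have "U0 * s powr (- \<beta>) * c \<le> U0 * ((1 + (Tm * (1 + \<rho>) / T0) powr \<beta>) * \<tau> powr (- \<beta>)) * c"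
      using U0_pos c by (intro mult_right_mono mult_left_mono) auto
    then show ?thesis by (simp add: U1_def mult.assoc)
  qed
  have "steps i k g x \<le> ennreal (U1 Tm * \<tau> powr (- \<beta>) * c)"
  proof (cases "\<tau> \<le> T0")
    case True
    have "steps i k g x \<le> ennreal (U0 * \<tau> powr (- \<beta>) * c)"
      using short_time_bound[OF g c gc k(1,2)] True by (simp add: \<tau>_def j_def)
    also have "\<dots> \<le> ennreal (U1 Tm * \<tau> powr (- \<beta>) * c)"
      using U1_ge[of Tm] c by (intro ennreal_leI mult_right_mono) auto
    finally show ?thesis .
  next
    case False
    obtain k' where k': "k = Suc k'" using k(1) by (cases k) auto
    have jl: "i + k' < n" "Suc (i + k') = j" using k k' by (auto simp: j_def)
    show ?thesis
    (* The last step alone may be longer than T0. *)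
    proof (cases "t j - t (i + k') \<le> T0")
      case False
      have "steps i k g x = steps i k' (step (i + k') g) x"
        using steps_append[of i k' 1 g] by (simp add: k')
      also have "\<dots> \<le> ennreal (U0 * (t j - t (i + k')) powr (- \<beta>) * c)"
        using single_step_bound[OF g c gc jl(1)] jl by (intro steps_le_const) auto
      also have "\<dots> \<le> ennreal (U1 Tm * \<tau> powr (- \<beta>) * c)"
      proof (intro ennreal_leI big)
        have "T0 / (1 + \<rho>) \<le> T0 / 1" using T0(1) \<rho> by (intro divide_left_mono) auto
        then show "T0 / (1 + \<rho>) \<le> t j - t (i + k')" using False by simp
      qed
      finally show ?thesis .
    next
      case True
      (* The longest final stretch within T0; by the ratio condition it is at least T0 / (1 + \<rho>) long. *)
      define r where "r = (LEAST r. t j - t (i + r) \<le> T0)"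
      have r1: "t j - t (i + r) \<le> T0" unfolding r_def by (rule LeastI[of _ k'], rule True)
      have r2: "r \<le> k'" unfolding r_def by (rule Least_le, rule True)
      have r0: "0 < r" using r1 False by (cases r) (auto simp: \<tau>_def)
      then obtain r' where r': "r = Suc r'" by (cases r) auto
      have r3: "T0 < t j - t (i + r')"
        using not_less_Least[of r' "\<lambda>r. t j - t (i + r) \<le> T0"] unfolding r_def[symmetric] r' by simp
      have lj: "i + r < j" using r2 jl by simp
      have rat: "t (i + r) - t (i + r') \<le> \<rho> * (t j - t (i + r))"
      proof -
        have "t (i + r) - t (i + r') \<le> \<rho> * (t (Suc (i + r)) - t (i + r))"
          using ratio(2)[of "i + r'"] lj j r' by simp
        also have "\<dots> \<le> \<rho> * (t j - t (i + r))"
        proof -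
          have "t (Suc (i + r)) \<le> t j" using t_strict[of "Suc (i + r)" j] lj j by (cases "Suc (i + r) = j") auto
          then show ?thesis using pos by (intro mult_left_mono) auto
        qed
        finally show ?thesis .
      qed
      have sp: "T0 / (1 + \<rho>) \<le> t j - t (i + r)"
      proof -
        have "T0 \<le> (1 + \<rho>) * (t j - t (i + r))" using r3 rat by (simp add: distrib_right)
        then show ?thesis using \<rho> by (simp add: pos_divide_le_eq mult.commute)
      qed
      have kr: "k = r + (k - r)" "0 < k - r" "i + r + (k - r) = j" using r2 k' by (auto simp: j_def)
      have "steps i k g x = steps i r (steps (i + r) (k - r) g) x"
        by (subst kr(1)) (simp only: steps_append)
      also have "\<dots> \<le> ennreal (U0 * (t j - t (i + r)) powr (- \<beta>) * c)"
      proof (rule steps_le_const)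
        show "i + r \<le> n" using lj j by simp
        show "steps (i + r) (k - r) g y \<le> ennreal (U0 * (t j - t (i + r)) powr (- \<beta>) * c)" for y
          using short_time_bound[OF g c gc kr(2), of "i + r"] r1 j unfolding kr(3) by blast
      qed
      also have "\<dots> \<le> ennreal (U1 Tm * \<tau> powr (- \<beta>) * c)"
        by (intro ennreal_leI big sp)
      finally show ?thesis .
    qed
  qed
  then show ?thesis by (simp add: \<tau>_def j_def)
qed

end

section \<open>Khasminskii's lemma for a chain\<close>

lemma ennreal_exp_real: "0 \<le> x \<Longrightarrow> ennreal_exp (ennreal x) = ennreal (exp x)"
  by (simp add: ennreal_exp_def)

lemma ennreal_exp_measurable [measurable]: "ennreal_exp \<in> borel_measurable borel"
  unfolding ennreal_exp_def[abs_def] by measurable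

lemma ennreal_exp_mono: "x \<le> y \<Longrightarrow> ennreal_exp x \<le> ennreal_exp y"
proof (cases y)
  case (real r)
  assume "x \<le> y"
  with real obtain s where "x = ennreal s" "0 \<le> s" "s \<le> r" by (cases x) (auto simp: top_unique)
  then show ?thesis using real by (simp add: ennreal_exp_real ennreal_leI)
qed (simp add: ennreal_exp_def)

lemma ennreal_exp_ge_1: "1 \<le> ennreal_exp x"
  by (cases x) (auto simp: ennreal_exp_def)

lemma ennreal_exp_add: "ennreal_exp (x + y) = ennreal_exp x * ennreal_exp y"
proof (cases "x = \<top> \<or> y = \<top>")
  case True
  have "ennreal_exp z \<noteq> 0" for z using ennreal_exp_ge_1[of z] by auto
  then show ?thesis using True by (auto simp: ennreal_exp_def ennreal_mult_top ennreal_top_mult)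
next
  case False
  then obtain r s where "x = ennreal r" "0 \<le> r" "y = ennreal s" "0 \<le> s"
    by (cases x; cases y) auto
  then show ?thesis
    by (simp add: ennreal_exp_real exp_add ennreal_mult flip: ennreal_plus)
qed

lemma ennreal_exp_small:
  assumes "x \<le> ennreal (1 / 4)"
  shows "ennreal_exp x \<le> 1 + 2 * x"
proof -
  obtain r where r: "x = ennreal r" "0 \<le> r" "r \<le> 1 / 4"
    using assms by (cases x) (auto simp: top_unique)
  have "exp r \<le> 1 + r + r\<^sup>2" using r by (intro exp_bound) auto
  also have "\<dots> \<le> 1 + 2 * r" using mult_left_mono[of r 1 r] r by (simp add: power2_eq_square)
  finally have "ennreal (exp r) \<le> ennreal (1 + 2 * r)" by (rule ennreal_leI)
  also have "\<dots> = 1 + 2 * ennreal r" using r by (simp add: ennreal_plus ennreal_mult)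
  finally show ?thesis using r by (simp add: ennreal_exp_real)
qed

context kernel_chain
begin

text \<open>The expectation, for the chain at \<open>x\<close> at the time \<open>t i\<close>, of the exponential of the sum of \<open>k\<close>
  potentials. There are \<open>Suc n\<close> potentials but only \<open>n\<close> transitions: none follows the last potential,
  which explains the case \<open>k = 0\<close>.\<close>

primrec expect_exp :: "(nat \<Rightarrow> 'a \<Rightarrow> ennreal) \<Rightarrow> nat \<Rightarrow> nat \<Rightarrow> 'a \<Rightarrow> ennreal" where
  "expect_exp V i 0 x = 1"
| "expect_exp V i (Suc k) x = ennreal_exp (V i x) * (if k = 0 then 1 else step i (expect_exp V (Suc i) k) x)"

primrec expect_sum :: "(nat \<Rightarrow> 'a \<Rightarrow> ennreal) \<Rightarrow> nat \<Rightarrow> nat \<Rightarrow> 'a \<Rightarrow> ennreal" where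
  "expect_sum V i 0 x = 0"
| "expect_sum V i (Suc k) x = V i x + (if k = 0 then 0 else step i (expect_sum V (Suc i) k) x)"

lemma step_const: "j < n \<Longrightarrow> step j (\<lambda>y. c) x = c"
  unfolding step_def using kern_section_measurable[of j x] kern_mass[of j x] by (simp add: nn_integral_multc)

lemma expect_exp_measurable:
  assumes "\<And>j. j \<le> n \<Longrightarrow> V j \<in> borel_measurable borel"
  shows "i + k \<le> Suc n \<Longrightarrow> expect_exp V i k \<in> borel_measurable borel"
proof (induction k arbitrary: i)
  case 0
  have "expect_exp V i 0 = (\<lambda>x. 1)" by (simp add: fun_eq_iff)
  then show ?case by simp
next
  case (Suc k)
  have [measurable]: "V i \<in> borel_measurable borel" using assms Suc.prems by simp
  have eq: "expect_exp V i (Suc k) = (\<lambda>x. ennreal_exp (V i x) * (if k = 0 then 1 else step i (expect_exp V (Suc i) k) x))"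
    by (simp add: fun_eq_iff)
  show ?case
  proof (cases "k = 0")
    case False
    then have [measurable]: "step i (expect_exp V (Suc i) k) \<in> borel_measurable borel"
      using Suc by (intro step_measurable Suc.IH) auto
    show ?thesis unfolding eq using False by simp
  qed (simp add: eq)
qed

lemma expect_sum_measurable:
  assumes "\<And>j. j \<le> n \<Longrightarrow> V j \<in> borel_measurable borel"
  shows "i + k \<le> Suc n \<Longrightarrow> expect_sum V i k \<in> borel_measurable borel"
proof (induction k arbitrary: i)
  case 0
  have "expect_sum V i 0 = (\<lambda>x. 0)" by (simp add: fun_eq_iff)
  then show ?case by simp
next
  case (Suc k)
  have [measurable]: "V i \<in> borel_measurable borel" using assms Suc.prems by simp
  have eq: "expect_sum V i (Suc k) = (\<lambda>x. V i x + (if k = 0 then 0 else step i (expect_sum V (Suc i) k) x))"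
    by (simp add: fun_eq_iff)
  show ?case
  proof (cases "k = 0")
    case False
    then have [measurable]: "step i (expect_sum V (Suc i) k) \<in> borel_measurable borel"
      using Suc by (intro step_measurable Suc.IH) auto
    show ?thesis unfolding eq using False by simp
  qed (simp add: eq)
qed

lemma expect_sum_eq:
  assumes V: "\<And>j. j \<le> n \<Longrightarrow> V j \<in> borel_measurable borel"
  shows "i + k \<le> Suc n \<Longrightarrow> expect_sum V i k x = (\<Sum>r<k. steps i r (V (i + r)) x)"
proof (induction k arbitrary: i x)
  case (Suc k)
  show ?case
  proof (cases "k = 0")
    case False
    then have i: "i < n" using Suc.prems by simp
    have IH: "expect_sum V (Suc i) k = (\<lambda>x. \<Sum>r<k. steps (Suc i) r (V (Suc i + r)) x)"
      by (rule ext, rule Suc.IH) (use Suc.prems in simp)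
    have "expect_sum V i (Suc k) x = V i x + step i (\<lambda>x. \<Sum>r<k. steps (Suc i) r (V (Suc i + r)) x) x"
      unfolding IH[symmetric] using False by simp
    also have "step i (\<lambda>x. \<Sum>r<k. steps (Suc i) r (V (Suc i + r)) x) x = (\<Sum>r<k. step i (steps (Suc i) r (V (Suc i + r))) x)"
    proof (rule step_sum[OF i])
      fix r assume "r \<in> {..<k}"
      then show "steps (Suc i) r (V (Suc i + r)) \<in> borel_measurable borel"
        using Suc.prems by (intro steps_measurable V) auto
    qed
    also have "V i x + \<dots> = (\<Sum>r<Suc k. steps i r (V (i + r)) x)"
      by (subst sum.lessThan_Suc_shift) simp
    finally show ?thesis .
  qed simp
qed simp

text \<open>With \<open>S\<close> for \<open>expect_sum\<close>, the induction step multiplies \<open>1 + 4 S'\<close>, which is at most 2, by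
  \<open>exp v \<le> 1 + 2 v\<close>, so a potential \<open>v\<close> contributes \<open>2 v * 2 = 4 v\<close>.\<close>

lemma khasminskii_small:
  assumes V: "\<And>j. j \<le> n \<Longrightarrow> V j \<in> borel_measurable borel"
  shows "i + k \<le> Suc n \<Longrightarrow> (\<And>r y. r \<le> k \<Longrightarrow> expect_sum V (i + r) (k - r) y \<le> ennreal (1 / 4))
    \<Longrightarrow> expect_exp V i k x \<le> 1 + 4 * expect_sum V i k x"
proof (induction k arbitrary: i x)
  case (Suc k)
  let ?P = "if k = 0 then 1 else step i (expect_exp V (Suc i) k) x"
  let ?Q = "if k = 0 then 0 else step i (expect_sum V (Suc i) k) x"
  have small: "expect_sum V (Suc i) k y \<le> ennreal (1 / 4)" for y
    using Suc.prems(2)[of 1 y] by simp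
  have IH: "expect_exp V (Suc i) k y \<le> 1 + 4 * expect_sum V (Suc i) k y" for y
  proof (rule Suc.IH)
    show "expect_sum V (Suc i + r) (k - r) y \<le> ennreal (1 / 4)" if "r \<le> k" for r y
      using Suc.prems(2)[of "Suc r" y] that by simp
  qed (use Suc.prems in simp)
  have PQ: "?P \<le> 1 + 4 * ?Q"
  proof (cases "k = 0")
    case False
    then have i: "i < n" using Suc.prems by simp
    have m: "expect_sum V (Suc i) k \<in> borel_measurable borel"
      using Suc.prems by (intro expect_sum_measurable V) auto
    have "step i (expect_exp V (Suc i) k) x \<le> step i (\<lambda>y. 1 + 4 * expect_sum V (Suc i) k y) x"
      by (rule step_mono[OF IH])
    also have "\<dots> = step i (\<lambda>y. 1) x + 4 * step i (expect_sum V (Suc i) k) x"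
      using m by (subst step_add[OF i]) (auto simp: step_cmult[OF i m])
    finally show ?thesis using False by (simp add: step_const[OF i])
  qed simp
  have P2: "?P \<le> 2"
  proof (cases "k = 0")
    case False
    then have i: "i < n" using Suc.prems by simp
    have "expect_exp V (Suc i) k y \<le> 2" for y
    proof -
      have "1 + 4 * expect_sum V (Suc i) k y \<le> 1 + 4 * ennreal (1 / 4)"
        by (intro add_left_mono mult_left_mono small) auto
      also have "4 * ennreal (1 / 4) = ennreal 1"
        by (subst ennreal_numeral[symmetric], subst ennreal_mult'[symmetric]) auto
      finally show ?thesis using IH[of y] by (simp add: order_trans)
    qed
    then show ?thesis using False step_le_const[OF i] by simp
  qed simp
  have Vs: "V i x \<le> ennreal (1 / 4)"
    using Suc.prems(2)[of 0 x] by (auto intro: order_trans[rotated])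
  have "expect_exp V i (Suc k) x \<le> (1 + 2 * V i x) * ?P"
    by (simp add: mult_right_mono[OF ennreal_exp_small[OF Vs]])
  also have "\<dots> = ?P + 2 * V i x * ?P" by (simp add: distrib_right)
  also have "\<dots> \<le> (1 + 4 * ?Q) + 2 * V i x * 2"
    by (intro add_mono PQ mult_left_mono P2) auto
  also have "\<dots> = 1 + 4 * expect_sum V i (Suc k) x"
  proof -
    have e: "expect_sum V i (Suc k) x = V i x + ?Q" by simp
    have four: "2 * v * 2 = 4 * v" for v :: ennreal
    proof -
      have "2 * v * 2 = (2 * 2) * v" by (metis mult.assoc mult.commute)
      also have "2 * 2 = (4 :: ennreal)" by simp
      finally show ?thesis .
    qed
    have "(1 + 4 * q) + 4 * v = 1 + 4 * (v + q)" for v q :: ennreal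
      by (metis distrib_left add.assoc add.commute)
    then show ?thesis unfolding e four .
  qed
  finally show ?case .
qed simp

lemma expect_exp_split:
  assumes V: "\<And>j. j \<le> n \<Longrightarrow> V j \<in> borel_measurable borel"
    and M: "\<And>y. expect_exp V (i + a) b y \<le> M"
  shows "i + a + b \<le> Suc n \<Longrightarrow> expect_exp V i (a + b) x \<le> expect_exp V i a x * M"
  using M
proof (induction a arbitrary: i x)
  case (Suc a)
  show ?case
  proof (cases "a + b = 0")
    case True
    then have "1 \<le> M" using Suc.prems(2)[of x] by simp
    then show ?thesis using True mult_left_mono[of 1 M "ennreal_exp (V i x)"] by simp
  next
    case False
    then have i: "i < n" using Suc.prems(1) by arith
    have m: "expect_exp V (Suc i) a \<in> borel_measurable borel"
      using Suc.prems by (intro expect_exp_measurable V) auto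
    have "expect_exp V (Suc i) (a + b) y \<le> expect_exp V (Suc i) a y * M" for y
      by (rule Suc.IH) (use Suc.prems in auto)
    then have "step i (expect_exp V (Suc i) (a + b)) x \<le> step i (\<lambda>y. M * expect_exp V (Suc i) a y) x"
      by (intro step_mono) (simp add: mult.commute)
    also have "\<dots> = M * step i (expect_exp V (Suc i) a) x" by (rule step_cmult[OF i m])
    also have "step i (expect_exp V (Suc i) a) x = (if a = 0 then 1 else step i (expect_exp V (Suc i) a) x)"
    proof (cases "a = 0")
      case True
      have "expect_exp V (Suc i) 0 = (\<lambda>x. 1)" by (simp add: fun_eq_iff)
      then show ?thesis using True step_const[OF i, of 1 x] by simp
    qed simp
    finally have le: "ennreal_exp (V i x) * step i (expect_exp V (Suc i) (a + b)) x
       \<le> ennreal_exp (V i x) * (M * (if a = 0 then 1 else step i (expect_exp V (Suc i) a) x))"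
      by (rule mult_left_mono) simp
    have "expect_exp V i (Suc a + b) x = ennreal_exp (V i x) * step i (expect_exp V (Suc i) (a + b)) x"
      using False by auto
    also note le
    also have "ennreal_exp (V i x) * (M * (if a = 0 then 1 else step i (expect_exp V (Suc i) a) x)) = expect_exp V i (Suc a) x * M"
      by (simp add: mult_ac)
    finally show ?thesis .
  qed
qed simp

text \<open>A block is followed by one single interval, whose mass makes the total exceed \<open>c0\<close>. The
  factor \<open>2 exp (B + \<mu>)\<close> for the two is at most the exponential of the rate times their mass.\<close>

lemma khasminskii:
  fixes \<mu> :: "nat \<Rightarrow> real"
  assumes V: "\<And>j. j \<le> n \<Longrightarrow> V j \<in> borel_measurable borel"
    and \<mu>: "\<And>j. 0 \<le> \<mu> j" and B: "0 \<le> B" and c0: "0 < c0"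
    and block: "\<And>i k x. i + k \<le> Suc n \<Longrightarrow> (\<Sum>r<k. \<mu> (i + r)) \<le> c0 \<Longrightarrow> expect_sum V i k x \<le> ennreal (1 / 4)"
    and single: "\<And>i x. i \<le> n \<Longrightarrow> V i x \<le> ennreal (B + \<mu> i)"
  shows "i + k \<le> Suc n \<Longrightarrow> expect_exp V i k x \<le> ennreal (2 * exp ((1 + (B + ln 2) / c0) * (\<Sum>r<k. \<mu> (i + r))))"
proof (induction k arbitrary: i x rule: less_induct)
  case (less k)
  define N where "N = 1 + (B + ln 2) / c0"
  have N: "1 \<le> N" using B c0 by (simp add: N_def)
  have small: "expect_exp V i k' y \<le> 2" if k': "i + k' \<le> Suc n" and s: "(\<Sum>r<k'. \<mu> (i + r)) \<le> c0" for i k' y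
  proof -
    have sub: "expect_sum V (i + r) (k' - r) z \<le> ennreal (1 / 4)" if "r \<le> k'" for r z
    proof (rule block)
      have "(\<Sum>l<k' - r. \<mu> (i + r + l)) = (\<Sum>l\<in>{r..<k'}. \<mu> (i + l))"
        by (rule sum.reindex_bij_witness[of _ "\<lambda>l. l - r" "\<lambda>l. r + l"]) (auto simp: add_ac)
      also have "\<dots> \<le> (\<Sum>l<k'. \<mu> (i + l))" by (intro sum_mono2) (auto simp: \<mu>)
      finally show "(\<Sum>l<k' - r. \<mu> (i + r + l)) \<le> c0" using s by simp
    qed (use that k' in simp)
    have "expect_exp V i k' y \<le> 1 + 4 * expect_sum V i k' y"
      by (rule khasminskii_small[OF V k' sub])
    also have "\<dots> \<le> 1 + 4 * ennreal (1 / 4)" using sub[of 0] by (intro add_left_mono mult_left_mono) auto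
    also have "4 * ennreal (1 / 4) = ennreal 1"
      by (subst ennreal_numeral[symmetric], subst ennreal_mult'[symmetric]) auto
    finally show ?thesis by simp
  qed
  show ?case
  proof (cases "(\<Sum>r<k. \<mu> (i + r)) \<le> c0")
    case True
    have "2 = ennreal (2 * 1)" by simp
    also have "\<dots> \<le> ennreal (2 * exp (N * (\<Sum>r<k. \<mu> (i + r))))"
      using N \<mu> by (intro ennreal_leI mult_left_mono) (auto intro!: mult_nonneg_nonneg sum_nonneg)
    finally show ?thesis using small[OF less.prems True, of x] by (simp add: N_def order_trans)
  next
    case False
    (* The interval i + r is the first at which the accumulated mass exceeds c0. *)
    define r where "r = (LEAST r. c0 < (\<Sum>l<Suc r. \<mu> (i + l)))"
    obtain k' where k': "k = Suc k'" using False c0 by (cases k) auto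
    have ex: "c0 < (\<Sum>l<Suc k'. \<mu> (i + l))" using False k' by simp
    have r1: "c0 < (\<Sum>l<Suc r. \<mu> (i + l))" unfolding r_def by (rule LeastI[of _ k'], rule ex)
    have r2: "r \<le> k'" unfolding r_def by (rule Least_le, rule ex)
    have r3: "(\<Sum>l<r. \<mu> (i + l)) \<le> c0"
    proof (cases r)
      case (Suc r')
      then show ?thesis
        using not_less_Least[of r' "\<lambda>r. c0 < (\<Sum>l<Suc r. \<mu> (i + l))"] unfolding r_def[symmetric] by simp
    qed (use c0 in simp)
    define s where "s = k - Suc r"
    have ks: "k = r + Suc s" "s < k" using r2 k' by (auto simp: s_def)
    let ?R = "\<Sum>l<s. \<mu> (Suc (i + r) + l)"
    have rest: "expect_exp V (Suc (i + r)) s y \<le> ennreal (2 * exp (N * ?R))" for y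
      using less.IH[OF ks(2), of "Suc (i + r)" y] less.prems ks by (simp add: N_def)
    have mid: "expect_exp V (i + r) (Suc s) y \<le> ennreal (exp (B + \<mu> (i + r)) * (2 * exp (N * ?R)))" for y
    proof -
      have "expect_exp V (i + r) (1 + s) y \<le> expect_exp V (i + r) 1 y * ennreal (2 * exp (N * ?R))"
        by (rule expect_exp_split[OF V]) (use rest less.prems ks in auto)
      also have "expect_exp V (i + r) 1 y \<le> ennreal_exp (ennreal (B + \<mu> (i + r)))"
        using ennreal_exp_mono[OF single[of "i + r" y]] less.prems ks by simp
      also have "\<dots> = ennreal (exp (B + \<mu> (i + r)))" by (rule ennreal_exp_real) (use B \<mu> in auto)
      finally show ?thesis by (simp add: ennreal_mult'[symmetric] mult_right_mono)
    qed
    have "expect_exp V i k x \<le> expect_exp V i r x * ennreal (exp (B + \<mu> (i + r)) * (2 * exp (N * ?R)))"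
      unfolding ks(1) by (rule expect_exp_split[OF V mid]) (use less.prems ks in auto)
    also have "\<dots> \<le> 2 * ennreal (exp (B + \<mu> (i + r)) * (2 * exp (N * ?R)))"
      by (intro mult_right_mono small r3) (use less.prems ks in auto)
    also have "\<dots> = ennreal (2 * (exp (B + \<mu> (i + r)) * (2 * exp (N * ?R))))"
      unfolding ennreal_numeral[symmetric] by (rule ennreal_mult'[symmetric]) simp
    also have "\<dots> \<le> ennreal (2 * exp (N * (\<Sum>r<k. \<mu> (i + r))))"
    proof (intro ennreal_leI mult_left_mono)
      have split: "(\<Sum>l<k. \<mu> (i + l)) = (\<Sum>l<Suc r. \<mu> (i + l)) + ?R"
      proof -
        have "(\<Sum>l<k. \<mu> (i + l)) = (\<Sum>l<Suc r. \<mu> (i + l)) + (\<Sum>l\<in>{Suc r..<k}. \<mu> (i + l))"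
          using sum.atLeastLessThan_concat[of 0 "Suc r" k "\<lambda>l. \<mu> (i + l)"] ks by (simp add: lessThan_atLeast0)
        also have "(\<Sum>l\<in>{Suc r..<k}. \<mu> (i + l)) = ?R"
          by (rule sum.reindex_bij_witness[of _ "\<lambda>l. Suc r + l" "\<lambda>l. l - Suc r"]) (auto simp: ks)
        finally show ?thesis .
      qed
      have "B + \<mu> (i + r) + ln 2 \<le> N * (\<Sum>l<Suc r. \<mu> (i + l))"
      proof -
        define Q S where "Q = (B + ln 2) / c0" and "S = (\<Sum>l<Suc r. \<mu> (i + l))"
        have Q: "Q * c0 = B + ln 2" "0 \<le> Q" using B c0 by (auto simp: Q_def)
        have "Q * c0 \<le> Q * S"
          using r1 Q(2) by (intro mult_left_mono) (auto simp: S_def)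
        moreover have "\<mu> (i + r) \<le> S" using \<mu> by (simp add: S_def sum_nonneg)
        ultimately have "B + \<mu> (i + r) + ln 2 \<le> S + Q * S" using Q(1) by linarith
        also have "\<dots> = N * S" by (simp add: N_def Q_def distrib_right)
        finally show ?thesis unfolding S_def .
      qed
      then have "exp (B + \<mu> (i + r) + ln 2) \<le> exp (N * (\<Sum>l<Suc r. \<mu> (i + l)))" by simp
      then have "exp (B + \<mu> (i + r)) * 2 \<le> exp (N * (\<Sum>l<Suc r. \<mu> (i + l)))" by (simp add: exp_add)
      then have "exp (B + \<mu> (i + r)) * 2 * exp (N * ?R) \<le> exp (N * (\<Sum>l<Suc r. \<mu> (i + l))) * exp (N * ?R)"
        by (intro mult_right_mono) auto
      then show "exp (B + \<mu> (i + r)) * (2 * exp (N * ?R)) \<le> exp (N * (\<Sum>r<k. \<mu> (i + r)))"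
        unfolding split by (simp only: distrib_left exp_add mult.assoc)
    qed auto
    finally show ?thesis by (simp add: N_def)
  qed
qed

lemma steps_Lp_bound:
  assumes g: "g \<in> borel_measurable borel" and k: "0 < k" "i + k \<le> n" and Tm: "t (i + k) - t i \<le> Tm"
  shows "steps i k g x \<le> ennreal (U1 Tm * (t (i + k) - t i) powr (- \<beta>)) * ennreal_powr (\<integral>\<^sup>+y. ennreal_powr (g y) p \<partial>lborel) (1 / p)"
proof -
  define \<tau> where "\<tau> = t (i + k) - t i"
  define u where "u = U1 Tm * \<tau> powr (- \<beta>)"
  let ?G = "\<integral>\<^sup>+y. ennreal_powr (g y) p \<partial>lborel"
  have \<tau>: "0 < \<tau>" using t_strict[of i "i + k"] k by (simp add: \<tau>_def)
  have u: "0 < u" using U1_ge[of Tm] U0_pos \<tau> by (simp add: u_def)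
  have b: "steps i k g x \<le> ennreal (u * c)" if "0 < c" "?G \<le> ennreal (c powr p)" for c
    using steps_sup_bound[OF g that k Tm] by (simp add: u_def \<tau>_def)
  show ?thesis unfolding \<tau>_def[symmetric] u_def[symmetric]
  proof (cases ?G)
    case (real G)
    show "steps i k g x \<le> ennreal u * ennreal_powr ?G (1 / p)"
    proof (cases "G = 0")
      case False
      then have G: "0 < G" using real by simp
      have "steps i k g x \<le> ennreal (u * G powr (1 / p))"
        by (rule b) (use G p1 real in \<open>auto simp: powr_powr\<close>)
      then show ?thesis using real u by (simp add: ennreal_powr_real ennreal_mult')
    next
      case True
      have small: "steps i k g x \<le> ennreal e" if e: "0 < e" for e
      proof -
        have "steps i k g x \<le> ennreal (u * (e / u))"
        proof (rule b)
          show "0 < e / u" using e u by simp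
          have "?G = 0" using real(2) True by simp
          then show "?G \<le> ennreal ((e / u) powr p)" by simp
        qed
        then show ?thesis using u by simp
      qed
      have "steps i k g x \<le> 0"
      proof (rule ennreal_le_epsilon)
        fix e :: real assume "0 < e"
        from small[OF this] show "steps i k g x \<le> 0 + ennreal e" by simp
      qed
      then show ?thesis by simp
    qed
  next
    case top
    then show "steps i k g x \<le> ennreal u * ennreal_powr ?G (1 / p)"
      using u by (simp add: ennreal_mult_top)
  qed
qed

end

section \<open>Exponential moments of additive functionals\<close>

context kernel_chain
begin

lemma step_measurable_parametric:
  assumes j: "j < n" and F: "(\<lambda>z. F (fst z) (snd z)) \<in> borel_measurable (borel \<Otimes>\<^sub>M borel)"
  shows "(\<lambda>z. step j (F (fst z :: real)) (snd z)) \<in> borel_measurable (borel \<Otimes>\<^sub>M borel)"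
proof -
  have k: "(\<lambda>w. gdens (A j (snd (fst w))) (snd w - snd (fst w))) \<in> borel_measurable ((borel \<Otimes>\<^sub>M borel) \<Otimes>\<^sub>M lborel :: ((real \<times> 'a) \<times> 'a) measure)"
    using measurable_compose[OF _ kern_measurable[OF j], of "\<lambda>w. (snd (fst w), snd w)" "(borel \<Otimes>\<^sub>M borel) \<Otimes>\<^sub>M lborel :: ((real \<times> 'a) \<times> 'a) measure"] by simp
  have g: "(\<lambda>w. F (fst (fst w)) (snd w)) \<in> borel_measurable ((borel \<Otimes>\<^sub>M borel) \<Otimes>\<^sub>M lborel :: ((real \<times> 'a) \<times> 'a) measure)"
    using measurable_compose[OF _ F, of "\<lambda>w. (fst (fst w), snd w)" "(borel \<Otimes>\<^sub>M borel) \<Otimes>\<^sub>M lborel :: ((real \<times> 'a) \<times> 'a) measure"] by simp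
  have "(\<lambda>(z, y). ennreal (gdens (A j (snd z)) (y - snd z)) * F (fst z) y) \<in> borel_measurable ((borel \<Otimes>\<^sub>M borel) \<Otimes>\<^sub>M lborel)"
    using borel_measurable_times_ennreal[OF measurable_compose[OF k measurable_ennreal] g] by (simp add: split_beta')
  then show ?thesis
    unfolding step_def by (rule lborel.borel_measurable_nn_integral)
qed

lemma steps_measurable_parametric:
  "i + k \<le> n \<Longrightarrow> (\<lambda>z. F (fst z) (snd z)) \<in> borel_measurable (borel \<Otimes>\<^sub>M borel)
   \<Longrightarrow> (\<lambda>z. steps i k (F (fst z :: real)) (snd z)) \<in> borel_measurable (borel \<Otimes>\<^sub>M borel)"
proof (induction k arbitrary: i)
  case (Suc k)
  then have "(\<lambda>z. steps (Suc i) k (F (fst z)) (snd z)) \<in> borel_measurable (borel \<Otimes>\<^sub>M borel)" by simp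
  with Suc.prems show ?case
    using step_measurable_parametric[of i "\<lambda>s. steps (Suc i) k (F s)"] by simp
qed simp

lemma section_measurable:
  "(\<lambda>z. F (fst z) (snd z)) \<in> borel_measurable (borel \<Otimes>\<^sub>M borel) \<Longrightarrow> F s \<in> borel_measurable borel"
  "(\<lambda>z. F (fst z) (snd z)) \<in> borel_measurable (borel \<Otimes>\<^sub>M borel) \<Longrightarrow> (\<lambda>s. F s x) \<in> borel_measurable borel"
  using measurable_compose[of "\<lambda>x. (s, x)" borel "borel \<Otimes>\<^sub>M borel" "\<lambda>z. F (fst z) (snd z)" borel]
    measurable_compose[of "\<lambda>s. (s, x)" borel "borel \<Otimes>\<^sub>M borel" "\<lambda>z. F (fst z) (snd z)" borel] by simp_all

lemma step_integral:
  assumes j: "j < n" and F: "(\<lambda>z. F (fst z) (snd z)) \<in> borel_measurable (borel \<Otimes>\<^sub>M borel)" and S: "S \<in> sets borel"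
  shows "step j (\<lambda>y. \<integral>\<^sup>+s\<in>S. F s y \<partial>lborel) x = (\<integral>\<^sup>+s\<in>(S :: real set). step j (F s) x \<partial>lborel)"
proof -
  let ?k = "\<lambda>y. ennreal (gdens (A j x) (y - x))"
  have k [measurable]: "?k \<in> borel_measurable borel"
    using measurable_compose[OF kern_section_measurable[OF j] measurable_ennreal] .
  have F' [measurable]: "(\<lambda>(s, y). F s y) \<in> borel_measurable (borel \<Otimes>\<^sub>M borel)" using F by (simp add: split_beta')
  note [measurable] = S
  have "step j (\<lambda>y. \<integral>\<^sup>+s\<in>S. F s y \<partial>lborel) x = (\<integral>\<^sup>+y. (\<integral>\<^sup>+s. ?k y * (F s y * indicator S s) \<partial>lborel) \<partial>lborel)"
    unfolding step_def using section_measurable(2)[OF F] S by (intro nn_integral_cong nn_integral_cmult[symmetric]) simp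
  also have "\<dots> = (\<integral>\<^sup>+s. (\<integral>\<^sup>+y. ?k y * (F s y * indicator S s) \<partial>lborel) \<partial>lborel)"
  proof (rule lborel_pair.Fubini')
    have "(\<lambda>z. ?k (snd z) * (F (fst z) (snd z) * indicator S (fst z))) \<in> borel_measurable (lborel \<Otimes>\<^sub>M lborel)"
      using F by measurable
    then show "(\<lambda>(s, y). ?k y * (F s y * indicator S s)) \<in> borel_measurable (lborel \<Otimes>\<^sub>M lborel)"
      by (simp add: split_beta')
  qed
  also have "\<dots> = (\<integral>\<^sup>+s\<in>S. step j (F s) x \<partial>lborel)"
  proof (rule nn_integral_cong)
    fix s
    have [measurable]: "F s \<in> borel_measurable borel" by (rule section_measurable(1)[OF F])
    have "(\<integral>\<^sup>+y. ?k y * (F s y * indicator S s) \<partial>lborel) = (\<integral>\<^sup>+y. (?k y * F s y) * indicator S s \<partial>lborel)"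
      by (simp only: mult.assoc)
    then show "(\<integral>\<^sup>+y. ?k y * (F s y * indicator S s) \<partial>lborel) = step j (F s) x * indicator S s"
      by (simp add: step_def nn_integral_multc)
  qed
  finally show ?thesis .
qed

lemma steps_integral:
  "i + k \<le> n \<Longrightarrow> (\<lambda>z. F (fst z) (snd z)) \<in> borel_measurable (borel \<Otimes>\<^sub>M borel) \<Longrightarrow> S \<in> sets borel \<Longrightarrow>
   steps i k (\<lambda>y. \<integral>\<^sup>+s\<in>S. F s y \<partial>lborel) x = (\<integral>\<^sup>+s\<in>(S :: real set). steps i k (F s) x \<partial>lborel)"
proof (induction k arbitrary: i x)
  case (Suc k)
  have "steps (Suc i) k (\<lambda>y. \<integral>\<^sup>+s\<in>S. F s y \<partial>lborel) = (\<lambda>y. \<integral>\<^sup>+s\<in>S. steps (Suc i) k (F s) y \<partial>lborel)"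
    using Suc by (intro ext Suc.IH) auto
  then show ?case
    using Suc.prems step_integral[of i "\<lambda>s. steps (Suc i) k (F s)" S x] steps_measurable_parametric[of "Suc i" k F] by simp
qed simp

end

text \<open>Young's inequality with a free parameter, the tangent inequality integrated in time.\<close>

lemma nn_integral_young:
  fixes F :: "real \<Rightarrow> ennreal"
  assumes q: "1 < q" and c: "0 < c" and ab: "a \<le> b" and F [measurable]: "F \<in> borel_measurable borel"
  shows "(\<integral>\<^sup>+s\<in>{a..<b}. F s \<partial>lborel) \<le> ennreal (c * (b - a)) + ennreal (c powr (1 - q)) * (\<integral>\<^sup>+s\<in>{a..<b}. ennreal_powr (F s) q \<partial>lborel)"
proof -
  have "(\<integral>\<^sup>+s\<in>{a..<b}. F s \<partial>lborel)
    \<le> (\<integral>\<^sup>+s. (ennreal c * indicator {a..<b} s + ennreal (c powr (1 - q)) * (ennreal_powr (F s) q * indicator {a..<b} s)) \<partial>lborel)"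
  proof (rule nn_integral_mono)
    fix s
    have "F s \<le> ennreal ((q - 1) / q * c) + ennreal (c powr (1 - q) / q) * ennreal_powr (F s) q"
      by (rule ennreal_power_tangent[OF q c])
    also have "\<dots> \<le> ennreal c + ennreal (c powr (1 - q)) * ennreal_powr (F s) q"
    proof (intro add_mono mult_right_mono ennreal_leI)
      show "(q - 1) / q * c \<le> c" using q c mult_right_mono[of "(q - 1) / q" 1 c] by simp
      show "c powr (1 - q) / q \<le> c powr (1 - q)" using q divide_left_mono[of 1 q "c powr (1 - q)"] by simp
    qed simp
    finally show "F s * indicator {a..<b} s
      \<le> ennreal c * indicator {a..<b} s + ennreal (c powr (1 - q)) * (ennreal_powr (F s) q * indicator {a..<b} s)"
      by (simp split: split_indicator)
  qed
  also have "\<dots> = ennreal c * ennreal (b - a) + ennreal (c powr (1 - q)) * (\<integral>\<^sup>+s\<in>{a..<b}. ennreal_powr (F s) q \<partial>lborel)"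
    using ab by (subst nn_integral_add) (auto simp: nn_integral_cmult nn_integral_cmult_indicator)
  finally show ?thesis using c ab by (simp add: ennreal_mult')
qed

text \<open>The chain with potentials \<open>V j\<close> that integrate \<open>f\<close> over the \<open>j\<close>-th interval. The interval number \<open>n\<close> ends
  at \<open>t (Suc n)\<close>, where no transition takes place. The mass \<open>\<mu> j\<close> bounds both norms of \<open>f\<close> on the interval.\<close>

locale chain_potential = kernel_chain t n A \<epsilon> K L \<alpha> \<rho> p
  for t n and A :: "nat \<Rightarrow> 'a::euclidean_space \<Rightarrow> 'a \<Rightarrow> real" and \<epsilon> K L \<alpha> \<rho> p +
  fixes f :: "real \<Rightarrow> 'a \<Rightarrow> ennreal" and q T D :: real and \<mu> :: "nat \<Rightarrow> real"
  assumes f: "(\<lambda>z. f (fst z) (snd z)) \<in> borel_measurable (borel \<Otimes>\<^sub>M borel)"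
    and q: "1 < q" and pq: "real DIM('a) / (2 * p) < (q - 1) / q"
    and last_less: "t n < t (Suc n)"
    and last_ratio: "\<And>j. Suc j = n \<Longrightarrow> t (Suc n) - t n \<le> \<rho> * (t n - t j)"
    and horizon: "t (Suc n) - t 0 \<le> T"
    and D: "0 < D" "\<And>j. j \<le> n \<Longrightarrow> t (Suc j) - t j \<le> \<rho> * D"
    and \<mu>: "\<And>j. 0 \<le> \<mu> j"
    and time_norm: "\<And>j. j \<le> n \<Longrightarrow>
      (\<integral>\<^sup>+s\<in>{t j..<t (Suc j)}. ennreal_powr (ennreal_powr (\<integral>\<^sup>+y. ennreal_powr (f s y) p \<partial>lborel) (1 / p)) q \<partial>lborel) \<le> ennreal (\<mu> j)"
    and sup_norm: "\<And>j x. j \<le> n \<Longrightarrow>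
      ennreal (D powr (q - 1)) * (\<integral>\<^sup>+s\<in>{t j..<t (Suc j)}. ennreal_powr (f s x) q \<partial>lborel) \<le> ennreal (\<mu> j)"
begin

definition "V j x = (\<integral>\<^sup>+s\<in>{t j..<t (Suc j)}. f s x \<partial>lborel)"
text \<open>\<open>\<beta>'\<close> is the exponent of the singularity in the dual space of \<open>L\<^sub>q\<close>, so \<open>\<beta>' < 1\<close> is the condition on
  \<open>p\<close> and \<open>q\<close>. The factor \<open>G\<close> multiplies the free parameter of Young's inequality in the bound for a block.\<close>

definition "\<beta>' = \<beta> * q / (q - 1)"
definition "G = \<rho> + U1 T * (\<rho> * (T powr (1 - \<beta>') / (1 - \<beta>')))"
definition "c0 = (1 / (8 * G)) powr (q - 1) / (8 * (1 + U1 T))"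
definition "rate = 1 + (\<rho> + ln 2) / c0"

lemma t_less': "j \<le> n \<Longrightarrow> t j < t (Suc j)"
  using t_less[of j] last_less by (cases "j = n") auto

lemma t_mono: "i \<le> j \<Longrightarrow> j \<le> Suc n \<Longrightarrow> t i \<le> t j"
proof (induction rule: dec_induct)
  case (step j)
  then show ?case using t_less'[of j] by simp
qed simp

lemma t_T: "i \<le> j \<Longrightarrow> j \<le> Suc n \<Longrightarrow> t j - t i \<le> T"
  using t_mono[of 0 i] t_mono[of j "Suc n"] horizon by auto

lemma \<beta>': "0 < \<beta>'" "\<beta>' < 1"
proof -
  show "0 < \<beta>'" using \<beta> q by (simp add: \<beta>'_def)
  have "\<beta> < (q - 1) / q" using pq by (simp add: \<beta>_def)
  then have "\<beta> * q < q - 1" using q by (simp add: pos_less_divide_eq)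
  then show "\<beta>' < 1" using q by (simp add: \<beta>'_def)
qed

lemma U1_pos: "0 < U1 T"
  using U1_ge[of T] U0_pos by simp

lemma G: "0 < G"
  unfolding G_def using pos U1_pos \<beta>' by (intro add_pos_nonneg mult_nonneg_nonneg) auto

lemma c0: "0 < c0"
  unfolding c0_def using G U1_pos by simp

lemma V_measurable: "V j \<in> borel_measurable borel"
proof -
  have "(\<lambda>z. f (snd z) (fst z)) \<in> borel_measurable (borel \<Otimes>\<^sub>M lborel)"
    using measurable_compose[OF _ f, of "\<lambda>z. (snd z, fst z)" "borel \<Otimes>\<^sub>M lborel"] by simp
  then have "(\<lambda>(x, s). f s x * indicator {t j..<t (Suc j)} s) \<in> borel_measurable (borel \<Otimes>\<^sub>M lborel)"
    unfolding split_beta' by measurable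
  then show ?thesis unfolding V_def by (rule lborel.borel_measurable_nn_integral)
qed

text \<open>No smoothing: Young's inequality at a fixed point, with the parameter scaled by the mesh \<open>D\<close>.\<close>

lemma V_bound:
  assumes j: "j \<le> n" and b: "0 < b"
  shows "V j x \<le> ennreal (b * \<rho> + b powr (1 - q) * \<mu> j)"
proof -
  let ?S = "\<integral>\<^sup>+s\<in>{t j..<t (Suc j)}. ennreal_powr (f s x) q \<partial>lborel"
  have bD: "0 < b / D" using b D by simp
  have "V j x \<le> ennreal (b / D * (t (Suc j) - t j)) + ennreal ((b / D) powr (1 - q)) * ?S"
    unfolding V_def by (rule nn_integral_young[OF q bD]) (use t_less'[OF j] section_measurable(2)[OF f] in auto)
  also have "\<dots> \<le> ennreal (b * \<rho>) + ennreal (b powr (1 - q)) * ennreal (\<mu> j)"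
  proof (intro add_mono ennreal_leI)
    have "b / D * (t (Suc j) - t j) \<le> b / D * (\<rho> * D)" using D(2)[OF j] bD by (intro mult_left_mono) auto
    then show "b / D * (t (Suc j) - t j) \<le> b * \<rho>" using D by simp
    have "(b / D) powr (1 - q) = b powr (1 - q) * D powr (q - 1)"
      using b D by (simp add: powr_divide powr_diff powr_minus divide_simps)
    then have "ennreal ((b / D) powr (1 - q)) * ?S = ennreal (b powr (1 - q)) * (ennreal (D powr (q - 1)) * ?S)"
      by (simp add: ennreal_mult mult.assoc)
    also have "\<dots> \<le> ennreal (b powr (1 - q)) * ennreal (\<mu> j)" by (intro mult_left_mono sup_norm j) simp
    finally show "ennreal ((b / D) powr (1 - q)) * ?S \<le> ennreal (b powr (1 - q)) * ennreal (\<mu> j)" .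
  qed
  also have "\<dots> = ennreal (b * \<rho> + b powr (1 - q) * \<mu> j)"
    using b pos \<mu>[of j] by (simp add: ennreal_mult)
  finally show ?thesis .
qed

lemma steps_V_bound:
  assumes k: "0 < k" "i + k \<le> n" and b: "0 < b"
  shows "steps i k (V (i + k)) x
    \<le> ennreal (U1 T * (b * ((t (Suc (i + k)) - t (i + k)) * (t (i + k) - t i) powr (- \<beta>')) + b powr (1 - q) * \<mu> (i + k)))"
proof -
  define j where "j = i + k"
  define \<tau> where "\<tau> = t j - t i"
  define h where "h = t (Suc j) - t j"
  (* This weight removes the singularity from the term with \<mu>, since (\<beta> - \<beta>') (1 - q) = \<beta>. *)
  define c where "c = b * \<tau> powr (\<beta> - \<beta>')"
  define \<nu> where "\<nu> s = ennreal_powr (\<integral>\<^sup>+y. ennreal_powr (f s y) p \<partial>lborel) (1 / p)" for s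
  have jn: "j \<le> n" using k by (simp add: j_def)
  have \<tau>: "0 < \<tau>" using t_strict[of i j] k by (simp add: \<tau>_def j_def)
  have h: "0 \<le> h" using t_less'[OF jn] by (simp add: h_def)
  have c: "0 < c" using b \<tau> by (simp add: c_def)
  have \<nu>m [measurable]: "\<nu> \<in> borel_measurable borel"
  proof -
    have "(\<lambda>z. f (fst z) (snd z)) \<in> borel_measurable (borel \<Otimes>\<^sub>M lborel)" using f by simp
    then have "(\<lambda>(s, y). ennreal_powr (f s y) p) \<in> borel_measurable (borel \<Otimes>\<^sub>M lborel)"
      unfolding split_beta' by measurable
    from lborel.borel_measurable_nn_integral[OF this] show ?thesis unfolding \<nu>_def by measurable
  qed
  let ?I = "{t j..<t (Suc j)}"
  have "steps i k (V j) x = (\<integral>\<^sup>+s\<in>?I. steps i k (f s) x \<partial>lborel)"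
    unfolding V_def[abs_def] by (rule steps_integral[OF k(2) f]) simp
  also have "\<dots> \<le> (\<integral>\<^sup>+s. ennreal (U1 T * \<tau> powr (- \<beta>)) * (\<nu> s * indicator ?I s) \<partial>lborel)"
  proof (rule nn_integral_mono)
    fix s
    have "steps i k (f s) x \<le> ennreal (U1 T * \<tau> powr (- \<beta>)) * \<nu> s"
      unfolding \<nu>_def \<tau>_def j_def by (rule steps_Lp_bound[OF section_measurable(1)[OF f] k]) (use t_T[of i "i + k"] k in auto)
    then show "steps i k (f s) x * indicator ?I s \<le> ennreal (U1 T * \<tau> powr (- \<beta>)) * (\<nu> s * indicator ?I s)"
      by (simp split: split_indicator)
  qed
  also have "\<dots> = ennreal (U1 T * \<tau> powr (- \<beta>)) * (\<integral>\<^sup>+s\<in>?I. \<nu> s \<partial>lborel)"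
    by (rule nn_integral_cmult) measurable
  also have "\<dots> \<le> ennreal (U1 T * \<tau> powr (- \<beta>)) * (ennreal (c * h) + ennreal (c powr (1 - q)) * ennreal (\<mu> j))"
  proof (rule mult_left_mono)
    have "(\<integral>\<^sup>+s\<in>?I. \<nu> s \<partial>lborel) \<le> ennreal (c * (t (Suc j) - t j)) + ennreal (c powr (1 - q)) * (\<integral>\<^sup>+s\<in>?I. ennreal_powr (\<nu> s) q \<partial>lborel)"
      by (rule nn_integral_young[OF q c]) (use t_less'[OF jn] in auto)
    also have "\<dots> \<le> ennreal (c * (t (Suc j) - t j)) + ennreal (c powr (1 - q)) * ennreal (\<mu> j)"
      using time_norm[OF jn] by (intro add_left_mono mult_left_mono) (auto simp: \<nu>_def)
    finally show "(\<integral>\<^sup>+s\<in>?I. \<nu> s \<partial>lborel) \<le> ennreal (c * h) + ennreal (c powr (1 - q)) * ennreal (\<mu> j)"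
      by (simp add: h_def)
  qed simp
  also have "\<dots> = ennreal (U1 T * \<tau> powr (- \<beta>) * (c * h + c powr (1 - q) * \<mu> j))"
    using c h \<mu>[of j] U1_pos by (simp add: ennreal_mult)
  also have "U1 T * \<tau> powr (- \<beta>) * (c * h + c powr (1 - q) * \<mu> j) = U1 T * (b * (h * \<tau> powr (- \<beta>')) + b powr (1 - q) * \<mu> j)"
  proof -
    have e: "(\<beta> - \<beta>') * (1 - q) = \<beta>"
    proof -
      have "\<beta>' * (q - 1) = \<beta> * q" using q by (simp add: \<beta>'_def)
      then show ?thesis by (simp add: algebra_simps)
    qed
    have 1: "\<tau> powr (- \<beta>) * c = b * \<tau> powr (- \<beta>')"
      by (simp add: c_def powr_add[symmetric])
    have "c powr (1 - q) = b powr (1 - q) * \<tau> powr \<beta>"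
      using b by (simp add: c_def powr_mult powr_powr e)
    then have 2: "\<tau> powr (- \<beta>) * c powr (1 - q) = b powr (1 - q)"
      using \<tau> by (simp add: powr_minus)
    have "\<tau> powr (- \<beta>) * (c * h + c powr (1 - q) * \<mu> j) = (\<tau> powr (- \<beta>) * c) * h + (\<tau> powr (- \<beta>) * c powr (1 - q)) * \<mu> j"
      by (simp only: distrib_left mult.assoc)
    also have "\<dots> = b * (h * \<tau> powr (- \<beta>')) + b powr (1 - q) * \<mu> j"
      unfolding 1 2 by simp
    finally show ?thesis by simp
  qed
  finally show ?thesis by (simp add: j_def \<tau>_def h_def)
qed

lemma block_bound:
  assumes k: "i + k \<le> Suc n" and small: "(\<Sum>r<k. \<mu> (i + r)) \<le> c0"
  shows "expect_sum V i k x \<le> ennreal (1 / 4)"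
proof (cases k)
  case (Suc k')
  (* The lengths of the intervals contribute b * G = 1 / 8, and c0 is such that the masses contribute at most as much. *)
  define b where "b = 1 / (8 * G)"
  define H where "H l = (t (Suc l) - t l) * (t l - t i) powr (- \<beta>')" for l
  define B where "B = b powr (1 - q)"
  have b: "0 < b" using G by (simp add: b_def)
  have B: "0 < B" using b by (simp add: B_def)
  have Hn: "0 \<le> H (i + r)" if "r < k" for r
    using t_less'[of "i + r"] that k by (simp add: H_def)
  have "expect_sum V i k x = (\<Sum>r<k. steps i r (V (i + r)) x)"
    by (rule expect_sum_eq[OF V_measurable k])
  also have "\<dots> = V i x + (\<Sum>r<k'. steps i (Suc r) (V (i + Suc r)) x)"
    unfolding Suc by (subst sum.lessThan_Suc_shift) (simp del: steps.simps(2))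
  also have "\<dots> \<le> ennreal (b * \<rho> + B * \<mu> i) + (\<Sum>r<k'. ennreal (U1 T * (b * H (i + Suc r) + B * \<mu> (i + Suc r))))"
  proof (intro add_mono sum_mono)
    show "V i x \<le> ennreal (b * \<rho> + B * \<mu> i)"
      unfolding B_def by (rule V_bound[OF _ b]) (use k Suc in simp)
    show "steps i (Suc r) (V (i + Suc r)) x \<le> ennreal (U1 T * (b * H (i + Suc r) + B * \<mu> (i + Suc r)))" if "r \<in> {..<k'}" for r
      unfolding H_def B_def by (rule steps_V_bound[OF _ _ b]) (use k Suc that in auto)
  qed
  also have "\<dots> = ennreal ((b * \<rho> + B * \<mu> i) + (\<Sum>r<k'. U1 T * (b * H (i + Suc r) + B * \<mu> (i + Suc r))))"
  proof -
    have nn: "0 \<le> U1 T * (b * H (i + Suc r) + B * \<mu> (i + Suc r))" if "r \<in> {..<k'}" for r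
      using U1_pos b B \<mu>[of "i + Suc r"] Hn[of "Suc r"] that Suc by (intro mult_nonneg_nonneg add_nonneg_nonneg) auto
    have n1: "0 \<le> b * \<rho> + B * \<mu> i" using b B pos \<mu>[of i] by simp
    show ?thesis by (simp only: sum_ennreal[OF nn] ennreal_plus[OF n1 sum_nonneg[OF nn]])
  qed
  also have "\<dots> \<le> ennreal (1 / 4)"
  proof (rule ennreal_leI)
    define R where "R = \<rho> * (T powr (1 - \<beta>') / (1 - \<beta>'))"
    define S where "S = (\<Sum>r<k. \<mu> (i + r))"
    have split: "S = \<mu> i + (\<Sum>r<k'. \<mu> (i + Suc r))"
      unfolding S_def Suc by (subst sum.lessThan_Suc_shift) simp
    have H: "(\<Sum>r<k'. H (i + Suc r)) \<le> R"
    proof -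
      have "(\<Sum>r<k'. H (i + Suc r)) = (\<Sum>l\<in>{Suc i..<i + k}. H l)"
        by (rule sum.reindex_bij_witness[of _ "\<lambda>l. l - Suc i" "\<lambda>r. i + Suc r"]) (auto simp: Suc)
      also have "\<dots> \<le> \<rho> * ((t (i + k) - t i) powr (1 - \<beta>') / (1 - \<beta>'))"
        unfolding H_def
      proof (rule forward_power_sum)
        show "t l < t (Suc l)" if "i \<le> l" "l < i + k" for l using that k by (intro t_less') simp
        show "t (Suc (Suc l)) - t (Suc l) \<le> \<rho> * (t (Suc l) - t l)" if "i \<le> l" "Suc l < i + k" for l
        proof (cases "Suc l = n")
          case True
          then show ?thesis using last_ratio[OF True] by simp
        next
          case False
          then show ?thesis using that k by (intro ratio(1)) simp
        qed
      qed (use \<beta>' pos Suc in auto)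
      also have "\<dots> \<le> R"
        unfolding R_def using t_T[of i "i + k"] t_mono[of i "i + k"] k \<beta>' pos
        by (intro mult_left_mono divide_right_mono powr_mono2) auto
      finally show ?thesis .
    qed
    have "(\<Sum>r<k'. U1 T * (b * H (i + Suc r) + B * \<mu> (i + Suc r))) = U1 T * (b * (\<Sum>r<k'. H (i + Suc r)) + B * (\<Sum>r<k'. \<mu> (i + Suc r)))"
      by (simp only: sum_distrib_left sum.distrib distrib_left)
    also have "\<dots> \<le> U1 T * (b * R + B * (\<Sum>r<k'. \<mu> (i + Suc r)))"
      using H b U1_pos by (intro mult_left_mono add_right_mono) auto
    finally have "(b * \<rho> + B * \<mu> i) + (\<Sum>r<k'. U1 T * (b * H (i + Suc r) + B * \<mu> (i + Suc r)))
      \<le> b * (\<rho> + U1 T * R) + B * (\<mu> i + U1 T * (\<Sum>r<k'. \<mu> (i + Suc r)))"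
      by (simp add: algebra_simps)
    also have "b * (\<rho> + U1 T * R) = 1 / 8"
      using G by (simp add: b_def G_def R_def)
    also have "B * (\<mu> i + U1 T * (\<Sum>r<k'. \<mu> (i + Suc r))) \<le> B * ((1 + U1 T) * S)"
    proof (rule mult_left_mono)
      have s0: "0 \<le> (\<Sum>r<k'. \<mu> (i + Suc r))" by (simp add: sum_nonneg \<mu>)
      have "0 \<le> U1 T * \<mu> i" using U1_pos \<mu>[of i] by simp
      then show "\<mu> i + U1 T * (\<Sum>r<k'. \<mu> (i + Suc r)) \<le> (1 + U1 T) * S"
        unfolding split using s0 by (simp add: algebra_simps)
    qed (use B in simp)
    also have "B * ((1 + U1 T) * S) \<le> B * ((1 + U1 T) * c0)"
      using small B U1_pos by (intro mult_left_mono) (auto simp: S_def)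
    also have "\<dots> = 1 / 8"
    proof -
      have "B * b powr (q - 1) = 1" using b by (simp add: B_def powr_add[symmetric])
      then have B8: "B * (b powr (q - 1) / 8) = 1 / 8" by simp
      have "(1 + U1 T) * (P / (8 * (1 + U1 T))) = P / 8" for P
        using U1_pos by (simp add: divide_simps)
      then have c: "(1 + U1 T) * c0 = b powr (q - 1) / 8" unfolding c0_def b_def by blast
      show ?thesis unfolding c by (rule B8)
    qed
    finally show "(b * \<rho> + B * \<mu> i) + (\<Sum>r<k'. U1 T * (b * H (i + Suc r) + B * \<mu> (i + Suc r))) \<le> 1 / 4"
      by simp
  qed
  finally show ?thesis .
qed simp

theorem exponential_moment: "expect_exp V 0 (Suc n) x \<le> ennreal (2 * exp (rate * (\<Sum>j\<le>n. \<mu> j)))"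
proof -
  have "expect_exp V 0 (Suc n) x \<le> ennreal (2 * exp ((1 + (\<rho> + ln 2) / c0) * (\<Sum>r<Suc n. \<mu> (0 + r))))"
  proof (rule khasminskii[OF V_measurable \<mu> _ c0 block_bound])
    show "V i y \<le> ennreal (\<rho> + \<mu> i)" if "i \<le> n" for i y
      using V_bound[OF that, of 1 y] by simp
  qed (use pos in auto)
  then show ?thesis by (simp add: rate_def lessThan_Suc_atMost del: sum.lessThan_Suc)
qed

end

section \<open>The Euler approximation\<close>

text \<open>Also true when \<open>g\<close> is not integrable, as the Bochner integral is then 0.\<close>

lemma exp_integral_le:
  fixes g :: "real \<Rightarrow> real"
  shows "ennreal (exp (LINT r:S|lborel. g r)) \<le> ennreal_exp (\<integral>\<^sup>+r\<in>S. ennreal \<bar>g r\<bar> \<partial>lborel)"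
proof (cases "set_integrable lborel S g")
  case True
  have "ennreal (norm (LINT r:S|lborel. g r)) \<le> (\<integral>\<^sup>+r. ennreal (norm (indicator S r *\<^sub>R g r)) \<partial>lborel)"
    unfolding set_lebesgue_integral_def using True unfolding set_integrable_def by (rule integral_norm_bound_ennreal)
  also have "\<dots> = (\<integral>\<^sup>+r\<in>S. ennreal \<bar>g r\<bar> \<partial>lborel)"
    by (rule nn_integral_cong) (simp split: split_indicator)
  finally have b: "ennreal (norm (LINT r:S|lborel. g r)) \<le> (\<integral>\<^sup>+r\<in>S. ennreal \<bar>g r\<bar> \<partial>lborel)" .
  have "ennreal (exp (LINT r:S|lborel. g r)) \<le> ennreal_exp (ennreal (norm (LINT r:S|lborel. g r)))"
    by (simp add: ennreal_exp_real ennreal_leI)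
  also have "\<dots> \<le> ennreal_exp (\<integral>\<^sup>+r\<in>S. ennreal \<bar>g r\<bar> \<partial>lborel)" by (rule ennreal_exp_mono[OF b])
  finally show ?thesis .
next
  case False
  then have "(LINT r:S|lborel. g r) = 0"
    unfolding set_lebesgue_integral_def set_integrable_def by (rule not_integrable_integral_eq)
  then show ?thesis by (simp add: ennreal_exp_ge_1)
qed

text \<open>Suprema over different points \<open>x j\<close> may be taken one after the other.\<close>

lemma sum_SUP_le:
  fixes a :: "nat \<Rightarrow> 'x \<Rightarrow> ennreal"
  shows "(\<And>x :: nat \<Rightarrow> 'x. c + (\<Sum>j<N. a j (x j)) \<le> B) \<Longrightarrow> c + (\<Sum>j<N. \<Squnion>y. a j y) \<le> B"
proof (induction N arbitrary: c)
  case (Suc N)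
  have "c + (\<Sum>j<N. \<Squnion>y. a j y) + a N y \<le> B" for y
  proof -
    have "(c + a N y) + (\<Sum>j<N. \<Squnion>y. a j y) \<le> B"
    proof (rule Suc.IH)
      fix x :: "nat \<Rightarrow> 'x"
      have "(\<Sum>j<N. a j ((x(N := y)) j)) = (\<Sum>j<N. a j (x j))" by (intro sum.cong) auto
      then show "(c + a N y) + (\<Sum>j<N. a j (x j)) \<le> B"
        using Suc.prems[of "x(N := y)"] by (simp add: ac_simps)
    qed
    then show ?thesis by (simp add: ac_simps)
  qed
  then have "(\<Squnion>y. c + (\<Sum>j<N. \<Squnion>y. a j y) + a N y) \<le> B" by (intro SUP_least)
  then show ?case by (simp add: ennreal_SUP_add_right add.assoc)
qed simp

text \<open>One Euler approximation with one function \<open>f\<close> and one time \<open>T\<close>; \<open>\<delta>\<close> stands for \<open>\<delta> T\<close>.\<close>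

locale euler_functional = diffusion_coefficient m \<sigma> \<epsilon> K \<alpha>
  for m and \<sigma> :: "real \<Rightarrow> real ^ 'd \<Rightarrow> nat \<Rightarrow> real ^ 'd" and \<epsilon> K \<alpha> +
  fixes M :: "'w measure" and F W and x0 :: "real ^ 'd" and \<tau> :: "nat \<Rightarrow> real" and X :: "real \<Rightarrow> 'w \<Rightarrow> real ^ 'd"
    and f :: "real \<Rightarrow> real ^ 'd \<Rightarrow> real" and p q T \<delta> \<rho> :: real
  assumes W: "wiener_process M F m W" and \<tau>: "partition_seq \<tau>"
    and X: "euler_approx M F m W \<sigma> x0 \<tau> X" and f: "borel_on_halfspace f"
    and \<alpha>: "0 < \<alpha>" "\<alpha> < 1" and p: "real CARD('d) < p" and q: "1 < q" and pq: "real CARD('d) / (2 * p) < (q - 1) / q"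
    and T: "0 < T" and \<delta>: "0 < \<delta>" "\<And>i. \<tau> (Suc i) \<le> T \<Longrightarrow> \<delta> \<le> (\<tau> (Suc i) - \<tau> i) / mesh \<tau> T"
    and last: "T - kappa \<tau> T \<le> mesh \<tau> T / \<delta>"
    and \<rho>: "\<rho> = max 1 (1 / \<delta>\<^sup>2)"
begin

abbreviation "D \<equiv> mesh \<tau> T"

text \<open>The partition truncated at \<open>T\<close>: \<open>\<tau> n\<close> is its last point before \<open>T\<close>, and \<open>T\<close> itself is appended. The
  covariances \<open>A j\<close> with \<open>j < n\<close> belong to full steps.\<close>

definition "n = (LEAST i. T \<le> \<tau> (Suc i))"
definition "grid j = (if j \<le> n then \<tau> j else T)"
definition "A j = cov (\<tau> j) (\<tau> (Suc j))"
definition "f' r y = ennreal \<bar>indicat_real {0..} r *\<^sub>R f r y\<bar>"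
definition "pot j y = (\<integral>\<^sup>+s\<in>{grid j..<grid (Suc j)}. f' s y \<partial>lborel)"

lemma \<tau>_mono: "strict_mono \<tau>" and \<tau>0: "\<tau> 0 = 0"
  using \<tau> by (auto simp: partition_seq_def)

lemma \<tau>_Suc: "\<tau> j < \<tau> (Suc j)"
  using \<tau>_mono by (simp add: strict_mono_def)

lemma \<tau>_nonneg: "0 \<le> \<tau> j"
  using strict_mono_less_eq[OF \<tau>_mono, of 0 j] by (simp add: \<tau>0)

lemma n: "\<tau> n < T" "T \<le> \<tau> (Suc n)"
proof -
  have "eventually (\<lambda>i. T \<le> \<tau> i) sequentially"
    using \<tau> by (simp add: partition_seq_def filterlim_at_top)
  then obtain i where "T \<le> \<tau> (Suc i)" by (auto simp: eventually_sequentially intro: le_SucI)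
  then show "T \<le> \<tau> (Suc n)" unfolding n_def by (rule LeastI)
  show "\<tau> n < T"
  proof (cases n)
    case 0
    then show ?thesis using T \<tau>0 by simp
  next
    case (Suc n')
    then have "\<not> T \<le> \<tau> (Suc n')" unfolding n_def by (intro not_less_Least) simp
    then show ?thesis using Suc by simp
  qed
qed

lemma full_step_iff: "j < n \<Longrightarrow> \<tau> (Suc j) \<le> T"
  using strict_mono_less_eq[OF \<tau>_mono, of "Suc j" n] n(1) by simp

lemma full_step_le_mesh:
  assumes "\<tau> (Suc i) \<le> T"
  shows "\<tau> (Suc i) - \<tau> i \<le> D"
proof -
  have "i \<le> n" if "\<tau> (Suc i) \<le> T" for i
    using that n(2) strict_mono_less_eq[OF \<tau>_mono, of "Suc i" "Suc n"] by simp
  then have "{\<tau> (Suc i) - \<tau> i |i. \<tau> (Suc i) \<le> T} \<subseteq> (\<lambda>i. \<tau> (Suc i) - \<tau> i) ` {..n}" by auto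
  then have "finite {\<tau> (Suc i) - \<tau> i |i. \<tau> (Suc i) \<le> T}" by (rule finite_subset) simp
  then show ?thesis
    unfolding mesh_def using assms by (intro cSup_upper) auto
qed

text \<open>If no full step fitted into \<open>{0..T}\<close>, the mesh would be 0, contrary to the bound for the
  incomplete interval, which has positive length. A full step is at most the mesh, hence \<open>\<delta> \<le> 1\<close>.\<close>

lemma mesh_pos: "0 < D" and \<delta>_le_1: "\<delta> \<le> 1" and last_le: "T - \<tau> n \<le> D / \<delta>"
proof -
  (* If T is a point of the partition then kappa \<tau> T = T and the last interval is a full step. *)
  have D: "0 < D \<and> T - \<tau> n \<le> D / \<delta> \<or> \<tau> (Suc n) \<le> T"
  proof (cases "T = \<tau> (Suc n)")
    case False
    then have "kappa \<tau> T = \<tau> n" using n by (intro kappa_eq \<tau>_mono) auto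
    then have l: "T - \<tau> n \<le> D / \<delta>" using last by simp
    then have "0 < D / \<delta>" using n(1) by linarith
    then show ?thesis using \<delta>(1) l by (simp add: zero_less_divide_iff)
  qed simp
  have ex: "\<exists>i. \<tau> (Suc i) \<le> T"
  proof (rule ccontr)
    assume no: "\<not> ?thesis"
    then have "D = 0" by (simp add: mesh_def)
    then show False using D no by auto
  qed
  then obtain i where i: "\<tau> (Suc i) \<le> T" by blast
  show Dp: "0 < D" using full_step_le_mesh[OF i] \<tau>_Suc[of i] by simp
  have "\<delta> \<le> (\<tau> (Suc i) - \<tau> i) / D" by (rule \<delta>(2)[OF i])
  also have "\<dots> \<le> 1" using full_step_le_mesh[OF i] Dp by simp
  finally show d1: "\<delta> \<le> 1" .
  show "T - \<tau> n \<le> D / \<delta>"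
  proof (cases "\<tau> (Suc n) \<le> T")
    case True
    have "D * \<delta> \<le> D * 1" using d1 Dp by (intro mult_left_mono) auto
    then have "D \<le> D / \<delta>" using \<delta>(1) by (simp add: pos_le_divide_eq)
    then show ?thesis using full_step_le_mesh[OF True] n by simp
  qed (use D in auto)
qed

lemma \<rho>_ge: "1 \<le> \<rho>" "1 / \<delta> \<le> \<rho>" "1 / \<delta>\<^sup>2 \<le> \<rho>"
proof -
  show "1 \<le> \<rho>" "1 / \<delta>\<^sup>2 \<le> \<rho>" by (simp_all add: \<rho>)
  have "\<delta> * \<delta> \<le> \<delta> * 1" using \<delta>(1) \<delta>_le_1 by (intro mult_left_mono) auto
  then have "1 / \<delta> \<le> 1 / \<delta>\<^sup>2" using \<delta>(1) by (intro divide_left_mono) (auto simp: power2_eq_square)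
  then show "1 / \<delta> \<le> \<rho>" by (simp add: \<rho>)
qed

text \<open>A bound \<open>D / \<delta>\<close>, valid for every interval including the last, is compared with a full step of length
  at least \<open>\<delta> D\<close>: this is why \<open>\<rho>\<close> is \<open>1 / \<delta>\<^sup>2\<close>.\<close>

lemma mesh_le_step:
  assumes "\<tau> (Suc i) \<le> T"
  shows "D / \<delta> \<le> \<rho> * (\<tau> (Suc i) - \<tau> i)"
proof -
  have "\<delta> * D \<le> \<tau> (Suc i) - \<tau> i" using \<delta>(2)[OF assms] mesh_pos by (simp add: pos_le_divide_eq)
  then have "1 / \<delta>\<^sup>2 * (\<delta> * D) \<le> \<rho> * (\<tau> (Suc i) - \<tau> i)"
    using \<rho>_ge \<tau>_Suc[of i] \<delta>(1) mesh_pos by (intro mult_mono) auto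
  moreover have "1 / \<delta>\<^sup>2 * (\<delta> * D) = D / \<delta>" using \<delta>(1) by (simp add: power2_eq_square)
  ultimately show ?thesis by simp
qed

lemma step_le_\<delta>: "\<tau> (Suc i) \<le> T \<Longrightarrow> \<tau> (Suc i) - \<tau> i \<le> D / \<delta>"
proof -
  assume i: "\<tau> (Suc i) \<le> T"
  have "D * \<delta> \<le> D * 1" using \<delta>_le_1 mesh_pos by (intro mult_left_mono) auto
  then have "D \<le> D / \<delta>" using \<delta>(1) by (simp add: pos_le_divide_eq)
  then show ?thesis using full_step_le_mesh[OF i] by simp
qed

lemma grid_Suc: "j < n \<Longrightarrow> grid (Suc j) - grid j = \<tau> (Suc j) - \<tau> j"
  by (simp add: grid_def)

lemma grid_last: "grid (Suc n) = T" "grid n = \<tau> n" "grid 0 = 0"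
  by (simp_all add: grid_def \<tau>0)

sublocale chain: kernel_chain grid n A \<epsilon> K "2 * sqrt K * K" \<alpha> \<rho> p
proof (unfold_locales)
  show "0 < \<epsilon>" "\<epsilon> \<le> K" "0 \<le> 2 * sqrt K * K" "0 < \<alpha>" "\<alpha> \<le> 1" "1 \<le> \<rho>"
    using pos eps_le_K \<alpha> \<rho>_ge by auto
  show "real DIM(real ^ 'd) < p" using p by simp
  show "grid j < grid (Suc j)" if "j < n" for j using grid_Suc[OF that] \<tau>_Suc[of j] by simp
  show "grid (Suc (Suc j)) - grid (Suc j) \<le> \<rho> * (grid (Suc j) - grid j)" if "Suc j < n" for j
    using step_le_\<delta>[OF full_step_iff[OF that]] mesh_le_step[OF full_step_iff, of j] that by (simp add: grid_Suc)
  show "grid (Suc j) - grid j \<le> \<rho> * (grid (Suc (Suc j)) - grid (Suc j))" if "Suc j < n" for j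
    using step_le_\<delta>[OF full_step_iff, of j] mesh_le_step[OF full_step_iff[OF that]] that by (simp add: grid_Suc)
  show "qform (A j x)" for j x unfolding A_def by (rule cov_qform[OF \<tau>_nonneg])
  show "\<epsilon> * (grid (Suc j) - grid j) * (l \<bullet> l) \<le> A j x l" "A j x l \<le> K * (grid (Suc j) - grid j) * (l \<bullet> l)"
    "\<bar>A j x l - A j y l\<bar> \<le> 2 * sqrt K * K * (grid (Suc j) - grid j) * norm (x - y) powr \<alpha> * (l \<bullet> l)" if "j < n" for j x y l
    unfolding A_def grid_Suc[OF that] using \<tau>_nonneg[of j] less_imp_le[OF \<tau>_Suc[of j]]
    by (simp_all only: cov_bounds cov_holder)
  show "(\<lambda>z. A j (fst z) (snd z)) \<in> borel_measurable (borel \<Otimes>\<^sub>M borel)" for j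
    unfolding A_def by (rule cov_measurable[OF \<tau>_nonneg]) measurable
qed

lemma f'_measurable: "(\<lambda>z. f' (fst z) (snd z)) \<in> borel_measurable (borel \<Otimes>\<^sub>M borel)"
  unfolding f'_def using halfspace_measurable[OF f] by measurable

lemma pot_measurable [measurable]: "pot j \<in> borel_measurable borel"
proof -
  have "(\<lambda>z. f' (snd z) (fst z)) \<in> borel_measurable (borel \<Otimes>\<^sub>M lborel)"
    using measurable_compose[OF _ f'_measurable, of "\<lambda>z. (snd z, fst z)" "borel \<Otimes>\<^sub>M lborel"] by simp
  then have "(\<lambda>(x, s). f' s x * indicator {grid j..<grid (Suc j)} s) \<in> borel_measurable (borel \<Otimes>\<^sub>M lborel)"
    unfolding split_beta' by measurable
  then show ?thesis unfolding pot_def by (rule lborel.borel_measurable_nn_integral)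
qed

lemma grid_cell:
  assumes "0 \<le> r" "r < T"
  obtains j where "j \<le> n" "r \<in> {grid j..<grid (Suc j)}" "kappa \<tau> r = \<tau> j"
proof -
  define j where "j = (LEAST j. r < grid (Suc j))"
  have ex: "r < grid (Suc n)" using assms by (simp add: grid_last)
  have r: "r < grid (Suc j)" unfolding j_def by (rule LeastI[of _ n], rule ex)
  have jn: "j \<le> n" unfolding j_def by (rule Least_le, rule ex)
  have rj: "grid j \<le> r"
  proof (cases j)
    case (Suc j')
    then have "\<not> r < grid (Suc j')" unfolding j_def by (intro not_less_Least) simp
    then show ?thesis using Suc by simp
  qed (use assms in \<open>simp add: grid_last\<close>)
  have "kappa \<tau> r = \<tau> j"
  proof (rule kappa_eq[OF \<tau>_mono])
    show "\<tau> j \<le> r" using rj jn by (simp add: grid_def)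
    show "r < \<tau> (Suc j)"
    proof (cases "j = n")
      case True
      then show ?thesis using assms(2) n(2) by simp
    next
      case False
      then show ?thesis using r jn by (simp add: grid_def)
    qed
  qed
  with jn rj r show ?thesis using that by simp
qed

lemma path_bound:
  "ennreal (exp (LINT r:{0..T}|lborel. f r (X (kappa \<tau> r) \<omega>))) \<le> ennreal_exp (\<Sum>j\<le>n. pot j (X (\<tau> j) \<omega>))"
proof -
  have "(\<integral>\<^sup>+r\<in>{0..T}. ennreal \<bar>f r (X (kappa \<tau> r) \<omega>)\<bar> \<partial>lborel)
    \<le> (\<integral>\<^sup>+r. (\<Sum>j\<le>n. f' r (X (\<tau> j) \<omega>) * indicator {grid j..<grid (Suc j)} r) \<partial>lborel)"
  proof (rule nn_integral_mono_AE)
    (* At r = T the value of kappa may be T itself, where the truncated partition has no interval. *)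
    show "AE r in lborel. ennreal \<bar>f r (X (kappa \<tau> r) \<omega>)\<bar> * indicator {0..T} r
      \<le> (\<Sum>j\<le>n. f' r (X (\<tau> j) \<omega>) * indicator {grid j..<grid (Suc j)} r)"
      using AE_lborel_singleton[of T]
    proof eventually_elim
      case (elim r)
      show ?case
      proof (cases "r \<in> {0..T}")
        case True
        then have "0 \<le> r" "r < T" using elim by auto
        then obtain j where j: "j \<le> n" "r \<in> {grid j..<grid (Suc j)}" "kappa \<tau> r = \<tau> j" by (rule grid_cell)
        have "f' r (X (\<tau> j) \<omega>) * indicator {grid j..<grid (Suc j)} r
          \<le> (\<Sum>j\<le>n. f' r (X (\<tau> j) \<omega>) * indicator {grid j..<grid (Suc j)} r)"
          using j(1) by (intro member_le_sum) auto
        then show ?thesis using j True by (simp add: f'_def)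
      qed simp
    qed
  qed
  also have "\<dots> = (\<Sum>j\<le>n. pot j (X (\<tau> j) \<omega>))"
    unfolding pot_def using chain.section_measurable(2)[OF f'_measurable] by (intro nn_integral_sum) simp
  finally show ?thesis by (intro order_trans[OF exp_integral_le] ennreal_exp_mono)
qed

lemma X_measurable: "X (\<tau> j) \<in> borel_measurable (F (\<tau> j))"
  using X \<tau>_nonneg by (simp add: euler_approx_def)

lemma fil: "filtration_on M F"
  using W by (simp add: wiener_process_def)

lemma X_measurable_M [measurable]: "X (\<tau> j) \<in> borel_measurable M"
  by (rule filtration_measurable_M[OF fil \<tau>_nonneg X_measurable])

lemma cov_A: "gdens (A j x) (y - x) = dens (\<tau> j) (\<tau> (Suc j)) x y"
  by (simp add: A_def dens_def)

text \<open>The one step law, applied with the product of the exponentials up to the time \<open>\<tau> i\<close> as a weight.\<close>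

lemma expectation_product:
  "i + k = n \<Longrightarrow> Z \<in> borel_measurable (F (\<tau> i)) \<Longrightarrow>
   (\<integral>\<^sup>+\<omega>. Z \<omega> * ennreal_exp (\<Sum>j\<in>{i..n}. pot j (X (\<tau> j) \<omega>)) \<partial>M) = (\<integral>\<^sup>+\<omega>. Z \<omega> * chain.expect_exp pot i (Suc k) (X (\<tau> i) \<omega>) \<partial>M)"
proof (induction k arbitrary: i Z)
  case (Suc k)
  interpret step: euler_step m \<sigma> \<epsilon> K \<alpha> M F W x0 \<tau> X i
    by unfold_locales (fact W \<tau> X)+
  define Z' where "Z' \<omega> = Z \<omega> * ennreal_exp (pot i (X (\<tau> i) \<omega>))" for \<omega>
  have Z': "Z' \<in> borel_measurable (F (\<tau> i))"
    unfolding Z'_def using Suc.prems(2) X_measurable[of i] by measurable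
  have Z'': "Z' \<in> borel_measurable (F (\<tau> (Suc i)))"
    by (rule filtration_measurable[OF fil \<tau>_nonneg _ Z']) (simp add: less_imp_le \<tau>_Suc)
  have split: "(\<Sum>j\<in>{i..n}. pot j (X (\<tau> j) \<omega>)) = pot i (X (\<tau> i) \<omega>) + (\<Sum>j\<in>{Suc i..n}. pot j (X (\<tau> j) \<omega>))" for \<omega>
    using Suc.prems(1) by (intro sum.atLeast_Suc_atMost) simp
  have "(\<integral>\<^sup>+\<omega>. Z \<omega> * ennreal_exp (\<Sum>j\<in>{i..n}. pot j (X (\<tau> j) \<omega>)) \<partial>M)
    = (\<integral>\<^sup>+\<omega>. Z' \<omega> * ennreal_exp (\<Sum>j\<in>{Suc i..n}. pot j (X (\<tau> j) \<omega>)) \<partial>M)"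
    by (simp only: split ennreal_exp_add Z'_def mult.assoc)
  also have "\<dots> = (\<integral>\<^sup>+\<omega>. Z' \<omega> * chain.expect_exp pot (Suc i) (Suc k) (X (\<tau> (Suc i)) \<omega>) \<partial>M)"
    by (rule Suc.IH[OF _ Z'']) (use Suc.prems in simp)
  also have "\<dots> = (\<integral>\<^sup>+\<omega>. Z' \<omega> * chain.step i (chain.expect_exp pot (Suc i) (Suc k)) (X (\<tau> i) \<omega>) \<partial>M)"
    unfolding chain.step_def cov_A
    by (rule step.one_step_law[OF Z' chain.expect_exp_measurable]) (use Suc.prems in auto)
  also have "\<dots> = (\<integral>\<^sup>+\<omega>. Z \<omega> * chain.expect_exp pot i (Suc (Suc k)) (X (\<tau> i) \<omega>) \<partial>M)"
    by (simp add: Z'_def mult.assoc)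
  finally show ?case .
qed simp

definition "time_part j = (\<integral>\<^sup>+s\<in>{grid j..<grid (Suc j)}.
  ennreal_powr (ennreal_powr (\<integral>\<^sup>+y. ennreal_powr (f' s y) p \<partial>lborel) (1 / p)) q \<partial>lborel)"
definition "sup_part j = (\<Squnion>x. \<integral>\<^sup>+s\<in>{grid j..<grid (Suc j)}. ennreal_powr (f' s x) q \<partial>lborel)"

lemma grid_mono: "i \<le> j \<Longrightarrow> j \<le> Suc n \<Longrightarrow> grid i \<le> grid j"
  using strict_mono_less_eq[OF \<tau>_mono, of i j] strict_mono_less_eq[OF \<tau>_mono, of i n] n(1) by (auto simp: grid_def)

lemma cells_sum:
  fixes H :: "real \<Rightarrow> ennreal" and h :: "nat \<Rightarrow> real \<Rightarrow> ennreal"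
  assumes hH: "\<And>j s. 0 \<le> s \<Longrightarrow> h j s \<le> H s"
  shows "(\<Sum>j\<le>n. h j s * indicator {grid j..<grid (Suc j)} s) \<le> H s * indicator {0..T} s"
proof (cases "\<exists>j\<le>n. s \<in> {grid j..<grid (Suc j)}")
  case True
  then obtain j where j: "j \<le> n" "s \<in> {grid j..<grid (Suc j)}" by blast
  have s: "0 \<le> s" "s < T"
    using j grid_mono[of 0 j] grid_mono[of "Suc j" "Suc n"] by (auto simp: grid_last)
  have other: "s \<notin> {grid l..<grid (Suc l)}" if "l \<le> n" "l \<noteq> j" for l
  proof (cases "l < j")
    case True
    then show ?thesis using grid_mono[of "Suc l" j] j by auto
  next
    case False
    then show ?thesis using grid_mono[of "Suc j" l] j that by auto
  qed
  have "(\<Sum>l\<le>n. h l s * indicator {grid l..<grid (Suc l)} s) = (\<Sum>l\<in>{j}. h l s * indicator {grid l..<grid (Suc l)} s)"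
    using other j(1) by (intro sum.mono_neutral_right) auto
  also have "\<dots> = h j s * indicator {grid j..<grid (Suc j)} s"
    using sum.insert[of "{}" j "\<lambda>l. h l s * indicator {grid l..<grid (Suc l)} s"] by (simp only: sum.empty add_0_right finite.emptyI empty_iff not_False_eq_True)
  also have "\<dots> \<le> H s * indicator {0..T} s" using j(2) hH[OF s(1), of j] s by simp
  finally show ?thesis .
next
  case False
  then have "(\<Sum>j\<le>n. h j s * indicator {grid j..<grid (Suc j)} s) = 0"
    by (intro sum.neutral) (auto simp: indicator_def)
  then show ?thesis by simp
qed

lemma time_part_sum: "(\<Sum>j\<le>n. time_part j) \<le> ennreal_powr (mixed_norm p q T f) q"
proof -
  define h where "h s = ennreal_powr (ennreal_powr (\<integral>\<^sup>+y. ennreal_powr (f' s y) p \<partial>lborel) (1 / p)) q" for s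
  have hm [measurable]: "h \<in> borel_measurable borel"
  proof -
    have "(\<lambda>z. f' (fst z) (snd z)) \<in> borel_measurable (borel \<Otimes>\<^sub>M lborel)" using f'_measurable by simp
    then have "(\<lambda>(s, y). ennreal_powr (f' s y) p) \<in> borel_measurable (borel \<Otimes>\<^sub>M lborel)"
      unfolding split_beta' by measurable
    from lborel.borel_measurable_nn_integral[OF this] show ?thesis unfolding h_def by measurable
  qed
  have "(\<Sum>j\<le>n. time_part j) = (\<integral>\<^sup>+s. (\<Sum>j\<le>n. h s * indicator {grid j..<grid (Suc j)} s) \<partial>lborel)"
    unfolding time_part_def h_def[symmetric] by (intro nn_integral_sum[symmetric]) simp
  also have "\<dots> \<le> (\<integral>\<^sup>+s\<in>{0..T}. ennreal_powr (Lp_norm p (f s)) q \<partial>lborel)"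
  proof (rule nn_integral_mono, rule cells_sum)
    show "h s \<le> ennreal_powr (Lp_norm p (f s)) q" if "0 \<le> s" for s
      using that by (simp add: h_def Lp_norm_def f'_def ennreal_powr_real)
  qed
  also have "\<dots> = ennreal_powr (mixed_norm p q T f) q"
    unfolding mixed_norm_def using q by (subst ennreal_powr_powr_inverse) auto
  finally show ?thesis .
qed

text \<open>The supremum over \<open>x\<close> need not be Borel in time, so its integral is not split by additivity. For points
  \<open>x j\<close> chosen in advance, one for each interval, the integrand is Borel and lies below the supremum.\<close>

lemma sup_part_sum: "(\<Sum>j\<le>n. sup_part j) \<le> ennreal_powr (mixed_sup_norm q T f) q"
proof -
  have m [measurable]: "(\<lambda>s. f' s y) \<in> borel_measurable borel" for y
    by (rule chain.section_measurable(2)[OF f'_measurable])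
  let ?H = "\<lambda>s. ennreal_powr (\<Squnion>x. ennreal \<bar>f s x\<bar>) q"
  have "0 + (\<Sum>j<Suc n. sup_part j) \<le> (\<integral>\<^sup>+s\<in>{0..T}. ?H s \<partial>lebesgue)"
    unfolding sup_part_def
  proof (rule sum_SUP_le)
    fix x :: "nat \<Rightarrow> real ^ 'd"
    let ?h = "\<lambda>s. \<Sum>j\<le>n. ennreal_powr (f' s (x j)) q * indicator {grid j..<grid (Suc j)} s"
    have "0 + (\<Sum>j<Suc n. \<integral>\<^sup>+s\<in>{grid j..<grid (Suc j)}. ennreal_powr (f' s (x j)) q \<partial>lborel) = (\<integral>\<^sup>+s. ?h s \<partial>lborel)"
      unfolding lessThan_Suc_atMost add_0 by (intro nn_integral_sum[symmetric]) simp
    also have "\<dots> = (\<integral>\<^sup>+s. ?h s \<partial>lebesgue)"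
      by (rule nn_integral_completion[symmetric]) measurable
    also have "\<dots> \<le> (\<integral>\<^sup>+s\<in>{0..T}. ?H s \<partial>lebesgue)"
    proof (rule nn_integral_mono, rule cells_sum)
      show "ennreal_powr (f' s (x j)) q \<le> ?H s" if "0 \<le> s" for j s
        using that q by (intro ennreal_powr_mono) (auto simp: f'_def intro: SUP_upper)
    qed
    finally show "0 + (\<Sum>j<Suc n. \<integral>\<^sup>+s\<in>{grid j..<grid (Suc j)}. ennreal_powr (f' s (x j)) q \<partial>lborel)
      \<le> (\<integral>\<^sup>+s\<in>{0..T}. ?H s \<partial>lebesgue)" .
  qed
  also have "\<dots> = ennreal_powr (mixed_sup_norm q T f) q"
    unfolding mixed_sup_norm_def using q by (subst ennreal_powr_powr_inverse) auto
  finally show ?thesis by (simp only: lessThan_Suc_atMost add_0)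
qed

text \<open>If one of the norms is infinite there is nothing to prove; otherwise the masses are finite and the
  bound for the chain applies.\<close>

theorem euler_exponential_bound:
  assumes N: "1 \<le> N" "chain_potential.rate TYPE(real ^ 'd) \<epsilon> K (2 * sqrt K * K) \<alpha> \<rho> p q T \<le> N"
  shows "(\<integral>\<^sup>+\<omega>. ennreal (exp (LINT r:{0..T}|lborel. f r (X (kappa \<tau> r) \<omega>))) \<partial>M)
    \<le> 2 * ennreal_exp (ennreal N * (ennreal_powr (mixed_norm p q T f) q
         + ennreal (D powr (q - 1)) * ennreal_powr (mixed_sup_norm q T f) q))"
    (is "?E \<le> 2 * ennreal_exp (ennreal N * ?Y)")
proof (cases "?Y = \<top>")
  case True
  have "ennreal N * ?Y = \<top>" unfolding True using N by (simp add: ennreal_mult_top)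
  then show ?thesis by (simp add: ennreal_exp_def ennreal_mult_top)
next
  case False
  define w where "w j = time_part j + ennreal (D powr (q - 1)) * sup_part j" for j
  define \<mu> where "\<mu> j = enn2real (w j)" for j
  have total: "(\<Sum>j\<le>n. w j) \<le> ?Y"
    unfolding w_def sum.distrib sum_distrib_left[symmetric]
    by (intro add_mono mult_left_mono time_part_sum sup_part_sum) simp
  have w: "w j = ennreal (\<mu> j)" if "j \<le> n" for j
  proof -
    have "w j \<le> (\<Sum>j\<le>n. w j)" using that by (intro member_le_sum) auto
    then have "w j \<le> ?Y" using total by (rule order_trans)
    moreover have "?Y < \<top>" using False less_top by blast
    ultimately have "w j < \<top>" by (rule le_less_trans)
    then show ?thesis by (simp add: \<mu>_def)
  qed
  interpret prob_space M using W by (simp add: wiener_process_def)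
  interpret pot: chain_potential grid n A \<epsilon> K "2 * sqrt K * K" \<alpha> \<rho> p f' q T D \<mu>
  proof (unfold_locales)
    show "real DIM(real ^ 'd) / (2 * p) < (q - 1) / q" using pq by simp
    show "grid n < grid (Suc n)" "grid (Suc n) - grid 0 \<le> T" using n(1) by (simp_all add: grid_last)
    show "grid (Suc n) - grid n \<le> \<rho> * (grid n - grid j)" if "Suc j = n" for j
      using last_le mesh_le_step[OF full_step_iff, of j] grid_Suc[of j] that by (auto simp: grid_last)
    show "grid (Suc j) - grid j \<le> \<rho> * D" if "j \<le> n" for j
    proof -
      have "grid (Suc j) - grid j \<le> D / \<delta>"
        using that last_le step_le_\<delta>[OF full_step_iff, of j] grid_Suc[of j] by (cases "j = n") (auto simp: grid_last)
      also have "\<dots> \<le> \<rho> * D" using mult_right_mono[OF \<rho>_ge(2), of D] mesh_pos by simp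
      finally show ?thesis .
    qed
    show "0 \<le> \<mu> j" for j by (simp add: \<mu>_def)
    show "(\<integral>\<^sup>+s\<in>{grid j..<grid (Suc j)}. ennreal_powr (ennreal_powr (\<integral>\<^sup>+y. ennreal_powr (f' s y) p \<partial>lborel) (1 / p)) q \<partial>lborel) \<le> ennreal (\<mu> j)"
      if "j \<le> n" for j
      unfolding w[OF that, symmetric] w_def time_part_def[symmetric] by simp
    show "ennreal (D powr (q - 1)) * (\<integral>\<^sup>+s\<in>{grid j..<grid (Suc j)}. ennreal_powr (f' s x) q \<partial>lborel) \<le> ennreal (\<mu> j)"
      if "j \<le> n" for j x
    proof -
      have "(\<integral>\<^sup>+s\<in>{grid j..<grid (Suc j)}. ennreal_powr (f' s x) q \<partial>lborel) \<le> sup_part j"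
        unfolding sup_part_def by (rule SUP_upper) simp
      then have "ennreal (D powr (q - 1)) * (\<integral>\<^sup>+s\<in>{grid j..<grid (Suc j)}. ennreal_powr (f' s x) q \<partial>lborel)
        \<le> ennreal (D powr (q - 1)) * sup_part j"
        by (rule mult_left_mono) simp
      also have "\<dots> \<le> w j" unfolding w_def by (rule add_increasing) simp_all
      finally show ?thesis unfolding w[OF that] .
    qed
  qed (fact f'_measurable q mesh_pos)+
  have pot: "pot.V = pot" by (simp add: fun_eq_iff pot.V_def pot_def)
  let ?S = "\<Sum>j\<le>n. \<mu> j"
  have S: "ennreal ?S \<le> ?Y"
  proof -
    have "ennreal ?S = (\<Sum>j\<le>n. ennreal (\<mu> j))" by (rule sum_ennreal[symmetric]) (simp add: \<mu>_def)
    also have "\<dots> = (\<Sum>j\<le>n. w j)" by (intro sum.cong refl) (simp add: w)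
    finally show ?thesis using total by simp
  qed
  have "?E \<le> (\<integral>\<^sup>+\<omega>. 1 * ennreal_exp (\<Sum>j\<in>{0..n}. pot j (X (\<tau> j) \<omega>)) \<partial>M)"
    using path_bound by (intro nn_integral_mono) (simp add: atLeast0AtMost)
  also have "\<dots> = (\<integral>\<^sup>+\<omega>. 1 * chain.expect_exp pot 0 (Suc n) (X (\<tau> 0) \<omega>) \<partial>M)"
    by (rule expectation_product) auto
  also have "\<dots> \<le> (\<integral>\<^sup>+\<omega>. ennreal (2 * exp (pot.rate * ?S)) \<partial>M)"
    using pot.exponential_moment unfolding pot by (intro nn_integral_mono) simp
  also have "\<dots> = ennreal (2 * exp (pot.rate * ?S))" by (simp add: emeasure_space_1)
  also have "\<dots> \<le> ennreal (2 * exp (N * ?S))"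
    using N(2) by (intro ennreal_leI mult_left_mono) (auto intro!: mult_right_mono sum_nonneg simp: \<mu>_def)
  also have "\<dots> = 2 * ennreal (exp (N * ?S))"
    unfolding ennreal_numeral[symmetric] by (rule ennreal_mult') simp
  also have "ennreal (exp (N * ?S)) = ennreal_exp (ennreal N * ennreal ?S)"
    using N(1) by (simp add: ennreal_mult'[symmetric] ennreal_exp_real sum_nonneg \<mu>_def)
  also have "2 * \<dots> \<le> 2 * ennreal_exp (ennreal N * ?Y)"
    by (intro mult_left_mono ennreal_exp_mono S) auto
  finally show ?thesis .
qed

end

theorem theorem4p6:
  fixes \<alpha> K \<epsilon> p q T :: real
  assumes "0 < \<alpha>" "\<alpha> < 1" "0 < K" "0 < \<epsilon>"
    and "1 \<le> q" "p > real CARD('d::finite) / \<alpha>" "real CARD('d) / p + 2 / q < 2"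
    and "0 \<le> T"
  shows "\<exists>N :: real \<Rightarrow> real.
    \<forall>(M :: 'w measure) F d1 W
     (\<sigma> :: real \<Rightarrow> real ^ 'd \<Rightarrow> nat \<Rightarrow> real ^ 'd) (x0 :: real ^ 'd)
     (t :: nat \<Rightarrow> nat \<Rightarrow> real) (x :: nat \<Rightarrow> real \<Rightarrow> 'w \<Rightarrow> real ^ 'd) (\<delta> :: real \<Rightarrow> real).
      wiener_process M F d1 W \<longrightarrow>
      (\<forall>k<d1. borel_on_halfspace (\<lambda>s y. \<sigma> s y k)) \<longrightarrow>
      (\<forall>s>0. \<forall>y. psd_le (\<epsilon> *\<^sub>R mat 1) (mat_AAt d1 (\<sigma> s y)) \<and> psd_le (mat_AAt d1 (\<sigma> s y)) (K *\<^sub>R mat 1)) \<longrightarrow>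
      (\<forall>s>0. \<forall>y z. mat_dist d1 (\<sigma> s y) (\<sigma> s z) \<le> K * norm (y - z) powr \<alpha>) \<longrightarrow>
      (\<forall>n\<ge>1. partition_seq (t n)) \<longrightarrow>
      (\<forall>S>0. (\<lambda>n. mesh (t n) S) \<longlonglongrightarrow> 0) \<longrightarrow>
      (\<forall>n\<ge>1. euler_approx M F d1 W \<sigma> x0 (t n) (x n)) \<longrightarrow>
      (\<forall>S>0. \<delta> S > 0 \<and>
        (\<forall>n\<ge>1. \<forall>i. t n (Suc i) \<le> S \<longrightarrow> (t n (Suc i) - t n i) / mesh (t n) S \<ge> \<delta> S)) \<longrightarrow>
      (\<forall>n\<ge>1. T - kappa (t n) T \<le> mesh (t n) T / \<delta> T \<longrightarrow>
        (\<forall>f :: real \<Rightarrow> real ^ 'd \<Rightarrow> real. borel_on_halfspace f \<longrightarrow>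
          (\<integral>\<^sup>+ \<omega>. ennreal (exp (LINT r:{0..T}|lborel. f r (x n (kappa (t n) r) \<omega>))) \<partial>M)
            \<le> 2 * ennreal_exp (ennreal (N (\<delta> T)) *
                (ennreal_powr (mixed_norm p q T f) q
                 + ennreal (mesh (t n) T powr (q - 1)) * ennreal_powr (mixed_sup_norm q T f) q))))"
proof -
  let ?d = "real CARD('d)"
  have d: "1 \<le> ?d" by simp
  have "?d \<le> ?d / \<alpha>" using assms(1,2) d by (simp add: pos_le_divide_eq)
  then have p: "?d < p" using assms(6) by simp
  have "0 < ?d / p" using p d by simp
  then have "2 / q < 2" using assms(7) by linarith
  then have q: "1 < q" using assms(5) by (simp add: divide_less_eq split: if_splits)
  have "?d / (2 * p) + 1 / q < 1" using assms(7) by simp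
  moreover have "(q - 1) / q = 1 - 1 / q" using q by (simp add: diff_divide_distrib)
  ultimately have pq: "?d / (2 * p) < (q - 1) / q" by simp
  define N where "N \<delta> = max 1 (chain_potential.rate TYPE(real ^ 'd) \<epsilon> K (2 * sqrt K * K) \<alpha> (max 1 (1 / \<delta>\<^sup>2)) p q T)" for \<delta>
  show ?thesis
  proof (rule exI[of _ N], intro allI impI)
    fix M :: "'w measure" and F d1 W and \<sigma> :: "real \<Rightarrow> real ^ 'd \<Rightarrow> nat \<Rightarrow> real ^ 'd" and x0 :: "real ^ 'd"
      and t :: "nat \<Rightarrow> nat \<Rightarrow> real" and x :: "nat \<Rightarrow> real \<Rightarrow> 'w \<Rightarrow> real ^ 'd"
      and \<delta> :: "real \<Rightarrow> real" and n and f :: "real \<Rightarrow> real ^ 'd \<Rightarrow> real"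
    assume W: "wiener_process M F d1 W"
      and bor: "\<forall>k<d1. borel_on_halfspace (\<lambda>s y. \<sigma> s y k)"
      and ell: "\<forall>s>0. \<forall>y. psd_le (\<epsilon> *\<^sub>R mat 1) (mat_AAt d1 (\<sigma> s y)) \<and> psd_le (mat_AAt d1 (\<sigma> s y)) (K *\<^sub>R mat 1)"
      and hol: "\<forall>s>0. \<forall>y z. mat_dist d1 (\<sigma> s y) (\<sigma> s z) \<le> K * norm (y - z) powr \<alpha>"
      and part: "\<forall>n\<ge>1. partition_seq (t n)"
      and euler: "\<forall>n\<ge>1. euler_approx M F d1 W \<sigma> x0 (t n) (x n)"
      and \<delta>: "\<forall>S>0. \<delta> S > 0 \<and> (\<forall>n\<ge>1. \<forall>i. t n (Suc i) \<le> S \<longrightarrow> (t n (Suc i) - t n i) / mesh (t n) S \<ge> \<delta> S)"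
      and n: "1 \<le> n" and last: "T - kappa (t n) T \<le> mesh (t n) T / \<delta> T" and f: "borel_on_halfspace f"
    show "(\<integral>\<^sup>+ \<omega>. ennreal (exp (LINT r:{0..T}|lborel. f r (x n (kappa (t n) r) \<omega>))) \<partial>M)
       \<le> 2 * ennreal_exp (ennreal (N (\<delta> T)) *
          (ennreal_powr (mixed_norm p q T f) q
           + ennreal (mesh (t n) T powr (q - 1)) * ennreal_powr (mixed_sup_norm q T f) q))"
    proof (cases "T = 0")
      case True
      interpret prob_space M using W by (simp add: wiener_process_def)
      have "(LINT r:{0..T}|lborel. g r) = 0" for g :: "real \<Rightarrow> real"
      proof -
        have "AE r in lborel. indicat_real {0..T} r *\<^sub>R g r = 0"
          using AE_lborel_singleton[of 0] by eventually_elim (simp add: True)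
        then show ?thesis unfolding set_lebesgue_integral_def by (rule integral_eq_zero_AE)
      qed
      then have "(\<integral>\<^sup>+ \<omega>. ennreal (exp (LINT r:{0..T}|lborel. f r (x n (kappa (t n) r) \<omega>))) \<partial>M) = 1"
        by (simp add: emeasure_space_1)
      also have "1 \<le> 2 * ennreal_exp y" for y
        using mult_mono[OF _ ennreal_exp_ge_1[of y], of 1 2] by simp
      finally show ?thesis .
    next
      case False
      then have T: "0 < T" using assms(8) by simp
      interpret euler_functional d1 \<sigma> \<epsilon> K \<alpha> M F W x0 "t n" "x n" f p q T "\<delta> T" "max 1 (1 / (\<delta> T)\<^sup>2)"
      proof (unfold_locales)
        show "0 < \<delta> T" using \<delta> T by blast
        show "\<delta> T \<le> (t n (Suc i) - t n i) / mesh (t n) T" if "t n (Suc i) \<le> T" for i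
          using \<delta> T n that by blast
        show "partition_seq (t n)" "euler_approx M F d1 W \<sigma> x0 (t n) (x n)" using part euler n by auto
        show "borel_on_halfspace (\<lambda>s y. \<sigma> s y k)" if "k < d1" for k using bor that by blast
        show "psd_le (\<epsilon> *\<^sub>R mat 1) (mat_AAt d1 (\<sigma> s y))" "psd_le (mat_AAt d1 (\<sigma> s y)) (K *\<^sub>R mat 1)"
          "mat_dist d1 (\<sigma> s y) (\<sigma> s z) \<le> K * norm (y - z) powr \<alpha>" if "0 < s" for s y z
          using ell hol that by auto
      qed (fact assms W f last T p q pq refl)+
      show ?thesis by (rule euler_exponential_bound) (simp_all add: N_def)
    qed
  qed
qed

end
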